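(* Let $A$ be a fixed finite set of feature values (regarded as real numbers) and let $\mathcal{X}=A^d$. Let $k,h$ be positive integers, let $\alpha,\beta\in(0,1]$, and let $0<\epsilon<\min\big(\frac{1}{k+1},\frac{\alpha}{5},\frac{\beta}{12.5}\big)$. There is a deterministic $(\alpha,\beta)$-feasible fully dynamic decision tree algorithm with pruning thresholds $k,h$ that has query time $O(h^* )$, uses space $O(nd)$, and has amortized running time per update $$O\Big(\frac{d\log^2 n}{\epsilon}\Big),$$ where $h^*\le h$ and $n$ are respectively the maximum height of the tree and the maximum size of the active set at any time.
   Context: **Examples and Gini gain.** The feature domain is $\mathcal{X}=A^d$ with $A$ a fixed finite set (so $|A|=O(1)$) and the label domain is $\mathcal{Y}=\{0,1\}$. $S$ denotes a finite multiset of labeled examples $(x,y)\in\mathcal{X}\times\mathcal{Y}$; $x_j$ is the $j$-th feature of $x$; $[d]=\{1,\dots,d\}$. It is assumed that an example can be stored in $O(d)$ bits and that each $x_j$ can be accessed in time $O(1)$. $S[x_j\le t]=\{(x,y)\in S: x_j\le t\}$ (as a sub-multiset), and similarly for $S[x_j>t]$. A split is a pair $(j,t)\in[d]\times\mathbb{R}$. The Gini index of $S$ is $g(S)=2p_S(1-p_S)$ with $p_S=\frac1{|S|}\sum_{(x,y)\in S}y$. The Gini gain of $(j,t)$ on $S$ is $G(S,j,t)=g(S)-\big(\frac{|S_-|}{|S|}g(S_-)+\frac{|S_+|}{|S|}g(S_+)\big)$ where $S_-=S[x_j\le t]$, $S_+=S[x_j>t]$. If $|S|=0$ then $g(S)=0$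 and $G(S,j,t)=0$. **Decision trees.** A decision tree is a triple $(T,\Sigma,L)$ where $T$ is a rooted directed binary tree with vertex set $V(T)$, $\Sigma$ assigns a split $\sigma_v=(j_v,t_v)$ to each internal node $v$, and $L$ assigns a label $L_v\in\{0,1\}$ to each leaf. An $x\in\mathcal{X}$ arriving at internal node $v$ goes to the left child if $x_{j_v}\le t_v$ and to the right child otherwise. $S_v$ denotes the sub-multiset of $S$ of those examples whose root-to-leaf route passes through $v$. $T(x)$ is the label of the leaf reached by $x$. The root has depth $0$. **Feasibility.** Let $k,h\in\mathbb{N}$. $(T,\Sigma,L)$ is $(\alpha,\beta)$-feasible with pruning thresholds $(k,h)$ w.r.t. $S$ if for every $v\in V(T)$: (1) if $|S_v|\le k$ or $g(S_v)=0$ or $\mathrm{depth}_T(v)=h$ then $v$ is a leaf, else if $g(S_v)\ge\alpha$ then $v$ is an internal node; (2) if $\sigma_v=(j,a)$ then $G(S_v,j,a)\ge G(S_v,j',a')-\beta$ for all $(j',a')\in[d]\times\mathbb{R}$; (3) if $v$ is a leaf then $L_v$ is a majority label of $S_v$. **Fully dynamic algorithms.** A fully dynamic decision tree algorithm $\mathcal{A}$ receives an arbitrary sequence of requests of three types: insertion $\mathrm{ins}(x,y)$, deletion $\mathrm{del}(x,y)$, labeling $\mathrm{lab}(x)$. The sequence induces an active multiset $S$, obtained by performing the insertions and deletions in order. After processing a sequence, $\mathcal{A}$ is coherent with a decision tree $T$ if for every $x\in\mathcal{X}$ a further request $\mathrm{lab}(x)$ makes $\mathcal{A}$ output $T(x)$.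 $\mathcal{A}$ is $(\alpha,\beta)$-feasible (for pruning thresholds $k,h$) if at any point in time it is coherent with a decision tree that is $(\alpha,\beta)$-feasible with pruning thresholds $(k,h)$ w.r.t. the current active multiset ("the tree" in the claim). Query time is the worst-case time to answer a request $\mathrm{lab}(x)$. An update is an insertion or a deletion; amortized running time per update $O(f)$ means that any sequence of $\mathcal{T}$ updates is processed in total time $O(\mathcal{T}f)$. *)

theory Defs
  imports Complex_Main "HOL-Library.Multiset" "HOL-Library.FuncSet" "HOL-Library.Sublist"
begin

section \<open>Examples and Gini gain\<close>

text \<open>A point of the feature domain \<open>A\<^sup>d\<close> is an extensional function on \<open>{1..d}\<close>. The label domain
  \<open>{0, 1}\<close> is \<^typ>\<open>bool\<close>, with \<^const>\<open>True\<close> for 1.\<close>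

type_synonym point = "nat \<Rightarrow> real"
type_synonym example = "point \<times> bool"

definition domain :: "real set \<Rightarrow> nat \<Rightarrow> point set" where
  "domain A d = {1..d} \<rightarrow>\<^sub>E A"

definition part_le :: "example multiset \<Rightarrow> nat \<Rightarrow> real \<Rightarrow> example multiset" where
  "part_le S j t = filter_mset (\<lambda>(x, y). x j \<le> t) S"

definition part_gt :: "example multiset \<Rightarrow> nat \<Rightarrow> real \<Rightarrow> example multiset" where
  "part_gt S j t = filter_mset (\<lambda>(x, y). x j > t) S"

definition pos_frac :: "example multiset \<Rightarrow> real" where
  "pos_frac S = (\<Sum>(x, y)\<in>#S. of_bool y) / real (size S)"

definition gini :: "example multiset \<Rightarrow> real" where
  "gini S = (if S = {#} then 0 else 2 * pos_frac S * (1 - pos_frac S))"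

definition gain :: "example multiset \<Rightarrow> nat \<Rightarrow> real \<Rightarrow> real" where
  "gain S j t = (if S = {#} then 0 else
     gini S - (real (size (part_le S j t)) / real (size S) * gini (part_le S j t)
             + real (size (part_gt S j t)) / real (size S) * gini (part_gt S j t)))"

section \<open>Decision trees\<close>

datatype dtree = Leaf bool | Node nat real dtree dtree

text \<open>A vertex is the list of directions leading to it from the root (\<^const>\<open>False\<close> is left).\<close>

fun vertices :: "dtree \<Rightarrow> bool list set" where
  "vertices (Leaf L) = {[]}"
| "vertices (Node j t l r) = {[]} \<union> (#) False ` vertices l \<union> (#) True ` vertices r"

text \<open>The subtree rooted at a vertex; the last equation concerns lists that are not vertices.\<close>

fun subtree :: "dtree \<Rightarrow> bool list \<Rightarrow> dtree" where
  "subtree T [] = T"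
| "subtree (Node j t l r) (b # v) = subtree (if b then r else l) v"
| "subtree (Leaf L) (b # v) = Leaf L"

definition height :: "dtree \<Rightarrow> nat" where
  "height T = Max (length ` vertices T)"

text \<open>The leaf reached by a point; its prefixes are the vertices on the root-to-leaf route.\<close>

fun route :: "dtree \<Rightarrow> point \<Rightarrow> bool list" where
  "route (Leaf L) x = []"
| "route (Node j t l r) x = (if x j \<le> t then False # route l x else True # route r x)"

definition classify :: "dtree \<Rightarrow> point \<Rightarrow> bool" where
  "classify T x = (case subtree T (route T x) of Leaf L \<Rightarrow> L | Node j t l r \<Rightarrow> undefined)"

definition at_vertex :: "example multiset \<Rightarrow> dtree \<Rightarrow> bool list \<Rightarrow> example multiset" where
  "at_vertex S T v = filter_mset (\<lambda>(x, y). prefix v (route T x)) S"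

definition majority :: "bool \<Rightarrow> example multiset \<Rightarrow> bool" where
  "majority L S \<longleftrightarrow>
     size (filter_mset (\<lambda>(x, y). y = L) S) \<ge> size (filter_mset (\<lambda>(x, y). y \<noteq> L) S)"

text \<open>The second conjunct includes that \<open>\<sigma>\<^sub>v\<close> is a split, i.e. lies in \<open>[d] \<times> \<real>\<close>.\<close>

definition feasible ::
  "nat \<Rightarrow> nat \<Rightarrow> nat \<Rightarrow> real \<Rightarrow> real \<Rightarrow> example multiset \<Rightarrow> dtree \<Rightarrow> bool" where
  "feasible d k h \<alpha> \<beta> S T \<longleftrightarrow>
     (\<forall>v\<in>vertices T. let Sv = at_vertex S T v; leaf = (\<exists>L. subtree T v = Leaf L) in
        (if size Sv \<le> k \<or> gini Sv = 0 \<or> length v = h then leaf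
         else gini Sv \<ge> \<alpha> \<longrightarrow> \<not> leaf) \<and>
        (\<forall>j t l r. subtree T v = Node j t l r \<longrightarrow>
           j \<in> {1..d} \<and> (\<forall>j'\<in>{1..d}. \<forall>t'. gain Sv j t \<ge> gain Sv j' t' - \<beta>)) \<and>
        (\<forall>L. subtree T v = Leaf L \<longrightarrow> majority L Sv))"

section \<open>Request sequences\<close>

datatype request = Ins point bool | Del point bool | Lab point

fun point_of :: "request \<Rightarrow> point" where
  "point_of (Ins x y) = x"
| "point_of (Del x y) = x"
| "point_of (Lab x) = x"

fun is_update :: "request \<Rightarrow> bool" where
  "is_update (Ins x y) = True"
| "is_update (Del x y) = True"
| "is_update (Lab x) = False"

definition requests :: "real set \<Rightarrow> nat \<Rightarrow> request list set" where
  "requests A d = {\<sigma>. \<forall>q\<in>set \<sigma>. point_of q \<in> domain A d}"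

definition num_updates :: "request list \<Rightarrow> nat" where
  "num_updates \<sigma> = length (filter is_update \<sigma>)"

text \<open>Deleting an example that is not active has no effect.\<close>

fun apply_request :: "request \<Rightarrow> example multiset \<Rightarrow> example multiset" where
  "apply_request (Ins x y) S = S + {#(x, y)#}"
| "apply_request (Del x y) S = S - {#(x, y)#}"
| "apply_request (Lab x) S = S"

definition active :: "request list \<Rightarrow> example multiset" where
  "active \<sigma> = fold apply_request \<sigma> {#}"

definition max_active :: "request list \<Rightarrow> nat" where
  "max_active \<sigma> = Max ((\<lambda>i. size (active (take i \<sigma>))) ` {..length \<sigma>})"

text \<open>Here \<open>tree \<sigma>\<close> stands for the decision tree held after the requests \<open>\<sigma>\<close>.\<close>

definition max_height :: "(request list \<Rightarrow> dtree) \<Rightarrow> request list \<Rightarrow> nat" where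
  "max_height tree \<sigma> = Max ((\<lambda>i. height (tree (take i \<sigma>))) ` {..length \<sigma>})"

section \<open>Word RAM\<close>

text \<open>
  Deterministic algorithms are programs of a unit-cost word RAM. A machine has finitely many
  registers (those occurring in its program) and \<open>M\<close> memory cells; each holds a word, i.e. a natural
  number less than \<open>W\<close>. An access outside the memory or an operation whose result is not a
  word blocks the machine, so a run that ends certifies the space bound \<open>M\<close> and the word size
  \<open>log W\<close>. The current request is available in a read-only input array. Every instruction
  and every evaluation of a test takes one time unit.
\<close>

datatype binop = Plus | Minus | Times | Div | Mod

text \<open>Subtraction is truncated, and \<open>a div 0 = 0\<close>, \<open>a mod 0 = a\<close>.\<close>

fun eval_binop :: "binop \<Rightarrow> nat \<Rightarrow> nat \<Rightarrow> nat" where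
  "eval_binop Plus a b = a + b"
| "eval_binop Minus a b = a - b"
| "eval_binop Times a b = a * b"
| "eval_binop Div a b = a div b"
| "eval_binop Mod a b = a mod b"

datatype test = Less nat nat | Equal nat nat

fun eval_test :: "test \<Rightarrow> (nat \<Rightarrow> nat) \<Rightarrow> bool" where
  "eval_test (Less a b) R = (R a < R b)"
| "eval_test (Equal a b) R = (R a = R b)"

text \<open>All arguments of type \<^typ>\<open>nat\<close> are register numbers, except for the literal in \<open>Const\<close>.\<close>

datatype com =
    Skip
  | Const nat nat
  | Op binop nat nat nat
  | Load nat nat
  | Store nat nat
  | Input nat nat
  | Seq com com
  | Cond test com com
  | While test com

fun com_size :: "com \<Rightarrow> nat" where
  "com_size (Seq c c') = com_size c + com_size c'"
| "com_size (Cond b c c') = 1 + com_size c + com_size c'"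
| "com_size (While b c) = 1 + com_size c"
| "com_size _ = 1"

text \<open>A state consists of the registers and the memory.\<close>

type_synonym state = "(nat \<Rightarrow> nat) \<times> (nat \<Rightarrow> nat)"

text \<open>\<open>exec W M I c s t s'\<close>: on input array \<open>I\<close>, the command \<open>c\<close> leads from \<open>s\<close> to \<open>s'\<close> in
  time \<open>t\<close>.\<close>

inductive exec ::
  "nat \<Rightarrow> nat \<Rightarrow> (nat \<Rightarrow> nat) \<Rightarrow> com \<Rightarrow> state \<Rightarrow> nat \<Rightarrow> state \<Rightarrow> bool"
  for W :: nat and M :: nat and I :: "nat \<Rightarrow> nat" where
  Skip: "exec W M I Skip (R, H) 1 (R, H)"
| Const: "v < W \<Longrightarrow> exec W M I (Const r v) (R, H) 1 (R(r := v), H)"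
| Op: "eval_binop f (R a) (R b) < W \<Longrightarrow>
    exec W M I (Op f r a b) (R, H) 1 (R(r := eval_binop f (R a) (R b)), H)"
| Load: "R a < M \<Longrightarrow> exec W M I (Load r a) (R, H) 1 (R(r := H (R a)), H)"
| Store: "R a < M \<Longrightarrow> exec W M I (Store a b) (R, H) 1 (R, H(R a := R b))"
| Input: "I (R a) < W \<Longrightarrow> exec W M I (Input r a) (R, H) 1 (R(r := I (R a)), H)"
| Seq: "exec W M I c s t s' \<Longrightarrow> exec W M I c' s' t' s'' \<Longrightarrow>
    exec W M I (Seq c c') s (t + t') s''"
| Cond_True: "eval_test b (fst s) \<Longrightarrow> exec W M I c s t s' \<Longrightarrow>
    exec W M I (Cond b c c') s (1 + t) s'"
| Cond_False: "\<not> eval_test b (fst s) \<Longrightarrow> exec W M I c' s t s' \<Longrightarrow>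
    exec W M I (Cond b c c') s (1 + t) s'"
| While_False: "\<not> eval_test b (fst s) \<Longrightarrow> exec W M I (While b c) s 1 s"
| While_True: "eval_test b (fst s) \<Longrightarrow> exec W M I c s t s' \<Longrightarrow>
    exec W M I (While b c) s' t' s'' \<Longrightarrow> exec W M I (While b c) s (1 + t + t') s''"

text \<open>The machine is deterministic, and its behaviour does not depend on \<open>W\<close> and \<open>M\<close> as long as it
  is not blocked.\<close>

lemma exec_mono:
  assumes "exec W M I c s t s'" "W \<le> W'" "M \<le> M'"
  shows "exec W' M' I c s t s'"
  using assms(1)
proof (induction rule: exec.induct)
  case (Seq c s t s' c' t' s'')
  show ?case by (rule exec.Seq[OF Seq.IH])
next
  case (While_True b s c t s' t' s'')
  show ?case by (rule exec.While_True[OF While_True.hyps(1) While_True.IH])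
next
  case (Cond_True b s c t s' c')
  show ?case by (rule exec.Cond_True[OF Cond_True.hyps(1) Cond_True.IH])
next
  case (Cond_False b s c' t s' c)
  show ?case by (rule exec.Cond_False[OF Cond_False.hyps(1) Cond_False.IH])
next
  case (While_False b s c)
  show ?case by (rule exec.While_False[OF While_False.hyps])
qed (rule exec.intros; insert assms(2,3), linarith)+

inductive_cases exec_SkipE: "exec W M I Skip s t s'"
inductive_cases exec_ConstE: "exec W M I (Const r v) s t s'"
inductive_cases exec_OpE: "exec W M I (Op f r a b) s t s'"
inductive_cases exec_LoadE: "exec W M I (Load r a) s t s'"
inductive_cases exec_StoreE: "exec W M I (Store a b) s t s'"
inductive_cases exec_InputE: "exec W M I (Input r a) s t s'"
inductive_cases exec_SeqE: "exec W M I (Seq c c') s t s'"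
inductive_cases exec_CondE: "exec W M I (Cond b c c') s t s'"
inductive_cases exec_WhileE: "exec W M I (While b c) s t s'"

lemma exec_deterministic:
  assumes "exec W M I c s t s'" "exec W M I c s u s''"
  shows "u = t \<and> s'' = s'"
  using assms
proof (induction arbitrary: u s'' rule: exec.induct)
  case (Skip R H)
  then show ?case by (rule exec_SkipE) simp
next
  case (Const v r R H)
  from Const.prems show ?case by (rule exec_ConstE) simp
next
  case (Op f R a b r H)
  from Op.prems show ?case by (rule exec_OpE) simp
next
  case (Load R a r H)
  from Load.prems show ?case by (rule exec_LoadE) simp
next
  case (Store R a b H)
  from Store.prems show ?case by (rule exec_StoreE) simp
next
  case (Input R a r H)
  from Input.prems show ?case by (rule exec_InputE) simp
next
  case (Seq c s t s' c' t' s'')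
  from Seq.prems obtain t1 s1 t2 where
    *: "u = t1 + t2" "exec W M I c s t1 s1" "exec W M I c' s1 t2 s''"
    by (auto elim: exec_SeqE)
  from Seq.IH(1)[OF *(2)] Seq.IH(2)[of t2 s''] * show ?case by simp
next
  case (Cond_True b s c t s' c')
  from Cond_True.prems Cond_True.hyps(1) obtain t1 where
    *: "u = 1 + t1" "exec W M I c s t1 s''"
    by (auto elim: exec_CondE)
  from Cond_True.IH[OF *(2)] * show ?case by simp
next
  case (Cond_False b s c' t s' c)
  from Cond_False.prems Cond_False.hyps(1) obtain t1 where
    *: "u = 1 + t1" "exec W M I c' s t1 s''"
    by (auto elim: exec_CondE)
  from Cond_False.IH[OF *(2)] * show ?case by simp
next
  case (While_False b s c)
  from While_False.prems While_False.hyps show ?case by (auto elim: exec_WhileE)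
next
  case (While_True b s c t s' t' s'')
  from While_True.prems While_True.hyps(1) obtain t1 s1 t2 where
    *: "u = 1 + t1 + t2" "exec W M I c s t1 s1" "exec W M I (While b c) s1 t2 s''"
    by (auto elim: exec_WhileE)
  from While_True.IH(1)[OF *(2)] While_True.IH(2)[of t2 s''] * show ?case by simp
qed

section \<open>Dynamic algorithms on the word RAM\<close>

text \<open>A feature value is presented to the machine by its rank in \<open>A\<close>, which preserves the order and
  fits in \<open>O(1)\<close> bits. Input cell 0 holds the type of the request, cell 1 the label, and cell
  \<open>1 + j\<close> the feature \<open>x\<^sub>j\<close>.\<close>

definition rank :: "real set \<Rightarrow> real \<Rightarrow> nat" where
  "rank A a = card {b \<in> A. b < a}"

fun kind_code :: "request \<Rightarrow> nat" where
  "kind_code (Ins x y) = 0"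
| "kind_code (Del x y) = 1"
| "kind_code (Lab x) = 2"

fun label_code :: "request \<Rightarrow> nat" where
  "label_code (Ins x y) = of_bool y"
| "label_code (Del x y) = of_bool y"
| "label_code (Lab x) = 0"

definition input :: "real set \<Rightarrow> nat \<Rightarrow> request \<Rightarrow> nat \<Rightarrow> nat" where
  "input A d q i =
     (if i = 0 then kind_code q
      else if i = 1 then label_code q
      else if i \<le> d + 1 then rank A (point_of q (i - 1))
      else 0)"

definition init_state :: state where
  "init_state = (\<lambda>_. 0, \<lambda>_. 0)"

text \<open>\<open>run A d W M P \<sigma> t s\<close>: processing the requests \<open>\<sigma>\<close> one after another, by one execution of
  \<open>P\<close> each, ends in state \<open>s\<close>; the executions for insertions and deletions take time \<open>t\<close> in total.\<close>

inductive run ::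
  "real set \<Rightarrow> nat \<Rightarrow> nat \<Rightarrow> nat \<Rightarrow> com \<Rightarrow> request list \<Rightarrow> nat \<Rightarrow> state \<Rightarrow> bool"
  for A d W M P where
  Nil: "run A d W M P [] 0 init_state"
| snoc: "run A d W M P \<sigma> t s \<Longrightarrow> exec W M (input A d q) P s u s' \<Longrightarrow>
    run A d W M P (\<sigma> @ [q]) (if is_update q then t + u else t) s'"

text \<open>The answer to a labeling request is left in register 0.\<close>

definition coherent ::
  "real set \<Rightarrow> nat \<Rightarrow> nat \<Rightarrow> nat \<Rightarrow> com \<Rightarrow> state \<Rightarrow> dtree \<Rightarrow> bool" where
  "coherent A d W M P s T \<longleftrightarrow>
     (\<forall>x\<in>domain A d. \<exists>t s'. exec W M (input A d (Lab x)) P s t s' \<and>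
        fst s' 0 = of_bool (classify T x))"

definition query_time_le ::
  "real set \<Rightarrow> nat \<Rightarrow> nat \<Rightarrow> nat \<Rightarrow> com \<Rightarrow> state \<Rightarrow> nat \<Rightarrow> bool" where
  "query_time_le A d W M P s b \<longleftrightarrow>
     (\<forall>x\<in>domain A d. \<exists>t s'. exec W M (input A d (Lab x)) P s t s' \<and> t \<le> b)"

text \<open>Words are polynomially bounded in all the parameters, i.e. they have
  \<open>O(log (n + d + k + h + 1/\<epsilon>))\<close> bits.\<close>

definition word_bound :: "nat \<Rightarrow> nat \<Rightarrow> nat \<Rightarrow> nat \<Rightarrow> real \<Rightarrow> nat \<Rightarrow> nat" where
  "word_bound C d k h \<epsilon> n = (C * (n + d + k + h + nat \<lceil>1 / \<epsilon>\<rceil>)) ^ C"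

end

theory Submission
  imports Defs "HOL-Library.Discrete_Functions"
begin

text \<open>A vertex of the maintained tree remembers the multiset \<open>S0\<close> for which it was built and counts the
  updates \<open>c\<close> that have reached it since then. With \<open>q = \<lceil>1/\<epsilon>\<rceil>\<close>, its budget is about \<open>|S0|/q\<close>. While \<open>c\<close>
  stays within the budget, the Gini index and all Gini gains have moved by so little that the decisions
  taken for \<open>S0\<close> (leaf or not, and a split of maximal gain) still meet the \<open>(\<alpha>, \<beta>)\<close>-conditions for the
  current multiset. An update descends to its leaf, and the first vertex on the route whose budget is
  already used up has its subtree rebuilt.

  Rebuilding for \<open>s\<close> examples costs \<open>O(d s log s)\<close>, because only the smaller child is recounted and the
  table of the larger one is obtained by subtraction. As \<open>s = O(q (budget + 1))\<close>, the rebuild is paid by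
  the counter of its vertex. Budgets depend only on \<open>\<lfloor>log |S0|\<rfloor>\<close>, and on a route it suffices to charge the
  first vertex of each of these \<open>O(log n)\<close> levels; this gives the second logarithm. Equal points
  share one record, found by a trie, and the points at a leaf form a linked list, so \<open>O(n)\<close> records of
  \<open>O(d)\<close> cells suffice.\<close>

section \<open>A while language and its compilation\<close>

text \<open>The update bound does not mention \<open>h\<close>, so routes must be short even where
  feasibility forces depth \<open>h\<close>. On the machine a vertex is split only if the split
  strictly lowers the impurity; such a split separates the points listed there, no split does so
  twice on one route, and the stored depth is at most \<open>d * card A\<close>. Where a vertex must
  be internal although no split helps, the deep part exists only in the decision tree of the
  specification. A second obstacle is that the program must not know \<open>n\<close>. Memory is
  never initialized as a whole, and fresh records are taken only when the free list is empty, so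
  \<open>N\<close>, \<open>W\<close> and \<open>M\<close> occur only in the proof. Budgets are
  computed from sizes rounded to powers of two because vertices of one level must have equal
  budgets: counters do not grow from parent to child, so the first exhausted vertex on a route never
  lies below another vertex of its level, and its whole counter is available as payment.\<close>

datatype ex = V nat | N nat | Bin binop ex ex | Get nat ex ex | In ex
datatype bex = Lt ex ex | Ne ex ex
datatype hcom = Asg nat ex | Put nat ex ex ex | HSeq hcom hcom (infixr ";;" 60)
  | If bex hcom hcom | Whl bex hcom | HSkip

text \<open>A memory maps an array, a record number and a position to a word. The cells of one record
  in all arrays are contiguous.\<close>

type_synonym mem = "nat \<Rightarrow> nat \<Rightarrow> nat \<Rightarrow> nat"
type_synonym st = "nat \<times> (nat \<Rightarrow> nat) \<times> mem"

text \<open>Points and vertices share one numbering: record \<open>i\<close> carries the fields of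
  point \<open>i\<close> and of vertex \<open>i\<close> side by side. Arrays 0 and 3 hold one count
  per label, array 12 the features, array 13 one row of \<open>m\<close> trie edges per depth, array
  14 two label counts per pair of feature and value.\<close>

definition wid :: "nat \<Rightarrow> nat \<Rightarrow> nat \<Rightarrow> nat" where
  "wid d m a = (if a = 0 \<or> a = 3 then 2 else if a < 12 then 1 else if a = 12 then d
     else if a = 13 then d * m else if a = 14 then 2 * d * m else 1)"

definition off :: "nat \<Rightarrow> nat \<Rightarrow> nat \<Rightarrow> nat" where
  "off d m a = (\<Sum>b<a. wid d m b)"

definition rsize :: "nat \<Rightarrow> nat \<Rightarrow> nat" where
  "rsize d m = off d m 16"

definition adr :: "nat \<Rightarrow> nat \<Rightarrow> nat \<Rightarrow> nat \<Rightarrow> nat \<Rightarrow> nat" where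
  "adr d m a i s = i * rsize d m + off d m a + s"

context
  fixes d m :: nat
begin

definition cadr :: "com \<Rightarrow> com \<Rightarrow> nat \<Rightarrow> nat \<Rightarrow> com" where
  "cadr ci cs a t = Seq ci (Seq (Const (t+1) (rsize d m)) (Seq (Op Times t t (t+1))
     (Seq cs (Seq (Op Plus t t (t+1)) (Seq (Const (t+1) (off d m a)) (Op Plus t t (t+1)))))))"

text \<open>There is no move instruction; a register is copied by adding it to 0. Temporaries form a
  stack: the value lands in register \<open>t\<close>, and everything below \<open>t\<close> is
  preserved.\<close>

primrec cx :: "ex \<Rightarrow> nat \<Rightarrow> com" where
  "cx (V r) t = Seq (Const t 0) (Op Plus t r t)"
| "cx (N n) t = Const t n"
| "cx (Bin f a b) t = Seq (cx a t) (Seq (cx b (t+1)) (Op f t t (t+1)))"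
| "cx (Get a e s) t = Seq (cadr (cx e t) (cx s (t+1)) a t) (Load t t)"
| "cx (In e) t = Seq (cx e t) (Input t t)"

text \<open>Registers from 100 on hold temporaries. A test is reduced to \<^term>\<open>Less 100 101\<close>.\<close>

primrec cb :: "bex \<Rightarrow> com" where
  "cb (Lt a b) = Seq (cx a 100) (cx b 101)"
| "cb (Ne a b) = Seq (cx a 100) (Seq (cx b 101) (Cond (Equal 100 101)
     (Seq (Const 100 0) (Const 101 0)) (Seq (Const 100 0) (Const 101 1))))"

text \<open>\<open>While\<close> tests registers only, so a loop condition is evaluated once before
  the loop and again at the end of each round.\<close>

primrec comp :: "hcom \<Rightarrow> com" where
  "comp (Asg r e) = Seq (cx e 100) (Seq (Const r 0) (Op Plus r 100 r))"
| "comp (Put a e s v) = Seq (cx v 100) (Seq (cadr (cx e 101) (cx s 102) a 101) (Store 101 100))"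
| "comp (HSeq c c') = Seq (comp c) (comp c')"
| "comp (If b c c') = Seq (cb b) (Cond (Less 100 101) (comp c) (comp c'))"
| "comp (Whl b c) = Seq (cb b) (While (Less 100 101) (Seq (comp c) (cb b)))"
| "comp HSkip = Skip"

end

primrec ct :: "ex \<Rightarrow> nat" where
  "ct (V r) = 2"
| "ct (N n) = 1"
| "ct (Bin f a b) = ct a + ct b + 1"
| "ct (Get a e s) = ct e + ct s + 6"
| "ct (In e) = ct e + 1"

primrec ctb :: "bex \<Rightarrow> nat" where
  "ctb (Lt a b) = ct a + ct b"
| "ctb (Ne a b) = ct a + ct b + 3"

section \<open>Timed semantics and weakest preconditions\<close>

locale ram =
  fixes d m NR W :: nat and I :: "nat \<Rightarrow> nat"
begin

primrec ev :: "ex \<Rightarrow> (nat \<Rightarrow> nat) \<Rightarrow> mem \<Rightarrow> nat" where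
  "ev (V r) R G = R r"
| "ev (N n) R G = n"
| "ev (Bin f a b) R G = eval_binop f (ev a R G) (ev b R G)"
| "ev (Get a e s) R G = G a (ev e R G) (ev s R G)"
| "ev (In e) R G = I (ev e R G)"

text \<open>Truncated subtraction, division and remainder never exceed their first operand, so only
  sums and products can overflow a word.\<close>

primrec ok :: "ex \<Rightarrow> (nat \<Rightarrow> nat) \<Rightarrow> mem \<Rightarrow> bool" where
  "ok (V r) R G \<longleftrightarrow> r < 100"
| "ok (N n) R G \<longleftrightarrow> n < W"
| "ok (Bin f a b) R G \<longleftrightarrow> ok a R G \<and> ok b R G \<and>
     (f = Plus \<or> f = Times \<longrightarrow> eval_binop f (ev a R G) (ev b R G) < W)"
| "ok (Get a e s) R G \<longleftrightarrow> ok e R G \<and> ok s R G \<and> a < 16 \<and> ev e R G < NR \<and> ev s R G < wid d m a"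
| "ok (In e) R G \<longleftrightarrow> ok e R G \<and> I (ev e R G) < W"

primrec okb :: "bex \<Rightarrow> (nat \<Rightarrow> nat) \<Rightarrow> mem \<Rightarrow> bool" where
  "okb (Lt a b) R G \<longleftrightarrow> ok a R G \<and> ok b R G"
| "okb (Ne a b) R G \<longleftrightarrow> ok a R G \<and> ok b R G"

primrec evb :: "bex \<Rightarrow> (nat \<Rightarrow> nat) \<Rightarrow> mem \<Rightarrow> bool" where
  "evb (Lt a b) R G \<longleftrightarrow> ev a R G < ev b R G"
| "evb (Ne a b) R G \<longleftrightarrow> ev a R G \<noteq> ev b R G"

definition upd :: "mem \<Rightarrow> nat \<Rightarrow> nat \<Rightarrow> nat \<Rightarrow> nat \<Rightarrow> mem" where
  "upd G a i s v = G(a := (G a)(i := (G a i)(s := v)))"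

text \<open>The clock is a component of the state, so a time bound is an ordinary conjunct of a
  postcondition.\<close>

inductive hx :: "hcom \<Rightarrow> st \<Rightarrow> st \<Rightarrow> bool" where
  hAsg: "ok e R G \<Longrightarrow> r < 100 \<Longrightarrow> hx (Asg r e) (t, R, G) (t + ct e + 2, R(r := ev e R G), G)"
| hPut: "ok v R G \<Longrightarrow> ok (Get a e s) R G \<Longrightarrow>
    hx (Put a e s v) (t, R, G) (t + ct e + ct s + ct v + 6, R, upd G a (ev e R G) (ev s R G) (ev v R G))"
| hSeq: "hx c s s' \<Longrightarrow> hx c' s' s'' \<Longrightarrow> hx (c ;; c') s s''"
| hIfT: "okb b R G \<Longrightarrow> evb b R G \<Longrightarrow> hx c (t + ctb b + 1, R, G) s' \<Longrightarrow> hx (If b c c') (t, R, G) s'"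
| hIfF: "okb b R G \<Longrightarrow> \<not> evb b R G \<Longrightarrow> hx c' (t + ctb b + 1, R, G) s' \<Longrightarrow> hx (If b c c') (t, R, G) s'"
| hWhF: "okb b R G \<Longrightarrow> \<not> evb b R G \<Longrightarrow> hx (Whl b c) (t, R, G) (t + ctb b + 1, R, G)"
| hWhT: "okb b R G \<Longrightarrow> evb b R G \<Longrightarrow> hx c (t + ctb b + 1, R, G) s' \<Longrightarrow> hx (Whl b c) s' s'' \<Longrightarrow>
    hx (Whl b c) (t, R, G) s''"
| hSkip: "hx HSkip (t, R, G) (t + 1, R, G)"

definition wp :: "hcom \<Rightarrow> (st \<Rightarrow> bool) \<Rightarrow> st \<Rightarrow> bool" where
  "wp c Q s \<longleftrightarrow> (\<exists>s'. hx c s s' \<and> Q s')"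

lemma wp_Asg [simp]: "wp (Asg r e) Q (t, R, G) \<longleftrightarrow>
    ok e R G \<and> r < 100 \<and> Q (t + ct e + 2, R(r := ev e R G), G)"
  unfolding wp_def by (subst hx.simps) auto

lemma wp_Put [simp]: "wp (Put a e s v) Q (t, R, G) \<longleftrightarrow> ok v R G \<and> ok (Get a e s) R G \<and>
    Q (t + ct e + ct s + ct v + 6, R, upd G a (ev e R G) (ev s R G) (ev v R G))"
  unfolding wp_def by (subst hx.simps) auto

lemma wp_Seq [simp]: "wp (c ;; c') Q s \<longleftrightarrow> wp c (wp c' Q) s"
  unfolding wp_def by (subst hx.simps) (simp, blast)

lemma wp_If [simp]: "wp (If b c c') Q (t, R, G) \<longleftrightarrow> okb b R G \<and>
    (if evb b R G then wp c Q (t + ctb b + 1, R, G) else wp c' Q (t + ctb b + 1, R, G))"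
  unfolding wp_def by (subst hx.simps) auto

lemma wp_Skip [simp]: "wp HSkip Q (t, R, G) \<longleftrightarrow> Q (t + 1, R, G)"
  unfolding wp_def by (subst hx.simps) auto

lemma wp_unfold: "wp (Whl b c) Q (t, R, G) \<longleftrightarrow> okb b R G \<and>
    (if evb b R G then wp c (wp (Whl b c) Q) (t + ctb b + 1, R, G) else Q (t + ctb b + 1, R, G))"
proof (cases "evb b R G")
  case True
  then show ?thesis unfolding wp_def by (subst hx.simps) (simp, blast)
next
  case False
  then show ?thesis unfolding wp_def by (subst hx.simps) simp
qed

lemma wp_mono: "wp c Q s \<Longrightarrow> (\<And>s'. Q s' \<Longrightarrow> Q' s') \<Longrightarrow> wp c Q' s"
  unfolding wp_def by blast

text \<open>The number of completed rounds is an index of the invariant rather than a register.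
  Hence \<open>J i\<close> can bound the clock linearly in \<open>i\<close>, and the rule gives
  total correctness with time.\<close>

lemma wp_for:
  assumes "J i (t, R, G)" "i \<le> n"
    and "\<And>i t R G. J i (t, R, G) \<Longrightarrow> i < n \<Longrightarrow>
      okb b R G \<and> evb b R G \<and> wp c (J (Suc i)) (t + ctb b + 1, R, G)"
    and "\<And>t R G. J n (t, R, G) \<Longrightarrow> okb b R G \<and> \<not> evb b R G \<and> Q (t + ctb b + 1, R, G)"
  shows "wp (Whl b c) Q (t, R, G)"
  using assms(1,2)
proof (induction "n - i" arbitrary: i t R G)
  case 0
  then show ?case using assms(4) by (simp add: wp_unfold)
next
  case (Suc k)
  then have *: "okb b R G \<and> evb b R G \<and> wp c (J (Suc i)) (t + ctb b + 1, R, G)"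
    using assms(3)[of i t R G] by simp
  have "wp c (wp (Whl b c) Q) (t + ctb b + 1, R, G)"
  proof (rule wp_mono[OF conjunct2[OF conjunct2[OF *]]])
    fix s' assume "J (Suc i) s'"
    then show "wp (Whl b c) Q s'" using Suc(1)[of "Suc i"] Suc(2) by (cases s') simp
  qed
  then show ?case using * by (simp add: wp_unfold)
qed

end

section \<open>Injectivity of the memory layout\<close>

lemma off_Suc_le: "a < a' \<Longrightarrow> off d m a + wid d m a \<le> off d m a'"
proof -
  assume "a < a'"
  then have "off d m (Suc a) \<le> off d m a'" unfolding off_def by (intro sum_mono2) auto
  then show ?thesis by (simp add: off_def)
qed

lemma adr_bound: "a < 16 \<Longrightarrow> s < wid d m a \<Longrightarrow> off d m a + s < rsize d m"
  using off_Suc_le[of a 16 d m] by (simp add: rsize_def)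

lemma off_inj:
  assumes "off d m a + s = off d m a' + s'" "s < wid d m a" "s' < wid d m a'"
  shows "a = a' \<and> s = s'"
proof -
  consider "a < a'" | "a' < a" | "a = a'" by linarith
  then show ?thesis
    using off_Suc_le[of a a' d m] off_Suc_le[of a' a d m] assms by cases auto
qed

lemma adr_inj:
  assumes "adr d m a i s = adr d m a' i' s'" "a < 16" "a' < 16" "s < wid d m a" "s' < wid d m a'"
  shows "a = a' \<and> i = i' \<and> s = s'"
proof -
  have b: "off d m a + s < rsize d m" "off d m a' + s' < rsize d m"
    using assms adr_bound by auto
  have "i = adr d m a i s div rsize d m" "i' = adr d m a' i' s' div rsize d m"
    using b div_mult_self3[of "rsize d m" "off d m a + s" i] div_mult_self3[of "rsize d m" "off d m a' + s'" i']
    unfolding adr_def add.assoc by auto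
  then have "i = i'" using assms(1) by simp
  then show ?thesis using assms off_inj[of d m a s a' s'] by (auto simp: adr_def)
qed

section \<open>Simulation by the word RAM\<close>

locale ram_impl = ram +
  fixes M :: nat
  assumes NR: "NR * rsize d m \<le> M" "M \<le> W" "2 \<le> NR"
begin

text \<open>Registers from 100 on are only required to hold words, so temporaries may be overwritten
  freely (\<open>rel_temp\<close>).\<close>

definition rel :: "state \<Rightarrow> (nat \<Rightarrow> nat) \<Rightarrow> mem \<Rightarrow> bool" where
  "rel s R G \<longleftrightarrow> (\<forall>r<100. fst s r = R r) \<and> (\<forall>r. fst s r < W) \<and> (\<forall>i. snd s i < W) \<and>
     (\<forall>a i x. a < 16 \<longrightarrow> x < wid d m a \<longrightarrow> snd s (adr d m a i x) = G a i x)"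

lemma rsize_bounds: "rsize d m < W" "2 < W" "i < NR \<Longrightarrow> i * rsize d m + rsize d m \<le> M"
proof -
  have r: "14 \<le> rsize d m"
    using off_Suc_le[of 14 16 d m] unfolding rsize_def by (simp add: off_def wid_def eval_nat_numeral)
  have "2 * rsize d m \<le> NR * rsize d m" using NR by (intro mult_le_mono1)
  then show "rsize d m < W" "2 < W" using NR r by linarith+
  assume "i < NR"
  then have "Suc i * rsize d m \<le> NR * rsize d m" by (intro mult_le_mono1) simp
  then show "i * rsize d m + rsize d m \<le> M" using NR by simp
qed

lemma adr_lt: "a < 16 \<Longrightarrow> x < wid d m a \<Longrightarrow> i < NR \<Longrightarrow> adr d m a i x < M"
  using adr_bound[of a x d m] rsize_bounds(3)[of i] unfolding adr_def by linarith

lemma rel_temp: "rel (R', H) R G \<Longrightarrow> 100 \<le> t \<Longrightarrow> v < W \<Longrightarrow> rel (R'(t := v), H) R G"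
  unfolding rel_def by auto

lemma cadr_correct:
  assumes ci: "\<exists>R1. exec W M I ci (R', H) ti (R1, H) \<and> R1 t = i \<and> rel (R1, H) R G \<and> (\<forall>r<t. R1 r = R' r)"
    and cs: "\<And>R1. rel (R1, H) R G \<Longrightarrow>
      \<exists>R2. exec W M I cs (R1, H) ts (R2, H) \<and> R2 (t+1) = x \<and> rel (R2, H) R G \<and> (\<forall>r<t+1. R2 r = R1 r)"
    and b: "i < NR" "a < 16" "x < wid d m a" "100 \<le> t"
  shows "\<exists>R2. exec W M I (cadr d m ci cs a t) (R', H) (ti + ts + 5) (R2, H) \<and> R2 t = adr d m a i x \<and>
     rel (R2, H) R G \<and> (\<forall>r<t. R2 r = R' r)"
proof -
  note adr = adr_lt[OF b(2,3,1)]
  have lt: "i * rsize d m < W" "i * rsize d m + x < W" "off d m a < W" "adr d m a i x < W"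
    using adr NR unfolding adr_def by linarith+
  obtain R1 where R1: "exec W M I ci (R', H) ti (R1, H)" "R1 t = i" "rel (R1, H) R G" "\<forall>r<t. R1 r = R' r"
    using ci by blast
  let ?R2 = "R1(t + 1 := rsize d m, t := i * rsize d m)"
  have "rel (R1(t + 1 := rsize d m), H) R G" using b by (intro rel_temp R1 rsize_bounds) simp
  then have r2: "rel (?R2, H) R G" by (rule rel_temp[OF _ b(4) lt(1)])
  then obtain R3 where R3: "exec W M I cs (?R2, H) ts (R3, H)" "R3 (t+1) = x" "rel (R3, H) R G"
    "\<forall>r<t+1. R3 r = ?R2 r" using cs by blast
  let ?R4 = "R3(t := i * rsize d m + x, t + 1 := off d m a, t := adr d m a i x)"
  have t1: "100 \<le> t + 1" using b by simp
  have r4: "rel (?R4, H) R G"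
    by (rule rel_temp[OF rel_temp[OF rel_temp[OF R3(3) b(4) lt(2)] t1 lt(3)] b(4) lt(4)])
  have "exec W M I (Const (t+1) (rsize d m)) (R1, H) 1 (R1(t+1 := rsize d m), H)"
    by (intro exec.Const rsize_bounds)
  moreover have "exec W M I (Op Times t t (t+1)) (R1(t+1 := rsize d m), H) 1 (?R2, H)"
    using exec.Op[of Times "R1(t+1 := rsize d m)" t "t+1" W M I t H] lt R1(2) by simp
  moreover have "exec W M I (Op Plus t t (t+1)) (R3, H) 1 (R3(t := i * rsize d m + x), H)"
    using exec.Op[of Plus R3 t "t+1" W M I t H] lt R3 by simp
  moreover have "exec W M I (Const (t+1) (off d m a)) (R3(t := i * rsize d m + x), H) 1
      (R3(t := i * rsize d m + x, t + 1 := off d m a), H)" by (intro exec.Const lt)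
  moreover have "exec W M I (Op Plus t t (t+1)) (R3(t := i * rsize d m + x, t + 1 := off d m a), H) 1 (?R4, H)"
    using exec.Op[of Plus "R3(t := i * rsize d m + x, t + 1 := off d m a)" t "t+1" W M I t H] lt
    by (simp add: adr_def ac_simps)
  ultimately have "exec W M I (cadr d m ci cs a t) (R', H) (ti + (1 + (1 + (ts + (1 + (1 + 1)))))) (?R4, H)"
    unfolding cadr_def using R1(1) R3(1) by (intro exec.Seq)
  then show ?thesis using r4 R3(4) R1(4) by (intro exI[of _ ?R4]) (simp add: eval_nat_numeral)
qed

lemma cx_correct:
  "rel (R', H) R G \<Longrightarrow> ok e R G \<Longrightarrow> 100 \<le> t \<Longrightarrow>
   \<exists>R''. exec W M I (cx d m e t) (R', H) (ct e) (R'', H) \<and> R'' t = ev e R G \<and> rel (R'', H) R G \<and>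
     (\<forall>r<t. R'' r = R' r)"
proof (induction e arbitrary: R' t)
  case (V r)
  let ?R = "R'(t := 0, t := R' r)"
  have "r < 100" using V(2) by simp
  then have rl: "R' r < W" "R' r = R r" using V(1) unfolding rel_def fst_conv by blast+
  have "exec W M I (Const t 0) (R', H) 1 (R'(t := 0), H)" using rsize_bounds by (intro exec.Const) simp
  moreover have "exec W M I (Op Plus t r t) (R'(t := 0), H) 1 (?R, H)"
    using exec.Op[of Plus "R'(t := 0)" r t W M I t H] rl V by simp
  ultimately have "exec W M I (cx d m (V r) t) (R', H) (1 + 1) (?R, H)"
    unfolding cx.simps by (intro exec.Seq)
  then show ?case using rl rel_temp[OF V(1,3) rl(1)] by (intro exI[of _ ?R]) (simp add: numeral_2_eq_2, simp add: fun_upd_def)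
next
  case (N n)
  then show ?case using exec.Const[of n W M I t R' H] rel_temp[of R' H R G t n]
    by (intro exI[of _ "R'(t := n)"]) (simp del: fun_upd_apply, simp)
next
  case (Bin f a b)
  from Bin.IH(1)[OF Bin.prems(1) _ Bin.prems(3)] Bin.prems(2) obtain R1 where
    R1: "exec W M I (cx d m a t) (R', H) (ct a) (R1, H)" "R1 t = ev a R G" "rel (R1, H) R G" "\<forall>r<t. R1 r = R' r"
    by auto
  from Bin.IH(2)[OF R1(3), of "t+1"] Bin.prems(2,3) obtain R2 where
    R2: "exec W M I (cx d m b (t+1)) (R1, H) (ct b) (R2, H)" "R2 (t+1) = ev b R G" "rel (R2, H) R G"
    "\<forall>r<t+1. R2 r = R1 r" by auto
  have w: "ev a R G < W" "ev b R G < W"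
    using R1(2,3) R2(2,3) by (metis (no_types, opaque_lifting) fst_conv rel_def)+
  then have lt: "eval_binop f (ev a R G) (ev b R G) < W"
    using Bin.prems(2) by (cases f) (auto intro: le_less_trans[OF div_le_dividend] le_less_trans[OF mod_less_eq_dividend])
  let ?R = "R2(t := eval_binop f (ev a R G) (ev b R G))"
  have "exec W M I (Op f t t (t+1)) (R2, H) 1 (?R, H)"
    using exec.Op[of f R2 t "t+1" W M I t H] lt R1(2) R2(2,4) by simp
  then have "exec W M I (cx d m (Bin f a b) t) (R', H) (ct a + (ct b + 1)) (?R, H)"
    unfolding cx.simps using R1(1) R2(1) by (intro exec.Seq)
  then show ?case using R1(4) R2(4) rel_temp[OF R2(3) Bin.prems(3) lt]
    by (intro exI[of _ ?R] conjI; (simp del: fun_upd_apply)?; simp?)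
next
  case (Get a e s)
  from cadr_correct[OF Get.IH(1)[OF Get.prems(1) _ Get.prems(3)], of "cx d m s (t+1)" "ct s" "ev s R G" a]
    Get.IH(2)[of _ "t+1"] Get.prems
  obtain R1 where R1: "exec W M I (cadr d m (cx d m e t) (cx d m s (t+1)) a t) (R', H) (ct e + ct s + 5) (R1, H)"
    "R1 t = adr d m a (ev e R G) (ev s R G)" "rel (R1, H) R G" "\<forall>r<t. R1 r = R' r" by auto
  have h: "H (R1 t) = G a (ev e R G) (ev s R G)" "H (R1 t) < W" "R1 t < M"
  proof -
    show "H (R1 t) = G a (ev e R G) (ev s R G)" using R1(2,3) Get.prems by (auto simp: rel_def)
    show "H (R1 t) < W" using R1(3) unfolding rel_def by simp
    show "R1 t < M" using R1(2) Get.prems adr_lt by simp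
  qed
  let ?R = "R1(t := H (R1 t))"
  have "exec W M I (Load t t) (R1, H) 1 (?R, H)" by (intro exec.Load h)
  then have "exec W M I (cx d m (Get a e s) t) (R', H) ((ct e + ct s + 5) + 1) (?R, H)"
    unfolding cx.simps using R1(1) by (intro exec.Seq)
  then show ?case using R1(4) h rel_temp[OF R1(3) Get.prems(3) h(2)]
    by (intro exI[of _ ?R] conjI; (simp del: fun_upd_apply add: ac_simps)?; simp?)
next
  case (In e)
  from In.IH[OF In.prems(1) _ In.prems(3)] In.prems(2) obtain R1 where
    R1: "exec W M I (cx d m e t) (R', H) (ct e) (R1, H)" "R1 t = ev e R G" "rel (R1, H) R G" "\<forall>r<t. R1 r = R' r"
    by auto
  let ?R = "R1(t := I (R1 t))"
  have lt: "I (R1 t) < W" using R1(2) In.prems(2) by simp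
  then have "exec W M I (Input t t) (R1, H) 1 (?R, H)" by (intro exec.Input)
  then have "exec W M I (cx d m (In e) t) (R', H) (ct e + 1) (?R, H)"
    unfolding cx.simps using R1(1) by (intro exec.Seq)
  then show ?case using R1(2,4) rel_temp[OF R1(3) In.prems(3) lt]
    by (intro exI[of _ ?R] conjI; (simp del: fun_upd_apply)?; simp?)
qed

lemma cb_correct:
  assumes "rel s R G" "okb b R G"
  shows "\<exists>s'. exec W M I (cb d m b) s (ctb b) s' \<and> rel s' R G \<and> (eval_test (Less 100 101) (fst s') \<longleftrightarrow> evb b R G)"
proof -
  obtain R' H where s: "s = (R', H)" by (cases s)
  have W: "0 < W" "1 < W" using rsize_bounds by auto
  obtain e1 e2 where e: "b = Lt e1 e2 \<or> b = Ne e1 e2" by (cases b) auto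
  then have oke: "ok e1 R G" "ok e2 R G" using assms(2) by auto
  from cx_correct[OF assms(1)[unfolded s] oke(1), of 100] obtain R1 where
    R1: "exec W M I (cx d m e1 100) (R', H) (ct e1) (R1, H)" "R1 100 = ev e1 R G" "rel (R1, H) R G" by auto
  from cx_correct[OF R1(3) oke(2), of 101] obtain R2 where
    R2: "exec W M I (cx d m e2 101) (R1, H) (ct e2) (R2, H)" "R2 101 = ev e2 R G" "rel (R2, H) R G"
      "R2 100 = ev e1 R G" using R1(2) by auto
  from e show ?thesis
  proof
    assume b: "b = Lt e1 e2"
    show ?thesis unfolding b s using R1 R2 by (intro exI[of _ "(R2, H)"]) (auto intro: exec.Seq)
  next
    assume b: "b = Ne e1 e2"
    let ?v = "if ev e1 R G = ev e2 R G then 0 else 1 :: nat"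
    let ?R = "R2(100 := 0, 101 := ?v)"
    have sq: "exec W M I (Seq (Const 100 0) (Const 101 v)) (R2, H) (1 + 1) (R2(100 := 0, 101 := v), H)"
      if "v < W" for v using W that by (intro exec.Seq[OF exec.Const exec.Const])
    have "exec W M I (Cond (Equal 100 101) (Seq (Const 100 0) (Const 101 0)) (Seq (Const 100 0) (Const 101 1)))
       (R2, H) (1 + (1 + 1)) (?R, H)"
    proof (cases "ev e1 R G = ev e2 R G")
      case True
      then show ?thesis using exec.Cond_True[OF _ sq[of 0]] R2 W by simp
    next
      case False
      then show ?thesis using exec.Cond_False[OF _ sq[of 1]] R2 W by simp
    qed
    then have "exec W M I (cb d m b) s (ct e1 + (ct e2 + (1 + (1 + 1)))) (?R, H)"
      unfolding b s cb.simps using R1(1) R2(1) by (intro exec.Seq)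
    moreover have "rel (?R, H) R G" using W by (intro rel_temp R2) auto
    ultimately show ?thesis unfolding b by (intro exI[of _ "(?R, H)"]) (simp add: numeral_3_eq_3)
  qed
qed

lemma rel_Asg:
  assumes "rel (R', H) R G" "v < W" "r < 100"
  shows "rel (R'(r := v), H) (R(r := v)) G"
  using assms unfolding rel_def by auto

lemma rel_Put:
  assumes "rel (R', H) R G" "v < W" "a < 16" "x < wid d m a"
  shows "rel (R', H(adr d m a i x := v)) R (upd G a i x v)"
proof -
  have "(H(adr d m a i x := v)) (adr d m a' i' x') = upd G a i x v a' i' x'"
    if "a' < 16" "x' < wid d m a'" for a' i' x'
  proof (cases "a' = a \<and> i' = i \<and> x' = x")
    case True
    then show ?thesis by (simp add: upd_def)
  next
    case False
    then have "adr d m a' i' x' \<noteq> adr d m a i x" using adr_inj assms that by blast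
    then show ?thesis using False assms(1) that by (auto simp: upd_def rel_def)
  qed
  then show ?thesis using assms(1,2) by (simp add: rel_def)
qed

text \<open>The compiled program takes exactly the time counted by the source semantics, so bounds
  proved with \<open>wp\<close> carry over without a further constant.\<close>

lemma comp_correct:
  "hx c \<sigma> \<sigma>' \<Longrightarrow> rel s (fst (snd \<sigma>)) (snd (snd \<sigma>)) \<Longrightarrow>
   \<exists>u s'. exec W M I (comp d m c) s u s' \<and> rel s' (fst (snd \<sigma>')) (snd (snd \<sigma>')) \<and> fst \<sigma>' = fst \<sigma> + u"
proof (induction arbitrary: s rule: hx.induct)
  case (hAsg e R G r t)
  obtain R' H where s: "s = (R', H)" by (cases s)
  from cx_correct[of R' H R G e 100] hAsg s obtain R1 where
    R1: "exec W M I (cx d m e 100) (R', H) (ct e) (R1, H)" "R1 100 = ev e R G" "rel (R1, H) R G" by auto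
  have lt: "ev e R G < W" using R1(2,3) by (metis (no_types, opaque_lifting) fst_conv rel_def)
  let ?R = "R1(r := 0, r := ev e R G)"
  have "exec W M I (Const r 0) (R1, H) 1 (R1(r := 0), H)" using rsize_bounds by (intro exec.Const) simp
  moreover have "exec W M I (Op Plus r 100 r) (R1(r := 0), H) 1 (?R, H)"
    using exec.Op[of Plus "R1(r := 0)" 100 r W M I r H] lt R1(2) hAsg by simp
  ultimately have "exec W M I (comp d m (Asg r e)) s (ct e + (1 + 1)) (?R, H)"
    unfolding comp.simps s using R1(1) by (intro exec.Seq)
  moreover have "rel (?R, H) (R(r := ev e R G)) G" using rel_Asg[OF R1(3) lt hAsg(2)] by simp
  ultimately show ?case by (intro exI[of _ "ct e + (1 + 1)"] exI[of _ "(?R, H)"]) (simp add: fun_upd_def)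
next
  case (hPut v R G a e x t)
  obtain R' H where s: "s = (R', H)" by (cases s)
  from cx_correct[of R' H R G v 100] hPut s obtain R1 where
    R1: "exec W M I (cx d m v 100) (R', H) (ct v) (R1, H)" "R1 100 = ev v R G" "rel (R1, H) R G" by auto
  from cadr_correct[OF cx_correct[OF R1(3), of e 101], of "cx d m x 102" "ct x" "ev x R G" a]
    cx_correct[of _ H R G x 102] hPut
  obtain R2 where R2: "exec W M I (cadr d m (cx d m e 101) (cx d m x 102) a 101) (R1, H) (ct e + ct x + 5) (R2, H)"
    "R2 101 = adr d m a (ev e R G) (ev x R G)" "rel (R2, H) R G" "R2 100 = ev v R G" using R1(2) by auto
  have lt: "ev v R G < W" using R1(2,3) by (metis (no_types, opaque_lifting) fst_conv rel_def)
  have M: "R2 101 < M" using R2(2) hPut adr_lt by simp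
  let ?H = "H(R2 101 := R2 100)"
  have "exec W M I (Store 101 100) (R2, H) 1 (R2, ?H)" using M by (intro exec.Store)
  then have "exec W M I (comp d m (Put a e x v)) s (ct v + ((ct e + ct x + 5) + 1)) (R2, ?H)"
    unfolding comp.simps s using R1(1) R2(1) by (intro exec.Seq)
  moreover have "rel (R2, ?H) R (upd G a (ev e R G) (ev x R G) (ev v R G))"
    using rel_Put[OF R2(3) lt, of a "ev x R G" "ev e R G"] hPut R2 by simp
  ultimately show ?case by (intro exI[of _ "ct v + ((ct e + ct x + 5) + 1)"] exI[of _ "(R2, ?H)"]) simp
next
  case (hSeq c \<sigma> \<sigma>' c' \<sigma>'')
  from hSeq.IH(1)[OF hSeq.prems] obtain u s1 where
    1: "exec W M I (comp d m c) s u s1" "rel s1 (fst (snd \<sigma>')) (snd (snd \<sigma>'))" "fst \<sigma>' = fst \<sigma> + u" by blast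
  from hSeq.IH(2)[OF 1(2)] obtain u' s2 where
    2: "exec W M I (comp d m c') s1 u' s2" "rel s2 (fst (snd \<sigma>'')) (snd (snd \<sigma>''))" "fst \<sigma>'' = fst \<sigma>' + u'" by blast
  show ?case using 1 2 exec.Seq[OF 1(1) 2(1)] by (intro exI[of _ "u + u'"] exI[of _ s2]) simp
next
  case (hIfT b R G c t s' c')
  from cb_correct[OF _ hIfT(1), of s] hIfT.prems obtain s1 where
    1: "exec W M I (cb d m b) s (ctb b) s1" "rel s1 R G" "eval_test (Less 100 101) (fst s1) \<longleftrightarrow> evb b R G" by auto
  from hIfT.IH[of s1] 1 obtain u s2 where
    2: "exec W M I (comp d m c) s1 u s2" "rel s2 (fst (snd s')) (snd (snd s'))" "fst s' = t + ctb b + 1 + u" by auto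
  show ?case using exec.Seq[OF 1(1) exec.Cond_True[OF _ 2(1)]] 1 2 hIfT(2)
    by (intro exI[of _ "ctb b + (1 + u)"] exI[of _ s2]) simp
next
  case (hIfF b R G c' t s' c)
  from cb_correct[OF _ hIfF(1), of s] hIfF.prems obtain s1 where
    1: "exec W M I (cb d m b) s (ctb b) s1" "rel s1 R G" "eval_test (Less 100 101) (fst s1) \<longleftrightarrow> evb b R G" by auto
  from hIfF.IH[of s1] 1 obtain u s2 where
    2: "exec W M I (comp d m c') s1 u s2" "rel s2 (fst (snd s')) (snd (snd s'))" "fst s' = t + ctb b + 1 + u" by auto
  show ?case using exec.Seq[OF 1(1) exec.Cond_False[OF _ 2(1)]] 1 2 hIfF(2)
    by (intro exI[of _ "ctb b + (1 + u)"] exI[of _ s2]) simp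
next
  case (hWhF b R G c t)
  from cb_correct[OF _ hWhF(1), of s] hWhF.prems obtain s1 where
    1: "exec W M I (cb d m b) s (ctb b) s1" "rel s1 R G" "eval_test (Less 100 101) (fst s1) \<longleftrightarrow> evb b R G" by auto
  show ?case using exec.Seq[OF 1(1) exec.While_False] 1 hWhF(2)
    by (intro exI[of _ "ctb b + 1"] exI[of _ s1]) simp
next
  case (hWhT b R G c t s' s'')
  from cb_correct[OF _ hWhT(1), of s] hWhT.prems obtain s1 where
    1: "exec W M I (cb d m b) s (ctb b) s1" "rel s1 R G" "eval_test (Less 100 101) (fst s1) \<longleftrightarrow> evb b R G" by auto
  from hWhT.IH(1)[of s1] 1 obtain u s2 where
    2: "exec W M I (comp d m c) s1 u s2" "rel s2 (fst (snd s')) (snd (snd s'))" "fst s' = t + ctb b + 1 + u" by auto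
  from hWhT.IH(2)[OF 2(2)] obtain v s4 where
    3: "exec W M I (comp d m (Whl b c)) s2 v s4" "rel s4 (fst (snd s'')) (snd (snd s''))" "fst s'' = fst s' + v" by blast
  \<comment> \<open>The remaining compiled loop starts with an evaluation of the test; this becomes
    the evaluation that closes the current round.\<close>
  from 3(1) obtain v1 s3 v2 where v: "v = v1 + v2" "exec W M I (cb d m b) s2 v1 s3"
    "exec W M I (While (Less 100 101) (Seq (comp d m c) (cb d m b))) s3 v2 s4"
    by (auto elim: exec_SeqE)
  have "exec W M I (comp d m (Whl b c)) s (ctb b + (1 + (u + v1) + v2)) s4"
    unfolding comp.simps using 1 hWhT(2)
    by (intro exec.Seq[OF 1(1)] exec.While_True[OF _ exec.Seq[OF 2(1) v(2)] v(3)]) simp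
  then show ?case using 2 3 v by (intro exI[of _ "ctb b + (1 + (u + v1) + v2)"] exI[of _ s4]) simp
next
  case (hSkip t R G)
  obtain R' H where s: "s = (R', H)" by (cases s)
  show ?case using exec.Skip[of W M I R' H] hSkip s by (intro exI[of _ 1] exI[of _ s]) simp
qed

lemma wp_exec:
  assumes "wp c Q (t, R, G)" "rel s R G"
  shows "\<exists>u s' R' G'. exec W M I (comp d m c) s u s' \<and> rel s' R' G' \<and> Q (t + u, R', G')"
  using assms comp_correct[of c "(t, R, G)" _ s] unfolding wp_def by fastforce

end

section \<open>Stability of the Gini gain\<close>

definition cls :: "example multiset \<Rightarrow> bool \<Rightarrow> nat" where
  "cls S y = size (filter_mset (\<lambda>e. snd e = y) S)"

text \<open>The Gini index multiplied by the size. In contrast to \<open>gini\<close>, it moves by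
  at most a constant per update whatever the size.\<close>

definition gF :: "example multiset \<Rightarrow> real" where
  "gF S = 2 * real (cls S True) * real (cls S False) / real (size S)"

lemma size_cls: "size S = cls S True + cls S False"
proof -
  have "S = filter_mset (\<lambda>e. snd e = True) S + filter_mset (\<lambda>e. snd e = False) S"
    using multiset_partition[of S "\<lambda>e. snd e = True"] by simp
  then show ?thesis unfolding cls_def by (metis size_union)
qed

lemma sum_labels: "(\<Sum>(x, y)\<in>#S. of_bool y :: real) = real (cls S True)"
  by (induction S) (auto simp: cls_def)

lemma gini_gF: "real (size S) * gini S = gF S"
proof (cases "S = {#}")
  case True
  then show ?thesis by (simp add: gF_def)
next
  case False
  then have s: "real (size S) \<noteq> 0" by simp
  then have "1 - pos_frac S = real (cls S False) / real (size S)"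
    unfolding pos_frac_def sum_labels using size_cls[of S] by (simp add: field_simps)
  then have "gini S = 2 * (real (cls S True) / real (size S)) * (real (cls S False) / real (size S))"
    using False unfolding gini_def by (simp add: pos_frac_def sum_labels)
  then show ?thesis using s unfolding gF_def by simp
qed

text \<open>The gain multiplied by the size. A predicate replaces the threshold, so that thresholds
  on real values and on ranks are treated alike.\<close>

definition GG :: "example multiset \<Rightarrow> (point \<Rightarrow> bool) \<Rightarrow> real" where
  "GG S P = gF S - gF (filter_mset (\<lambda>e. P (fst e)) S) - gF (filter_mset (\<lambda>e. \<not> P (fst e)) S)"

lemma gain_GG: "real (size S) * gain S j t = GG S (\<lambda>x. x j \<le> t)"
proof (cases "S = {#}")
  case True
  then show ?thesis by (simp add: GG_def gF_def)
next
  case False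
  then have s: "real (size S) \<noteq> 0" by simp
  have l: "part_le S j t = filter_mset (\<lambda>e. fst e j \<le> t) S"
    "part_gt S j t = filter_mset (\<lambda>e. \<not> fst e j \<le> t) S"
    unfolding part_le_def part_gt_def by (auto intro!: filter_mset_cong)
  show ?thesis using False s unfolding gain_def GG_def l[symmetric] gini_gF[symmetric]
    by (simp add: field_simps)
qed

text \<open>With \<open>a\<close> examples of the label that is added and \<open>b\<close> of the
  other one, the increment is \<open>2 * b^2 / ((a + b) * (a + b + 1))\<close>, which lies between 0
  and 2.\<close>

lemma gF_add: "gF S \<le> gF (add_mset e S)" "gF (add_mset e S) \<le> gF S + 2"
proof -
  have *: "2 * a * b / (a + b) \<le> 2 * (a + 1) * b / (a + 1 + b) \<and>
      2 * (a + 1) * b / (a + 1 + b) \<le> 2 * a * b / (a + b) + 2"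
    if "0 \<le> a" "0 \<le> b" for a b :: real
  proof (cases "a + b = 0")
    case True
    then have "a = 0" "b = 0" using that by auto
    then show ?thesis by simp
  next
    case False
    then have p: "0 < a + b" using that by linarith
    have "2 * (a + 1) * b / (a + 1 + b) - 2 * a * b / (a + b) = 2 * b\<^sup>2 / ((a + b) * (a + 1 + b))"
      using p by (simp add: field_simps power2_eq_square)
    moreover have "0 \<le> 2 * b\<^sup>2 / ((a + b) * (a + 1 + b))" using p that by simp
    moreover have "2 * b\<^sup>2 / ((a + b) * (a + 1 + b)) \<le> 2"
    proof -
      have "b * b \<le> (a + b) * (a + 1 + b)" using that by (intro mult_mono) auto
      then show ?thesis using p by (simp add: divide_le_eq power2_eq_square)
    qed
    ultimately show ?thesis by linarith
  qed
  have g: "gF S = 2 * real (cls S True) * real (cls S False) / (real (cls S True) + real (cls S False))" for S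
    unfolding gF_def using size_cls[of S] by simp
  have "gF S \<le> gF (add_mset e S) \<and> gF (add_mset e S) \<le> gF S + 2"
  proof (cases "snd e")
    case True
    then have "cls (add_mset e S) True = cls S True + 1" "cls (add_mset e S) False = cls S False"
      by (auto simp: cls_def)
    then show ?thesis using *[of "real (cls S True)" "real (cls S False)"] by (simp add: g add.commute)
  next
    case False
    then have "cls (add_mset e S) True = cls S True" "cls (add_mset e S) False = cls S False + 1"
      by (auto simp: cls_def)
    then show ?thesis using *[of "real (cls S False)" "real (cls S True)"]
      by (simp add: g algebra_simps)
  qed
  then show "gF S \<le> gF (add_mset e S)" "gF (add_mset e S) \<le> gF S + 2" by auto
qed

lemma gF_lip: "\<bar>gF (add_mset e S) - gF S\<bar> \<le> 2"
  using gF_add[where S = S and e = e] by linarith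

text \<open>The whole and exactly one part receive the example. Both increments lie between 0 and 2
  by monotonicity of \<open>gF\<close>, so their difference is at most 2 instead of 4.\<close>

lemma GG_lip: "\<bar>GG (add_mset e S) P - GG S P\<bar> \<le> 2"
  using gF_add[where S = S and e = e] gF_add[where S = "filter_mset (\<lambda>e. P (fst e)) S" and e = e]
    gF_add[where S = "filter_mset (\<lambda>e. \<not> P (fst e)) S" and e = e]
  unfolding GG_def by (cases "P (fst e)") auto

text \<open>\<open>rem\<close> also covers an absent example: such a deletion changes nothing but is
  counted as an update.\<close>

inductive close :: "example multiset \<Rightarrow> nat \<Rightarrow> example multiset \<Rightarrow> bool" for S0 where
  none: "close S0 0 S0"
| add: "close S0 c S \<Longrightarrow> close S0 (Suc c) (S + {#e#})"
| rem: "close S0 c S \<Longrightarrow> close S0 (Suc c) (S - {#e#})"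

lemma close_lip:
  fixes f :: "example multiset \<Rightarrow> real"
  assumes "close S0 c S" and l: "\<And>e S. \<bar>f (add_mset e S) - f S\<bar> \<le> K"
  shows "\<bar>f S - f S0\<bar> \<le> K * real c"
  using assms(1)
proof induction
  case none
  then show ?case by simp
next
  case (add c S e)
  then show ?case using l[of e S] by (simp add: algebra_simps)
next
  case (rem c S e)
  have "\<bar>f (S - {#e#}) - f S\<bar> \<le> K"
  proof (cases "e \<in># S")
    case True
    then have "S = add_mset e (S - {#e#})" by simp
    then show ?thesis using l[of e "S - {#e#}"] by (metis abs_minus_commute)
  next
    case False
    then show ?thesis using l[of e S] by (simp add: diff_single_trivial)
  qed
  then show ?case using rem by (simp add: algebra_simps)
qed

lemma close_cls: "close S0 c S \<Longrightarrow> cls S0 y \<le> cls S y + c"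
  using close_lip[of S0 c S "\<lambda>S. real (cls S y)" 1] by (force simp: cls_def)

lemma close_size: "close S0 c S \<Longrightarrow> size S0 \<le> size S + c"
  using close_lip[of S0 c S "\<lambda>S. real (size S)" 1] by force

section \<open>Levels and budgets\<close>

definition lev :: "example multiset \<Rightarrow> nat" where
  "lev S = floor_log (size S)"

text \<open>Rounding the size to a power of two makes the budget a function of the level. The
  subtracted 1 is a reserve: a positive counter \<open>c\<close> within the budget gives
  \<open>(c + 1) * q <= size S\<close>, so \<open>c\<close> deletions cannot wipe out a class that
  holds at least the fraction \<open>1 / q\<close> of \<open>S\<close>.\<close>

definition budget :: "nat \<Rightarrow> example multiset \<Rightarrow> nat" where
  "budget q S = 2 ^ lev S div q - 1"

lemma budget_cases:
  assumes "c \<le> budget q S" "0 < q"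
  shows "c = 0 \<or> (c + 1) * q \<le> size S"
proof (rule disjCI)
  assume "\<not> (c + 1) * q \<le> size S"
  show "c = 0"
  proof (rule ccontr)
    assume c: "c \<noteq> 0"
    then have s: "size S \<noteq> 0" and "c + 1 \<le> 2 ^ lev S div q"
      using assms(1) \<open>0 < q\<close> unfolding budget_def lev_def
      by (auto simp: div_eq_0_iff intro: ccontr)
    then have "(c + 1) * q \<le> 2 ^ lev S" using assms(2) by (metis div_times_less_eq_dividend mult_le_mono1 order_trans)
    also have "\<dots> \<le> size S" using s floor_log_exp2_le[of "size S"] unfolding lev_def by (simp del: size_eq_0_iff_empty)
    finally show False using \<open>\<not> (c + 1) * q \<le> size S\<close> by simp
  qed
qed

text \<open>One factor 2 pays for rounding the size to a power of two, the other for the rounding in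
  the division and the subtracted 1. This is the link between the cost of a rebuild and the counter
  that pays for it.\<close>

lemma budget_spent:
  assumes "0 < q"
  shows "size S < 4 * q * (budget q S + 1)"
proof -
  have "size S < 2 * 2 ^ lev S"
    using floor_log_exp2_gt[of "size S"] unfolding lev_def by simp
  moreover have "2 ^ lev S < q * (2 ^ lev S div q + 1)" using assms
    by (metis Suc_eq_plus1 dividend_less_times_div mult_Suc_right add.commute)
  moreover have "q * (2 ^ lev S div q + 1) \<le> 2 * q * (budget q S + 1)"
    unfolding budget_def using assms by (cases "2 ^ lev S div q") auto
  ultimately show ?thesis by linarith
qed

text \<open>The next conditions are evaluated on the multiset \<open>S0\<close> for which a vertex was built; the
  conclusions hold for the current multiset \<open>S\<close>.\<close>

locale thresholds =
  fixes k q :: nat and \<alpha> \<beta> \<epsilon> :: real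
  assumes eps: "0 < \<epsilon>" "\<epsilon> < 1 / (real k + 1)" "\<epsilon> < \<alpha> / 5" "\<epsilon> < \<beta> / 12.5" "\<beta> \<le> 1"
    and q: "q = nat \<lceil>1 / \<epsilon>\<rceil>"
begin

lemma q_ge: "1 / \<epsilon> \<le> real q" "real q < 1 / \<epsilon> + 1" "k + 1 < q" "5 \<le> q" "1 / real q \<le> \<epsilon>"
proof -
  have p: "0 < 1 / \<epsilon>" using eps by simp
  show 1: "1 / \<epsilon> \<le> real q" using real_nat_ceiling_ge q by blast
  show "real q < 1 / \<epsilon> + 1" using p q by linarith
  have "real k + 1 < 1 / \<epsilon>" using eps by (simp add: field_simps)
  then show "k + 1 < q" using 1 by linarith
  have "\<epsilon> < 1 / 12.5" using eps by (simp add: field_simps)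
  then have "5 \<le> 1 / \<epsilon>" using eps by (simp add: field_simps)
  then show "5 \<le> q" using 1 by linarith
  then have "0 < real q" by simp
  then show "1 / real q \<le> \<epsilon>" using 1 eps by (simp add: field_simps)
qed

context
  fixes S0 S c
  assumes cl: "close S0 c S" and c: "c = 0 \<or> (c + 1) * q \<le> size S0"
begin

text \<open>If any update was counted, then \<open>size S0 >= (c + 1) * q\<close>, and at least
  \<open>q > k\<close> examples remain; \<open>q > k + 1\<close> comes from the bound
  \<open>1 / (k + 1)\<close> on \<epsilon>.\<close>

lemma size_gt: "k < size S0 \<Longrightarrow> k < size S"
proof -
  assume k: "k < size S0"
  show ?thesis
  proof (cases "c = 0")
    case False
    then have "c * q + q \<le> size S0" using c by simp
    moreover have "c * 1 \<le> c * q" using q_ge by (intro mult_le_mono2) simp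
    ultimately show ?thesis using close_size[OF cl] q_ge(3) by linarith
  qed (use k close_size[OF cl] in simp)
qed

text \<open>At most \<open>k < q\<close> examples give budget 0, so no update has been tolerated
  yet.\<close>

lemma size_le: "size S0 \<le> k \<Longrightarrow> S = S0"
proof -
  assume "size S0 \<le> k"
  then have "\<not> (c + 1) * q \<le> size S0" using q_ge(3) by (auto simp: not_le intro: le_less_trans)
  then have "c = 0" using c by simp
  then show ?thesis using cl by (auto elim: close.cases)
qed

lemma cq: "real c * real q \<le> real (size S0)"
proof -
  have "c * q \<le> size S0" using c by (auto simp: algebra_simps)
  then show ?thesis by (metis of_nat_le_iff of_nat_mult)
qed

text \<open>From \<open>c <= size S0 / q\<close> and \<open>q >= 5\<close> the snapshot is at most
  5/4 times as large as \<open>S\<close>, which turns drift relative to the snapshot into drift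
  relative to the current size. The left side is the joint drift of two scaled gains.\<close>

lemma slack: "4 * real c \<le> 5 * \<epsilon> * real (size S)"
proof -
  have "real c * 5 \<le> real c * real q" using q_ge(4) by (intro mult_left_mono) auto
  then have c5: "5 * real c \<le> real (size S0)" using cq by linarith
  have "real (size S0) \<le> real (size S) + real c" using close_size[OF cl] by simp
  then have "4 * real (size S0) \<le> 5 * real (size S)" using c5 by linarith
  then have "4 * (real c * real q) \<le> 5 * real (size S)" using cq by linarith
  then have "4 * real c \<le> 5 * real (size S) * (1 / real q)"
    using q_ge(4) by (simp add: field_simps)
  also have "\<dots> \<le> 5 * real (size S) * \<epsilon>" using q_ge(5) by (intro mult_left_mono) auto
  finally show ?thesis by (simp add: algebra_simps)
qed

text \<open>The product condition leaves each class of \<open>S0\<close> at least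
  \<open>size S0 / q\<close> examples. By the reserve in the budget this exceeds \<open>c\<close>,
  so both labels survive.\<close>

lemma gini_pos:
  assumes "size S0 \<noteq> 0" "size S0 * size S0 \<le> cls S0 True * cls S0 False * q"
  shows "gini S \<noteq> 0"
proof -
  have *: "0 < cls S y" for y
  proof -
    have "size S0 * size S0 \<le> cls S0 y * q * size S0"
    proof -
      have "cls S0 True * cls S0 False = cls S0 y * cls S0 (\<not> y)" by (cases y) auto
      moreover have "cls S0 (\<not> y) \<le> size S0" using size_cls[of S0] by (cases y) auto
      ultimately have "cls S0 True * cls S0 False * q \<le> cls S0 y * size S0 * q" by simp
      from order_trans[OF assms(2) this] show ?thesis by (simp add: ac_simps)
    qed
    then have s: "size S0 \<le> cls S0 y * q" using assms(1) by simp
    have "c < cls S0 y"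
    proof (cases "c = 0")
      case True
      then show ?thesis using s assms(1) by (cases "cls S0 y") auto
    next
      case False
      then have "(c + 1) * q \<le> cls S0 y * q" using s c by linarith
      then have "c + 1 \<le> cls S0 y" using q_ge(4) mult_le_cancel2[of "c + 1" q "cls S0 y"] by linarith
      then show ?thesis by simp
    qed
    then show ?thesis using close_cls[OF cl, of y] by linarith
  qed
  then have "0 < real (cls S True)" "0 < real (cls S False)" by simp_all
  then have "0 < gF S" unfolding gF_def using size_cls[of S] by (auto intro!: divide_pos_pos)
  then show ?thesis using gini_gF[of S] by force
qed

text \<open>On the snapshot \<open>gF S0 * q < 2 * size S0\<close>, the drift adds at most
  \<open>2 * c * q <= 2 * size S0\<close>, and \<open>4 * size S0 <= 5 * size S\<close>. Hence
  \<open>gini S < 5 / q\<close>, the origin of the bound \<alpha>/5.\<close>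

lemma gini_small:
  assumes "cls S0 True * cls S0 False * q < size S0 * size S0" "S \<noteq> {#}"
  shows "gini S < \<alpha>"
proof -
  have s0: "0 < real (size S0)" using assms(1) by (cases "size S0") auto
  have "real (cls S0 True * cls S0 False * q) < real (size S0 * size S0)" using assms(1) of_nat_less_iff by blast
  then have f0: "gF S0 * real q < 2 * real (size S0)"
    unfolding gF_def using s0 by (simp add: field_simps)
  have "\<bar>gF S - gF S0\<bar> \<le> 2 * real c" by (rule close_lip[OF cl gF_lip])
  then have "gF S * real q \<le> gF S0 * real q + 2 * (real c * real q)"
    using q_ge(4) by (metis (no_types, opaque_lifting) abs_le_D1 diff_le_eq add.commute distrib_right mult.assoc mult_right_mono of_nat_0_le_iff)
  then have "gF S * real q < 4 * real (size S0)" using f0 cq by linarith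
  also have "\<dots> \<le> 5 * real (size S)"
  proof -
    have "real c * 5 \<le> real c * real q" using q_ge(4) by (intro mult_left_mono) auto
    then show ?thesis using cq close_size[OF cl] by linarith
  qed
  finally have "real (size S) * gini S * real q < 5 * real (size S)" using gini_gF by metis
  then have "real (size S) * (gini S * real q) < real (size S) * 5" by (simp add: ac_simps)
  moreover have "0 < real (size S)" using assms(2) by (simp add: nonempty_has_size)
  ultimately have "gini S * real q < 5" by (simp only: mult_less_cancel_left_pos)
  then have "gini S < 5 * (1 / real q)" using q_ge(4) by (simp add: field_simps)
  also have "\<dots> \<le> 5 * \<epsilon>" using q_ge(5) by simp
  finally show ?thesis using eps by simp
qed

text \<open>Each of the two scaled gains drifts by at most \<open>2 * c\<close>, and
  \<open>slack\<close> compares the sum with \<open>\<beta> * size S\<close>.\<close>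

lemma gain_opt:
  assumes "GG S0 (\<lambda>x. x j' \<le> t') \<le> GG S0 (\<lambda>x. x j \<le> t)" "S \<noteq> {#}"
  shows "gain S j' t' - \<beta> \<le> gain S j t"
proof -
  have "\<bar>GG S P - GG S0 P\<bar> \<le> 2 * real c" for P by (rule close_lip[OF cl GG_lip])
  then have "GG S (\<lambda>x. x j' \<le> t') \<le> GG S (\<lambda>x. x j \<le> t) + 4 * real c"
    using assms(1) by (smt (verit, best))
  also have "\<dots> \<le> GG S (\<lambda>x. x j \<le> t) + \<beta> * real (size S)"
  proof -
    have "5 * \<epsilon> * real (size S) \<le> \<beta> * real (size S)" using eps by (intro mult_right_mono) auto
    then show ?thesis using slack by linarith
  qed
  finally have "real (size S) * gain S j' t' \<le> real (size S) * (gain S j t + \<beta>)"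
    by (simp add: gain_GG algebra_simps)
  moreover have "0 < real (size S)" using assms(2) by (simp add: nonempty_has_size)
  ultimately show ?thesis by (simp only: mult_le_cancel_left_pos diff_le_eq)
qed

end

end

section \<open>The program\<close>

abbreviation (input) "rNI \<equiv> 43 :: nat"
abbreviation (input) "rNB \<equiv> 2 :: nat"
abbreviation (input) "rFR \<equiv> 3 :: nat"
abbreviation (input) "rY \<equiv> 4 :: nat"
abbreviation (input) "rL \<equiv> 5 :: nat"
abbreviation (input) "rA \<equiv> 6 :: nat"
abbreviation (input) "rP \<equiv> 7 :: nat"
abbreviation (input) "rCUR \<equiv> 8 :: nat"
abbreviation (input) "rOLD \<equiv> 9 :: nat"
abbreviation (input) "rNEW \<equiv> 10 :: nat"
abbreviation (input) "rV \<equiv> 11 :: nat"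
abbreviation (input) "rTRIG \<equiv> 12 :: nat"
abbreviation (input) "rEND \<equiv> 13 :: nat"
abbreviation (input) "rTEND \<equiv> 14 :: nat"
abbreviation (input) "rU \<equiv> 15 :: nat"
abbreviation (input) "rLIST \<equiv> 16 :: nat"
abbreviation (input) "rI \<equiv> 18 :: nat"
abbreviation (input) "rX \<equiv> 19 :: nat"
abbreviation (input) "rV1 \<equiv> 20 :: nat"
abbreviation (input) "rS \<equiv> 21 :: nat"
abbreviation (input) "rP2 \<equiv> 22 :: nat"
abbreviation (input) "rBN \<equiv> 23 :: nat"
abbreviation (input) "rBD \<equiv> 24 :: nat"
abbreviation (input) "rBJ \<equiv> 25 :: nat"
abbreviation (input) "rBA \<equiv> 26 :: nat"
abbreviation (input) "rJ \<equiv> 27 :: nat"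
abbreviation (input) "rP1 \<equiv> 28 :: nat"
abbreviation (input) "rN1 \<equiv> 29 :: nat"
abbreviation (input) "rS1 \<equiv> 30 :: nat"
abbreviation (input) "rS2 \<equiv> 31 :: nat"
abbreviation (input) "rCN \<equiv> 32 :: nat"
abbreviation (input) "rCD \<equiv> 33 :: nat"
abbreviation (input) "rLC \<equiv> 34 :: nat"
abbreviation (input) "rRC \<equiv> 35 :: nat"
abbreviation (input) "rW \<equiv> 36 :: nat"
abbreviation (input) "rSM \<equiv> 37 :: nat"
abbreviation (input) "rBG \<equiv> 38 :: nat"
abbreviation (input) "rPT \<equiv> 39 :: nat"
abbreviation (input) "rNT \<equiv> 40 :: nat"
abbreviation (input) "rM0 \<equiv> 41 :: nat"
abbreviation (input) "rU0 \<equiv> 42 :: nat"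

text \<open>Pointers are successors of record numbers, with 0 for nil. Records of points: label counts \<open>aIC\<close>,
  features \<open>aKEY\<close>, trie \<open>aTRI\<close>, next point in the list of a leaf \<open>aINX\<close>, membership in such a list \<open>aLST\<close>.
  Records of vertices: label counts \<open>aNN\<close>, successor in preorder \<open>aNXT\<close> (also used for the free list),
  right child \<open>aRGT\<close> (0 at a leaf), split \<open>aNJ\<close> and \<open>aNA\<close>, unused budget \<open>aBUD\<close>, depth \<open>aDEP\<close>, list of
  points \<open>aHEAD\<close> and its length \<open>aLEN\<close>, label counts per feature value \<open>aCNT\<close>.\<close>

abbreviation (input) "aIC \<equiv> 0 :: nat"
abbreviation (input) "aINX \<equiv> 15 :: nat"
abbreviation (input) "aLST \<equiv> 2 :: nat"
abbreviation (input) "aNN \<equiv> 3 :: nat"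
abbreviation (input) "aNXT \<equiv> 4 :: nat"
abbreviation (input) "aRGT \<equiv> 5 :: nat"
abbreviation (input) "aNJ \<equiv> 6 :: nat"
abbreviation (input) "aNA \<equiv> 7 :: nat"
abbreviation (input) "aBUD \<equiv> 8 :: nat"
abbreviation (input) "aDEP \<equiv> 9 :: nat"
abbreviation (input) "aHEAD \<equiv> 10 :: nat"
abbreviation (input) "aLEN \<equiv> 11 :: nat"
abbreviation (input) "aKEY \<equiv> 12 :: nat"
abbreviation (input) "aTRI \<equiv> 13 :: nat"
abbreviation (input) "aCNT \<equiv> 14 :: nat"

abbreviation ex_plus (infixl "\<oplus>" 75) where "a \<oplus> b \<equiv> Bin Plus a b"
abbreviation ex_minus (infixl "\<ominus>" 75) where "a \<ominus> b \<equiv> Bin Minus a b"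
abbreviation ex_times (infixl "\<otimes>" 78) where "a \<otimes> b \<equiv> Bin Times a b"
abbreviation inc where "inc r \<equiv> Asg r (V r \<oplus> N 1)"
abbreviation Get1 where "Get1 a e \<equiv> Get a e (N 0)"
abbreviation Put1 where "Put1 a e v \<equiv> Put a e (N 0) v"

section \<open>Routines of the program\<close>

definition p_clear :: "nat \<Rightarrow> ex \<Rightarrow> nat \<Rightarrow> hcom" where
  "p_clear a e n = Asg rL (N 0) ;; Whl (Lt (V rL) (N n)) (Put a e (V rL) (N 0) ;; inc rL)"

text \<open>A trie vertex of depth \<open>l\<close> is represented by the first point that passes through it, so that row
  \<open>l\<close> of the table of a point holds the edges below its vertex of depth \<open>l\<close>.\<close>

definition p_trie :: "nat \<Rightarrow> nat \<Rightarrow> hcom" where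
  "p_trie d m = p_clear aTRI (V rNI) (d * m) ;; Asg rCUR (N 0) ;; Asg rL (N 0) ;;
     Whl (Lt (V rL) (N d)) (
       Asg rA (V rL \<otimes> N m \<oplus> Get aKEY (V rNI) (V rL)) ;;
       Asg rP (Get aTRI (V rCUR) (V rA)) ;;
       If (Lt (N 0) (V rP)) (Asg rCUR (V rP \<ominus> N 1))
         (Put aTRI (V rCUR) (V rA) (V rNI \<oplus> N 1) ;; Asg rCUR (V rNI)) ;;
       inc rL)"

definition p_add :: "nat \<Rightarrow> nat \<Rightarrow> hcom" where
  "p_add d m = Asg rL (N 0) ;; Whl (Lt (V rL) (N d)) (
       Asg rA ((V rL \<otimes> N m \<oplus> Get aKEY (V rI) (V rL)) \<otimes> N 2) ;;
       Put aCNT (V rU) (V rA) (Get aCNT (V rU) (V rA) \<oplus> Get aIC (V rI) (N 0)) ;;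
       Put aCNT (V rU) (V rA \<oplus> N 1) (Get aCNT (V rU) (V rA \<oplus> N 1) \<oplus> Get aIC (V rI) (N 1)) ;;
       inc rL)"

definition p_count :: "nat \<Rightarrow> nat \<Rightarrow> hcom" where
  "p_count d m = p_clear aCNT (V rU) (2 * d * m) ;; Put aNN (V rU) (N 0) (N 0) ;; Put aNN (V rU) (N 1) (N 0) ;;
     Asg rX (Get1 aHEAD (V rU)) ;;
     Whl (Lt (N 0) (V rX)) (
       Asg rI (V rX \<ominus> N 1) ;; Asg rX (Get1 aINX (V rI)) ;;
       Put aNN (V rU) (N 0) (Get aNN (V rU) (N 0) \<oplus> Get aIC (V rI) (N 0)) ;;
       Put aNN (V rU) (N 1) (Get aNN (V rU) (N 1) \<oplus> Get aIC (V rI) (N 1)) ;;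
       p_add d m)"

definition p_alloc :: "nat \<Rightarrow> hcom" where
  "p_alloc r = If (Lt (N 0) (V rFR)) (Asg r (V rFR \<ominus> N 1) ;; Asg rFR (Get1 aNXT (V r)))
     (inc rNB ;; Asg r (V rNB))"

definition p_part :: hcom where
  "p_part = Put1 aHEAD (V rLC) (N 0) ;; Put1 aHEAD (V rRC) (N 0) ;;
     Put1 aLEN (V rLC) (N 0) ;; Put1 aLEN (V rRC) (N 0) ;;
     Asg rX (Get1 aHEAD (V rV)) ;;
     Whl (Lt (N 0) (V rX)) (
       Asg rI (V rX \<ominus> N 1) ;; Asg rX (Get1 aINX (V rI)) ;;
       If (Lt (V rBA) (Get aKEY (V rI) (V rBJ))) (Asg rW (V rRC)) (Asg rW (V rLC)) ;;
       Put1 aINX (V rI) (Get1 aHEAD (V rW)) ;; Put1 aHEAD (V rW) (V rI \<oplus> N 1) ;;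
       Put1 aLEN (V rW) (Get1 aLEN (V rW) \<oplus> N 1))"

text \<open>Maximizing the gain means minimizing \<open>P1 N1 / S1 + P2 N2 / S2\<close>, where \<open>S1\<close>, \<open>S2\<close> are the sizes of the two
  parts with \<open>P1\<close>, \<open>P2\<close> positive and \<open>N1\<close>, \<open>N2\<close> negative examples; fractions are compared by cross multiplication.\<close>

definition p_cand :: "nat \<Rightarrow> hcom" where
  "p_cand m = Asg rP1 (V rP1 \<oplus> Get aCNT (V rV) ((V rJ \<otimes> N m \<oplus> V rA) \<otimes> N 2 \<oplus> N 1)) ;;
     Asg rN1 (V rN1 \<oplus> Get aCNT (V rV) ((V rJ \<otimes> N m \<oplus> V rA) \<otimes> N 2)) ;;
     Asg rS1 (V rP1 \<oplus> V rN1) ;; Asg rS2 (V rS \<ominus> V rS1) ;;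
     Asg rCN (V rP1 \<otimes> V rN1 \<otimes> V rS2 \<oplus> (V rPT \<ominus> V rP1) \<otimes> (V rNT \<ominus> V rN1) \<otimes> V rS1) ;;
     Asg rCD (V rS1 \<otimes> V rS2) ;;
     If (Lt (V rCN \<otimes> V rBD) (V rBN \<otimes> V rCD))
       (Asg rBN (V rCN) ;; Asg rBD (V rCD) ;; Asg rBJ (V rJ) ;; Asg rBA (V rA)) HSkip"

text \<open>The initial champion is the unsplit vertex, marked by the impossible feature
  \<open>d\<close>. Only strict improvements replace it, so a split that wins has two nonempty
  sides.\<close>

definition p_best :: "nat \<Rightarrow> nat \<Rightarrow> hcom" where
  "p_best d m = Asg rBN (V rPT \<otimes> V rNT) ;; Asg rBD (V rS) ;; Asg rBJ (N d) ;; Asg rBA (N 0) ;; Asg rJ (N 0) ;;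
     Whl (Lt (V rJ) (N d)) (
       Asg rP1 (N 0) ;; Asg rN1 (N 0) ;; Asg rA (N 0) ;;
       Whl (Lt (V rA) (N m)) (p_cand m ;; inc rA) ;;
       inc rJ)"

definition p_sub :: "nat \<Rightarrow> nat \<Rightarrow> hcom" where
  "p_sub d m = Asg rL (N 0) ;; Whl (Lt (V rL) (N (2 * d * m)))
       (Put aCNT (V rBG) (V rL) (Get aCNT (V rV) (V rL) \<ominus> Get aCNT (V rSM) (V rL)) ;; inc rL) ;;
     Put aNN (V rBG) (N 0) (Get aNN (V rV) (N 0) \<ominus> Get aNN (V rSM) (N 0)) ;;
     Put aNN (V rBG) (N 1) (Get aNN (V rV) (N 1) \<ominus> Get aNN (V rSM) (N 1))"

text \<open>Only the right child has a pointer of its own; the left child is the preorder successor.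
  Both children are spliced in before the old successor, which keeps the thread valid for the loops
  that build and collect.\<close>

definition p_link :: hcom where
  "p_link = Put1 aDEP (V rLC) (Get1 aDEP (V rV) \<oplus> N 1) ;; Put1 aDEP (V rRC) (Get1 aDEP (V rV) \<oplus> N 1) ;;
     Put1 aNXT (V rRC) (Get1 aNXT (V rV)) ;; Put1 aNXT (V rLC) (V rRC \<oplus> N 1) ;;
     Put1 aNXT (V rV) (V rLC \<oplus> N 1) ;; Put1 aRGT (V rV) (V rRC \<oplus> N 1) ;;
     Put1 aNJ (V rV) (V rBJ) ;; Put1 aNA (V rV) (V rBA)"

definition p_split :: "nat \<Rightarrow> nat \<Rightarrow> hcom" where
  "p_split d m = p_alloc rLC ;; p_alloc rRC ;; p_part ;;
     If (Lt (Get1 aLEN (V rRC)) (Get1 aLEN (V rLC))) (Asg rSM (V rRC) ;; Asg rBG (V rLC))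
       (Asg rSM (V rLC) ;; Asg rBG (V rRC)) ;;
     Asg rU (V rSM) ;; p_count d m ;; p_sub d m ;; p_link"

definition p_budget :: "nat \<Rightarrow> hcom" where
  "p_budget q = Asg rPT (Get aNN (V rV) (N 1)) ;; Asg rNT (Get aNN (V rV) (N 0)) ;; Asg rS (V rPT \<oplus> V rNT) ;;
     Asg rP2 (N 1) ;; Whl (Lt (V rP2 \<otimes> N 2) (V rS \<oplus> N 1)) (Asg rP2 (V rP2 \<otimes> N 2)) ;;
     Put1 aBUD (V rV) (Bin Div (V rP2) (N q) \<ominus> N 1) ;; Put1 aRGT (V rV) (N 0)"

definition p_proc :: "nat \<Rightarrow> nat \<Rightarrow> nat \<Rightarrow> nat \<Rightarrow> nat \<Rightarrow> hcom" where
  "p_proc d m k h q = p_budget q ;;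
     If (Lt (N k) (V rS))
       (If (Lt (V rPT \<otimes> V rNT \<otimes> N q) (V rS \<otimes> V rS)) HSkip
         (If (Lt (Get1 aDEP (V rV)) (N h))
           (p_best d m ;; If (Lt (V rBJ) (N d)) (p_split d m) HSkip) HSkip)) HSkip"

text \<open>No stack is kept: children that have just been linked follow their parent on the
  preorder thread, so the loop meets them next.\<close>

definition p_build :: "nat \<Rightarrow> nat \<Rightarrow> nat \<Rightarrow> nat \<Rightarrow> nat \<Rightarrow> hcom" where
  "p_build d m k h q = Whl (Ne (V rV1) (V rTEND))
     (Asg rV (V rV1 \<ominus> N 1) ;; p_proc d m k h q ;; Asg rV1 (Get1 aNXT (V rV)))"

definition p_collect_list :: hcom where
  "p_collect_list = Asg rX (Get1 aHEAD (V rV)) ;;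
     Whl (Lt (N 0) (V rX)) (
       Asg rI (V rX \<ominus> N 1) ;; Asg rX (Get1 aINX (V rI)) ;;
       If (Lt (N 0) (Get aIC (V rI) (N 0) \<oplus> Get aIC (V rI) (N 1)))
         (Put1 aINX (V rI) (V rLIST) ;; Asg rLIST (V rI \<oplus> N 1))
         (Put1 aLST (V rI) (N 0)))"

text \<open>The root \<open>rU0\<close> of the subtree keeps its record, because its parent and its
  preorder predecessor point there. The successor is read before the field is reused as a link of
  the free list.\<close>

definition p_collect :: hcom where
  "p_collect = Whl (Ne (V rV1) (V rTEND)) (
       Asg rV (V rV1 \<ominus> N 1) ;; Asg rV1 (Get1 aNXT (V rV)) ;;
       If (Lt (N 0) (Get1 aRGT (V rV))) HSkip p_collect_list ;;
       If (Ne (V rV) (V rU0)) (Put1 aNXT (V rV) (V rFR) ;; Asg rFR (V rV \<oplus> N 1)) HSkip)"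

definition p_local :: hcom where
  "p_local = Asg rU0 (V rTRIG \<ominus> N 1) ;; Asg rV1 (V rTRIG) ;; Asg rLIST (N 0) ;; p_collect"

definition p_move :: "nat \<Rightarrow> nat \<Rightarrow> hcom" where
  "p_move d m = Put aIC (V rNI) (N 0) (Get aIC (V rOLD) (N 0)) ;; Put aIC (V rNI) (N 1) (Get aIC (V rOLD) (N 1)) ;;
     Asg rL (N 0) ;; Whl (Lt (V rL) (N d)) (Put aKEY (V rNI) (V rL) (Get aKEY (V rOLD) (V rL)) ;; inc rL) ;;
     p_trie d m ;; Put1 aINX (V rNI) (V rLIST) ;; Asg rLIST (V rNI \<oplus> N 1) ;; Put1 aLST (V rNI) (N 1) ;;
     inc rNI"

text \<open>A rebuild at the root is the occasion to drop dead points: live records are moved down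
  in place, the trie is grown anew, and all vertex records are released at once.\<close>

definition p_global :: "nat \<Rightarrow> nat \<Rightarrow> hcom" where
  "p_global d m = Asg rM0 (V rNI) ;; Asg rNI (N 0) ;; Asg rLIST (N 0) ;; Asg rOLD (N 0) ;;
     Whl (Lt (V rOLD) (V rM0)) (
       If (Lt (N 0) (Get aIC (V rOLD) (N 0) \<oplus> Get aIC (V rOLD) (N 1))) (p_move d m) HSkip ;; inc rOLD) ;;
     Asg rNB (N 0) ;; Asg rFR (N 0) ;; Asg rU0 (N 0) ;; Asg rTEND (N 0) ;; Put1 aDEP (N 0) (N 0)"

definition p_rebuild :: "nat \<Rightarrow> nat \<Rightarrow> nat \<Rightarrow> nat \<Rightarrow> nat \<Rightarrow> hcom" where
  "p_rebuild d m k h q = If (Ne (V rTRIG) (N 1)) p_local (p_global d m) ;;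
     Put1 aHEAD (V rU0) (V rLIST) ;; Put1 aNXT (V rU0) (V rTEND) ;; Asg rU (V rU0) ;; p_count d m ;;
     Asg rV1 (V rU0 \<oplus> N 1) ;; p_build d m k h q"

text \<open>\<open>rTRIG\<close> latches the first exhausted vertex and \<open>rTEND\<close> the
  pointer behind its subtree. Further down no budget is touched, since those vertices are about to
  be discarded.\<close>

definition p_touch :: hcom where
  "p_touch = If (Lt (N 0) (V rTRIG)) HSkip
     (If (Lt (N 0) (Get1 aBUD (V rV))) (Put1 aBUD (V rV) (Get1 aBUD (V rV) \<ominus> N 1))
       (Asg rTRIG (V rV \<oplus> N 1) ;; Asg rTEND (V rEND)))"

text \<open>\<open>rEND\<close> is the preorder successor of the current subtree: the right sibling
  after a step to the left, unchanged after a step to the right.\<close>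

definition p_walk :: hcom where
  "p_walk = Whl (Lt (N 0) (Get1 aRGT (V rV))) (
       If (Lt (Get1 aNA (V rV)) (Get aKEY (V rCUR) (Get1 aNJ (V rV)))) (Asg rV (Get1 aRGT (V rV) \<ominus> N 1))
         (Asg rEND (Get1 aRGT (V rV)) ;; Asg rV (Get1 aNXT (V rV) \<ominus> N 1)) ;;
       p_touch)"

text \<open>The point is written to the free slot \<open>rNI\<close> and inserted in the trie. If
  the search ends at another record, the point was already known and the slot stays free.\<close>

definition p_item :: "nat \<Rightarrow> nat \<Rightarrow> hcom" where
  "p_item d m = Asg rL (N 0) ;; Whl (Lt (V rL) (N d)) (Put aKEY (V rNI) (V rL) (In (V rL \<oplus> N 2)) ;; inc rL) ;;
     p_trie d m ;;
     If (Ne (V rCUR) (V rNI)) HSkip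
       (Put aIC (V rNI) (N 0) (N 0) ;; Put aIC (V rNI) (N 1) (N 0) ;; Put1 aLST (V rNI) (N 0) ;; inc rNI) ;;
     Asg rY (In (N 1)) ;; Asg rOLD (Get aIC (V rCUR) (V rY)) ;;
     If (Lt (N 0) (In (N 0))) (Asg rNEW (V rOLD \<ominus> N 1)) (Asg rNEW (V rOLD \<oplus> N 1)) ;;
     Put aIC (V rCUR) (V rY) (V rNEW)"

text \<open>Adding \<open>rNEW\<close> before subtracting \<open>rOLD\<close> avoids truncation. For
  a deletion of an inactive example both are 0, and the counts stay as they are.\<close>

definition p_leaf :: hcom where
  "p_leaf = Put aNN (V rV) (V rY) (Get aNN (V rV) (V rY) \<oplus> V rNEW \<ominus> V rOLD) ;;
     If (Lt (N 0) (Get1 aLST (V rCUR))) HSkip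
       (Put1 aINX (V rCUR) (Get1 aHEAD (V rV)) ;; Put1 aHEAD (V rV) (V rCUR \<oplus> N 1) ;; Put1 aLST (V rCUR) (N 1))"

text \<open>The leaf is updated before a rebuild, so that the collection already finds a new point
  in one of the lists.\<close>

definition p_update :: "nat \<Rightarrow> nat \<Rightarrow> nat \<Rightarrow> nat \<Rightarrow> nat \<Rightarrow> hcom" where
  "p_update d m k h q = p_item d m ;;
     Asg rV (N 0) ;; Asg rEND (N 0) ;; Asg rTRIG (N 0) ;; Asg rTEND (N 0) ;; p_touch ;; p_walk ;; p_leaf ;;
     If (Lt (N 0) (V rTRIG)) (p_rebuild d m k h q) HSkip"

definition p_label :: hcom where
  "p_label = Asg rV (N 0) ;; Whl (Lt (N 0) (Get1 aRGT (V rV)))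
       (If (Lt (Get1 aNA (V rV)) (In (Get1 aNJ (V rV) \<oplus> N 2))) (Asg rV (Get1 aRGT (V rV) \<ominus> N 1))
         (Asg rV (Get1 aNXT (V rV) \<ominus> N 1))) ;;
     If (Lt (Get aNN (V rV) (N 0)) (Get aNN (V rV) (N 1))) (Asg 0 (N 1)) (Asg 0 (N 0))"

definition p_main :: "nat \<Rightarrow> nat \<Rightarrow> nat \<Rightarrow> nat \<Rightarrow> nat \<Rightarrow> hcom" where
  "p_main d m k h q = If (Lt (In (N 0)) (N 2)) (p_update d m k h q) p_label"

lemmas prog_defs = p_clear_def p_trie_def p_add_def p_count_def p_alloc_def p_part_def p_cand_def p_best_def
  p_sub_def p_link_def p_split_def p_budget_def p_proc_def p_build_def p_collect_list_def p_collect_def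
  p_local_def p_move_def p_global_def p_rebuild_def p_touch_def p_walk_def p_item_def p_leaf_def p_update_def
  p_label_def p_main_def

text \<open>The parameters enter the code as literals only; they never determine how many
  instructions are generated.\<close>

lemma com_size_main: "\<exists>c. \<forall>d m k h q. com_size (comp d m (p_main d m k h q)) = c"
proof -
  have "com_size (comp d m (p_main d m k h q)) = com_size (comp 0 0 (p_main 0 0 0 0 0))" for d m k h q
    unfolding prog_defs by (simp add: cadr_def)
  then show ?thesis by blast
qed

section \<open>Linked lists and table indices\<close>

fun lst :: "(nat \<Rightarrow> nat) \<Rightarrow> nat \<Rightarrow> nat list \<Rightarrow> bool" where
  "lst nx p [] \<longleftrightarrow> p = 0"
| "lst nx p (i # its) \<longleftrightarrow> p = Suc i \<and> lst nx (nx i) its"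

lemma lst_cong: "lst nx p its \<Longrightarrow> (\<And>i. i \<in> set its \<Longrightarrow> nx' i = nx i) \<Longrightarrow> lst nx' p its"
  by (induction its arbitrary: p) auto

lemma lst_0: "lst nx 0 its \<longleftrightarrow> its = []"
  by (cases its) auto

definition cidx :: "nat \<Rightarrow> nat \<Rightarrow> nat \<Rightarrow> nat \<Rightarrow> nat" where
  "cidx m l a y = (l * m + a) * 2 + y"

lemma tidx_less: "l < d \<Longrightarrow> a < m \<Longrightarrow> l * m + a < d * m" for l d a m :: nat
proof -
  assume "l < d" "a < m"
  then have "Suc l * m \<le> d * m" by (intro mult_le_mono1) simp
  then show "l * m + a < d * m" using \<open>a < m\<close> by simp
qed

lemma tidx_inj: "a < m \<Longrightarrow> a' < m \<Longrightarrow> l * m + a = l' * m + a' \<longleftrightarrow> l = l' \<and> a = a'" for l l' a a' m :: nat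
proof -
  assume a: "a < m" "a' < m"
  have "l = (l * m + a) div m" "l' = (l' * m + a') div m" using a by simp_all
  then show ?thesis by force
qed

lemma cidx_less: "l < d \<Longrightarrow> a < m \<Longrightarrow> y < 2 \<Longrightarrow> cidx m l a y < 2 * d * m"
  using tidx_less[of l d a m] unfolding cidx_def by simp

lemma cidx_inj:
  "a < m \<Longrightarrow> a' < m \<Longrightarrow> y < 2 \<Longrightarrow> y' < 2 \<Longrightarrow> cidx m l a y = cidx m l' a' y' \<longleftrightarrow> l = l' \<and> a = a' \<and> y = y'"
proof -
  assume a: "a < m" "a' < m" "y < 2" "y' < 2"
  have "cidx m l a y = cidx m l' a' y' \<longleftrightarrow> l * m + a = l' * m + a' \<and> y = y'"
    unfolding cidx_def using a by presburger
  then show ?thesis using tidx_inj[OF a(1,2)] by auto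
qed

text \<open>\<open>Z\<close> bounds the parameters, table sizes and counts. The largest intermediate
  results are the cross products in \<open>p_cand\<close>, at most \<open>2 * Z ^ 5\<close>.\<close>

locale rb = ram +
  fixes k h q Z :: nat
  assumes bounds: "1 \<le> d" "2 * d * m + 2 \<le> Z" "d + 2 \<le> Z" "NR + 2 \<le> Z" "k \<le> Z" "h \<le> Z" "q \<le> Z" "1 \<le> q"
    and W: "8 * Z ^ 6 \<le> W"
begin

lemma Z_ge: "2 \<le> Z" using bounds by linarith

lemma Zpow: "i \<le> j \<Longrightarrow> Z ^ i \<le> Z ^ j"
  using Z_ge by (intro power_increasing) auto

lemma wlt: "x \<le> 7 * Z \<Longrightarrow> x < W"
proof -
  assume "x \<le> 7 * Z"
  moreover have "Z \<le> Z ^ 6" using Zpow[of 1 6] by simp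
  ultimately show "x < W" using W Z_ge by linarith
qed

lemma wbd: "2 * d * m < W" "d * m < W" "d < W" "m < W" "k < W" "h < W" "q < W" "0 < W" "Suc 0 < W" "2 < W" "1 < W"
  "NR < W"
proof -
  have dm: "m \<le> d * m" using bounds by simp
  moreover have "2 * d * m \<le> Z" "d * m \<le> Z" using bounds by (simp_all add: mult.assoc)
  ultimately have "m \<le> Z" by linarith
  note this \<open>2 * d * m \<le> Z\<close> \<open>d * m \<le> Z\<close>
  then show "2 * d * m < W" "d * m < W" "d < W" "m < W" "k < W" "h < W" "q < W" "0 < W" "Suc 0 < W" "2 < W" "1 < W"
    "NR < W"
    using bounds Z_ge by (auto intro!: wlt)
qed

lemma upd_apply: "upd G a i s v a' i' s' = (if a' = a \<and> i' = i \<and> s' = s then v else G a' i' s')"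
  by (simp add: upd_def)

lemmas wids = wid_def

text \<open>Like the later rules for routines, this is stated for an arbitrary postcondition
  \<open>Q\<close>, with time bound and frame conditions as premises of \<open>Q\<close>; such rules
  chain along a program.\<close>

lemma clear:
  assumes "a < 16" "R r < NR" "n \<le> wid d m a" "n < W" "r \<noteq> rL" "r < 100"
    and Q: "\<And>t' R' G'. t' \<le> t + 25 * n + 20 \<Longrightarrow> (\<And>r. r \<noteq> rL \<Longrightarrow> R' r = R r) \<Longrightarrow>
      (\<And>a' i s. \<not> (a' = a \<and> i = R r \<and> s < n) \<Longrightarrow> G' a' i s = G a' i s) \<Longrightarrow>
      (\<And>s. s < n \<Longrightarrow> G' a (R r) s = 0) \<Longrightarrow> Q (t', R', G')"
  shows "wp (p_clear a (V r) n) Q (t, R, G)"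
proof -
  let ?J = "\<lambda>l (t', R', G'). t' \<le> t + 5 + 25 * l \<and> (\<forall>r. r \<noteq> rL \<longrightarrow> R' r = R r) \<and> R' rL = l \<and>
      (\<forall>a' i s. \<not> (a' = a \<and> i = R r \<and> s < l) \<longrightarrow> G' a' i s = G a' i s) \<and>
      (\<forall>s<l. G' a (R r) s = 0)"
  show ?thesis unfolding p_clear_def
    apply (simp add: wbd)
    apply (rule wp_for[where J = ?J and i = 0 and n = n])
    subgoal by simp
    subgoal by simp
    subgoal for l t' R' G' using assms(1-6) by (auto simp: wbd upd_apply less_Suc_eq)
    subgoal for t' R' G' using assms(1-6) by (auto intro!: Q)
    done
qed

definition csum :: "mem \<Rightarrow> nat list \<Rightarrow> nat \<Rightarrow> nat \<Rightarrow> nat \<Rightarrow> nat" where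
  "csum G its l a y = (\<Sum>i\<leftarrow>its. if G aKEY i l = a then G aIC i y else 0)"

definition nsum :: "mem \<Rightarrow> nat list \<Rightarrow> nat \<Rightarrow> nat" where
  "nsum G its y = (\<Sum>i\<leftarrow>its. G aIC i y)"

lemma csum_le: "csum G its l a y \<le> nsum G its y"
  unfolding csum_def nsum_def by (intro sum_list_mono) auto

lemma add:
  assumes "R rU < NR" "R rI < NR" "\<And>l. l < d \<Longrightarrow> G aKEY (R rI) l < m"
    and b: "\<And>l a y. l < d \<Longrightarrow> a < m \<Longrightarrow> y < 2 \<Longrightarrow> G aCNT (R rU) (cidx m l a y) + G aIC (R rI) y \<le> Z"
    and Q: "\<And>t' R' G'. t' \<le> t + 100 * d + 20 \<Longrightarrow> (\<And>r. r \<noteq> rL \<Longrightarrow> r \<noteq> rA \<Longrightarrow> R' r = R r) \<Longrightarrow>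
      (\<And>a' i s. \<not> (a' = aCNT \<and> i = R rU) \<Longrightarrow> G' a' i s = G a' i s) \<Longrightarrow>
      (\<And>l a y. l < d \<Longrightarrow> a < m \<Longrightarrow> y < 2 \<Longrightarrow> G' aCNT (R rU) (cidx m l a y) =
        G aCNT (R rU) (cidx m l a y) + (if G aKEY (R rI) l = a then G aIC (R rI) y else 0)) \<Longrightarrow> Q (t', R', G')"
  shows "wp (p_add d m) Q (t, R, G)"
proof -
  let ?u = "R rU" and ?i = "R rI"
  let ?J = "\<lambda>n (t', R', G'). t' \<le> t + 3 + 100 * n \<and> (\<forall>r. r \<noteq> rL \<longrightarrow> r \<noteq> rA \<longrightarrow> R' r = R r) \<and> R' rL = n \<and>
      (\<forall>a' i s. \<not> (a' = aCNT \<and> i = ?u) \<longrightarrow> G' a' i s = G a' i s) \<and>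
      (\<forall>l<d. \<forall>a<m. \<forall>y<2. G' aCNT ?u (cidx m l a y) =
        G aCNT ?u (cidx m l a y) + (if l < n \<and> G aKEY ?i l = a then G aIC ?i y else 0))"
  show ?thesis unfolding p_add_def
    apply (simp add: wbd)
    apply (rule wp_for[where J = ?J and i = 0 and n = d])
    subgoal by simp
    subgoal by simp
    subgoal premises p for n t' R' G'
    proof -
      let ?a = "G aKEY ?i n"
      have a: "?a < m" using assms(3) p by auto
      have J: "t' \<le> t + 3 + 100 * n" "\<And>r. r \<noteq> rL \<Longrightarrow> r \<noteq> rA \<Longrightarrow> R' r = R r" "R' rL = n"
        "\<And>a' i s. \<not> (a' = aCNT \<and> i = ?u) \<Longrightarrow> G' a' i s = G a' i s"
        "\<And>l a y. l < d \<Longrightarrow> a < m \<Longrightarrow> y < 2 \<Longrightarrow> G' aCNT ?u (cidx m l a y) =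
          G aCNT ?u (cidx m l a y) + (if l < n \<and> G aKEY ?i l = a then G aIC ?i y else 0)"
        using p(1) by auto
      have c01: "n * m * 2 + ?a * 2 = cidx m n ?a 0" "Suc (cidx m n ?a 0) = cidx m n ?a 1"
        by (auto simp: cidx_def)
      have ix: "cidx m n ?a 0 < 2 * d * m" "cidx m n ?a (Suc 0) < 2 * d * m" "n * m + ?a < d * m"
        using cidx_less[of n d ?a m] tidx_less[of n d ?a m] a p by auto
      have w: "cidx m n ?a 0 < W" "cidx m n ?a (Suc 0) < W" "n * m + ?a < W" "n * m < W" "n < W" "Suc n < W"
        using ix wbd p by linarith+
      have v: "G' aCNT ?u (cidx m n ?a y) + G aIC ?i y < W" if "y < 2" for y
        using b[of n ?a y] J(5)[of n ?a y] that p a by (auto intro!: wlt)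
      show ?thesis using p(2) assms(1,2) a v[of 0] v[of 1]
        using J(1) by (auto simp: J(2-) wbd w c01 ix wids upd_apply cidx_inj less_Suc_eq)
    qed
    subgoal for t' R' G' using wbd by (auto intro!: Q)
    done
qed


lemma count:
  assumes "R rU < NR" "lst (\<lambda>i. G aINX i 0) (G aHEAD (R rU) 0) its"
    and i: "\<And>i l. i \<in> set its \<Longrightarrow> i < NR" "\<And>i l. i \<in> set its \<Longrightarrow> l < d \<Longrightarrow> G aKEY i l < m"
    and b: "nsum G its 0 + nsum G its 1 \<le> Z"
    and Q: "\<And>t' R' G'. t' \<le> t + 100 * (d * m) + 200 + 250 * (d * length its) \<Longrightarrow>
      (\<And>r. r \<noteq> rL \<Longrightarrow> r \<noteq> rA \<Longrightarrow> r \<noteq> rX \<Longrightarrow> r \<noteq> rI \<Longrightarrow> R' r = R r) \<Longrightarrow>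
      (\<And>a' i s. \<not> ((a' = aCNT \<or> a' = aNN) \<and> i = R rU) \<Longrightarrow> G' a' i s = G a' i s) \<Longrightarrow>
      (\<And>l a y. l < d \<Longrightarrow> a < m \<Longrightarrow> y < 2 \<Longrightarrow> G' aCNT (R rU) (cidx m l a y) = csum G its l a y) \<Longrightarrow>
      (\<And>y. y < 2 \<Longrightarrow> G' aNN (R rU) y = nsum G its y) \<Longrightarrow> Q (t', R', G')"
  shows "wp (p_count d m) Q (t, R, G)"
proof -
  let ?u = "R rU" and ?n = "length its"
  define J where "J = (\<lambda>n (t', R', G'). t' \<le> t + 100 * (d * m) + 150 + 250 * (d * n) \<and>
      (\<forall>r. r \<noteq> rL \<longrightarrow> r \<noteq> rA \<longrightarrow> r \<noteq> rX \<longrightarrow> r \<noteq> rI \<longrightarrow> R' r = R r) \<and>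
      lst (\<lambda>i. G aINX i 0) (R' rX) (drop n its) \<and>
      (\<forall>a' i s. \<not> ((a' = aCNT \<or> a' = aNN) \<and> i = ?u) \<longrightarrow> G' a' i s = G a' i s) \<and>
      (\<forall>l<d. \<forall>a<m. \<forall>y<2. G' aCNT ?u (cidx m l a y) = csum G (take n its) l a y) \<and>
      (\<forall>y<2. G' aNN ?u y = nsum G (take n its) y))"
  show ?thesis unfolding p_count_def
    apply simp
    apply (rule clear)
    subgoal by simp
    subgoal using assms(1) by simp
    subgoal by (simp add: wids)
    subgoal by (simp add: wbd)
    subgoal by simp
    subgoal by simp
    subgoal premises p for t1 R1 G1
    proof -
      have z: "G1 aCNT ?u (cidx m l a y) = 0" if "l < d" "a < m" "y < 2" for l a y
        using p(4)[OF cidx_less[OF that]] by simp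
      have p1: "t1 \<le> t + 50 * (d * m) + 20" using p(1) by simp
      show ?thesis
      apply (simp add: wbd wids p(2) assms(1))
      apply (rule wp_for[where J = J and i = 0 and n = ?n])
      subgoal using p(2,3) p1 assms(2) by (auto simp: J_def upd_apply csum_def nsum_def z less_Suc_eq numeral_2_eq_2)
      subgoal by simp
      subgoal premises pp for n t' R' G'
      proof -
        let ?i = "its ! n"
        have J: "t' \<le> t + 100 * (d * m) + 150 + 250 * (d * n)"
          "\<And>r. r \<noteq> rL \<Longrightarrow> r \<noteq> rA \<Longrightarrow> r \<noteq> rX \<Longrightarrow> r \<noteq> rI \<Longrightarrow> R' r = R r"
          "lst (\<lambda>i. G aINX i 0) (R' rX) (drop n its)"
          "\<And>a' i s. \<not> ((a' = aCNT \<or> a' = aNN) \<and> i = ?u) \<Longrightarrow> G' a' i s = G a' i s"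
          "\<And>l a y. l < d \<Longrightarrow> a < m \<Longrightarrow> y < 2 \<Longrightarrow> G' aCNT ?u (cidx m l a y) = csum G (take n its) l a y"
          "\<And>y. y < 2 \<Longrightarrow> G' aNN ?u y = nsum G (take n its) y"
          using pp(1) by (auto simp: J_def)
        have ii: "?i \<in> set its" using pp(2) by simp
        have dr: "drop n its = ?i # drop (Suc n) its" using pp(2) by (simp add: Cons_nth_drop_Suc)
        have x: "R' rX = Suc ?i" "lst (\<lambda>i. G aINX i 0) (G aINX ?i 0) (drop (Suc n) its)"
          using J(3) unfolding dr by auto
        have ts: "take (Suc n) its = take n its @ [?i]" using pp(2) by (simp add: take_Suc_conv_app_nth)
        have ns: "nsum G (take n its) y + G aIC ?i y \<le> nsum G its y" for y
        proof -
          have "nsum G its y = nsum G (take (Suc n) its) y + nsum G (drop (Suc n) its) y"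
            unfolding nsum_def by (metis append_take_drop_id map_append sum_list_append)
          then show ?thesis unfolding ts by (simp add: nsum_def)
        qed
        have nz: "nsum G its y \<le> Z" if "y < 2" for y using b that by (auto simp: less_Suc_eq numeral_2_eq_2)
        have w: "nsum G (take n its) y + G aIC ?i y < W" if "y < 2" for y
          using ns[of y] nz[OF that] by (intro wlt) simp
        show ?thesis
          apply (simp add: x J(2-) wbd wids upd_apply assms(1) i(1)[OF ii] w[of 0, simplified] w[of 1, simplified])
          apply (rule add)
          subgoal using J(2) assms(1) by simp
          subgoal using i(1)[OF ii] by simp
          subgoal using i(2)[OF ii] by (simp add: upd_apply J)
          subgoal for l a y using J(2) J(5)[of l a y] csum_le[of G "take n its" l a y] ns[of y] nz[of y] by (simp add: upd_apply J)
          subgoal premises q for t2 R2 G2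
            unfolding J_def prod.case
            apply (intro conjI allI impI)
            subgoal
            proof -
              have "1 \<le> d" by (rule bounds)
              then show ?thesis using q(1) J(1) by (simp add: algebra_simps)
            qed
            subgoal for r using q(2)[of r] J(2)[of r] by simp
            subgoal using q(2) x(2) by simp
            subgoal for a' j s using q(3)[of a' j s] J(2)[of rU] J(4)[of a' j s] by (auto simp: upd_apply)
            subgoal for l a y using q(4)[of l a y] J(2)[of rU] J(5)[of l a y] by (simp add: ts csum_def upd_apply J(4))
            subgoal for y using q(3)[of aNN ?u y] J(2)[of rU] J(6)[of y]
              by (auto simp: ts nsum_def upd_apply less_Suc_eq numeral_2_eq_2)
            done
          done
      qed
      subgoal for t' R' G' using wbd by (auto simp: J_def lst_0 intro!: Q)
      done
    qed
    done
qed

section \<open>Comparing impurities by cross multiplication\<close>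

definition fv :: "nat \<Rightarrow> nat \<Rightarrow> real" where
  "fv a b = real a * real b / real (a + b)"

lemma frac_less: "0 < cd \<Longrightarrow> 0 < bd \<Longrightarrow> cn / cd < bn / bd \<longleftrightarrow> cn * bd < bn * cd" for cn cd bn bd :: real
  by (simp add: field_simps)

text \<open>The difficulty is an empty part, where the denominator is 0. A strict cross inequality
  is then impossible, so an accepted candidate is a genuine split; a rejected degenerate candidate
  has the value of the unsplit vertex, which the champion does not exceed.\<close>

lemma fv_frac:
  assumes "P1 \<le> PT" "N1 \<le> NT"
  shows "real (P1 * N1 * (PT + NT - (P1 + N1)) + (PT - P1) * (NT - N1) * (P1 + N1)) * real bd
      < real bn * real ((P1 + N1) * (PT + NT - (P1 + N1))) \<Longrightarrow> 0 < bd \<Longrightarrow>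
      0 < (P1 + N1) * (PT + NT - (P1 + N1)) \<and> fv P1 N1 + fv (PT - P1) (NT - N1) < real bn / real bd"
    and "\<not> real (P1 * N1 * (PT + NT - (P1 + N1)) + (PT - P1) * (NT - N1) * (P1 + N1)) * real bd
      < real bn * real ((P1 + N1) * (PT + NT - (P1 + N1))) \<Longrightarrow> 0 < bd \<Longrightarrow> real bn / real bd \<le> fv PT NT \<Longrightarrow>
      real bn / real bd \<le> fv P1 N1 + fv (PT - P1) (NT - N1)"
    and "0 < (P1 + N1) * (PT + NT - (P1 + N1)) \<Longrightarrow>
      real (P1 * N1 * (PT + NT - (P1 + N1)) + (PT - P1) * (NT - N1) * (P1 + N1)) /
        real ((P1 + N1) * (PT + NT - (P1 + N1))) = fv P1 N1 + fv (PT - P1) (NT - N1)"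
proof -
  let ?s1 = "P1 + N1" and ?s2 = "PT + NT - (P1 + N1)"
  let ?cn = "P1 * N1 * ?s2 + (PT - P1) * (NT - N1) * ?s1" and ?cd = "?s1 * ?s2"
  have s2: "?s2 = (PT - P1) + (NT - N1)" using assms by simp
  have eq: "real ?cn / real ?cd = fv P1 N1 + fv (PT - P1) (NT - N1)" if "0 < ?cd"
  proof -
    have "0 < ?s1" "0 < ?s2" using that by auto
    then have p: "real ?s1 \<noteq> 0" "real ?s2 \<noteq> 0" by (simp_all only: of_nat_eq_0_iff neq0_conv not_False_eq_True)
    have "fv P1 N1 = real (P1 * N1) / real ?s1" "fv (PT - P1) (NT - N1) = real ((PT - P1) * (NT - N1)) / real ?s2"
      unfolding fv_def s2 by simp_all
    then have "fv P1 N1 + fv (PT - P1) (NT - N1) =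
        (real (P1 * N1) * real ?s2 + real ((PT - P1) * (NT - N1)) * real ?s1) / (real ?s1 * real ?s2)"
      using add_frac_eq[OF p] by (simp only:)
    then show ?thesis by (simp only: of_nat_add of_nat_mult)
  qed
  then show "0 < ?cd \<Longrightarrow> real ?cn / real ?cd = fv P1 N1 + fv (PT - P1) (NT - N1)" .
  show "0 < ?cd \<and> fv P1 N1 + fv (PT - P1) (NT - N1) < real bn / real bd"
    if l: "real ?cn * real bd < real bn * real ?cd" and bd: "0 < bd"
  proof -
    have c: "0 < ?cd"
    proof (rule ccontr)
      assume "\<not> 0 < ?cd"
      then have "?cd = 0" by (simp only: not_gr_zero)
      then have "real bn * real ?cd = 0" by (simp only: of_nat_0 mult_zero_right)
      moreover have "0 \<le> real ?cn * real bd" by (intro mult_nonneg_nonneg) auto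
      ultimately show False using l by linarith
    qed
    then have "0 < real ?cd" "0 < real bd" using bd by (simp_all only: of_nat_0_less_iff)
    then have "real ?cn / real ?cd < real bn / real bd" using l by (simp only: frac_less)
    then show ?thesis using c eq by simp
  qed
  show "real bn / real bd \<le> fv P1 N1 + fv (PT - P1) (NT - N1)"
    if l: "\<not> real ?cn * real bd < real bn * real ?cd" and bd: "0 < bd" and le: "real bn / real bd \<le> fv PT NT"
  proof (cases "0 < ?cd")
    case True
    have "0 < real ?cd" "0 < real bd" using True bd by (simp_all only: of_nat_0_less_iff)
    then have "real bn / real bd \<le> real ?cn / real ?cd" using l by (simp only: frac_less not_less[symmetric] not_False_eq_True)
    then show ?thesis using eq[OF True] by simp
  next
    case False
    then have "?s1 = 0 \<or> ?s2 = 0" by (metis mult_is_0 neq0_conv)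
    then show ?thesis
    proof
      assume "?s1 = 0"
      then show ?thesis using le by (simp add: fv_def)
    next
      assume "?s2 = 0"
      then have "P1 = PT" "N1 = NT" using assms by auto
      then show ?thesis using le by (simp add: fv_def)
    qed
  qed
qed


section \<open>The trie described by first matches\<close>

definition fnd :: "((nat \<Rightarrow> nat) \<Rightarrow> bool) \<Rightarrow> (nat \<Rightarrow> nat) list \<Rightarrow> nat" where
  "fnd P ks = (let i = length (takeWhile (\<lambda>x. \<not> P x) ks) in if i < length ks then Suc i else 0)"

lemma fnd_Nil: "fnd P [] = 0"
  by (simp add: fnd_def)

lemma fnd_snoc: "fnd P (ks @ [f]) = (if fnd P ks \<noteq> 0 then fnd P ks else if P f then Suc (length ks) else 0)"
proof (cases "\<exists>x\<in>set ks. P x")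
  case True
  then obtain x where x: "x \<in> set ks" "P x" by blast
  then have "length (takeWhile (\<lambda>x. \<not> P x) ks) < length ks"
    by (metis length_takeWhile_less_P_nth in_set_conv_nth linorder_neqE_nat nth_mem order.refl less_irrefl le_eq_less_or_eq length_takeWhile_le takeWhile_eq_all_conv takeWhile_eq_take take_all)
  then show ?thesis using x by (simp add: fnd_def Let_def takeWhile_append1[of x])
next
  case False
  then have tw: "takeWhile (\<lambda>x. \<not> P x) ks = ks" by (simp add: takeWhile_eq_all_conv)
  show ?thesis using False by (auto simp: fnd_def Let_def tw takeWhile_append)
qed

lemma fnd_0: "fnd P ks = 0 \<longleftrightarrow> (\<forall>x\<in>set ks. \<not> P x)"
  by (induction ks rule: rev_induct) (auto simp: fnd_Nil fnd_snoc)

lemma fnd_SucD: "fnd P ks = Suc i \<Longrightarrow> i < length ks \<and> P (ks ! i)"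
  by (induction ks rule: rev_induct) (auto simp: fnd_Nil fnd_snoc nth_append split: if_splits)

lemma fnd_cong: "(\<And>x. x \<in> set ks \<Longrightarrow> P x = P' x) \<Longrightarrow> fnd P ks = fnd P' ks"
  by (induction ks rule: rev_induct) (auto simp: fnd_Nil fnd_snoc)

definition agr :: "nat \<Rightarrow> (nat \<Rightarrow> nat) \<Rightarrow> (nat \<Rightarrow> nat) \<Rightarrow> bool" where
  "agr l f g \<longleftrightarrow> (\<forall>l'<l. f l' = g l')"

text \<open>Row \<open>l\<close> of the owner of a trie vertex: the edge labelled \<open>a\<close>
  leads to the owner of the child, i.e. to the first key with the longer prefix. The offset by one
  in \<open>fnd\<close> makes this a pointer, with 0 for a missing edge.\<close>

definition trow :: "(nat \<Rightarrow> nat) list \<Rightarrow> nat \<Rightarrow> nat \<Rightarrow> nat \<Rightarrow> nat" where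
  "trow ks i l a = fnd (\<lambda>g. agr l (ks ! i) g \<and> g l = a) ks"

text \<open>Record \<open>i\<close> represents the trie vertex of depth \<open>l\<close> on its own
  route.\<close>

definition towner :: "(nat \<Rightarrow> nat) list \<Rightarrow> nat \<Rightarrow> nat \<Rightarrow> bool" where
  "towner ks i l \<longleftrightarrow> fnd (agr l (ks ! i)) ks = Suc i"

text \<open>Only the rows of owners are constrained; the search reads no others.\<close>

definition trieI :: "mem \<Rightarrow> (nat \<Rightarrow> nat) list \<Rightarrow> bool" where
  "trieI G ks \<longleftrightarrow> (\<forall>i<length ks. \<forall>l<d. \<forall>a<m. towner ks i l \<longrightarrow> G aTRI i (l * m + a) = trow ks i l a)"

lemma agr_cong: "agr l f f' \<Longrightarrow> agr l f = agr l f'"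
  unfolding agr_def by (intro ext) auto

lemma fnd_agr_cong: "agr l f f' \<Longrightarrow> fnd (agr l f) ks = fnd (agr l f') ks"
  using agr_cong by (metis (full_types))

text \<open>Appending \<open>f\<close> affects one entry per depth: the owner \<open>cur\<close> of
  the prefix of \<open>f\<close> gets an edge to the new record if it had none for the value
  \<open>f l\<close>.\<close>

lemma trow_step:
  fixes ks f
  defines "k2 \<equiv> ks @ [f]"
  assumes cur: "fnd (agr l f) k2 = Suc cur" and i: "i \<le> length ks" and ow: "towner k2 i l"
  shows "i < length ks \<Longrightarrow> towner ks i l"
    and "trow k2 i l a = (let old = (if i < length ks then trow ks i l a else 0)
       in if i = cur \<and> a = f l \<and> old = 0 then Suc (length ks) else old)"
proof -
  have sn: "fnd P k2 = (if fnd P ks \<noteq> 0 then fnd P ks else if P f then Suc (length ks) else 0)" for P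
    unfolding k2_def by (rule fnd_snoc)
  have k2i: "k2 ! i = (if i < length ks then ks ! i else f)" using i by (auto simp: k2_def nth_append)
  show 1: "towner ks i l" if "i < length ks" using ow that unfolding towner_def sn k2i by (auto split: if_splits)
  show "trow k2 i l a = (let old = (if i < length ks then trow ks i l a else 0)
       in if i = cur \<and> a = f l \<and> old = 0 then Suc (length ks) else old)"
  proof (cases "i < length ks")
    case True
    have i1: "i = cur" if "agr l (ks ! i) f"
      using fnd_agr_cong[OF that, of k2] cur ow True unfolding towner_def k2i by simp
    have i2: "agr l (ks ! i) f" if "i = cur"
    proof -
      have "k2 ! cur = ks ! i" using k2i True that by simp
      then show ?thesis using fnd_SucD[OF cur] unfolding agr_def by auto
    qed
    have "agr l (ks ! i) f \<longleftrightarrow> i = cur" using i1 i2 by blast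
    then show ?thesis unfolding trow_def sn k2i Let_def using True by (cases "i = cur"; cases "a = f l") auto
  next
    case False
    then have i': "i = length ks" using i by simp
    have o: "fnd (agr l f) k2 = Suc (length ks)" using ow i' unfolding towner_def k2i by simp
    then have "fnd (agr l f) ks = 0" using fnd_SucD[of "agr l f" ks] unfolding sn by (auto split: if_splits)
    then have "fnd (\<lambda>g. agr l f g \<and> g l = a) ks = 0" by (auto simp: fnd_0)
    then show ?thesis using i' o cur unfolding trow_def sn k2i Let_def by (auto simp: agr_def)
  qed
qed

text \<open>Following this edge, or creating it, leads to the owner of the prefix that is longer by
  one.\<close>

lemma tcur_step:
  fixes ks f
  defines "k2 \<equiv> ks @ [f]"
  assumes cur: "fnd (agr l f) k2 = Suc cur"
  shows "cur < length ks \<Longrightarrow> towner ks cur l"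
    and "fnd (agr (Suc l) f) k2 =
       (let old = (if cur < length ks then trow ks cur l (f l) else 0) in if old = 0 then Suc (length ks) else old)"
proof -
  have sn: "fnd P k2 = (if fnd P ks \<noteq> 0 then fnd P ks else if P f then Suc (length ks) else 0)" for P
    unfolding k2_def by (rule fnd_snoc)
  have ag: "agr l f (k2 ! cur)" "cur < Suc (length ks)" using fnd_SucD[OF cur] by (auto simp: k2_def)
  have S: "agr (Suc l) f g \<longleftrightarrow> agr l f g \<and> g l = f l" for g by (auto simp: agr_def less_Suc_eq)
  show "towner ks cur l" if "cur < length ks"
  proof -
    have "agr l (ks ! cur) f" using ag that by (auto simp: k2_def nth_append agr_def)
    then have "fnd (agr l (ks ! cur)) ks = fnd (agr l f) ks" by (rule fnd_agr_cong)
    moreover have "fnd (agr l f) ks = Suc cur" using cur that unfolding sn by (auto split: if_splits)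
    ultimately show ?thesis unfolding towner_def by simp
  qed
  show "fnd (agr (Suc l) f) k2 =
       (let old = (if cur < length ks then trow ks cur l (f l) else 0) in if old = 0 then Suc (length ks) else old)"
  proof (cases "cur < length ks")
    case True
    then have "agr l f (ks ! cur)" using ag by (auto simp: k2_def nth_append)
    then have "agr l (ks ! cur) = agr l f" by (metis agr_cong)
    then have "trow ks cur l (f l) = fnd (agr (Suc l) f) ks" unfolding trow_def by (auto simp: S intro!: fnd_cong)
    then show ?thesis using True unfolding sn by (auto simp: agr_def)
  next
    case False
    then have "fnd (agr l f) ks = 0" using cur fnd_SucD[of "agr l f" ks] unfolding sn by (auto split: if_splits)
    then have "fnd (agr (Suc l) f) ks = 0" by (auto simp: fnd_0 S)
    then show ?thesis using False unfolding sn by (auto simp: agr_def)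
  qed
qed

text \<open>A duplicate of an earlier key is never a first match, so the tables are the same with
  and without it. Thus the insertion routine also serves as lookup.\<close>

lemma trie_dup:
  assumes "trieI G (ks @ [f])" "i0 < length ks" "agr d f (ks ! i0)"
  shows "trieI G ks"
  unfolding trieI_def
proof (intro allI impI)
  fix i l a assume *: "i < length ks" "l < d" "a < m" "towner ks i l"
  have e: "fnd P (ks @ [f]) = fnd P ks" if "P f \<longrightarrow> P (ks ! i0)" for P
    using that assms(2) by (auto simp: fnd_snoc fnd_0)
  have e1: "fnd (agr l x) (ks @ [f]) = fnd (agr l x) ks" for x
    using assms(3) *(2) by (intro e) (auto simp: agr_def)
  have e2: "fnd (\<lambda>g. agr l x g \<and> g l = a) (ks @ [f]) = fnd (\<lambda>g. agr l x g \<and> g l = a) ks" for x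
    using assms(3) *(2) by (intro e) (auto simp: agr_def)
  have "towner (ks @ [f]) i l" using * unfolding towner_def by (simp add: nth_append e1)
  then have "G aTRI i (l * m + a) = trow (ks @ [f]) i l a" using assms(1) * by (simp add: trieI_def)
  also have "\<dots> = trow ks i l a" using * unfolding trow_def by (simp add: nth_append e2)
  finally show "G aTRI i (l * m + a) = trow ks i l a" .
qed

lemma trie:
  assumes "R rNI = length ks" "length ks < NR" "trieI G ks"
    and f: "\<And>l. l < d \<Longrightarrow> G aKEY (length ks) l = f l" "\<And>l. l < d \<Longrightarrow> f l < m"
    and Q: "\<And>t' R' G' cur. t' \<le> t + 100 * (d * m) + 200 * d \<Longrightarrow>
      (\<And>r. r \<noteq> rL \<Longrightarrow> r \<noteq> rA \<Longrightarrow> r \<noteq> rP \<Longrightarrow> r \<noteq> rCUR \<Longrightarrow> R' r = R r) \<Longrightarrow>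
      (\<And>a i s. a \<noteq> aTRI \<Longrightarrow> G' a i s = G a i s) \<Longrightarrow>
      R' rCUR = cur \<Longrightarrow> fnd (agr d f) (ks @ [f]) = Suc cur \<Longrightarrow> trieI G' (ks @ [f]) \<Longrightarrow> Q (t', R', G')"
  shows "wp (p_trie d m) Q (t, R, G)"
proof -
  let ?n = "length ks" and ?k2 = "ks @ [f]"
  \<comment> \<open>Rows above depth \<open>l\<close> already describe the extended list of keys,
    rows from \<open>l\<close> on still the old list; there the row of the new record is
    zero.\<close>
  define J where "J = (\<lambda>l (t', R', G'). t' \<le> t + 50 * (d * m) + 50 + 100 * l \<and>
      (\<forall>r. r \<noteq> rL \<longrightarrow> r \<noteq> rA \<longrightarrow> r \<noteq> rP \<longrightarrow> r \<noteq> rCUR \<longrightarrow> R' r = R r) \<and> R' rL = l \<and>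
      (\<forall>a i s. a \<noteq> aTRI \<longrightarrow> G' a i s = G a i s) \<and> fnd (agr l f) ?k2 = Suc (R' rCUR) \<and>
      (\<forall>i\<le>?n. \<forall>l'<l. \<forall>a<m. towner ?k2 i l' \<longrightarrow> G' aTRI i (l' * m + a) = trow ?k2 i l' a) \<and>
      (\<forall>i<?n. \<forall>l'\<ge>l. l' < d \<longrightarrow> (\<forall>a<m. towner ks i l' \<longrightarrow> G' aTRI i (l' * m + a) = trow ks i l' a)) \<and>
      (\<forall>l'\<ge>l. l' < d \<longrightarrow> (\<forall>a<m. G' aTRI ?n (l' * m + a) = 0)))"
  have f0: "fnd (agr 0 f) ?k2 = Suc 0"
  proof (cases ks)
    case Nil
    then show ?thesis by (simp add: fnd_def Let_def agr_def)
  next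
    case (Cons k ks')
    then show ?thesis by (simp add: fnd_def Let_def agr_def)
  qed
  show ?thesis unfolding p_trie_def
    apply simp
    apply (rule clear)
    subgoal by simp
    subgoal using assms by simp
    subgoal by (simp add: wids)
    subgoal by (simp add: wbd)
    subgoal by simp
    subgoal by simp
    subgoal premises p for t1 R1 G1
      apply (simp add: wbd)
      apply (rule wp_for[where J = J and i = 0 and n = d])
      subgoal
        unfolding J_def prod.case
        apply (intro conjI allI impI)
        subgoal using p(1) by simp
        subgoal using p(2) by simp
        subgoal by simp
        subgoal using p(3) by simp
        subgoal using f0 by simp
        subgoal by simp
        subgoal using p(3) assms(1,3) by (simp add: trieI_def)
        subgoal using p(4) assms(1) tidx_less by simp
        done
      subgoal by simp
      subgoal premises pp for l t' R' G'
      proof -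
        let ?cur = "R' rCUR"
        have J: "t' \<le> t + 50 * (d * m) + 50 + 100 * l"
          "\<And>r. r \<noteq> rL \<Longrightarrow> r \<noteq> rA \<Longrightarrow> r \<noteq> rP \<Longrightarrow> r \<noteq> rCUR \<Longrightarrow> R' r = R r" "R' rL = l"
          "\<And>a i s. a \<noteq> aTRI \<Longrightarrow> G' a i s = G a i s" "fnd (agr l f) ?k2 = Suc ?cur"
          "\<And>i l' a. i \<le> ?n \<Longrightarrow> l' < l \<Longrightarrow> a < m \<Longrightarrow> towner ?k2 i l' \<Longrightarrow> G' aTRI i (l' * m + a) = trow ?k2 i l' a"
          "\<And>i l' a. i < ?n \<Longrightarrow> l \<le> l' \<Longrightarrow> l' < d \<Longrightarrow> a < m \<Longrightarrow> towner ks i l' \<Longrightarrow> G' aTRI i (l' * m + a) = trow ks i l' a"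
          "\<And>l' a. l \<le> l' \<Longrightarrow> l' < d \<Longrightarrow> a < m \<Longrightarrow> G' aTRI ?n (l' * m + a) = 0"
          using pp(1) unfolding J_def by auto
        note cs = tcur_step[OF J(5)]
        have cn: "?cur \<le> ?n" using fnd_SucD[OF J(5)] by simp
        define old where "old = (\<lambda>i a. if i < ?n then trow ks i l a else 0)"
        have old: "G' aTRI i (l * m + a) = old i a" if "i \<le> ?n" "a < m" "i < ?n \<longrightarrow> towner ks i l" for i a
          using J(7)[of i l a] J(8)[of l a] that pp(2) by (auto simp: old_def le_less)
        have oc: "G' aTRI ?cur (l * m + f l) = old ?cur (f l)" using old cn f(2)[OF pp(2)] cs(1) by simp
        have row: "trow ?k2 i l a = (if i = ?cur \<and> a = f l \<and> old i a = 0 then Suc ?n else old i a)"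
          "i < ?n \<Longrightarrow> towner ks i l" if "i \<le> ?n" "towner ?k2 i l" for i a
          using trow_step[OF J(5) that] unfolding old_def Let_def by auto
        have nc: "fnd (agr (Suc l) f) ?k2 = (if old ?cur (f l) = 0 then Suc ?n else old ?cur (f l))"
          using cs(2) unfolding old_def Let_def by simp
        have ix: "l * m + f l < d * m" using tidx_less[OF pp(2) f(2)[OF pp(2)]] .
        have w: "l * m < W" "l * m + f l < W" "Suc ?n < W" "l < W" "Suc l < W"
          using ix wbd assms(2) pp(2) by linarith+
        have key: "G aKEY ?n l = f l" using f(1) pp(2) by simp
        define G2 where "G2 = (if old ?cur (f l) = 0 then upd G' aTRI ?cur (l * m + f l) (Suc ?n) else G')"
        have G2: "G2 aTRI i (l' * m + a) = (if i = ?cur \<and> l' = l \<and> a = f l \<and> old i a = 0 then Suc ?n else G' aTRI i (l' * m + a))"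
          if "a < m" for i l' a
          using that f(2)[OF pp(2)] tidx_inj[where a = a and m = m and a' = "f l" and l = l' and l' = l] by (auto simp: G2_def upd_apply)
        have fin: "J (Suc l) (t2, R2, G2)"
          if "t2 \<le> t' + 100" "\<And>r. r \<noteq> rL \<Longrightarrow> r \<noteq> rA \<Longrightarrow> r \<noteq> rP \<Longrightarrow> r \<noteq> rCUR \<Longrightarrow> R2 r = R' r" "R2 rL = Suc l"
            "fnd (agr (Suc l) f) ?k2 = Suc (R2 rCUR)" for t2 R2
          unfolding J_def prod.case
          apply (intro conjI allI impI)
          subgoal using that(1) J(1) by simp
          subgoal using that(2) J(2) by simp
          subgoal using that by simp
          subgoal using J(4) by (simp add: G2_def upd_apply)
          subgoal using that by simp
          subgoal for i l' a
            using G2[of a i l'] J(6)[of i l' a] row(1)[of i a] row(2)[of i] old[of i a] by (auto simp: less_Suc_eq)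
          subgoal for i l' a using G2[of a i l'] J(7)[of i l' a] by simp
          subgoal for l' a using G2[of a ?n l'] J(8)[of l' a] by simp
          done
        show ?thesis
          apply (simp add: J(2,3,4) wbd wids assms(1,2) w key ix pp(2) oc le_less_trans[OF cn assms(2)])
          apply (intro conjI impI)
          subgoal
          proof -
            assume o: "0 < old ?cur (f l)"
            then have "G' = G2" by (simp add: G2_def)
            then show ?thesis using o nc by (auto intro!: fin)
          qed
          subgoal
          proof -
            assume o: "old ?cur (f l) = 0"
            have e: "upd G' aTRI ?cur (l * m + f l) (Suc ?n) = G2" by (simp add: G2_def o)
            show ?thesis unfolding e by (rule fin) (simp_all add: nc o)
          qed
          done
      qed
      subgoal premises pp for t' R' G'
      proof -
        note J = pp[unfolded J_def prod.case]
        have tr: "trieI G' (ks @ [f])" using J by (simp add: trieI_def less_Suc_eq_le)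
        have L: "R' rL = d" using J by simp
        have d: "1 \<le> d" by (rule bounds)
        show ?thesis
          apply (simp add: L wbd)
          apply (rule Q[where cur = "R' rCUR"])
          using J tr d by simp_all
      qed
      done
    done
qed

end

section \<open>Memory allocation and the best split\<close>

context rb
begin

text \<open>\<open>rNB\<close> is the largest record number handed out so far. Zeroed registers
  satisfy this with record 0 in use, which is the root.\<close>

definition avail :: "(nat \<Rightarrow> nat) \<Rightarrow> mem \<Rightarrow> nat set \<Rightarrow> bool" where
  "avail R G AV \<longleftrightarrow> (\<exists>fl. lst (\<lambda>i. G aNXT i 0) (R rFR) fl \<and> distinct fl \<and> (\<forall>i\<in>set fl. i \<le> R rNB) \<and>
     AV = set fl \<union> {R rNB<..<NR} \<and> R rNB < NR)"

lemma avail_cong: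
  assumes "avail R G AV" "R' rFR = R rFR" "R' rNB = R rNB" "\<And>i. i \<in> AV \<Longrightarrow> G' aNXT i 0 = G aNXT i 0"
  shows "avail R' G' AV"
proof -
  obtain fl where "lst (\<lambda>i. G aNXT i 0) (R rFR) fl" "distinct fl" "\<forall>i\<in>set fl. i \<le> R rNB"
     "AV = set fl \<union> {R rNB<..<NR}" "R rNB < NR" using assms(1) by (auto simp: avail_def)
  then show ?thesis unfolding avail_def using assms(2-)
    by (intro exI[of _ fl]) (auto intro: lst_cong)
qed

lemma avail_less: "avail R G AV \<Longrightarrow> i \<in> AV \<Longrightarrow> i < NR"
  by (auto simp: avail_def)

lemma avail_free:
  assumes "avail R G AV" "v < NR" "v \<notin> AV" "R' rFR = Suc v" "R' rNB = R rNB"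
    "G' aNXT v 0 = R rFR" "\<And>i. i \<in> AV \<Longrightarrow> G' aNXT i 0 = G aNXT i 0"
  shows "avail R' G' (insert v AV)"
proof -
  obtain fl where fl: "lst (\<lambda>i. G aNXT i 0) (R rFR) fl" "distinct fl" "\<forall>i\<in>set fl. i \<le> R rNB"
     "AV = set fl \<union> {R rNB<..<NR}" "R rNB < NR" using assms(1) by (auto simp: avail_def)
  have "lst (\<lambda>i. G' aNXT i 0) (R rFR) fl" using fl(1) by (rule lst_cong) (use fl(4) assms(7) in auto)
  then show ?thesis unfolding avail_def using assms(2-6) fl
    by (intro exI[of _ "v # fl"]) auto
qed

lemma alloc:
  assumes av: "avail R G AV" "AV \<noteq> {}" and r: "r \<noteq> rFR" "r \<noteq> rNB" "r < 100"
    and Q: "\<And>t' R' x. t' \<le> t + 60 \<Longrightarrow> x \<in> AV \<Longrightarrow> R' r = x \<Longrightarrow> avail R' G (AV - {x}) \<Longrightarrow>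
      (\<And>r'. r' \<noteq> r \<Longrightarrow> r' \<noteq> rFR \<Longrightarrow> r' \<noteq> rNB \<Longrightarrow> R' r' = R r') \<Longrightarrow> Q (t', R', G)"
  shows "wp (p_alloc r) Q (t, R, G)"
proof -
  obtain fl where fl: "lst (\<lambda>i. G aNXT i 0) (R rFR) fl" "distinct fl" "\<forall>i\<in>set fl. i \<le> R rNB"
     "AV = set fl \<union> {R rNB<..<NR}" "R rNB < NR" using av(1) by (auto simp: avail_def)
  show ?thesis
  proof (cases fl)
    case Nil
    then have 0: "R rFR = 0" "Suc (R rNB) < NR" using fl av(2) by auto
    have w: "Suc (R rNB) < W" using 0(2) wbd by linarith
    have "avail (R(rNB := Suc (R rNB), r := Suc (R rNB))) G (AV - {Suc (R rNB)})"
      unfolding avail_def using 0 Nil fl r by (intro exI[of _ "[]"]) auto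
    then show ?thesis unfolding p_alloc_def using r w
      by (simp add: 0(1) wbd) (rule Q[of _ "Suc (R rNB)"], use 0 Nil fl r in auto)
  next
    case (Cons x fl')
    then have x: "R rFR = Suc x" "x \<in> AV" "x \<le> R rNB" "x < NR" using fl by auto
    have "avail (R(r := x, rFR := G aNXT x 0)) G (AV - {x})"
      unfolding avail_def using Cons fl r x by (intro exI[of _ fl']) auto
    then show ?thesis unfolding p_alloc_def using r x
      by (simp add: wbd wids) (rule Q[of _ x], use r in auto)
  qed
qed

lemma budget:
  assumes v: "R rV < NR" and b: "G aNN (R rV) 1 + G aNN (R rV) 0 \<le> Z"
    and Q: "\<And>t' R' G'. t' \<le> t + 200 + 50 * floor_log (G aNN (R rV) 1 + G aNN (R rV) 0) \<Longrightarrow>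
      (\<And>r. r \<notin> {rPT, rNT, rS, rP2} \<Longrightarrow> R' r = R r) \<Longrightarrow>
      R' rPT = G aNN (R rV) 1 \<Longrightarrow> R' rNT = G aNN (R rV) 0 \<Longrightarrow> R' rS = G aNN (R rV) 1 + G aNN (R rV) 0 \<Longrightarrow>
      (\<And>a i s. \<not> ((a = aBUD \<or> a = aRGT) \<and> i = R rV) \<Longrightarrow> G' a i s = G a i s) \<Longrightarrow>
      G' aBUD (R rV) 0 = 2 ^ floor_log (G aNN (R rV) 1 + G aNN (R rV) 0) div q - 1 \<Longrightarrow>
      G' aRGT (R rV) 0 = 0 \<Longrightarrow> Q (t', R', G')"
  shows "wp (p_budget q) Q (t, R, G)"
proof -
  let ?s = "G aNN (R rV) 1 + G aNN (R rV) 0"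
  let ?n = "floor_log ?s"
  define J where "J = (\<lambda>i (t', R', G'). t' \<le> t + 100 + 50 * i \<and> (\<forall>r. r \<notin> {rPT, rNT, rS, rP2} \<longrightarrow> R' r = R r) \<and>
     R' rPT = G aNN (R rV) 1 \<and> R' rNT = G aNN (R rV) 0 \<and> R' rS = ?s \<and> G' = G \<and> R' rP2 = 2 ^ i)"
  \<comment> \<open>\<open>floor_log 0 = 0\<close>, so for an empty vertex the power is 1 and
    exceeds the size; hence the maximum.\<close>
  have p: "2 ^ i \<le> max 1 ?s" if "i \<le> ?n" for i
  proof (cases "?s = 0")
    case True
    then show ?thesis using that by simp
  next
    case False
    then have "(2::nat) ^ ?n \<le> ?s" by (intro floor_log_exp2_le) simp
    moreover have "(2::nat) ^ i \<le> 2 ^ ?n" using that by (intro power_increasing) auto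
    ultimately have "2 ^ i \<le> ?s" by (rule order_trans[rotated])
    then show ?thesis by (rule max.coboundedI2)
  qed
  have w: "2 ^ i * 2 < W" if "i \<le> ?n" for i using p[OF that] b Z_ge by (intro wlt) linarith
  have ws: "Suc ?s < W" using b Z_ge by (intro wlt) linarith
  show ?thesis unfolding p_budget_def
    using v ws
    apply (simp add: wbd wids)
    apply (rule wp_for[where J = J and i = 0 and n = ?n])
    subgoal by (simp add: J_def)
    subgoal by simp
    subgoal premises pp for i t' R' G'
    proof -
      have "2 ^ Suc i \<le> max 1 ?s" using p[of "Suc i"] pp by simp
      moreover have "?s \<noteq> 0" using pp(4) by (cases "?s = 0") auto
      ultimately have "2 ^ Suc i \<le> ?s" by (simp only: max_def split: if_splits)
      then have "2 ^ i * 2 \<le> ?s" by simp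
      then show ?thesis using pp(3) w[of i] pp(4) ws by (simp add: J_def wbd)
    qed
    subgoal premises pp for t' R' G'
    proof -
      have "?s < 2 ^ ?n * 2" using floor_log_exp2_gt[of ?s] by simp
      then show ?thesis using pp(3) w[of ?n] ws v
        apply (simp add: J_def wbd wids)
        apply (rule Q)
        by (auto simp: upd_apply)
    qed
    done
qed

lemma part:
  assumes V: "R rLC < NR" "R rRC < NR" "R rV < NR" "R rLC \<noteq> R rRC" "R rV \<noteq> R rLC" "R rV \<noteq> R rRC"
    and l: "lst (\<lambda>i. G aINX i 0) (G aHEAD (R rV) 0) its" "distinct its" "\<And>i. i \<in> set its \<Longrightarrow> i < NR" "R rBJ < d"
    and Q: "\<And>t' R' G'. t' \<le> t + 100 + 200 * length its \<Longrightarrow>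
      (\<And>r. r \<notin> {rX, rI, rW} \<Longrightarrow> R' r = R r) \<Longrightarrow>
      (\<And>a i s. \<not> (a = aINX \<and> i \<in> set its \<or> (a = aHEAD \<or> a = aLEN) \<and> (i = R rLC \<or> i = R rRC)) \<Longrightarrow> G' a i s = G a i s) \<Longrightarrow>
      lst (\<lambda>i. G' aINX i 0) (G' aHEAD (R rLC) 0) (rev (filter (\<lambda>i. G aKEY i (R rBJ) \<le> R rBA) its)) \<Longrightarrow>
      lst (\<lambda>i. G' aINX i 0) (G' aHEAD (R rRC) 0) (rev (filter (\<lambda>i. \<not> G aKEY i (R rBJ) \<le> R rBA) its)) \<Longrightarrow>
      G' aLEN (R rLC) 0 = length (filter (\<lambda>i. G aKEY i (R rBJ) \<le> R rBA) its) \<Longrightarrow>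
      G' aLEN (R rRC) 0 = length (filter (\<lambda>i. \<not> G aKEY i (R rBJ) \<le> R rBA) its) \<Longrightarrow>
      Q (t', R', G')"
  shows "wp p_part Q (t, R, G)"
proof -
  let ?n = "length its" and ?l = "R rLC" and ?r = "R rRC"
  let ?P = "\<lambda>i. G aKEY i (R rBJ) \<le> R rBA"
  have card: "?n \<le> NR"
  proof -
    have "set its \<subseteq> {..<NR}" using l(3) by auto
    then have "card (set its) \<le> NR" by (metis card_lessThan card_mono finite_lessThan)
    then show ?thesis using l(2) by (simp add: distinct_card)
  qed
  define J where "J = (\<lambda>n (t', R', G'). t' \<le> t + 80 + 200 * n \<and> (\<forall>r. r \<notin> {rX, rI, rW} \<longrightarrow> R' r = R r) \<and>
      (\<forall>a i s. \<not> (a = aINX \<and> i \<in> set (take n its) \<or> (a = aHEAD \<or> a = aLEN) \<and> (i = ?l \<or> i = ?r)) \<longrightarrow> G' a i s = G a i s) \<and>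
      lst (\<lambda>i. G' aINX i 0) (R' rX) (drop n its) \<and>
      lst (\<lambda>i. G' aINX i 0) (G' aHEAD ?l 0) (rev (filter ?P (take n its))) \<and>
      lst (\<lambda>i. G' aINX i 0) (G' aHEAD ?r 0) (rev (filter (\<lambda>i. \<not> ?P i) (take n its))) \<and>
      G' aLEN ?l 0 = length (filter ?P (take n its)) \<and>
      G' aLEN ?r 0 = length (filter (\<lambda>i. \<not> ?P i) (take n its)))"
  show ?thesis unfolding p_part_def
    apply (simp add: wbd wids V)
    apply (rule wp_for[where J = J and i = 0 and n = ?n])
    subgoal unfolding J_def prod.case using V l(1) by (simp add: upd_apply)
    subgoal by simp
    subgoal premises pp for n t' R' G'
    proof -
      let ?i = "its ! n" and ?w = "if ?P (its ! n) then ?l else ?r"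
      have J: "t' \<le> t + 80 + 200 * n" "\<And>r. r \<notin> {rX, rI, rW} \<Longrightarrow> R' r = R r"
        "\<And>a i s. \<not> (a = aINX \<and> i \<in> set (take n its) \<or> (a = aHEAD \<or> a = aLEN) \<and> (i = ?l \<or> i = ?r)) \<Longrightarrow> G' a i s = G a i s"
        "lst (\<lambda>i. G' aINX i 0) (R' rX) (drop n its)"
        "lst (\<lambda>i. G' aINX i 0) (G' aHEAD ?l 0) (rev (filter ?P (take n its)))"
        "lst (\<lambda>i. G' aINX i 0) (G' aHEAD ?r 0) (rev (filter (\<lambda>i. \<not> ?P i) (take n its)))"
        "G' aLEN ?l 0 = length (filter ?P (take n its))"
        "G' aLEN ?r 0 = length (filter (\<lambda>i. \<not> ?P i) (take n its))"
        using pp(1) unfolding J_def prod.case by blast+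
      have J2: "R' rLC = ?l" "R' rRC = ?r" "R' rBJ = R rBJ" "R' rBA = R rBA" using J(2) by auto
      have ii: "?i \<in> set its" "?i < NR" using pp(2) l(3) by auto
      have dr: "drop n its = ?i # drop (Suc n) its" using pp(2) by (simp add: Cons_nth_drop_Suc)
      have x: "R' rX = Suc ?i" "lst (\<lambda>i. G' aINX i 0) (G' aINX ?i 0) (drop (Suc n) its)"
        using J(4) unfolding dr by auto
      have ts: "take (Suc n) its = take n its @ [?i]" using pp(2) by (simp add: take_Suc_conv_app_nth)
      have nin: "?i \<notin> set (take n its)" "?i \<notin> set (drop (Suc n) its)"
      proof -
        have "distinct (take n its @ ?i # drop (Suc n) its)" using l(2) pp(2) by (simp add: id_take_nth_drop[symmetric])
        then show "?i \<notin> set (take n its)" "?i \<notin> set (drop (Suc n) its)" by auto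
      qed
      have key: "G' aKEY ?i (R rBJ) = G aKEY ?i (R rBJ)" using J(3) by simp
      have ln: "G' aLEN ?w 0 \<le> n" using J(7,8) pp(2) by (auto intro: order_trans[OF length_filter_le])
      have w: "Suc ?i < W" "Suc (G' aLEN ?l 0) < W" "Suc (G' aLEN ?r 0) < W"
      proof -
        have lf: "length (filter P (take n its)) \<le> n" for P using length_filter_le[of P "take n its"] pp(2) by simp
        have "NR < W" by (rule wbd)
        then show "Suc ?i < W" "Suc (G' aLEN ?l 0) < W" "Suc (G' aLEN ?r 0) < W"
          using ii(2) lf[of ?P] lf[of "\<lambda>i. \<not> ?P i"] J(7,8) card pp(2) by linarith+
      qed
      define G2 where "G2 = upd (upd (upd G' aINX ?i 0 (G' aHEAD ?w 0)) aHEAD ?w 0 (Suc ?i)) aLEN ?w 0 (Suc (G' aLEN ?w 0))"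
      have fin: "J (Suc n) (t2, R2, G2)"
        if "t2 \<le> t' + 200" "\<And>r. r \<notin> {rX, rI, rW} \<Longrightarrow> R2 r = R' r" "R2 rX = G' aINX ?i 0" for t2 R2
        unfolding J_def prod.case
        apply (intro conjI allI impI)
        subgoal using that(1) J(1) by simp
        subgoal using that(2) J(2) by simp
        subgoal for a i s using J(3)[of a i s] by (auto simp: G2_def upd_apply ts)
        subgoal unfolding that(3) by (rule lst_cong[OF x(2)]) (use nin(2) in \<open>auto simp: G2_def upd_apply\<close>)
        subgoal
        proof (cases "?P ?i")
          case True
          have "lst (\<lambda>i. G2 aINX i 0) (G' aHEAD ?l 0) (rev (filter ?P (take n its)))"
            by (rule lst_cong[OF J(5)]) (use nin(1) in \<open>auto simp: G2_def upd_apply\<close>)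
          then show ?thesis using True by (simp add: ts G2_def upd_apply)
        next
          case False
          have "lst (\<lambda>i. G2 aINX i 0) (G' aHEAD ?l 0) (rev (filter ?P (take n its)))"
            by (rule lst_cong[OF J(5)]) (use nin(1) in \<open>auto simp: G2_def upd_apply\<close>)
          then show ?thesis using False V by (simp add: ts G2_def upd_apply)
        qed
        subgoal
        proof (cases "?P ?i")
          case True
          have "lst (\<lambda>i. G2 aINX i 0) (G' aHEAD ?r 0) (rev (filter (\<lambda>i. \<not> ?P i) (take n its)))"
            by (rule lst_cong[OF J(6)]) (use nin(1) in \<open>auto simp: G2_def upd_apply\<close>)
          then show ?thesis using True V by (simp add: ts G2_def upd_apply)
        next
          case False
          have "lst (\<lambda>i. G2 aINX i 0) (G' aHEAD ?r 0) (rev (filter (\<lambda>i. \<not> ?P i) (take n its)))"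
            by (rule lst_cong[OF J(6)]) (use nin(1) in \<open>auto simp: G2_def upd_apply\<close>)
          then show ?thesis using False by (simp add: ts G2_def upd_apply)
        qed
        subgoal using J(7) V by (simp add: ts G2_def upd_apply)
        subgoal using J(8) V by (simp add: ts G2_def upd_apply)
        done
      show ?thesis
      proof (cases "?P ?i")
        case True
        then have "\<not> R rBA < G aKEY ?i (R rBJ)" by simp
        then show ?thesis using V ii l(4) w True
          apply (simp add: x(1) J2 key wbd wids upd_apply)
          apply (rule fin[unfolded G2_def if_P[OF True]])
          by auto
      next
        case False
        then have "R rBA < G aKEY ?i (R rBJ)" by simp
        then show ?thesis using V ii l(4) w False
          apply (simp add: x(1) J2 key wbd wids upd_apply)
          apply (rule fin[unfolded G2_def if_not_P[OF False]])
          by auto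
      qed
    qed
    subgoal premises pp for t' R' G'
    proof -
      note J = pp[unfolded J_def prod.case]
      have "R' rX = 0" using J by (simp add: lst_0[symmetric])
      then show ?thesis apply (simp add: wbd)
        apply (rule Q)
        using J by simp_all
    qed
    done
qed

lemma sub:
  assumes V: "R rV < NR" "R rSM < NR" "R rBG < NR" "R rBG \<noteq> R rV" "R rBG \<noteq> R rSM"
    and Q: "\<And>t' R' G'. t' \<le> t + 200 + 200 * (d * m) \<Longrightarrow> (\<And>r. r \<noteq> rL \<Longrightarrow> R' r = R r) \<Longrightarrow>
      (\<And>a i s. \<not> ((a = aCNT \<or> a = aNN) \<and> i = R rBG) \<Longrightarrow> G' a i s = G a i s) \<Longrightarrow>
      (\<And>c. c < 2 * d * m \<Longrightarrow> G' aCNT (R rBG) c = G aCNT (R rV) c - G aCNT (R rSM) c) \<Longrightarrow>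
      (\<And>y. y < 2 \<Longrightarrow> G' aNN (R rBG) y = G aNN (R rV) y - G aNN (R rSM) y) \<Longrightarrow> Q (t', R', G')"
  shows "wp (p_sub d m) Q (t, R, G)"
proof -
  define J where "J = (\<lambda>l (t', R', G'). t' \<le> t + 10 + 100 * l \<and> (\<forall>r. r \<noteq> rL \<longrightarrow> R' r = R r) \<and> R' rL = l \<and>
      (\<forall>a i s. \<not> (a = aCNT \<and> i = R rBG) \<longrightarrow> G' a i s = G a i s) \<and>
      (\<forall>c<l. G' aCNT (R rBG) c = G aCNT (R rV) c - G aCNT (R rSM) c))"
  define n where "n = 2 * d * m"
  have n: "n < W" using wbd(1) by (simp add: n_def)
  have w: "wid d m aCNT = n" by (simp add: wids n_def)
  show ?thesis unfolding p_sub_def n_def[symmetric]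
    apply (simp add: wbd)
    apply (rule wp_for[where J = J and i = 0 and n = n])
    subgoal by (simp add: J_def)
    subgoal by simp
    subgoal for l t' R' G' using V n by (auto simp: J_def w upd_apply less_Suc_eq)
    subgoal premises pp for t' R' G'
    proof -
      note J = pp[unfolded J_def prod.case]
      have dm: "100 * n = 200 * (d * m)" by (simp add: n_def)
      show ?thesis using J V n
        apply (simp add: wbd)
        apply (simp add: wids)
        apply (rule Q)
        subgoal using dm by simp
        subgoal by simp
        subgoal by (auto simp: upd_apply)
        subgoal by (simp add: upd_apply n_def)
        subgoal by (auto simp: upd_apply less_Suc_eq numeral_2_eq_2)
        done
    qed
    done
qed

section \<open>Searching for the best split\<close>

definition vv :: "nat \<Rightarrow> nat \<Rightarrow> nat \<Rightarrow> nat \<Rightarrow> real" where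
  "vv PT NT p n = fv p n + fv (PT - p) (NT - n)"

text \<open>\<open>D\<close> is the set of candidates seen so far. Strictness in the last
  alternative later yields two nonempty sides, and the bounds on \<open>bn\<close> and
  \<open>bd\<close> keep the next cross products within a word.\<close>

definition good :: "nat \<Rightarrow> nat \<Rightarrow> (nat \<Rightarrow> nat \<Rightarrow> real) \<Rightarrow> (nat \<times> nat) set \<Rightarrow> nat \<Rightarrow> nat \<Rightarrow> nat \<Rightarrow> nat \<Rightarrow> bool" where
  "good PT NT f D bn bd bj ba \<longleftrightarrow> 0 < bd \<and> real bn / real bd \<le> fv PT NT \<and>
     (\<forall>(j, a)\<in>D. real bn / real bd \<le> f j a) \<and>
     (bj = d \<and> real bn / real bd = fv PT NT \<or>
      bj < d \<and> ba < m \<and> real bn / real bd = f bj ba \<and> real bn / real bd < fv PT NT) \<and>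
     bn \<le> 2 * Z ^ 3 \<and> bd \<le> Z ^ 2"

lemma cand_arith:
  assumes g: "good PT NT f D bn bd bj ba" and le: "p \<le> PT" "n \<le> NT" and Z: "PT + NT \<le> Z"
    and f: "f j a = vv PT NT p n" and ja: "j < d" "a < m"
  defines "cn \<equiv> p * n * (PT + NT - (p + n)) + (PT - p) * (NT - n) * (p + n)"
    and "cd \<equiv> (p + n) * (PT + NT - (p + n))"
  shows "p * n * (PT + NT - (p + n)) < W" "(PT - p) * (NT - n) * (p + n) < W" "cn < W" "cd < W"
    "cn * bd < W" "bn * cd < W" "p * n < W" "(PT - p) * (NT - n) < W"
    "cn * bd < bn * cd \<Longrightarrow> good PT NT f (insert (j, a) D) cn cd j a"
    "\<not> cn * bd < bn * cd \<Longrightarrow> good PT NT f (insert (j, a) D) bn bd bj ba"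
proof -
  have z: "p \<le> Z" "n \<le> Z" "PT - p \<le> Z" "NT - n \<le> Z" "p + n \<le> Z" "PT + NT - (p + n) \<le> Z" using le Z by linarith+
  have t3: "x * y * w \<le> Z ^ 3" if "x \<le> Z" "y \<le> Z" "w \<le> Z" for x y w
    using mult_le_mono[OF mult_le_mono[OF that(1,2)] that(3)] by (simp add: power3_eq_cube)
  have b: "p * n * (PT + NT - (p + n)) \<le> Z ^ 3" "(PT - p) * (NT - n) * (p + n) \<le> Z ^ 3" using t3 z by blast+
  then have cn: "cn \<le> 2 * Z ^ 3" unfolding cn_def by linarith
  have cd: "cd \<le> Z ^ 2" unfolding cd_def using mult_le_mono[OF z(5,6)] by (simp add: power2_eq_square)
  have bb: "bn \<le> 2 * Z ^ 3" "bd \<le> Z ^ 2" "0 < bd" using g by (auto simp: good_def)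
  have "cn * bd \<le> 2 * Z ^ 3 * Z ^ 2" by (intro mult_le_mono cn bb)
  moreover have "bn * cd \<le> 2 * Z ^ 3 * Z ^ 2" by (intro mult_le_mono cd bb)
  moreover have e5: "2 * Z ^ 3 * Z ^ 2 = 2 * Z ^ 5" by (simp add: power_add[symmetric])
  moreover have zz: "Z ^ 2 \<le> Z ^ 6" "Z ^ 3 \<le> Z ^ 6" "Z ^ 5 \<le> Z ^ 6" "0 < Z ^ 6" using Zpow Z_ge by auto
  ultimately show "cn * bd < W" "bn * cd < W" using W by linarith+
  show "p * n * (PT + NT - (p + n)) < W" "(PT - p) * (NT - n) * (p + n) < W" "cn < W" "cd < W"
    using b cn cd zz W by linarith+
  have "p * n \<le> Z ^ 2" "(PT - p) * (NT - n) \<le> Z ^ 2" using mult_le_mono z by (simp_all add: power2_eq_square)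
  then show "p * n < W" "(PT - p) * (NT - n) < W" using zz W by linarith+
  note F = fv_frac(1)[OF le, of bd bn, folded cn_def cd_def] fv_frac(2)[OF le, of bd bn, folded cn_def cd_def]
    fv_frac(3)[OF le, folded cn_def cd_def]
  have r: "real cn * real bd < real bn * real cd \<longleftrightarrow> cn * bd < bn * cd"
    by (metis of_nat_less_iff of_nat_mult)
  show "good PT NT f (insert (j, a) D) cn cd j a" if "cn * bd < bn * cd"
  proof -
    have 1: "0 < cd" "fv p n + fv (PT - p) (NT - n) < real bn / real bd" using F(1) r that bb by auto
    moreover have "real cn / real cd = fv p n + fv (PT - p) (NT - n)" using F(3)[OF 1(1)] .
    ultimately show ?thesis using g ja cn cd f unfolding good_def vv_def by fastforce
  qed
  show "good PT NT f (insert (j, a) D) bn bd bj ba" if "\<not> cn * bd < bn * cd"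
    using F(2) r that bb g f unfolding good_def vv_def by auto
qed

lemma best:
  assumes v: "R rV < NR" and S: "R rS = R rPT + R rNT" "0 < R rS" "R rS \<le> Z"
    and c: "\<And>j a y. j < d \<Longrightarrow> a < m \<Longrightarrow> y < 2 \<Longrightarrow> G aCNT (R rV) (cidx m j a y) = c j a y"
    and b: "\<And>j. j < d \<Longrightarrow> (\<Sum>a<m. c j a 1) \<le> R rPT" "\<And>j. j < d \<Longrightarrow> (\<Sum>a<m. c j a 0) \<le> R rNT"
    and f: "\<And>j a. j < d \<Longrightarrow> a < m \<Longrightarrow> f j a = vv (R rPT) (R rNT) (\<Sum>a'<Suc a. c j a' 1) (\<Sum>a'<Suc a. c j a' 0)"
    and Q: "\<And>t' R'. t' \<le> t + 200 + 200 * d + 300 * (d * m) \<Longrightarrow>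
      (\<And>r. r \<notin> {rP1, rN1, rS1, rS2, rCN, rCD, rBN, rBD, rBJ, rBA, rJ, rA} \<Longrightarrow> R' r = R r) \<Longrightarrow>
      good (R rPT) (R rNT) f ({..<d} \<times> {..<m}) (R' rBN) (R' rBD) (R' rBJ) (R' rBA) \<Longrightarrow> Q (t', R', G)"
  shows "wp (p_best d m) Q (t, R, G)"
proof -
  let ?PT = "R rPT" and ?NT = "R rNT"
  \<comment> \<open>Prefix sums over the values of one feature: the counts of consecutive thresholds
    arise one from the next, so all candidates together cost \<open>O(d * m)\<close>.\<close>
  define SP where "SP = (\<lambda>j a y. \<Sum>a'<a. c j a' y)"
  define FR where "FR = {rP1, rN1, rS1, rS2, rCN, rCD, rBN, rBD, rBJ, rBA, rJ, rA}"
  define D where "D = (\<lambda>(j::nat) (a::nat). {..<j} \<times> {..<m} \<union> {j} \<times> {..<a})"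
  define J where "J = (\<lambda>j (t', R', G'). t' \<le> t + 100 + (200 + 300 * m) * j \<and> (\<forall>r. r \<notin> FR \<longrightarrow> R' r = R r) \<and>
      R' rJ = j \<and> G' = G \<and> good ?PT ?NT f ({..<j} \<times> {..<m}) (R' rBN) (R' rBD) (R' rBJ) (R' rBA))"
  have sp: "SP j a 1 \<le> ?PT" "SP j a 0 \<le> ?NT" if "j < d" "a \<le> m" for j a
  proof -
    have "SP j a y \<le> (\<Sum>a<m. c j a y)" for y unfolding SP_def using that by (intro sum_mono2) auto
    then show "SP j a 1 \<le> ?PT" "SP j a 0 \<le> ?NT" using b[OF that(1)] order_trans by blast+
  qed
  have pn: "?PT * ?NT < W"
  proof -
    have "?PT * ?NT \<le> Z * Z" using S by (intro mult_le_mono) linarith+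
    also have "\<dots> \<le> Z ^ 6" using Zpow[of 2 6] by (simp add: power2_eq_square)
    finally have "?PT * ?NT \<le> Z ^ 6" .
    moreover have "0 < Z ^ 6" using Z_ge by simp
    ultimately show ?thesis using W by linarith
  qed
  have init: "good ?PT ?NT f {} (?PT * ?NT) (R rS) d 0"
  proof -
    have "?PT * ?NT \<le> Z ^ 2" unfolding power2_eq_square using S by (intro mult_le_mono) linarith+
    moreover have "Z ^ 2 \<le> Z ^ 3" "Z \<le> Z ^ 2" using Zpow[of 2 3] Zpow[of 1 2] by auto
    ultimately show ?thesis using S unfolding good_def fv_def by auto
  qed
  show ?thesis unfolding p_best_def
    apply (simp add: wbd pn)
    apply (rule wp_for[where J = J and i = 0 and n = d])
    subgoal unfolding J_def prod.case using init S by (simp add: FR_def)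
    subgoal by simp
    subgoal premises pp for j t' R' G'
    proof -
      have J: "t' \<le> t + 100 + (200 + 300 * m) * j" "\<And>r. r \<notin> FR \<Longrightarrow> R' r = R r" "R' rJ = j" "G' = G"
        "good ?PT ?NT f ({..<j} \<times> {..<m}) (R' rBN) (R' rBD) (R' rBJ) (R' rBA)"
        using pp(1) unfolding J_def by auto
      define J2 where "J2 = (\<lambda>a (t2, R2, G2). t2 \<le> t' + 50 + 300 * a \<and> (\<forall>r. r \<notin> FR \<longrightarrow> R2 r = R r) \<and>
        R2 rJ = j \<and> R2 rA = a \<and> R2 rP1 = SP j a 1 \<and> R2 rN1 = SP j a 0 \<and> G2 = G \<and>
        good ?PT ?NT f (D j a) (R2 rBN) (R2 rBD) (R2 rBJ) (R2 rBA))"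
      show ?thesis using pp(2)
        apply (simp add: J(3) wbd)
        apply (rule wp_for[where J = J2 and i = 0 and n = m])
        subgoal unfolding J2_def prod.case using J by (simp add: FR_def SP_def D_def)
        subgoal by simp
        subgoal premises p2 for a t2 R2 G2
        proof -
          have K: "t2 \<le> t' + 50 + 300 * a" "\<And>r. r \<notin> FR \<Longrightarrow> R2 r = R r" "R2 rJ = j" "R2 rA = a"
            "R2 rP1 = SP j a 1" "R2 rN1 = SP j a 0" "G2 = G" "good ?PT ?NT f (D j a) (R2 rBN) (R2 rBD) (R2 rBJ) (R2 rBA)"
            using p2(2) unfolding J2_def by auto
          have K2: "R2 rV = R rV" "R2 rPT = ?PT" "R2 rNT = ?NT" "R2 rS = ?PT + ?NT" using K(2) S by (auto simp: FR_def)
          let ?p = "SP j (Suc a) 1" and ?n = "SP j (Suc a) 0"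
          have ja: "j < d" "a < m" using pp(2) p2(3) by auto
          have le: "?p \<le> ?PT" "?n \<le> ?NT" using sp[of j "Suc a"] ja by auto
          have SS: "SP j a 1 + c j a 1 = ?p" "SP j a 0 + c j a 0 = ?n" by (auto simp: SP_def)
          have fja: "f j a = vv ?PT ?NT ?p ?n" using f[OF ja] by (simp add: SP_def)
          have Z: "?PT + ?NT \<le> Z" using S by simp
          note ca = cand_arith[OF K(8) le Z fja ja]
          have Dj: "insert (j, a) (D j a) = D j (Suc a)" by (auto simp: D_def)
          have c01: "j * m * 2 + a * 2 = cidx m j a 0" "Suc (cidx m j a 0) = cidx m j a (Suc 0)"
            by (auto simp: cidx_def)
          have ix: "cidx m j a 0 < 2 * d * m" "cidx m j a (Suc 0) < 2 * d * m" "j * m + a < d * m"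
            using cidx_less[of j d a m] tidx_less[of j d a m] ja by auto
          have w: "cidx m j a 0 < W" "cidx m j a (Suc 0) < W" "j * m + a < W" "j * m < W" "j < W" "Suc j < W" "a < W" "Suc a < W"
            "?p < W" "?n < W" "?p + ?n < W"
            using ix wbd ja le Z wlt[of "?PT + ?NT"] by linarith+
          have cc: "G aCNT (R rV) (cidx m j a 0) = c j a 0" "G aCNT (R rV) (cidx m j a (Suc 0)) = c j a 1"
            using c[OF ja] by auto
          have SS': "SP j a (Suc 0) + c j a (Suc 0) = SP j (Suc a) (Suc 0)" using SS by simp
          have w': "SP j (Suc a) (Suc 0) < W" "SP j (Suc a) (Suc 0) + SP j (Suc a) 0 < W" using w by simp_all
          note ca' = ca[unfolded One_nat_def]
          show ?thesis unfolding p_cand_def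
            using v ja ca'(1-8)
            apply (simp add: K(3-7) K2 wbd wids c01 ix w w' cc SS SS')
            apply (intro conjI impI)
            subgoal
              unfolding J2_def prod.case
              apply (intro conjI allI impI)
              subgoal using K(1) by simp
              subgoal using K(2) by (simp add: FR_def)
              subgoal by (simp add: K(3))
              subgoal by simp
              subgoal by simp
              subgoal by simp
              subgoal by simp
              subgoal using ca'(9) unfolding Dj by simp
              done
            subgoal
              unfolding J2_def prod.case
              apply (intro conjI allI impI)
              subgoal using K(1) by simp
              subgoal using K(2) by (simp add: FR_def)
              subgoal by (simp add: K(3))
              subgoal by simp
              subgoal by simp
              subgoal by simp
              subgoal by simp
              subgoal using ca'(10)[unfolded not_less Dj] apply - apply (simp only: fun_upd_apply) by fastforce
              done
            done
        qed
        subgoal premises p2 for t2 R2 G2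
        proof -
          note K = p2(2)[unfolded J2_def prod.case]
          have Dj: "D j m = {..<Suc j} \<times> {..<m}" by (auto simp: D_def less_Suc_eq)
          have w: "Suc j < W" using pp(2) wbd by linarith
          show ?thesis using K w
            apply (simp add: wbd J_def)
            apply (intro conjI)
            subgoal using J(1) by simp
            subgoal by (auto simp: FR_def)
            subgoal by (simp add: Dj)
            done
        qed
        done
    qed
    subgoal premises pp for t' R' G'
    proof -
      note J = pp[unfolded J_def prod.case]
      have G: "G' = G" "R' rJ = d" using J by simp_all
      have e: "(200 + 300 * m) * d = 200 * d + 300 * (d * m)" by (simp add: algebra_simps)
      show ?thesis
        apply (simp add: wbd G)
        apply (rule Q)
        subgoal using J e by simp
        subgoal using J by (simp add: FR_def)
        subgoal using J by simp
        done
    qed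
    done
qed

end

section \<open>Processing one vertex\<close>

context rb
begin

text \<open>A vertex waiting to be processed: list, tables, depth and thread are complete, while
  budget and right pointer are still to be set.\<close>

definition pend :: "mem \<Rightarrow> nat \<Rightarrow> nat list \<Rightarrow> nat \<Rightarrow> nat \<Rightarrow> bool" where
  "pend G v its dep e \<longleftrightarrow> lst (\<lambda>i. G aINX i 0) (G aHEAD v 0) its \<and>
     (\<forall>l<d. \<forall>a<m. \<forall>y<2. G aCNT v (cidx m l a y) = csum G its l a y) \<and>
     (\<forall>y<2. G aNN v y = nsum G its y) \<and> G aDEP v 0 = dep \<and> G aNXT v 0 = e"

definition itok :: "mem \<Rightarrow> nat list \<Rightarrow> bool" where
  "itok G its \<longleftrightarrow> distinct its \<and> (\<forall>i\<in>set its. i < NR \<and> (\<forall>l<d. G aKEY i l < m)) \<and> nsum G its 0 + nsum G its 1 \<le> Z"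

lemma nsum_part: "nsum G its y = nsum G (rev (filter P its)) y + nsum G (rev (filter (\<lambda>i. \<not> P i) its)) y"
  unfolding nsum_def by (induction its) auto

lemma csum_part: "csum G its l a y = csum G (rev (filter P its)) l a y + csum G (rev (filter (\<lambda>i. \<not> P i) its)) l a y"
  unfolding csum_def by (induction its) auto

lemma sums_cong:
  assumes "\<And>i s. G' aIC i s = G aIC i s" "\<And>i s. G' aKEY i s = G aKEY i s"
  shows "nsum G' its y = nsum G its y" "csum G' its l a y = csum G its l a y" "itok G' its = itok G its"
proof -
  show n: "nsum G' its y = nsum G its y" for y using assms by (simp add: nsum_def)
  show "csum G' its l a y = csum G its l a y" unfolding csum_def assms ..
  show "itok G' its = itok G its" using assms by (simp add: itok_def n)
qed

lemma itok_filter: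
  assumes "itok G its"
  shows "itok G (rev (filter P its))"
proof -
  have "nsum G (rev (filter P its)) y \<le> nsum G its y" for y using nsum_part[of G its y P] by simp
  then have "nsum G (rev (filter P its)) 0 + nsum G (rev (filter P its)) 1 \<le> nsum G its 0 + nsum G its 1"
    by (intro add_mono)
  then show ?thesis using assms unfolding itok_def by auto
qed

lemma link:
  assumes V: "R rLC < NR" "R rRC < NR" "R rV < NR" "R rLC \<noteq> R rRC" "R rV \<noteq> R rLC" "R rV \<noteq> R rRC"
    and dep: "Suc (G aDEP (R rV) 0) < W"
    and Q: "\<And>t' G'. t' \<le> t + 300 \<Longrightarrow>
      (\<And>a i s. \<not> (a \<in> {aNXT, aDEP} \<and> (i = R rLC \<or> i = R rRC)) \<Longrightarrow> \<not> (a \<in> {aNXT, aRGT, aNJ, aNA} \<and> i = R rV) \<Longrightarrow>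
         G' a i s = G a i s) \<Longrightarrow>
      G' aDEP (R rLC) 0 = Suc (G aDEP (R rV) 0) \<Longrightarrow> G' aDEP (R rRC) 0 = Suc (G aDEP (R rV) 0) \<Longrightarrow>
      G' aNXT (R rRC) 0 = G aNXT (R rV) 0 \<Longrightarrow> G' aNXT (R rLC) 0 = Suc (R rRC) \<Longrightarrow>
      G' aNXT (R rV) 0 = Suc (R rLC) \<Longrightarrow> G' aRGT (R rV) 0 = Suc (R rRC) \<Longrightarrow> G' aNJ (R rV) 0 = R rBJ \<Longrightarrow>
      G' aNA (R rV) 0 = R rBA \<Longrightarrow> Q (t', R, G')"
  shows "wp p_link Q (t, R, G)"
proof -
  have w: "Suc (R rLC) < W" "Suc (R rRC) < W" using V wbd by linarith+
  show ?thesis unfolding p_link_def using V dep w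
    apply (simp add: wbd wids upd_apply)
    apply (rule Q)
    by (auto simp: upd_apply)
qed

lemma split:
  assumes v: "R rV < NR" "R rV \<notin> AV" "avail R G AV" "2 \<le> card AV"
    and p: "pend G (R rV) its dep e" "itok G its" and dep: "Suc dep < W"
    and ja: "R rBJ = j" "R rBA = a" "j < d"
  defines "il \<equiv> rev (filter (\<lambda>i. G aKEY i j \<le> a) its)" and "ir \<equiv> rev (filter (\<lambda>i. \<not> G aKEY i j \<le> a) its)"
  assumes Q: "\<And>t' R' G' l r. t' \<le> t + 1500 + 300 * (d * m) + 200 * length its + 250 * (d * min (length il) (length ir)) \<Longrightarrow>
      (\<And>x. x \<in> {rNI, rTEND, rV} \<Longrightarrow> R' x = R x) \<Longrightarrow> l \<in> AV \<Longrightarrow> r \<in> AV \<Longrightarrow> l \<noteq> r \<Longrightarrow>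
      avail R' G' (AV - {l, r}) \<Longrightarrow> pend G' l il (Suc dep) (Suc r) \<Longrightarrow> pend G' r ir (Suc dep) e \<Longrightarrow>
      G' aNXT (R rV) 0 = Suc l \<Longrightarrow> G' aRGT (R rV) 0 = Suc r \<Longrightarrow> G' aNJ (R rV) 0 = j \<Longrightarrow> G' aNA (R rV) 0 = a \<Longrightarrow>
      (\<And>a i s. a \<in> {aIC, aKEY, aTRI, aLST} \<Longrightarrow> G' a i s = G a i s) \<Longrightarrow>
      (\<And>i s. i \<notin> set its \<Longrightarrow> G' aINX i s = G aINX i s) \<Longrightarrow>
      (\<And>a i s. a \<noteq> aINX \<Longrightarrow> i \<noteq> R rV \<Longrightarrow> i \<noteq> l \<Longrightarrow> i \<noteq> r \<Longrightarrow> G' a i s = G a i s) \<Longrightarrow>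
      (\<And>a s. a \<in> {aBUD, aDEP} \<Longrightarrow> G' a (R rV) s = G a (R rV) s) \<Longrightarrow> Q (t', R', G')"
  shows "wp (p_split d m) Q (t, R, G)"
proof -
  let ?v = "R rV"
  have pd: "lst (\<lambda>i. G aINX i 0) (G aHEAD ?v 0) its"
     "\<And>l a y. l < d \<Longrightarrow> a < m \<Longrightarrow> y < 2 \<Longrightarrow> G aCNT ?v (cidx m l a y) = csum G its l a y"
     "\<And>y. y < 2 \<Longrightarrow> G aNN ?v y = nsum G its y" "G aDEP ?v 0 = dep" "G aNXT ?v 0 = e"
    using p(1) by (auto simp: pend_def)
  have it: "distinct its" "\<And>i. i \<in> set its \<Longrightarrow> i < NR" "\<And>i l. i \<in> set its \<Longrightarrow> l < d \<Longrightarrow> G aKEY i l < m"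
    using p(2) by (auto simp: itok_def)
  have itl: "itok G il" "itok G ir" unfolding il_def ir_def by (intro itok_filter p)+
  have ne: "AV \<noteq> {}" using v(4) by auto
  show ?thesis unfolding p_split_def
    apply (simp only: wp_Seq)
    apply (rule alloc[OF v(3) ne])
    subgoal by simp
    subgoal by simp
    subgoal by simp
    subgoal premises p1 for t1 R1 l
    proof -
      note t1 = p1(1)
      have R1: "R1 rLC = l" "\<And>x. x \<noteq> rLC \<Longrightarrow> x \<noteq> rFR \<Longrightarrow> x \<noteq> rNB \<Longrightarrow> R1 x = R x" using p1(3,5) by auto
      have ne2: "AV - {l} \<noteq> {}"
      proof
        assume "AV - {l} = {}"
        then have "AV \<subseteq> {l}" by auto
        then have "card AV \<le> card {l}" by (intro card_mono) auto
        then show False using v(4) by simp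
      qed
      show ?thesis
        apply (simp only: wp_Seq)
        apply (rule alloc[OF p1(4) ne2])
        subgoal by simp
        subgoal by simp
        subgoal by simp
        subgoal premises p2 for t2 R2 r
        proof -
          have R2: "R2 rLC = l" "R2 rRC = r" "\<And>x. x \<noteq> rLC \<Longrightarrow> x \<noteq> rRC \<Longrightarrow> x \<noteq> rFR \<Longrightarrow> x \<noteq> rNB \<Longrightarrow> R2 x = R x"
            using p2(3,5) R1 by auto
          have lr: "l \<in> AV" "r \<in> AV" "l \<noteq> r" "l < NR" "r < NR" "?v \<noteq> l" "?v \<noteq> r"
            using p1(2) p2(2) v avail_less[OF v(3)] by auto
          have av: "avail R2 G (AV - {l, r})" using p2(4) by (metis Diff_insert insert_commute)
          have R2V: "R2 rV = ?v" "R2 rBJ = j" "R2 rBA = a" using R2(3) ja by auto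
          show ?thesis
            apply (simp only: wp_Seq)
            apply (rule part[where its = its])
            subgoal using R2 lr by simp
            subgoal using R2 lr by simp
            subgoal using R2V v by simp
            subgoal using R2 lr by simp
            subgoal using R2 R2V lr by simp
            subgoal using R2 R2V lr by simp
            subgoal using pd(1) R2V by simp
            subgoal by (rule it(1))
            subgoal by (rule it(2))
            subgoal using R2V ja by simp
            subgoal premises p3 for t3 R3 G3
            proof -
              have R3: "R3 rLC = l" "R3 rRC = r" "R3 rV = ?v" "R3 rBJ = j" "R3 rBA = a" "R3 rFR = R2 rFR"
                "R3 rNB = R2 rNB" "R3 rNI = R rNI" "R3 rTEND = R rTEND"
                using p3(2) R2 R2V by auto
              note fr3 = p3(3)[unfolded R2(1,2)]
              have L3: "lst (\<lambda>i. G3 aINX i 0) (G3 aHEAD l 0) il" "lst (\<lambda>i. G3 aINX i 0) (G3 aHEAD r 0) ir"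
                "G3 aLEN l 0 = length il" "G3 aLEN r 0 = length ir"
                using p3(4-7) unfolding R2(1,2) R2V il_def ir_def by (simp_all del: not_le)
              \<comment> \<open>The smaller and the larger child with their lists; these definitions
                confine the question which side is smaller.\<close>
              define sm where "sm = (if length ir < length il then r else l)"
              define bg where "bg = (if length ir < length il then l else r)"
              define im where "im = (if length ir < length il then ir else il)"
              define ib where "ib = (if length ir < length il then il else ir)"
              have sb: "sm < NR" "bg < NR" "bg \<noteq> ?v" "bg \<noteq> sm" "sm \<noteq> ?v" "{sm, bg} = {l, r}"
                using lr by (auto simp: sm_def bg_def)
              have Lm: "lst (\<lambda>i. G3 aINX i 0) (G3 aHEAD sm 0) im" "lst (\<lambda>i. G3 aINX i 0) (G3 aHEAD bg 0) ib"
                using L3 by (auto simp: sm_def im_def bg_def ib_def)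
              have lim: "length im = min (length il) (length ir)" by (auto simp: im_def)
              have s3: "nsum G3 xs y = nsum G xs y" "csum G3 xs l' a' y = csum G xs l' a' y" "itok G3 xs = itok G xs"
                for xs l' a' y using sums_cong[of G3 G] fr3 by auto
              have itm: "itok G3 im" using itl unfolding s3(3) by (auto simp: im_def)
              have tot: "nsum G its y = nsum G im y + nsum G ib y" "csum G its l' a' y = csum G im l' a' y + csum G ib l' a' y"
                for y l' a'
                using nsum_part[of G its y "\<lambda>i. G aKEY i j \<le> a"] csum_part[of G its l' a' y "\<lambda>i. G aKEY i j \<le> a"]
                by (auto simp: im_def ib_def il_def ir_def)
              \<comment> \<open>Both branches of the length comparison continue alike, so the
                continuation is treated once.\<close>
              have cnt: "wp (p_count d m) (wp (p_sub d m ;; p_link) Q) (t4, R4, G3)"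
                if t4: "t4 \<le> t3 + 100" and R4: "R4 rSM = sm" "R4 rBG = bg" "R4 rU = sm"
                  "\<And>x. x \<notin> {rSM, rBG, rU} \<Longrightarrow> R4 x = R3 x" for t4 R4
                apply (rule count[where its = im])
                subgoal using R4 sb by simp
                subgoal using Lm(1) R4 by simp
                subgoal using itm by (simp add: itok_def)
                subgoal using itm by (simp add: itok_def)
                subgoal using itm by (simp add: itok_def)
                subgoal premises p5 for t5 R5 G5
                proof -
                  have R5: "R5 rSM = sm" "R5 rBG = bg" "R5 rV = ?v" "R5 rLC = l" "R5 rRC = r" "R5 rBJ = j" "R5 rBA = a"
                    "R5 rFR = R2 rFR" "R5 rNB = R2 rNB" "R5 rNI = R rNI" "R5 rTEND = R rTEND"
                    using p5(2) R4 R3 by auto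
                  note fr5 = p5(3)[unfolded R4(3)]
                  note c5 = p5(4,5)[unfolded R4(3)]
                  show ?thesis
                    apply (simp only: wp_Seq)
                    apply (rule sub)
                    subgoal using R5 v by simp
                    subgoal using R5 sb by simp
                    subgoal using R5 sb by simp
                    subgoal using R5 sb by simp
                    subgoal using R5 sb by simp
                    subgoal premises p6 for t6 R6 G6
                    proof -
                      have R6: "R6 rV = ?v" "R6 rLC = l" "R6 rRC = r" "R6 rBJ = j" "R6 rBA = a"
                        "R6 rFR = R2 rFR" "R6 rNB = R2 rNB" "R6 rNI = R rNI" "R6 rTEND = R rTEND"
                        using p6(2) R5 by auto
                      note fr6 = p6(3)[unfolded R5]
                      note c6 = p6(4,5)[unfolded R5]
                      have d6: "G6 aDEP ?v 0 = dep" "G6 aNXT ?v 0 = e" using fr6 fr5 fr3 pd by auto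
                      show ?thesis
                        apply (rule link)
                        subgoal using R6 lr by simp
                        subgoal using R6 lr by simp
                        subgoal using R6 v by simp
                        subgoal using R6 lr by simp
                        subgoal using R6 lr by simp
                        subgoal using R6 lr by simp
                        subgoal using R6 d6 dep by simp
                        subgoal premises p7 for t7 G7
                        proof -
                          note fr7 = p7(2)[unfolded R6]
                          note f7 = p7(3-10)[unfolded R6]
                          have s7: "nsum G7 xs y = nsum G xs y" "csum G7 xs l' a' y = csum G xs l' a' y" for xs l' a' y
                            using sums_cong[of G7 G] fr7 fr6 fr5 fr3 by auto
                          have cm: "G7 aCNT sm (cidx m l' a' y) = csum G im l' a' y" if "l' < d" "a' < m" "y < 2" for l' a' y
                            using c5(1)[OF that] fr6[of aCNT sm] fr7[of aCNT sm] sb s3(2) by auto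
                          have nm: "G7 aNN sm y = nsum G im y" if "y < 2" for y
                            using c5(2)[OF that] fr6[of aNN sm] fr7[of aNN sm] sb s3(1) by auto
                          have cv: "G5 aCNT ?v x = G aCNT ?v x" "G5 aNN ?v x = G aNN ?v x" for x
                            using fr5[of aCNT ?v] fr5[of aNN ?v] fr3[of aCNT ?v] fr3[of aNN ?v] sb by auto
                          have cb: "G7 aCNT bg (cidx m l' a' y) = csum G ib l' a' y" if "l' < d" "a' < m" "y < 2" for l' a' y
                          proof -
                            have "G7 aCNT bg (cidx m l' a' y) = G5 aCNT ?v (cidx m l' a' y) - G5 aCNT sm (cidx m l' a' y)"
                              using c6(1)[OF cidx_less[OF that]] fr7[of aCNT bg] by auto
                            then show ?thesis using c5(1)[OF that] cv pd(2)[OF that] s3(2) tot(2) by simp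
                          qed
                          have nb: "G7 aNN bg y = nsum G ib y" if "y < 2" for y
                          proof -
                            have "G7 aNN bg y = G5 aNN ?v y - G5 aNN sm y" using c6(2)[OF that] fr7[of aNN bg] by auto
                            then show ?thesis using c5(2)[OF that] cv pd(3)[OF that] s3(1) tot(1) by simp
                          qed
                          have clr: "(\<forall>l'<d. \<forall>a'<m. \<forall>y<2. G7 aCNT l (cidx m l' a' y) = csum G il l' a' y) \<and>
                              (\<forall>l'<d. \<forall>a'<m. \<forall>y<2. G7 aCNT r (cidx m l' a' y) = csum G ir l' a' y) \<and>
                              (\<forall>y<2. G7 aNN l y = nsum G il y) \<and> (\<forall>y<2. G7 aNN r y = nsum G ir y)"
                          proof (cases "length ir < length il")
                            case True
                            then have "sm = r" "bg = l" "im = ir" "ib = il" by (auto simp: sm_def bg_def im_def ib_def)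
                            then show ?thesis using cm nm cb nb by simp
                          next
                            case False
                            then have "sm = l" "bg = r" "im = il" "ib = ir" by (auto simp: sm_def bg_def im_def ib_def)
                            then show ?thesis using cm nm cb nb by simp
                          qed
                          have INX: "G7 aINX i s = G3 aINX i s" "G7 aHEAD i s = G3 aHEAD i s" for i s
                            using fr7 fr6 fr5 by auto
                          have t: "t7 \<le> t + 1500 + 300 * (d * m) + 200 * length its + 250 * (d * min (length il) (length ir))"
                            using p7(1) p6(1) p5(1) t4 p3(1) p2(1) p1(1) unfolding lim by linarith
                          have nfr: "G7 a i s = G a i s" if "a \<noteq> aINX" "i \<noteq> ?v" "i \<noteq> l" "i \<noteq> r" for a i s
                            proof -
                              have "i \<noteq> sm" "i \<noteq> bg" using that sb(6) by auto
                              then show ?thesis using that fr7 fr6 fr5 fr3 by auto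
                            qed
                          show ?thesis
                          proof (rule Q[OF t, of R6 l r])
                            show "R6 x = R x" if "x \<in> {rNI, rTEND, rV}" for x using that R6 by auto
                            show "avail R6 G7 (AV - {l, r})"
                            proof (rule avail_cong[OF av])
                              fix i assume i: "i \<in> AV - {l, r}"
                              then have "i \<noteq> ?v" using v(2) by blast
                              then show "G7 aNXT i 0 = G aNXT i 0" using i by (intro nfr) auto
                            qed (use R6 in simp_all)
                            show "pend G7 l il (Suc dep) (Suc r)" "pend G7 r ir (Suc dep) e"
                              using L3 clr f7 d6 unfolding pend_def s7 INX by simp_all
                            show "G7 a i s = G a i s" if "a \<in> {aIC, aKEY, aTRI, aLST}" for a i s
                              using that fr7 fr6 fr5 fr3 by auto
                            show "G7 aINX i s = G aINX i s" if "i \<notin> set its" for i s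
                              using that fr3 INX by auto
                            show "G7 a i s = G a i s" if "a \<noteq> aINX" "i \<noteq> ?v" "i \<noteq> l" "i \<noteq> r" for a i s
                              by (rule nfr[OF that])
                            show "G7 a ?v s = G a ?v s" if "a \<in> {aBUD, aDEP}" for a s
                              using that fr7 fr6 fr5 fr3 lr by auto
                          qed (use lr f7 in simp_all)
                        qed
                        done
                    qed
                    done
                qed
                done
              show ?thesis
                apply (simp add: R3 lr wbd wids L3(3,4))
                apply (intro conjI impI)
                subgoal by (rule cnt) (auto simp: sm_def bg_def)
                subgoal by (rule cnt) (auto simp: sm_def bg_def)
                done
            qed
            done
        qed
        done
    qed
    done
qed

definition vf :: "mem \<Rightarrow> nat list \<Rightarrow> nat \<Rightarrow> nat \<Rightarrow> real" where
  "vf G its j a = vv (nsum G its 1) (nsum G its 0)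
     (nsum G (rev (filter (\<lambda>i. G aKEY i j \<le> a) its)) 1) (nsum G (rev (filter (\<lambda>i. G aKEY i j \<le> a) its)) 0)"

lemma csum_prefix: "(\<Sum>a'<Suc a. csum G its j a' y) = nsum G (rev (filter (\<lambda>i. G aKEY i j \<le> a) its)) y"
proof -
  have "(\<Sum>a'<Suc a. csum G its j a' y) = (\<Sum>i\<leftarrow>its. \<Sum>a'<Suc a. if G aKEY i j = a' then G aIC i y else 0)"
    unfolding csum_def by (induction its) (simp_all add: sum.distrib)
  also have "\<dots> = (\<Sum>i\<leftarrow>its. if G aKEY i j \<le> a then G aIC i y else 0)"
    by (intro arg_cong[of _ _ sum_list] map_cong refl) (auto simp: sum.delta' less_Suc_eq_le)
  also have "\<dots> = nsum G (rev (filter (\<lambda>i. G aKEY i j \<le> a) its)) y"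
    unfolding nsum_def by (induction its) auto
  finally show ?thesis .
qed

lemma csum_all:
  assumes "\<And>i. i \<in> set its \<Longrightarrow> G aKEY i j < m"
  shows "(\<Sum>a<m. csum G its j a y) = nsum G its y"
proof (cases m)
  case 0
  then have "its = []" using assms by (cases its) auto
  then show ?thesis by (simp add: 0 nsum_def)
next
  case (Suc m')
  have "filter (\<lambda>i. G aKEY i j \<le> m') its = its" using assms Suc by (auto simp: filter_id_conv less_Suc_eq_le)
  then show ?thesis unfolding Suc csum_prefix by (simp add: nsum_def rev_map[symmetric])
qed

definition split_cond :: "nat \<Rightarrow> nat \<Rightarrow> nat \<Rightarrow> bool" where
  "split_cond PT NT dep \<longleftrightarrow> k < PT + NT \<and> (PT + NT) * (PT + NT) \<le> PT * NT * q \<and> dep < h"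

definition base :: "nat \<Rightarrow> nat" where
  "base s = 3000 + 50 * floor_log s + 200 * d + 600 * (d * m)"

text \<open>\<open>QL\<close> and \<open>QS\<close> are the outcomes leaf and split. The bound on
  \<open>AV\<close> is the space reserve: a nonempty list of \<open>L\<close> records yields at most
  \<open>L\<close> leaves, hence \<open>2 * L - 1\<close> vertices, of which the root is already
  allocated.\<close>

lemma proc:
  assumes v: "R rV = v" "v < NR" "v \<notin> AV" "avail R G AV" "2 * max 1 (length its) \<le> card AV + 2"
    and p: "pend G v its dep e" "itok G its" and dep: "dep \<le> h"
  defines "PT \<equiv> nsum G its 1" and "NT \<equiv> nsum G its 0"
  assumes QL: "\<And>t' R' G'. t' \<le> t + base (PT + NT) \<Longrightarrow> (\<And>x. x \<in> {rNI, rTEND, rV, rFR, rNB} \<Longrightarrow> R' x = R x) \<Longrightarrow>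
      (\<And>a i s. \<not> (a \<in> {aBUD, aRGT} \<and> i = v) \<Longrightarrow> G' a i s = G a i s) \<Longrightarrow>
      G' aBUD v 0 = 2 ^ floor_log (PT + NT) div q - 1 \<Longrightarrow> G' aRGT v 0 = 0 \<Longrightarrow>
      (split_cond PT NT dep \<Longrightarrow> \<forall>j<d. \<forall>a<m. fv PT NT \<le> vf G its j a) \<Longrightarrow> Q (t', R', G')"
    and QS: "\<And>t' R' G' l r j a il ir. il = rev (filter (\<lambda>i. G aKEY i j \<le> a) its) \<Longrightarrow>
      ir = rev (filter (\<lambda>i. \<not> G aKEY i j \<le> a) its) \<Longrightarrow> il \<noteq> [] \<Longrightarrow> ir \<noteq> [] \<Longrightarrow>
      t' \<le> t + base (PT + NT) + 200 * length its + 250 * (d * min (length il) (length ir)) \<Longrightarrow>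
      split_cond PT NT dep \<Longrightarrow> j < d \<Longrightarrow> a < m \<Longrightarrow> vf G its j a \<le> fv PT NT \<Longrightarrow>
      (\<And>j' a'. j' < d \<Longrightarrow> a' < m \<Longrightarrow> vf G its j a \<le> vf G its j' a') \<Longrightarrow>
      (\<And>x. x \<in> {rNI, rTEND, rV} \<Longrightarrow> R' x = R x) \<Longrightarrow> l \<in> AV \<Longrightarrow> r \<in> AV \<Longrightarrow> l \<noteq> r \<Longrightarrow>
      avail R' G' (AV - {l, r}) \<Longrightarrow> pend G' l il (Suc dep) (Suc r) \<Longrightarrow> pend G' r ir (Suc dep) e \<Longrightarrow>
      G' aNXT v 0 = Suc l \<Longrightarrow> G' aRGT v 0 = Suc r \<Longrightarrow> G' aNJ v 0 = j \<Longrightarrow> G' aNA v 0 = a \<Longrightarrow>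
      G' aBUD v 0 = 2 ^ floor_log (PT + NT) div q - 1 \<Longrightarrow> G' aDEP v 0 = dep \<Longrightarrow>
      (\<And>a i s. a \<in> {aIC, aKEY, aTRI, aLST} \<Longrightarrow> G' a i s = G a i s) \<Longrightarrow>
      (\<And>i s. i \<notin> set its \<Longrightarrow> G' aINX i s = G aINX i s) \<Longrightarrow>
      (\<And>a i s. a \<noteq> aINX \<Longrightarrow> i \<noteq> v \<Longrightarrow> i \<noteq> l \<Longrightarrow> i \<noteq> r \<Longrightarrow> G' a i s = G a i s) \<Longrightarrow> Q (t', R', G')"
  shows "wp (p_proc d m k h q) Q (t, R, G)"
proof -
  let ?s = "PT + NT"
  have pd: "lst (\<lambda>i. G aINX i 0) (G aHEAD v 0) its"
     "\<And>l a y. l < d \<Longrightarrow> a < m \<Longrightarrow> y < 2 \<Longrightarrow> G aCNT v (cidx m l a y) = csum G its l a y"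
     "\<And>y. y < 2 \<Longrightarrow> G aNN v y = nsum G its y" "G aDEP v 0 = dep" "G aNXT v 0 = e"
    using p(1) by (auto simp: pend_def)
  have it: "distinct its" "\<And>i. i \<in> set its \<Longrightarrow> i < NR" "\<And>i l. i \<in> set its \<Longrightarrow> l < d \<Longrightarrow> G aKEY i l < m" "?s \<le> Z"
    using p(2) by (auto simp: itok_def PT_def NT_def)
  have NN: "G aNN v 1 = PT" "G aNN v (Suc 0) = PT" "G aNN v 0 = NT" using pd(3) by (auto simp: PT_def NT_def)
  have w: "PT * NT * q < W" "?s * ?s < W" "PT * NT < W"
  proof -
    have z: "PT \<le> Z" "NT \<le> Z" "q \<le> Z" using it bounds by linarith+
    have "PT * NT * q \<le> Z * Z * Z" using z by (intro mult_le_mono)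
    moreover have "?s * ?s \<le> Z * Z" using it by (intro mult_le_mono)
    moreover have "PT * NT \<le> Z * Z" using z by (intro mult_le_mono)
    moreover have "Z * Z * Z \<le> Z ^ 6" "Z * Z \<le> Z ^ 6" "0 < Z ^ 6"
      using Zpow[of 3 6] Zpow[of 2 6] Z_ge by (auto simp: power3_eq_cube power2_eq_square)
    ultimately show "PT * NT * q < W" "?s * ?s < W" "PT * NT < W" using W by linarith+
  qed
  have vfe: "vf G its j a = vv PT NT (\<Sum>a'<Suc a. csum G its j a' 1) (\<Sum>a'<Suc a. csum G its j a' 0)" for j a
    unfolding vf_def csum_prefix PT_def NT_def ..
  show ?thesis unfolding p_proc_def
    apply (simp only: wp_Seq)
    apply (rule budget)
    subgoal using v by simp
    subgoal using it NN v by simp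
    subgoal premises p1 for t1 R1 G1
    proof -
      have R1: "R1 rPT = PT" "R1 rNT = NT" "R1 rS = ?s" "R1 rV = v"
        "\<And>x. x \<notin> {rPT, rNT, rS, rP2} \<Longrightarrow> R1 x = R x"
        using p1(2-5) v NN by auto
      have t1: "t1 \<le> t + 200 + 50 * floor_log ?s" using p1(1) v NN by simp
      note fr1 = p1(6)[unfolded v(1)]
      have bud: "G1 aBUD v 0 = 2 ^ floor_log ?s div q - 1" "G1 aRGT v 0 = 0" using p1(7,8) v NN by auto
      have d1: "G1 aDEP v 0 = dep" using fr1 pd by auto
      have fin: "Q (t', R', G1)"
        if "t' \<le> t1 + 1000 + 200 * d + 300 * (d * m)" "\<And>x. x \<in> {rNI, rTEND, rV, rFR, rNB} \<Longrightarrow> R' x = R1 x"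
          "split_cond PT NT dep \<Longrightarrow> \<forall>j<d. \<forall>a<m. fv PT NT \<le> vf G its j a" for t' R'
        by (rule QL) (use that t1 R1 fr1 bud in \<open>auto simp: base_def\<close>)
      show ?thesis
      proof (cases "split_cond PT NT dep")
        case False
        then show ?thesis using w v(2) it(4) unfolding split_cond_def
          by (auto simp: R1 wbd wids d1 split_cond_def intro!: fin)
      next
        case True
        then have c: "k < ?s" "\<not> PT * NT * q < ?s * ?s" "dep < h" by (auto simp: split_cond_def)
        show ?thesis
          apply (simp add: R1 wbd wids d1 v(2) w c)
          apply (rule best[where c = "csum G its" and f = "vf G its"])
          subgoal using R1 v by simp
          subgoal using R1 by simp
          subgoal using R1(3) c(1) by linarith
          subgoal using R1 it by simp
          subgoal for j a y using R1 fr1[of aCNT v] pd(2)[of j a y] by auto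
          subgoal for j using R1 csum_all[of its G j 1] it(3) by (simp add: PT_def)
          subgoal for j using R1 csum_all[of its G j 0] it(3) by (simp add: NT_def)
          subgoal unfolding vfe R1 ..
          subgoal premises p2 for t2 R2
          proof -
            have R2: "R2 rV = v" "\<And>x. x \<in> {rNI, rTEND, rV, rFR, rNB} \<Longrightarrow> R2 x = R x" using p2(2) R1 by auto
            note g = p2(3)[unfolded R1 good_def]
            have t2: "t2 \<le> t + 600 + 50 * floor_log ?s + 200 * d + 300 * (d * m)" using p2(1) t1 by simp
            show ?thesis
            proof (cases "R2 rBJ < d")
              case False
              then have "fv PT NT \<le> vf G its j a" if "j < d" "a < m" for j a using g that by auto
              then show ?thesis using False t2 apply (simp add: wbd)
                by (rule QL) (use R2 fr1 bud in \<open>auto simp: base_def\<close>)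
            next
              case bj: True
              let ?j = "R2 rBJ" and ?a = "R2 rBA"
              have ja: "?a < m" "vf G its ?j ?a < fv PT NT" "\<And>j a. j < d \<Longrightarrow> a < m \<Longrightarrow> vf G its ?j ?a \<le> vf G its j a"
                using g bj by auto
              define il where "il = rev (filter (\<lambda>i. G aKEY i ?j \<le> ?a) its)"
              define ir where "ir = rev (filter (\<lambda>i. \<not> G aKEY i ?j \<le> ?a) its)"
              have ns: "PT = nsum G il 1 + nsum G ir 1" "NT = nsum G il 0 + nsum G ir 0"
                unfolding PT_def NT_def il_def ir_def by (rule nsum_part)+
              have vfl: "vf G its ?j ?a = fv (nsum G il 1) (nsum G il 0) + fv (nsum G ir 1) (nsum G ir 0)"
                unfolding vf_def vv_def PT_def[symmetric] NT_def[symmetric] il_def[symmetric] using ns by simp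
              \<comment> \<open>With an empty side the value of the split would equal that of the
                unsplit vertex, contrary to strictness.\<close>
              have ne: "il \<noteq> []" "ir \<noteq> []"
              proof -
                show "il \<noteq> []"
                proof
                  assume "il = []"
                  then show False using ja(2) ns unfolding vfl by (simp add: nsum_def fv_def)
                qed
                show "ir \<noteq> []"
                proof
                  assume "ir = []"
                  then show False using ja(2) ns unfolding vfl by (simp add: nsum_def fv_def)
                qed
              qed
              have len: "length its = length il + length ir"
                unfolding il_def ir_def using sum_length_filter_compl[of "\<lambda>i. G aKEY i ?j \<le> ?a" its] by simp
              then have "2 \<le> length its" using ne by (cases il; cases ir) auto
              then have c2: "2 \<le> card AV" using v(5) by simp
              have av: "avail R2 G1 AV"
              proof (rule avail_cong[OF v(4)])
                show "G1 aNXT i 0 = G aNXT i 0" if "i \<in> AV" for i using fr1 by simp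
              qed (use R2 in simp_all)
              have s1: "nsum G1 xs y = nsum G xs y" "csum G1 xs l' a' y = csum G xs l' a' y" "itok G1 xs = itok G xs"
                for xs l' a' y using sums_cong[of G1 G] fr1 by auto
              have pnd: "pend G1 v its dep e" using p(1) unfolding pend_def s1 using fr1 by simp
              have key: "G1 aKEY i x = G aKEY i x" for i x using fr1 by simp
              have wd: "Suc dep < W" using dep bounds Z_ge by (intro wlt) linarith
              show ?thesis using bj apply (simp add: wbd)
                apply (rule split[where AV = AV and its = its and dep = dep and e = e and j = ?j and a = ?a])
                subgoal using R2 v by simp
                subgoal using R2 v by simp
                subgoal by (rule av)
                subgoal by (rule c2)
                subgoal using R2 pnd by simp
                subgoal using p(2) s1 by simp
                subgoal by (rule wd)
                subgoal by simp
                subgoal by simp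
                subgoal by simp
                unfolding key il_def[symmetric] ir_def[symmetric] R2(1)
                subgoal premises p3 for t3 R3 G3 l r
                  apply (rule QS[OF il_def ir_def ne, where t' = t3 and l = l and r = r and R' = R3 and G' = G3])
                  subgoal using p3(2) t2 by (simp add: base_def)
                  subgoal by (rule True)
                  subgoal by (rule bj)
                  subgoal by (rule ja)
                  subgoal using ja by simp
                  subgoal by (rule ja)
                  subgoal using p3(3) R2 by auto
                  subgoal by (rule p3)
                  subgoal by (rule p3)
                  subgoal by (rule p3)
                  subgoal by (rule p3)
                  subgoal by (rule p3)
                  subgoal by (rule p3)
                  subgoal by (rule p3)
                  subgoal by (rule p3)
                  subgoal by (rule p3)
                  subgoal by (rule p3)
                  subgoal using p3(17)[of aBUD] bud by simp
                  subgoal using p3(17)[of aDEP] d1 by simp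
                  subgoal for a i s using p3(14)[of a i s] fr1[of a i s] by auto
                  subgoal for i s using p3(15)[of i s] fr1 by simp
                  subgoal for a i s using p3(16)[of a i s] fr1 by simp
                  done
                done
            qed
          qed
          done
      qed
    qed
    done
qed

end

section \<open>Trees with snapshots\<close>

definition kv :: "real set \<Rightarrow> point \<Rightarrow> nat \<Rightarrow> nat" where
  "kv A x l = rank A (x (Suc l))"

text \<open>A real threshold that cuts off exactly \<open>a + 1\<close> values of \<open>A\<close>;
  on \<open>A\<close> it acts like the test whether the rank is at most \<open>a\<close>.\<close>

definition thr :: "real set \<Rightarrow> nat \<Rightarrow> real" where
  "thr A a = (SOME t. card {b \<in> A. b \<le> t} = Suc a)"

lemma le_iff_rank:
  assumes "finite A" "b \<in> A"
  shows "b \<le> t \<longleftrightarrow> rank A b < card {b \<in> A. b \<le> t}"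
proof
  assume "b \<le> t"
  then have "{c \<in> A. c < b} \<subset> {c \<in> A. c \<le> t}" using assms by auto
  then show "rank A b < card {b \<in> A. b \<le> t}" unfolding rank_def using assms by (intro psubset_card_mono) auto
next
  assume r: "rank A b < card {b \<in> A. b \<le> t}"
  show "b \<le> t"
  proof (rule ccontr)
    assume "\<not> b \<le> t"
    then have "card {c \<in> A. c \<le> t} \<le> rank A b" unfolding rank_def using assms by (intro card_mono) auto
    then show False using r by simp
  qed
qed

lemma rank_less: "finite A \<Longrightarrow> b \<in> A \<Longrightarrow> rank A b < card A"
  unfolding rank_def by (intro psubset_card_mono) auto

lemma rank_inj: "finite A \<Longrightarrow> b \<in> A \<Longrightarrow> b' \<in> A \<Longrightarrow> rank A b = rank A b' \<Longrightarrow> b = b'"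
  using le_iff_rank[of A b b'] le_iff_rank[of A b' b] le_iff_rank[of A b b] le_iff_rank[of A b' b']
  by (metis order_antisym order_refl)

text \<open>The element of rank \<open>a\<close> in the sorted enumeration of \<open>A\<close> is a
  witness.\<close>

lemma thr_card:
  assumes "finite A" "a < card A"
  shows "card {b \<in> A. b \<le> thr A a} = Suc a"
proof -
  obtain f where f: "bij_betw f {..<card A} A" "strict_mono_on {..<card A} f"
  proof
    let ?xs = "sorted_list_of_set A"
    show "bij_betw (\<lambda>i. ?xs ! i) {..<card A} A" using assms(1) by (intro bij_betw_nth) auto
    show "strict_mono_on {..<card A} (\<lambda>i. ?xs ! i)"
      using strict_sorted_list_of_set[of A] by (auto simp: strict_mono_on_def sorted_wrt_nth_less)
  qed
  have "{b \<in> A. b \<le> f a} = f ` {..a}"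
  proof (intro set_eqI iffI)
    fix b assume "b \<in> {b \<in> A. b \<le> f a}"
    then obtain i where i: "i < card A" "b = f i" "f i \<le> f a" using f(1) by (auto simp: bij_betw_def)
    then have "i \<le> a" using f(2) assms(2) by (meson lessThan_iff not_le strict_mono_onD)
    then show "b \<in> f ` {..a}" using i by auto
  next
    fix b assume "b \<in> f ` {..a}"
    then obtain i where i: "i \<le> a" "b = f i" by auto
    then have "f i \<le> f a" using f(2) assms(2) by (meson lessThan_iff le_less_trans strict_mono_on_leD)
    then show "b \<in> {b \<in> A. b \<le> f a}" using i f(1) assms(2) by (auto simp: bij_betw_def)
  qed
  moreover have "inj_on f {..a}" using f(1) assms(2) by (auto simp: bij_betw_def intro: inj_on_subset)
  ultimately have "card {b \<in> A. b \<le> f a} = Suc a" by (simp add: card_image)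
  then show ?thesis unfolding thr_def by (rule someI)
qed

text \<open>The arguments shared by \<open>AL\<close> and \<open>AN\<close> are the record number of the vertex, the multiset for which it was
  built and the number of updates since then.\<close>

datatype atr =
    AL nat "nat list" "example multiset" nat
  | AN nat nat nat "example multiset" nat atr atr

primrec cof :: "atr \<Rightarrow> nat" where
  "cof (AL v xs S0 c) = c"
| "cof (AN v j a S0 c l r) = c"

primrec root :: "atr \<Rightarrow> nat" where
  "root (AL v xs S0 c) = v"
| "root (AN v j a S0 c l r) = v"

primrec snap :: "atr \<Rightarrow> example multiset" where
  "snap (AL v xs S0 c) = S0"
| "snap (AN v j a S0 c l r) = S0"

text \<open>Each leaf counts for at least 1, so the weight bounds the number of leaves and of listed
  records at the same time (\<open>ndl_length\<close>).\<close>

primrec wt :: "atr \<Rightarrow> nat" where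
  "wt (AL v xs S0 c) = max 1 (length xs)"
| "wt (AN v j a S0 c l r) = wt l + wt r"

primrec ht :: "atr \<Rightarrow> nat" where
  "ht (AL v xs S0 c) = 0"
| "ht (AN v j a S0 c l r) = Suc (max (ht l) (ht r))"

lemma wt_pos: "1 \<le> wt T"
  by (induction T) auto

section \<open>Chains, heights and a recursive form of feasibility\<close>

fun chain :: "real \<Rightarrow> nat \<Rightarrow> bool \<Rightarrow> dtree" where
  "chain tm 0 L = Leaf L"
| "chain tm (Suc n) L = Node 1 tm (chain tm n L) (Leaf L)"

lemma finite_vertices: "finite (vertices T)"
  by (induction T) auto

lemma vertices_ne: "[] \<in> vertices T"
  by (cases T) auto

lemma height_Leaf: "height (Leaf L) = 0"
  by (simp add: height_def)

lemma height_Node: "height (Node j t l r) = Suc (max (height l) (height r))"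
proof -
  have m: "Max (Suc ` length ` vertices T) = Suc (Max (length ` vertices T))" for T
    by (rule mono_Max_commute[symmetric]) (use finite_vertices vertices_ne in \<open>auto simp: mono_def\<close>)
  have "length ` vertices (Node j t l r) = insert 0 (Suc ` length ` vertices l \<union> Suc ` length ` vertices r)"
    by (simp add: image_Un image_image)
  then have "height (Node j t l r) = Max (insert 0 (Suc ` length ` vertices l \<union> Suc ` length ` vertices r))"
    by (simp add: height_def)
  also have "\<dots> = max 0 (max (Max (Suc ` length ` vertices l)) (Max (Suc ` length ` vertices r)))"
    using finite_vertices vertices_ne[of l] vertices_ne[of r]
    by (subst Max_insert) (auto intro!: arg_cong2[of _ _ _ _ max] Max_Un)
  finally show ?thesis by (simp add: m height_def)
qed

lemma classify_Leaf: "classify (Leaf L) x = L"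
  by (simp add: classify_def)

lemma classify_Node: "classify (Node j t l r) x = (if x j \<le> t then classify l x else classify r x)"
  by (simp add: classify_def)

lemma classify_chain: "classify (chain tm n L) x = L"
  by (induction n) (auto simp: classify_Leaf classify_Node)

lemma height_chain: "height (chain tm n L) = n"
  by (induction n) (auto simp: height_Leaf height_Node)

definition vertex_ok where
  "vertex_ok k h \<alpha> dep S leaf \<longleftrightarrow>
    (if size S \<le> k \<or> gini S = 0 \<or> dep = h then leaf else gini S \<ge> \<alpha> \<longrightarrow> \<not> leaf)"

text \<open>\<open>feasible\<close> with multiset and depth handed down the tree, instead of being
  recomputed from the root at every vertex.\<close>

fun feas where
  "feas d k h \<alpha> \<beta> dep S (Leaf L) \<longleftrightarrow> vertex_ok k h \<alpha> dep S True \<and> majority L S"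
| "feas d k h \<alpha> \<beta> dep S (Node j t l r) \<longleftrightarrow> vertex_ok k h \<alpha> dep S False \<and> j \<in> {1..d} \<and>
    (\<forall>j'\<in>{1..d}. \<forall>t'. gain S j t \<ge> gain S j' t' - \<beta>) \<and>
    feas d k h \<alpha> \<beta> (Suc dep) (part_le S j t) l \<and> feas d k h \<alpha> \<beta> (Suc dep) (part_gt S j t) r"

lemma at_vertex_simps:
  "at_vertex S T [] = S"
  "at_vertex S (Node j t l r) (False # v) = at_vertex (part_le S j t) l v"
  "at_vertex S (Node j t l r) (True # v) = at_vertex (part_gt S j t) r v"
  unfolding at_vertex_def part_le_def part_gt_def filter_filter_mset case_prod_beta
  by (simp, (rule filter_mset_cong, auto split: if_splits)+)

lemma feas_vertex:
  "feas d k h \<alpha> \<beta> dep S T \<Longrightarrow> v \<in> vertices T \<Longrightarrow>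
     vertex_ok k h \<alpha> (dep + length v) (at_vertex S T v) (\<exists>L. subtree T v = Leaf L) \<and>
     (\<forall>j t l r. subtree T v = Node j t l r \<longrightarrow> j \<in> {1..d} \<and>
        (\<forall>j'\<in>{1..d}. \<forall>t'. gain (at_vertex S T v) j t \<ge> gain (at_vertex S T v) j' t' - \<beta>)) \<and>
     (\<forall>L. subtree T v = Leaf L \<longrightarrow> majority L (at_vertex S T v))"
proof (induction T arbitrary: dep S v)
  case (Leaf L)
  then show ?case by (auto simp: at_vertex_simps)
next
  case (Node j t l r)
  consider "v = []" | w where "v = False # w" "w \<in> vertices l" | w where "v = True # w" "w \<in> vertices r"
    using Node.prems(2) by auto
  then show ?case
  proof cases
    case 1
    then show ?thesis using Node.prems(1) by (simp add: at_vertex_simps)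
  next
    case (2 w)
    have "feas d k h \<alpha> \<beta> (Suc dep) (part_le S j t) l" using Node.prems(1) by simp
    from Node.IH(1)[OF this 2(2)] show ?thesis unfolding 2(1) by (simp add: at_vertex_simps)
  next
    case (3 w)
    have "feas d k h \<alpha> \<beta> (Suc dep) (part_gt S j t) r" using Node.prems(1) by simp
    from Node.IH(2)[OF this 3(2)] show ?thesis unfolding 3(1) by (simp add: at_vertex_simps)
  qed
qed

lemma feas_feasible: "feas d k h \<alpha> \<beta> 0 S T \<Longrightarrow> feasible d k h \<alpha> \<beta> S T"
  unfolding feasible_def Let_def using feas_vertex[of d k h \<alpha> \<beta> 0 S T]
  unfolding vertex_ok_def by simp

lemma majority_cls: "majority (cls S False < cls S True) S"
proof -
  have "size (filter_mset (\<lambda>(x, y). y) S) = cls S True" "size (filter_mset (\<lambda>(x, y). \<not> y) S) = cls S False"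
    unfolding cls_def by (auto intro!: arg_cong[of _ _ size] filter_mset_cong)
  then show ?thesis unfolding majority_def by (cases "cls S False < cls S True") simp_all
qed

section \<open>The decision tree denoted by an annotated tree\<close>

locale dt = thresholds +
  fixes A :: "real set" and d h :: nat
  assumes A: "finite A" and d: "1 \<le> d"
begin

abbreviation "m \<equiv> card A"
abbreviation "K \<equiv> kv A"

definition splittable :: "nat \<Rightarrow> example multiset \<Rightarrow> bool" where
  "splittable dep S0 \<longleftrightarrow> k < size S0 \<and> size S0 * size S0 \<le> cls S0 True * cls S0 False * q \<and> dep < h"

text \<open>No feature value exceeds this threshold; inserting 0 keeps the maximum defined for empty
  \<open>A\<close>.\<close>

definition tmax :: real where
  "tmax = Max (insert 0 A)"

abbreviation sle :: "nat \<Rightarrow> nat \<Rightarrow> example multiset \<Rightarrow> example multiset" where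
  "sle j a S \<equiv> filter_mset (\<lambda>e. K (fst e) j \<le> a) S"

abbreviation sgt :: "nat \<Rightarrow> nat \<Rightarrow> example multiset \<Rightarrow> example multiset" where
  "sgt j a S \<equiv> filter_mset (\<lambda>e. \<not> K (fst e) j \<le> a) S"

text \<open>A leaf whose snapshot has no split of positive gain may still have to be an internal vertex; it
  then stands for a chain of vertices down to depth \<open>h\<close> whose splits send every point to the left.\<close>

primrec toD :: "nat \<Rightarrow> example multiset \<Rightarrow> atr \<Rightarrow> dtree" where
  "toD dep S (AL v xs S0 c) = chain tmax (if splittable dep S0 then h - dep else 0) (cls S False < cls S True)"
| "toD dep S (AN v j a S0 c l r) =
    Node (Suc j) (thr A a) (toD (Suc dep) (sle j a S) l) (toD (Suc dep) (sgt j a S) r)"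

definition okS :: "example multiset \<Rightarrow> bool" where
  "okS S \<longleftrightarrow> fst ` set_mset S \<subseteq> domain A d"

text \<open>\<open>X\<close> is the region of the vertex; a split must separate two of its points,
  which bounds the height. Counters do not grow downwards, since an update that reaches a child has
  also reached the parent. The weight bounds express that an update lists at most one further
  record.\<close>

primrec wf :: "nat \<Rightarrow> point set \<Rightarrow> example multiset \<Rightarrow> atr \<Rightarrow> bool" where
  "wf dep X S (AL v xs S0 c) \<longleftrightarrow> close S0 c S \<and> okS S0 \<and> c \<le> budget q S0 \<and> dep \<le> h \<and>
     (splittable dep S0 \<longrightarrow> (\<forall>j<d. \<forall>a<m. GG S0 (\<lambda>x. K x j \<le> a) \<le> 0)) \<and>
     max 1 (length xs) \<le> max 1 (size S0) + c"
| "wf dep X S (AN v j a S0 c l r) \<longleftrightarrow> close S0 c S \<and> okS S0 \<and> c \<le> budget q S0 \<and> splittable dep S0 \<and>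
     j < d \<and> a < m \<and> 0 \<le> GG S0 (\<lambda>x. K x j \<le> a) \<and>
     (\<forall>j'<d. \<forall>a'<m. GG S0 (\<lambda>x. K x j' \<le> a') \<le> GG S0 (\<lambda>x. K x j \<le> a)) \<and>
     (\<exists>x\<in>X. K x j \<le> a) \<and> (\<exists>x\<in>X. \<not> K x j \<le> a) \<and>
     wt l + wt r \<le> max 1 (size S0) + c \<and> cof l \<le> c \<and> cof r \<le> c \<and>
     wf (Suc dep) {x \<in> X. K x j \<le> a} (sle j a S) l \<and> wf (Suc dep) {x \<in> X. \<not> K x j \<le> a} (sgt j a S) r"

lemma le_thr: "x \<in> domain A d \<Longrightarrow> j < d \<Longrightarrow> a < m \<Longrightarrow> x (Suc j) \<le> thr A a \<longleftrightarrow> K x j \<le> a"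
  using le_iff_rank[OF A, of "x (Suc j)" "thr A a"] thr_card[OF A, of a]
  by (force simp: domain_def kv_def PiE_iff)

lemma K_less: "x \<in> domain A d \<Longrightarrow> j < d \<Longrightarrow> K x j < m"
  using rank_less[OF A] by (force simp: domain_def kv_def PiE_iff)

lemma K_inj: "x \<in> domain A d \<Longrightarrow> y \<in> domain A d \<Longrightarrow> (\<And>j. j < d \<Longrightarrow> K x j = K y j) \<Longrightarrow> x = y"
proof -
  assume xy: "x \<in> domain A d" "y \<in> domain A d" and e: "\<And>j. j < d \<Longrightarrow> K x j = K y j"
  have "x i = y i" if "i \<in> {1..d}" for i
    using e[of "i - 1"] that xy rank_inj[OF A, of "x i" "y i"] by (force simp: domain_def kv_def PiE_iff)
  then show "x = y" using xy unfolding domain_def by (intro PiE_ext[of x "{1..d}" "\<lambda>_. A" y])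
qed

lemma le_tmax: "x \<in> domain A d \<Longrightarrow> x 1 \<le> tmax"
  using d A by (auto simp: domain_def tmax_def PiE_iff intro!: Max_ge)

lemma GG_cong: "(\<And>x. x \<in> fst ` set_mset S \<Longrightarrow> P x = Q x) \<Longrightarrow> GG S P = GG S Q"
  unfolding GG_def by (intro arg_cong2[of _ _ _ _ minus] arg_cong[of _ _ gF] filter_mset_cong) auto

lemma GG_triv: "GG S (\<lambda>x. b) = 0"
  by (cases b) (auto simp: GG_def gF_def)

text \<open>On \<open>A\<close> a real threshold acts as a threshold on ranks or as a split with an
  empty left part. The latter has gain 0, whence the condition \<open>0 <= g\<close>.\<close>

lemma GG_any:
  assumes "okS S" "j' \<in> {1..d}" "0 \<le> g" "\<And>j a. j < d \<Longrightarrow> a < m \<Longrightarrow> GG S (\<lambda>x. K x j \<le> a) \<le> g"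
  shows "GG S (\<lambda>x. x j' \<le> t') \<le> g"
proof -
  let ?a = "card {b \<in> A. b \<le> t'}"
  have "GG S (\<lambda>x. x j' \<le> t') = GG S (\<lambda>x. K x (j' - 1) < ?a)"
  proof (rule GG_cong)
    fix x assume "x \<in> fst ` set_mset S"
    then have "x j' \<in> A" using assms(1,2) by (auto simp: okS_def domain_def PiE_iff)
    then show "(x j' \<le> t') = (K x (j' - 1) < ?a)" using le_iff_rank[OF A] assms(2) by (simp add: kv_def)
  qed
  also have "\<dots> \<le> g"
  proof (cases "?a")
    case 0
    then show ?thesis using GG_triv[of S False] assms(3) by simp
  next
    case (Suc a)
    moreover have "?a \<le> m" using A by (intro card_mono) auto
    moreover have "j' - 1 < d" using assms(2) by auto
    ultimately show ?thesis using assms(4)[of "j' - 1" a] assms(2) by (simp add: less_Suc_eq_le)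
  qed
  finally show ?thesis .
qed

lemma okS_filter: "okS S \<Longrightarrow> okS (filter_mset P S)"
  by (auto simp: okS_def)

lemma feas_empty_leaf: "feas d k h \<alpha> \<beta> dep {#} (Leaf L)"
  by (simp add: vertex_ok_def majority_def)

text \<open>Every split sends the whole multiset to the left, so nothing but the depth changes along
  the chain, and at depth \<open>h\<close> a leaf is prescribed. The leaves to the right receive no
  examples.\<close>

lemma feas_chain:
  assumes "okS S" "k < size S" "gini S \<noteq> 0" "dep + n = h"
    and "\<And>j' t'. j' \<in> {1..d} \<Longrightarrow> gain S j' t' - \<beta> \<le> gain S 1 tmax" and L: "majority L S"
  shows "feas d k h \<alpha> \<beta> dep S (chain tmax n L)"
  using assms(4)
proof (induction n arbitrary: dep)
  case 0
  then show ?case using L by (simp add: vertex_ok_def)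
next
  case (Suc n)
  have "part_le S 1 tmax = S" "part_gt S 1 tmax = {#}"
  proof -
    have le: "fst e 1 \<le> tmax" if "e \<in># S" for e using that assms(1) le_tmax by (force simp: okS_def)
    have "part_le S 1 tmax = filter_mset (\<lambda>_. True) S" "part_gt S 1 tmax = filter_mset (\<lambda>_. False) S"
      unfolding part_le_def part_gt_def case_prod_beta not_le[symmetric]
      by (rule filter_mset_cong[OF refl], use le in simp)+
    then show "part_le S 1 tmax = S" "part_gt S 1 tmax = {#}" by simp_all
  qed
  then show ?case using Suc assms(2,3,5) d feas_empty_leaf by (simp add: vertex_ok_def)
qed

lemma feas_toD:
  "wf dep X S T \<Longrightarrow> okS S \<Longrightarrow> feas d k h \<alpha> \<beta> dep S (toD dep S T)"
proof (induction T arbitrary: dep X S)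
  case (AL v xs S0 c)
  then have cl: "close S0 c S" and b: "c = 0 \<or> (c + 1) * q \<le> size S0"
    using budget_cases[of c q S0] q_ge(4) by auto
  show ?case
  proof (cases "splittable dep S0")
    case True
    then have sp: "k < size S0" "size S0 * size S0 \<le> cls S0 True * cls S0 False * q" "dep < h"
      by (auto simp: splittable_def)
    have ne: "k < size S" by (rule size_gt[OF cl b sp(1)])
    then have ne': "S \<noteq> {#}" by auto
    \<comment> \<open>The chain's split is trivial and has gain 0 on the snapshot, where no split
      has positive gain; \<open>gain_opt\<close> carries this optimality over to
      \<open>S\<close>.\<close>
    have "GG S0 (\<lambda>x. x 1 \<le> tmax) = GG S0 (\<lambda>x. True)"
      using AL.prems le_tmax by (intro GG_cong) (auto simp: okS_def)
    then have t0: "GG S0 (\<lambda>x. x 1 \<le> tmax) = 0" by (simp add: GG_triv)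
    have "gain S j' t' - \<beta> \<le> gain S 1 tmax" if "j' \<in> {1..d}" for j' t'
      using AL.prems True that t0 GG_any[of S0 j' 0 t'] by (intro gain_opt[OF cl b _ ne']) auto
    moreover have "gini S \<noteq> 0" using sp(1) by (intro gini_pos[OF cl b _ sp(2)]) auto
    ultimately show ?thesis using True sp ne AL.prems(2) majority_cls
      by (auto intro!: feas_chain)
  next
    case False
    have "vertex_ok k h \<alpha> dep S True"
    proof (cases "size S \<le> k \<or> gini S = 0 \<or> dep = h")
      case False
      then have "k < size S0" using size_le[OF cl b] by force
      moreover have "dep < h" using AL.prems False by auto
      ultimately have "cls S0 True * cls S0 False * q < size S0 * size S0"
        using \<open>\<not> splittable dep S0\<close> by (auto simp: splittable_def)
      moreover have "S \<noteq> {#}" using False by auto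
      ultimately have "gini S < \<alpha>" by (rule gini_small[OF cl b])
      then show ?thesis using False by (auto simp: vertex_ok_def)
    qed (simp add: vertex_ok_def)
    then show ?thesis using False majority_cls by simp
  qed
next
  case (AN v j a S0 c l r)
  then have cl: "close S0 c S" and b: "c = 0 \<or> (c + 1) * q \<le> size S0"
    and sp: "k < size S0" "size S0 * size S0 \<le> cls S0 True * cls S0 False * q" "dep < h"
    and ja: "j < d" "a < m"
    using budget_cases[of c q S0] q_ge(4) by (auto simp: splittable_def)
  have ne: "k < size S" by (rule size_gt[OF cl b sp(1)])
  then have ne': "S \<noteq> {#}" by auto
  have e: "GG S0 (\<lambda>x. x (Suc j) \<le> thr A a) = GG S0 (\<lambda>x. K x j \<le> a)"
    using AN.prems ja le_thr by (intro GG_cong) (auto simp: okS_def)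
  have "gain S j' t' - \<beta> \<le> gain S (Suc j) (thr A a)" if "j' \<in> {1..d}" for j' t'
    using AN.prems that e GG_any[of S0 j' "GG S0 (\<lambda>x. K x j \<le> a)" t']
    by (intro gain_opt[OF cl b _ ne']) auto
  moreover have "part_le S (Suc j) (thr A a) = sle j a S" "part_gt S (Suc j) (thr A a) = sgt j a S"
    unfolding part_le_def part_gt_def using AN.prems(2) le_thr ja
    by (auto intro!: filter_mset_cong simp: okS_def not_le[symmetric])
  moreover have "gini S \<noteq> 0" using sp by (intro gini_pos[OF cl b]) auto
  ultimately show ?case
    using AN.IH(1)[of "Suc dep" _ "sle j a S"] AN.IH(2)[of "Suc dep" _ "sgt j a S"] AN.prems okS_filter ja ne sp
    by (auto simp: vertex_ok_def)
qed

lemma height_toD: "wf dep X S T \<Longrightarrow> height (toD dep S T) \<le> h - dep"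
proof (induction T arbitrary: dep X S)
  case (AL v xs S0 c)
  then show ?case by (simp add: height_chain)
next
  case (AN v j a S0 c l r)
  then have "height (toD (Suc dep) (sle j a S) l) \<le> h - Suc dep" "height (toD (Suc dep) (sgt j a S) r) \<le> h - Suc dep"
    "dep < h" by (auto simp: splittable_def)
  then show ?case by (simp add: height_Node)
qed

lemma ht_le_height: "ht T \<le> height (toD dep S T)"
proof (induction T arbitrary: dep S)
  case (AN v j a S0 c l r)
  show ?case unfolding ht.simps toD.simps height_Node Suc_le_mono by (intro max.mono AN)
qed simp

section \<open>Bounding the stored height by separating splits\<close>

definition nontriv :: "point set \<Rightarrow> (nat \<times> nat) set" where
  "nontriv X = {(j, a). j < d \<and> a < m \<and> (\<exists>x\<in>X. K x j \<le> a) \<and> (\<exists>x\<in>X. \<not> K x j \<le> a)}"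

lemma nontriv_sub: "nontriv X \<subseteq> {..<d} \<times> {..<m}"
  by (auto simp: nontriv_def)

lemma finite_nontriv: "finite (nontriv X)"
  using finite_subset[OF nontriv_sub] by blast

lemma card_nontriv: "card (nontriv X) \<le> d * m"
  using card_mono[OF _ nontriv_sub[of X]] by simp

text \<open>Below a split all points of the region lie on one side of it, so this pair separates
  them no longer.\<close>

lemma card_nontriv_child:
  assumes "(j, a) \<in> nontriv X" "Y \<subseteq> {x \<in> X. K x j \<le> a} \<or> Y \<subseteq> {x \<in> X. \<not> K x j \<le> a}"
  shows "card (nontriv Y) < card (nontriv X)"
proof -
  have "nontriv Y \<subseteq> nontriv X - {(j, a)}" using assms(2) by (auto simp: nontriv_def)
  then have "nontriv Y \<subset> nontriv X" using assms(1) by auto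
  then show ?thesis using finite_nontriv by (rule psubset_card_mono[rotated])
qed

lemma ht_nontriv: "wf dep X S T \<Longrightarrow> ht T \<le> card (nontriv X)"
proof (induction T arbitrary: dep X S)
  case (AN v j a S0 c l r)
  then have "(j, a) \<in> nontriv X" by (auto simp: nontriv_def)
  then have "card (nontriv {x \<in> X. K x j \<le> a}) < card (nontriv X)"
    "card (nontriv {x \<in> X. \<not> K x j \<le> a}) < card (nontriv X)"
    using card_nontriv_child by blast+
  then show ?case using AN by fastforce
qed simp

lemma ht_le: "wf dep X S T \<Longrightarrow> ht T \<le> d * m"
  using ht_nontriv card_nontriv order_trans by blast

end

section \<open>Building a subtree\<close>

primrec ndl :: "atr \<Rightarrow> nat list" where
  "ndl (AL v xs S0 c) = [v]"
| "ndl (AN v j a S0 c l r) = v # ndl l @ ndl r"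

primrec itl :: "atr \<Rightarrow> nat list" where
  "itl (AL v xs S0 c) = xs"
| "itl (AN v j a S0 c l r) = itl l @ itl r"

primrec czero :: "atr \<Rightarrow> bool" where
  "czero (AL v xs S0 c) \<longleftrightarrow> c = 0"
| "czero (AN v j a S0 c l r) \<longleftrightarrow> c = 0 \<and> czero l \<and> czero r"

lemma root_ndl: "root T \<in> set (ndl T)"
  by (cases T) auto

lemma czero_cof: "czero T \<Longrightarrow> cof T = 0"
  by (cases T) auto

lemma filter_mset_or:
  assumes "\<And>x. \<not> (P x \<and> P' x)"
  shows "filter_mset (\<lambda>x. P x \<or> P' x) S = filter_mset P S + filter_mset P' S"
  using assms by (auto intro!: multiset_eqI)

lemma size_points:
  "distinct xs \<Longrightarrow> size (filter_mset (\<lambda>e. fst e \<in> set xs \<and> P (fst e) \<and> snd e = y) S) =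
     (\<Sum>x\<leftarrow>xs. if P x then count S (x, y) else 0)"
proof (induction xs)
  case (Cons x xs)
  have "filter_mset (\<lambda>e. fst e \<in> set (x # xs) \<and> P (fst e) \<and> snd e = y) S =
      filter_mset (\<lambda>e. e = (x, y) \<and> P x \<or> fst e \<in> set xs \<and> P (fst e) \<and> snd e = y) S"
    by (rule filter_mset_cong) (auto simp: prod_eq_iff)
  also have "\<dots> = filter_mset (\<lambda>e. e = (x, y) \<and> P x) S + filter_mset (\<lambda>e. fst e \<in> set xs \<and> P (fst e) \<and> snd e = y) S"
    using Cons.prems by (intro filter_mset_or) auto
  finally show ?case using Cons by (cases "P x") (simp_all add: filter_eq_replicate_mset)
qed simp

text \<open>The recurrence of counting only the smaller part: if \<open>a <= b\<close>, then
  \<open>a + b >= 2 * a\<close>, so the logarithm attached to each unit of \<open>a\<close> grows by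
  1, and this pays for \<open>min a b\<close>.\<close>

lemma floor_log_split:
  assumes "1 \<le> a" "1 \<le> b"
  shows "min a b + a * floor_log a + b * floor_log b \<le> (a + b) * floor_log (a + b)"
proof -
  have *: "a + a * floor_log a + b * floor_log b \<le> (a + b) * floor_log (a + b)" if "a \<le> b" "1 \<le> a" for a b
  proof -
    have "Suc (floor_log a) = floor_log (2 * a)" using that by (simp add: floor_log_twice)
    also have "\<dots> \<le> floor_log (a + b)" using that by (intro monoD[OF floor_log_mono]) simp
    finally have "a * Suc (floor_log a) \<le> a * floor_log (a + b)" by (intro mult_le_mono2)
    then have 1: "a + a * floor_log a \<le> a * floor_log (a + b)" by simp
    have 2: "b * floor_log b \<le> b * floor_log (a + b)"
      by (intro mult_le_mono2 monoD[OF floor_log_mono]) simp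
    show ?thesis using 1 2 unfolding add_mult_distrib by linarith
  qed
  show ?thesis using *[of a b] *[of b a] assms by (cases "a \<le> b") (auto simp: min_def add.commute)
qed

text \<open>\<open>N\<close> bounds the active size at all times. Including dead records, a tree
  weighs at most \<open>2 * N + 1\<close> and so has at most \<open>4 * N + 1\<close> vertices; the
  other records leave room for a new subtree.\<close>

locale algo = dt k q \<alpha> \<beta> \<epsilon> A d h + rb d "card A" NR W I k h q Z
  for k q \<alpha> \<beta> \<epsilon> A d h NR W I Z +
  fixes N :: nat
  assumes NR_N: "NR = 8 * N + 16" and N_Z: "2 * N + 2 \<le> Z"
begin

lemma gF_fv: "gF S = 2 * fv (cls S True) (cls S False)"
  unfolding gF_def fv_def size_cls[of S] by simp

text \<open>A record whose counts have both dropped to 0 may stay in \<open>ps\<close>, and in the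
  trie, until the next rebuild at the root.\<close>

definition itemsI :: "mem \<Rightarrow> point list \<Rightarrow> example multiset \<Rightarrow> bool" where
  "itemsI G ps S \<longleftrightarrow> distinct ps \<and> set ps \<subseteq> domain A d \<and> length ps \<le> NR \<and> size S \<le> N \<and>
     (\<forall>i<length ps. (\<forall>l<d. G aKEY i l = K (ps ! i) l) \<and> (\<forall>y. G aIC i (of_bool y) = count S (ps ! i, y)))"

definition ms :: "point list \<Rightarrow> example multiset \<Rightarrow> nat list \<Rightarrow> example multiset" where
  "ms ps S its = filter_mset (\<lambda>e. fst e \<in> (!) ps ` set its) S"

lemma nsum_cls:
  assumes "itemsI G ps S" "distinct its" "set its \<subseteq> {..<length ps}"
  shows "nsum G its (of_bool y) = cls (ms ps S its) y"
proof -
  have dp: "distinct ps" using assms(1) by (simp add: itemsI_def)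
  have d: "distinct (map ((!) ps) its)"
    using assms(2,3) dp by (auto simp: distinct_map inj_on_def nth_eq_iff_index_eq subset_iff)
  have "cls (ms ps S its) y = size (filter_mset (\<lambda>e. fst e \<in> set (map ((!) ps) its) \<and> True \<and> snd e = y) S)"
    unfolding cls_def ms_def filter_filter_mset by (intro arg_cong[of _ _ size] filter_mset_cong) auto
  also have "\<dots> = (\<Sum>x\<leftarrow>map ((!) ps) its. count S (x, y))" using size_points[OF d, of "\<lambda>_. True"] by simp
  also have "\<dots> = nsum G its (of_bool y)"
    unfolding nsum_def map_map comp_def using assms(1,3)
    by (intro arg_cong[of _ _ sum_list] map_cong refl) (auto simp: itemsI_def subset_iff)
  finally show ?thesis by simp
qed

lemma ms_filter:
  assumes "itemsI G ps S" "set its \<subseteq> {..<length ps}" "j < d"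
  shows "ms ps S (rev (filter (\<lambda>i. G aKEY i j \<le> a) its)) = sle j a (ms ps S its)"
    "ms ps S (rev (filter (\<lambda>i. \<not> G aKEY i j \<le> a) its)) = sgt j a (ms ps S its)"
    "(!) ps ` set (rev (filter (\<lambda>i. G aKEY i j \<le> a) its)) = {x \<in> (!) ps ` set its. K x j \<le> a}"
    "(!) ps ` set (rev (filter (\<lambda>i. \<not> G aKEY i j \<le> a) its)) = {x \<in> (!) ps ` set its. \<not> K x j \<le> a}"
proof -
  have k: "G aKEY i j = K (ps ! i) j" if "i \<in> set its" for i using assms that by (auto simp: itemsI_def subset_iff)
  show 3: "(!) ps ` set (rev (filter (\<lambda>i. G aKEY i j \<le> a) its)) = {x \<in> (!) ps ` set its. K x j \<le> a}"
    "(!) ps ` set (rev (filter (\<lambda>i. \<not> G aKEY i j \<le> a) its)) = {x \<in> (!) ps ` set its. \<not> K x j \<le> a}"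
    using k by auto
  show "ms ps S (rev (filter (\<lambda>i. G aKEY i j \<le> a) its)) = sle j a (ms ps S its)"
    "ms ps S (rev (filter (\<lambda>i. \<not> G aKEY i j \<le> a) its)) = sgt j a (ms ps S its)"
    unfolding ms_def 3 filter_filter_mset by (auto intro!: filter_mset_cong)
qed

lemma okS_items:
  assumes "itemsI G ps S" "set its \<subseteq> {..<length ps}"
  shows "okS (ms ps S its)"
  using assms by (auto simp: itemsI_def okS_def ms_def subset_iff)

text \<open>The program minimizes \<open>vf\<close>; as the scaled gain is twice the decrease from
  \<open>fv\<close>, this maximizes the gain.\<close>

lemma GG_vf:
  assumes "itemsI G ps S" "distinct its" "set its \<subseteq> {..<length ps}" "j < d"
  shows "GG (ms ps S its) (\<lambda>x. K x j \<le> a) = 2 * (fv (nsum G its 1) (nsum G its 0) - vf G its j a)"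
proof -
  let ?il = "rev (filter (\<lambda>i. G aKEY i j \<le> a) its)" and ?ir = "rev (filter (\<lambda>i. \<not> G aKEY i j \<le> a) its)"
  have sub: "set ?il \<subseteq> {..<length ps}" "set ?ir \<subseteq> {..<length ps}" "distinct ?il" "distinct ?ir" using assms by auto
  have n: "nsum G xs 1 = cls (ms ps S xs) True" "nsum G xs 0 = cls (ms ps S xs) False"
    if "distinct xs" "set xs \<subseteq> {..<length ps}" for xs
    using nsum_cls[OF assms(1) that, of True] nsum_cls[OF assms(1) that, of False] by auto
  have "GG (ms ps S its) (\<lambda>x. K x j \<le> a) = gF (ms ps S its) - gF (ms ps S ?il) - gF (ms ps S ?ir)"
    unfolding GG_def ms_filter[OF assms(1,3,4)] ..
  also have "\<dots> = 2 * (fv (nsum G its 1) (nsum G its 0) - vf G its j a)"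
  proof -
    have e: "nsum G its y - nsum G ?il y = nsum G ?ir y" for y
      using nsum_part[of G its y "\<lambda>i. G aKEY i j \<le> a"] by simp
    show ?thesis unfolding gF_fv vf_def vv_def e n[OF assms(2,3), symmetric] n[OF sub(3,1), symmetric] n[OF sub(4,2), symmetric]
      by simp
  qed
  finally show ?thesis .
qed

lemma size_ms:
  assumes "itemsI G ps S" "distinct its" "set its \<subseteq> {..<length ps}"
  shows "nsum G its 1 + nsum G its 0 = size (ms ps S its)" "size (ms ps S its) \<le> N"
  using nsum_cls[OF assms, of True] nsum_cls[OF assms, of False] size_cls[of "ms ps S its"]
    assms(1) size_filter_mset_lesseq[of "\<lambda>e. fst e \<in> (!) ps ` set its" S]
  by (auto simp: itemsI_def ms_def)

lemma itok_items:
  assumes "itemsI G ps S" "distinct its" "set its \<subseteq> {..<length ps}"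
  shows "itok G its"
  using assms size_ms[OF assms] N_Z K_less unfolding itok_def itemsI_def by (fastforce simp: subset_iff)

lemma live_length:
  assumes "\<And>i. i \<in> set its \<Longrightarrow> 0 < G aIC i 0 + G aIC i 1"
  shows "length its \<le> nsum G its 1 + nsum G its 0"
  using assms by (induction its) (fastforce simp: nsum_def)+

text \<open>The last argument is the pointer to the successor of the subtree in preorder.\<close>

primrec rep :: "mem \<Rightarrow> nat \<Rightarrow> example multiset \<Rightarrow> atr \<Rightarrow> nat \<Rightarrow> bool" where
  "rep G dep S (AL v xs S0 c) e \<longleftrightarrow> G aNXT v 0 = e \<and> G aRGT v 0 = 0 \<and> lst (\<lambda>i. G aINX i 0) (G aHEAD v 0) xs \<and>
     (\<forall>y. G aNN v (of_bool y) = cls S y) \<and> G aBUD v 0 + c = budget q S0 \<and> G aDEP v 0 = dep"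
| "rep G dep S (AN v j a S0 c l r) e \<longleftrightarrow> G aNXT v 0 = Suc (root l) \<and> G aRGT v 0 = Suc (root r) \<and>
     G aNJ v 0 = j \<and> G aNA v 0 = a \<and> G aBUD v 0 + c = budget q S0 \<and> G aDEP v 0 = dep \<and>
     rep G (Suc dep) (sle j a S) l (Suc (root r)) \<and> rep G (Suc dep) (sgt j a S) r e"

text \<open>Listed records, dead ones included, lie in the region of their leaf. Hence the points of
  a subtree can be gathered from its own lists.\<close>

primrec plc :: "point list \<Rightarrow> point set \<Rightarrow> atr \<Rightarrow> bool" where
  "plc ps X (AL v xs S0 c) \<longleftrightarrow> (\<forall>i\<in>set xs. ps ! i \<in> X)"
| "plc ps X (AN v j a S0 c l r) \<longleftrightarrow> plc ps {x \<in> X. K x j \<le> a} l \<and> plc ps {x \<in> X. \<not> K x j \<le> a} r"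

definition ndarr :: "nat set" where
  "ndarr = {aNXT, aRGT, aNJ, aNA, aBUD, aDEP, aHEAD, aNN}"

lemma rep_cong:
  assumes "\<And>a i s. a \<in> ndarr \<Longrightarrow> i \<in> set (ndl T) \<Longrightarrow> s = 0 \<or> a = aNN \<Longrightarrow> G' a i s = G a i s"
    "\<And>i s. i \<in> set (itl T) \<Longrightarrow> G' aINX i s = G aINX i s"
  shows "rep G dep S T e \<Longrightarrow> rep G' dep S T e"
  using assms
proof (induction T arbitrary: dep S e)
  case (AL v xs S0 c)
  then show ?case using lst_cong[of "\<lambda>i. G aINX i 0" _ xs "\<lambda>i. G' aINX i 0"] by (simp add: ndarr_def)
next
  case (AN v j a S0 c l r)
  have "rep G' (Suc dep) (sle j a S) l (Suc (root r))" using AN.prems by (intro AN.IH(1)) auto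
  moreover have "rep G' (Suc dep) (sgt j a S) r e" using AN.prems by (intro AN.IH(2)) auto
  ultimately show ?case using AN.prems by (simp add: ndarr_def)
qed

lemma plc_mono: "plc ps X T \<Longrightarrow> X \<subseteq> Y \<Longrightarrow> plc ps Y T"
proof (induction T arbitrary: X Y)
  case (AN v j a S0 c l r)
  show ?case using AN.prems AN.IH(1)[of "{x \<in> X. K x j \<le> a}" "{x \<in> Y. K x j \<le> a}"]
      AN.IH(2)[of "{x \<in> X. \<not> K x j \<le> a}" "{x \<in> Y. \<not> K x j \<le> a}"] by auto
qed auto

definition bc :: nat where
  "bc = base N + 100"

text \<open>Time to build over \<open>L\<close> records whose region admits \<open>D\<close>
  separating splits: at most \<open>2 * L - 1\<close> vertices at cost \<open>bc\<close> (one if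
  \<open>L = 0\<close>), each record moved at most \<open>D\<close> times, and the recounting of
  smaller children.\<close>

definition bt :: "nat \<Rightarrow> nat \<Rightarrow> nat" where
  "bt L D = (2 * max 1 L - 1) * bc + 200 * (L * D) + 250 * (d * (L * floor_log L))"

text \<open>Both children have fewer separating splits than the parent, so one unit of
  \<open>D\<close> pays for the partition; \<open>floor_log_split\<close> pays for recounting the
  smaller child.\<close>

lemma bt_split:
  assumes "1 \<le> L1" "1 \<le> L2" "D1 < D" "D2 < D"
  shows "bc + 200 * (L1 + L2) + 250 * (d * min L1 L2) + bt L1 D1 + bt L2 D2 \<le> bt (L1 + L2) D"
proof -
  have "L1 * Suc D1 \<le> L1 * D" "L2 * Suc D2 \<le> L2 * D" using assms by (intro mult_le_mono2; simp)+
  then have 1: "200 * (L1 + L2) + 200 * (L1 * D1) + 200 * (L2 * D2) \<le> 200 * ((L1 + L2) * D)"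
    by (simp add: algebra_simps)
  have "d * (min L1 L2 + L1 * floor_log L1 + L2 * floor_log L2) \<le> d * ((L1 + L2) * floor_log (L1 + L2))"
    using floor_log_split[OF assms(1,2)] by (rule mult_le_mono2)
  then have 2: "250 * (d * min L1 L2) + 250 * (d * (L1 * floor_log L1)) + 250 * (d * (L2 * floor_log L2)) \<le>
     250 * (d * ((L1 + L2) * floor_log (L1 + L2)))" by (simp add: distrib_left)
  have 3: "bc + (2 * max 1 L1 - 1) * bc + (2 * max 1 L2 - 1) * bc = (2 * max 1 (L1 + L2) - 1) * bc"
  proof -
    obtain x y where "L1 = Suc x" "L2 = Suc y" using assms by (metis Suc_le_D One_nat_def)
    then show ?thesis by (simp add: algebra_simps)
  qed
  show ?thesis unfolding bt_def using 1 2 3 by linarith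
qed

lemma base_le: "s \<le> N \<Longrightarrow> base s \<le> base N"
  unfolding base_def using monoD[OF floor_log_mono, of s N] by simp

lemma split_cond_splittable:
  assumes "itemsI G ps S" "distinct its" "set its \<subseteq> {..<length ps}"
  shows "split_cond (nsum G its 1) (nsum G its 0) dep \<longleftrightarrow> splittable dep (ms ps S its)"
  using nsum_cls[OF assms, of True] nsum_cls[OF assms, of False] size_ms[OF assms]
  unfolding split_cond_def splittable_def by simp

lemma build_unfold: "wp (p_build d m k h q) Q (t, R, G) \<longleftrightarrow>
    (if R rV1 \<noteq> R rTEND then wp (Asg rV (V rV1 \<ominus> ex.N 1) ;; p_proc d m k h q ;; Asg rV1 (Get1 aNXT (V rV)))
       (wp (p_build d m k h q) Q) (t + 8, R, G) else Q (t + 8, R, G))"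
proof -
  have "ctb (Ne (V rV1) (V rTEND)) + 1 = 8" by simp
  then show ?thesis unfolding p_build_def by (subst wp_unfold) (simp add: add.commute)
qed

text \<open>The program iterates, so the rule treats the stretch of the thread that belongs to one
  subtree and hands over to the same loop standing at \<open>e\<close>. In the induction the
  continuation for the left child is the instance for the right child. The condition on
  \<open>te\<close> keeps the loop from stopping within the stretch.\<close>

lemma build_seg:
  assumes "pend G v its dep e" "itemsI G ps S" "distinct its" "set its \<subseteq> {..<length ps}"
    and "\<And>i. i \<in> set its \<Longrightarrow> 0 < G aIC i 0 + G aIC i 1"
    and "v < NR" "v \<notin> AV" "avail R G AV" "2 * max 1 (length its) \<le> card AV + 2" "dep \<le> h"
    and "R rV1 = Suc v" "R rTEND = te" "te = 0 \<or> te - 1 \<notin> insert v AV"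
    and Q: "\<And>t' R' G' T AV'. t' \<le> t + bt (length its) (card (nontriv ((!) ps ` set its))) \<Longrightarrow>
      R' rNI = R rNI \<Longrightarrow> R' rTEND = te \<Longrightarrow> R' rV1 = e \<Longrightarrow> avail R' G' AV' \<Longrightarrow> AV' \<subseteq> AV \<Longrightarrow> root T = v \<Longrightarrow>
      snap T = ms ps S its \<Longrightarrow> set (ndl T) = insert v (AV - AV') \<Longrightarrow> distinct (ndl T) \<Longrightarrow>
      card AV + 2 \<le> card AV' + 2 * max 1 (length its) \<Longrightarrow>
      rep G' dep (ms ps S its) T e \<Longrightarrow> wf dep ((!) ps ` set its) (ms ps S its) T \<Longrightarrow> czero T \<Longrightarrow>
      plc ps ((!) ps ` set its) T \<Longrightarrow> set (itl T) = set its \<Longrightarrow> distinct (itl T) \<Longrightarrow>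
      wt T \<le> max 1 (length its) \<Longrightarrow>
      (\<And>a i s. a \<in> {aIC, aKEY, aTRI, aLST} \<Longrightarrow> G' a i s = G a i s) \<Longrightarrow>
      (\<And>i s. i \<notin> set its \<Longrightarrow> G' aINX i s = G aINX i s) \<Longrightarrow>
      (\<And>a i s. a \<noteq> aINX \<Longrightarrow> i \<noteq> v \<Longrightarrow> i \<notin> AV \<Longrightarrow> G' a i s = G a i s) \<Longrightarrow>
      wp (p_build d m k h q) Q (t', R', G')"
  shows "wp (p_build d m k h q) Q (t, R, G)"
  using assms
proof (induction "length its" arbitrary: its G R t v dep e AV rule: less_induct)
  case (less its G R t v dep e AV)
  note pend = less.prems(1) and it = less.prems(2-4) and live = less.prems(5) and v = less.prems(6,7)
    and av = less.prems(8,9) and dep = less.prems(10) and reg = less.prems(11,12,13) and Q = less.prems(14)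
  let ?S0 = "ms ps S its" and ?X = "(!) ps ` set its"
  have ne: "Suc v \<noteq> te" using reg(3) by auto
  have sz: "nsum G its 1 + nsum G its 0 = size ?S0" "size ?S0 \<le> N" using size_ms[OF it] by auto
  have "length its \<le> nsum G its 1 + nsum G its 0" by (rule live_length) (rule live)
  then have len: "length its \<le> size ?S0" using sz by simp
  have bs: "base (nsum G its 1 + nsum G its 0) \<le> base N" using sz base_le by simp
  have okS0: "okS ?S0" by (rule okS_items[OF it(1,3)])
  have itk: "itok G its" by (rule itok_items[OF it])
  show ?case
    apply (subst build_unfold)
    apply (simp add: reg ne wbd)
    apply (rule proc[where v = v and AV = AV and its = its and dep = dep and e = e])
    subgoal by simp
    subgoal by (rule v)
    subgoal by (rule v)
    subgoal by (rule avail_cong[OF av(1)]) simp_all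
    subgoal by (rule av)
    subgoal by (rule pend)
    subgoal by (rule itk)
    subgoal by (rule dep)
    subgoal premises p for t' R' G'
    proof -
      let ?T = "AL v its ?S0 0"
      have R': "R' rV = v" "R' rNI = R rNI" "R' rTEND = te" "R' rFR = R rFR" "R' rNB = R rNB" using p(2) reg by auto
      have nx: "G' aNXT v 0 = e" using p(3) pend by (simp add: pend_def)
      have btb: "bc \<le> bt (length its) D" for D
      proof -
        have "1 * bc \<le> (2 * max 1 (length its) - 1) * bc" by (intro mult_le_mono1) simp
        then show ?thesis unfolding bt_def by linarith
      qed
      have t: "t' + 50 \<le> t + bt (length its) (card (nontriv ?X))"
        using p(1) bs btb[of "card (nontriv ?X)"] unfolding bc_def by simp
      show ?thesis
        apply (simp add: R' v wids nx wbd)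
        apply (rule Q[where T = ?T and AV' = AV])
        subgoal using t by simp
        subgoal using R' by simp
        subgoal using R' by simp
        subgoal by simp
        subgoal by (rule avail_cong[OF av(1)]) (use R' p(3) in auto)
        subgoal by simp
        subgoal by simp
        subgoal by simp
        subgoal by simp
        subgoal by simp
        subgoal by simp
        subgoal
        proof -
          have "lst (\<lambda>i. G' aINX i 0) (G' aHEAD v 0) its" using pend p(3) by (simp add: pend_def)
          moreover have "G' aNN v (of_bool y) = cls ?S0 y" for y
            using pend p(3) nsum_cls[OF it, of y] by (simp add: pend_def)
          moreover have "G' aBUD v 0 = budget q ?S0" using p(4) sz by (simp add: budget_def lev_def)
          moreover have "G' aDEP v 0 = dep" using pend p(3) by (simp add: pend_def)
          ultimately show ?thesis using nx p(5) by simp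
        qed
        subgoal
          using p(6) okS0 dep len split_cond_splittable[OF it, of dep] GG_vf[OF it] by (auto intro: close.none)
        subgoal by simp
        subgoal by auto
        subgoal by simp
        subgoal using it by simp
        subgoal by simp
        subgoal using p(3) by auto
        subgoal using p(3) by auto
        subgoal using p(3) by auto
        done
    qed
    subgoal premises p for t' R' G' l r j a il ir
    proof -
      note il = p(1) and ir = p(2)
      have ja: "j < d" "a < m" by fact+
      have R': "R' rV = v" "R' rNI = R rNI" "R' rTEND = te" using p(11) reg by auto
      have lr: "l \<in> AV" "r \<in> AV" "l \<noteq> r" "l < NR" "r < NR" "v \<noteq> l" "v \<noteq> r"
        using p(12,13,14) v avail_less[OF av(1)] by auto
      have fin: "finite AV" using av(1) by (auto simp: avail_def)
      note fi = p(24) and finx = p(25) and fo = p(26)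
      have len2: "length its = length il + length ir"
        unfolding il ir using sum_length_filter_compl[of "\<lambda>i. G aKEY i j \<le> a" its] by simp
      have l1: "1 \<le> length il" "1 \<le> length ir" using p(3,4) by (auto simp: Suc_le_eq)
      note msf = ms_filter[OF it(1,3) ja(1), of a, folded il ir]
      have sub: "set il \<subseteq> {..<length ps}" "set ir \<subseteq> {..<length ps}" "distinct il" "distinct ir"
        "set il \<subseteq> set its" "set ir \<subseteq> set its" "set il \<inter> set ir = {}" "set il \<union> set ir = set its"
        using it unfolding il ir by auto
      \<comment> \<open>Both sides contain points of the region; this strict decrease of
        \<open>nontriv\<close> is what \<open>bt_split\<close> consumes.\<close>
      have ntX: "(j, a) \<in> nontriv ?X"
      proof -
        have "(!) ps ` set il \<noteq> {}" "(!) ps ` set ir \<noteq> {}" using l1 by auto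
        then show ?thesis using ja unfolding msf nontriv_def by auto
      qed
      have D: "card (nontriv ((!) ps ` set il)) < card (nontriv ?X)" "card (nontriv ((!) ps ` set ir)) < card (nontriv ?X)"
        using card_nontriv_child[OF ntX] unfolding msf by blast+
      have itI: "itemsI G' ps S" using it(1) fi unfolding itemsI_def by simp
      have cAV: "card (AV - {l, r}) + 2 = card AV"
        using lr fin card_Diff_subset[of "{l, r}" AV] card_mono[OF fin, of "{l, r}"] by simp
      have tt: "t' \<le> t + 50 + base N + 200 * length its + 250 * (d * min (length il) (length ir))"
        using p(5) bs by simp
      show ?thesis
        apply (simp add: R' v wids p(18) wbd)
        apply (rule less.hyps[where its = il and v = l and dep = "Suc dep" and e = "Suc r" and AV = "AV - {l, r}"])
        subgoal using len2 l1 by linarith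
        subgoal by (rule p(16))
        subgoal by (rule itI)
        subgoal by (rule sub)
        subgoal by (rule sub)
        subgoal for i using live[of i] sub fi by auto
        subgoal by (rule lr)
        subgoal by simp
        subgoal by (rule avail_cong[OF p(15)]) simp_all
        subgoal using av(2) cAV len2 l1 by linarith
        subgoal using p(6) by (simp add: split_cond_def)
        subgoal by simp
        subgoal using R' by simp
        subgoal using reg(3) lr by auto
        subgoal premises p1 for t1 R1 G1 AV1 T1
        proof -
          have AV1: "l \<notin> AV1" "r \<notin> AV1" "AV1 \<subseteq> AV" "v \<notin> AV1" using p1(6) v(2) by auto
          \<comment> \<open>Building the left subtree relinks only its own records, so the list and
            tables of the waiting right sibling are intact.\<close>
          have pr: "pend G1 r ir (Suc dep) e"
          proof -
            have s: "nsum G1 xs y = nsum G' xs y" "csum G1 xs l' a' y = csum G' xs l' a' y" for xs y l' a'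
              using sums_cong[of G1 G'] p1(19) by auto
            have x: "G1 x r z = G' x r z" if "x \<noteq> aINX" for x z using p1(21)[OF that] lr by auto
            have "lst (\<lambda>i. G1 aINX i 0) (G' aHEAD r 0) ir"
              by (rule lst_cong[of "\<lambda>i. G' aINX i 0"]) (use p(17) p1(20) sub(7) in \<open>auto simp: pend_def\<close>)
            then show ?thesis using p(17) unfolding pend_def s by (simp add: x)
          qed
          show ?thesis
            apply (rule less.hyps[where its = ir and v = r and dep = "Suc dep" and e = e and AV = AV1])
            subgoal using len2 l1 by linarith
            subgoal by (rule pr)
            subgoal using itI p1(19) unfolding itemsI_def by simp
            subgoal by (rule sub)
            subgoal by (rule sub)
            subgoal for i using live[of i] sub fi p1(19) by auto
            subgoal by (rule lr)
            subgoal by (rule AV1)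
            subgoal by (rule p1(5))
            subgoal using p1(11) av(2) cAV len2 l1 by linarith
            subgoal using p(6) by (simp add: split_cond_def)
            subgoal by (rule p1(4))
            subgoal by (rule p1(3))
            subgoal using reg(3) lr AV1 by auto
            subgoal premises p2 for t2 R2 G2 AV2 T2
            proof -
              let ?T = "AN v j a ?S0 0 T1 T2"
              have nd1: "set (ndl T1) = insert l (AV - {l, r} - AV1)" by (rule p1(9))
              have nd2: "set (ndl T2) = insert r (AV1 - AV2)" by (rule p2(9))
              have fo2: "G2 x i s = G1 x i s" if "x \<noteq> aINX" "i \<noteq> r" "i \<notin> AV1" for x i s using p2(21) that by simp
              have fo1: "G1 x i s = G' x i s" if "x \<noteq> aINX" "i \<noteq> l" "i \<notin> AV - {l, r}" for x i s using p1(21) that by simp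
              have vv: "G2 x v s = G' x v s" if "x \<noteq> aINX" for x s
                using fo2[OF that, of v s] fo1[OF that, of v s] v(2) lr AV1 by simp
              have rep1: "rep G2 (Suc dep) (ms ps S il) T1 (Suc r)"
              proof (rule rep_cong[OF _ _ p1(12)])
                fix x i s assume x: "x \<in> ndarr" "i \<in> set (ndl T1)"
                then have "x \<noteq> aINX" "i \<noteq> r" "i \<notin> AV1" using nd1 AV1 lr by (auto simp: ndarr_def)
                then show "G2 x i s = G1 x i s" by (rule fo2)
              next
                fix i s assume "i \<in> set (itl T1)"
                then show "G2 aINX i s = G1 aINX i s" using p1(16) sub(7) by (intro p2(20)) auto
              qed
              have rep: "rep G2 dep ?S0 ?T e"
                using rep1 p2(12) p1(7) p2(7) p(18,19,20,21) vv fo sz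
                unfolding rep.simps msf[symmetric] by (simp add: budget_def lev_def p(22,23))
              show ?thesis
                apply (rule Q[where T = ?T and AV' = AV2])
                subgoal
                proof -
                  have "t2 \<le> t + bc + 200 * length its + 250 * (d * min (length il) (length ir)) +
                      bt (length il) (card (nontriv ((!) ps ` set il))) + bt (length ir) (card (nontriv ((!) ps ` set ir)))"
                    using p2(1) p1(1) tt unfolding bc_def by simp
                  also have "\<dots> \<le> t + bt (length its) (card (nontriv ?X))"
                    using bt_split[OF l1 D] unfolding len2 by simp
                  finally show ?thesis .
                qed
                subgoal using p2(2) p1(2) R' by simp
                subgoal by (rule p2(3))
                subgoal by (rule p2(4))
                subgoal by (rule p2(5))
                subgoal using p2(6) AV1 by auto
                subgoal by simp
                subgoal by simp
                subgoal using nd1 nd2 p2(6) AV1 lr by auto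
                subgoal using p1(10) p2(10) nd1 nd2 p2(6) AV1 lr v(2) by auto
                subgoal using p1(11) p2(11) cAV len2 l1 by linarith
                subgoal by (rule rep)
                subgoal
                  using okS0 p(6) split_cond_splittable[OF it, of dep] ja GG_vf[OF it] p(9,10) ntX
                    p1(18) p2(18) len len2 l1 p1(13,14) p2(13,14) czero_cof
                  unfolding wf.simps msf by (auto intro: close.none simp: nontriv_def)
                subgoal using p1(14) p2(14) by simp
                subgoal using p1(15) p2(15) msf by simp
                subgoal using p1(16) p2(16) sub by auto
                subgoal using p1(16,17) p2(16,17) sub by auto
                subgoal using p1(18) p2(18) len2 l1 unfolding wt.simps by linarith
                subgoal using p2(19) p1(19) fi by simp
                subgoal premises pp for i s
                proof -
                  have "i \<notin> set il" "i \<notin> set ir" using pp sub(5,6) by blast+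
                  then show ?thesis using p2(20) p1(20) finx[OF pp] by simp
                qed
                subgoal premises pp for x i s
                proof -
                  have "i \<noteq> l" "i \<noteq> r" "i \<notin> AV1" using pp lr AV1 by blast+
                  then show ?thesis using fo2[of x i s] fo1[of x i s] fo[of x i s] pp by simp
                qed
                done
            qed
            done
        qed
        done
    qed
    done
qed

end

section \<open>Collecting the points of a subtree\<close>

context algo
begin

text \<open>The part of \<open>rep\<close> that traversals rely on. Counts and budgets are left out,
  because a collection runs after the update has changed them.\<close>

primrec shp :: "mem \<Rightarrow> atr \<Rightarrow> nat \<Rightarrow> bool" where
  "shp G (AL v xs S0 c) e \<longleftrightarrow> G aNXT v 0 = e \<and> G aRGT v 0 = 0 \<and> lst (\<lambda>i. G aINX i 0) (G aHEAD v 0) xs"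
| "shp G (AN v j a S0 c l r) e \<longleftrightarrow> G aNXT v 0 = Suc (root l) \<and> G aRGT v 0 = Suc (root r) \<and>
     G aNJ v 0 = j \<and> G aNA v 0 = a \<and> shp G l (Suc (root r)) \<and> shp G r e"

lemma rep_shp: "rep G dep S T e \<Longrightarrow> shp G T e"
  by (induction T arbitrary: dep S e) auto

lemma shp_cong:
  assumes "\<And>a i s. a \<in> {aNXT, aRGT, aNJ, aNA, aHEAD} \<Longrightarrow> i \<in> set (ndl T) \<Longrightarrow> G' a i s = G a i s"
    "\<And>i s. i \<in> set (itl T) \<Longrightarrow> G' aINX i s = G aINX i s"
  shows "shp G T e \<Longrightarrow> shp G' T e"
  using assms
proof (induction T arbitrary: e)
  case (AL v xs S0 c)
  then show ?case using lst_cong[of "\<lambda>i. G aINX i 0" _ xs "\<lambda>i. G' aINX i 0"] by simp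
next
  case (AN v j a S0 c l r)
  have "shp G' l (Suc (root r))" using AN.prems by (intro AN.IH(1)) auto
  moreover have "shp G' r e" using AN.prems by (intro AN.IH(2)) auto
  ultimately show ?case using AN.prems by simp
qed

definition live :: "mem \<Rightarrow> nat \<Rightarrow> bool" where
  "live G i \<longleftrightarrow> 0 < G aIC i 0 + G aIC i 1"

lemma collect_list:
  assumes "R rV = v" "v < NR" "lst (\<lambda>i. G aINX i 0) (G aHEAD v 0) xs" "distinct xs"
    and i: "\<And>i. i \<in> set xs \<Longrightarrow> i < NR \<and> G aIC i 0 + G aIC i 1 \<le> Z"
    and acc: "lst (\<lambda>i. G aINX i 0) (R rLIST) acc" "set acc \<inter> set xs = {}"
    and Q: "\<And>t' R' G'. t' \<le> t + 50 + 200 * length xs \<Longrightarrow> (\<And>r. r \<notin> {rX, rI, rLIST} \<Longrightarrow> R' r = R r) \<Longrightarrow>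
      lst (\<lambda>i. G' aINX i 0) (R' rLIST) (rev (filter (live G) xs) @ acc) \<Longrightarrow>
      (\<And>a i s. a \<noteq> aINX \<Longrightarrow> a \<noteq> aLST \<Longrightarrow> G' a i s = G a i s) \<Longrightarrow>
      (\<And>i s. i \<notin> set xs \<Longrightarrow> G' aINX i s = G aINX i s) \<Longrightarrow>
      (\<And>i. G' aLST i 0 = (if i \<in> set xs \<and> \<not> live G i then 0 else G aLST i 0)) \<Longrightarrow> Q (t', R', G')"
  shows "wp p_collect_list Q (t, R, G)"
proof -
  let ?n = "length xs"
  define J where "J = (\<lambda>n (t', R', G'). t' \<le> t + 30 + 200 * n \<and> (\<forall>r. r \<notin> {rX, rI, rLIST} \<longrightarrow> R' r = R r) \<and>
      lst (\<lambda>i. G' aINX i 0) (R' rX) (drop n xs) \<and>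
      lst (\<lambda>i. G' aINX i 0) (R' rLIST) (rev (filter (live G) (take n xs)) @ acc) \<and>
      (\<forall>a i s. a \<noteq> aINX \<longrightarrow> a \<noteq> aLST \<longrightarrow> G' a i s = G a i s) \<and>
      (\<forall>i s. i \<notin> set (take n xs) \<longrightarrow> G' aINX i s = G aINX i s) \<and>
      (\<forall>i. G' aLST i 0 = (if i \<in> set (take n xs) \<and> \<not> live G i then 0 else G aLST i 0)))"
  show ?thesis unfolding p_collect_list_def
    apply (simp add: wbd wids assms(1,2))
    apply (rule wp_for[where J = J and i = 0 and n = ?n])
    subgoal unfolding J_def prod.case using assms(3) acc by simp
    subgoal by simp
    subgoal premises pp for n t' R' G'
    proof -
      let ?i = "xs ! n"
      have J: "t' \<le> t + 30 + 200 * n" "\<And>r. r \<notin> {rX, rI, rLIST} \<Longrightarrow> R' r = R r"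
        "lst (\<lambda>i. G' aINX i 0) (R' rX) (drop n xs)"
        "lst (\<lambda>i. G' aINX i 0) (R' rLIST) (rev (filter (live G) (take n xs)) @ acc)"
        "\<And>a i s. a \<noteq> aINX \<Longrightarrow> a \<noteq> aLST \<Longrightarrow> G' a i s = G a i s"
        "\<And>i s. i \<notin> set (take n xs) \<Longrightarrow> G' aINX i s = G aINX i s"
        "\<And>i. G' aLST i 0 = (if i \<in> set (take n xs) \<and> \<not> live G i then 0 else G aLST i 0)"
        using pp(1) unfolding J_def prod.case by blast+
      have ii: "?i \<in> set xs" "?i < NR" "G aIC ?i 0 + G aIC ?i 1 \<le> Z" using pp(2) i by auto
      have dr: "drop n xs = ?i # drop (Suc n) xs" using pp(2) by (simp add: Cons_nth_drop_Suc)
      have x: "R' rX = Suc ?i" "lst (\<lambda>i. G' aINX i 0) (G' aINX ?i 0) (drop (Suc n) xs)"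
        using J(3) unfolding dr by auto
      have ts: "take (Suc n) xs = take n xs @ [?i]" using pp(2) by (simp add: take_Suc_conv_app_nth)
      have "distinct (take n xs @ ?i # drop (Suc n) xs)" using assms(4) pp(2) by (simp add: id_take_nth_drop[symmetric])
      then have nin: "?i \<notin> set (take n xs)" "?i \<notin> set (drop (Suc n) xs)" "?i \<notin> set acc" using acc(2) ii by auto
      have w: "G aIC ?i 0 + G aIC ?i (Suc 0) < W" "Suc ?i < W"
      proof -
        show "G aIC ?i 0 + G aIC ?i (Suc 0) < W" using ii by (intro wlt) simp
        show "Suc ?i < W" using ii wbd by linarith
      qed
      have ic: "G' aIC ?i s = G aIC ?i s" for s using J(5) by simp
      show ?thesis
      proof (cases "live G ?i")
        case True
        then have l: "0 < G aIC ?i 0 \<or> 0 < G aIC ?i (Suc 0)" by (auto simp: live_def)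
        show ?thesis
          apply (simp add: x(1) ii wbd wids w ic l)
          unfolding J_def prod.case
          apply (intro conjI allI impI)
          subgoal using J(1) by simp
          subgoal using J(2) by simp
          subgoal using nin(2) by (auto intro: lst_cong[OF x(2)] simp: upd_apply)
          subgoal
          proof -
            have "lst (\<lambda>i. upd G' aINX ?i 0 (R' rLIST) aINX i 0) (R' rLIST) (rev (filter (live G) (take n xs)) @ acc)"
              by (rule lst_cong[OF J(4)]) (use nin in \<open>auto simp: upd_apply\<close>)
            then show ?thesis using True by (simp add: ts upd_apply)
          qed
          subgoal using J(5) by (simp add: upd_apply)
          subgoal using J(6) by (simp add: upd_apply ts)
          subgoal using J(7) True by (auto simp: upd_apply ts)
          done
      next
        case False
        then have l: "G aIC ?i 0 = 0" "G aIC ?i (Suc 0) = 0" by (auto simp: live_def)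
        show ?thesis
          apply (simp add: x(1) ii wbd wids w ic l)
          unfolding J_def prod.case
          apply (intro conjI allI impI)
          subgoal using J(1) by simp
          subgoal using J(2) by simp
          subgoal using nin(2) by (auto intro: lst_cong[OF x(2)] simp: upd_apply)
          subgoal using lst_cong[OF J(4)] False by (simp add: ts upd_apply)
          subgoal using J(5) by (simp add: upd_apply)
          subgoal using J(6) by (simp add: upd_apply ts)
          subgoal using J(7) False by (auto simp: upd_apply ts)
          done
      qed
    qed
    subgoal premises pp for t' R' G'
    proof -
      note J = pp[unfolded J_def prod.case]
      have "R' rX = 0" using J by (simp add: lst_0[symmetric])
      then show ?thesis apply (simp add: wbd)
        apply (rule Q)
        using J by simp_all
    qed
    done
qed

definition p_free :: hcom where
  "p_free = If (Ne (V rV) (V rU0)) (Put1 aNXT (V rV) (V rFR) ;; Asg rFR (V rV \<oplus> ex.N 1)) HSkip"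

lemma collect_unfold: "wp p_collect Q (t, R, G) \<longleftrightarrow>
    (if R rV1 \<noteq> R rTEND then wp (Asg rV (V rV1 \<ominus> ex.N 1) ;; Asg rV1 (Get1 aNXT (V rV)) ;;
       If (Lt (ex.N 0) (Get1 aRGT (V rV))) HSkip p_collect_list ;;
       p_free)
       (wp p_collect Q) (t + 8, R, G) else Q (t + 8, R, G))"
proof -
  have "ctb (Ne (V rV1) (V rTEND)) + 1 = 8" by simp
  then show ?thesis unfolding p_collect_def p_free_def by (subst wp_unfold) (simp add: add.commute)
qed

lemma collect_free:
  assumes av: "avail R G AV" "v < NR" "v \<notin> AV" "R rV = v" "R rU0 = u"
    and Q: "\<And>t' R' G'. t' \<le> t + 50 \<Longrightarrow> (\<And>r. r \<notin> {rFR} \<Longrightarrow> R' r = R r) \<Longrightarrow>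
      avail R' G' (AV \<union> ({v} - {u})) \<Longrightarrow>
      (\<And>a i s. \<not> (a = aNXT \<and> i = v \<and> i \<noteq> u) \<Longrightarrow> G' a i s = G a i s) \<Longrightarrow> Q (t', R', G')"
  shows "wp p_free Q (t, R, G)"
proof -
  have w: "Suc v < W" using av(2) wbd by linarith
  show ?thesis
  proof (cases "v = u")
    case True
    then show ?thesis using av unfolding p_free_def by simp (rule Q, auto)
  next
    case False
    have "avail (R(rFR := Suc v)) (upd G aNXT v 0 (R rFR)) (insert v AV)"
      by (rule avail_free[OF av(1-3)]) (use av(3) in \<open>auto simp: upd_apply\<close>)
    then show ?thesis using av w False unfolding p_free_def
      by (simp add: wbd wids) (rule Q, auto simp: upd_apply)
  qed
qed

definition cpost where
  "cpost T t R G e AV u acc t' R' G' acc' \<longleftrightarrow>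
    t' \<le> t + 300 * length (ndl T) + 200 * length (itl T) \<and>
    (\<forall>r. r \<in> {rNI, rTEND, rU0} \<longrightarrow> R' r = R r) \<and>
    R' rV1 = e \<and>
    avail R' G' (AV \<union> (set (ndl T) - {u})) \<and>
    lst (\<lambda>i. G' aINX i 0) (R' rLIST) acc' \<and>
    distinct acc' \<and>
    set acc' = set acc \<union> {i \<in> set (itl T). live G i} \<and>
    (\<forall>a i s. a \<notin> {aINX, aLST, aNXT} \<longrightarrow> G' a i s = G a i s) \<and>
    (\<forall>i s. i \<notin> set (itl T) \<longrightarrow> G' aINX i s = G aINX i s) \<and>
    (\<forall>i. G' aLST i 0 = (if i \<in> set (itl T) \<and> \<not> live G i then 0 else G aLST i 0)) \<and>
    (\<forall>i s. i \<notin> set (ndl T) - {u} \<longrightarrow> G' aNXT i s = G aNXT i s)"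

lemma cpostI:
  assumes "t' \<le> t + 300 * length (ndl T) + 200 * length (itl T)"
    "\<And>r. r \<in> {rNI, rTEND, rU0} \<Longrightarrow> R' r = R r"
    "R' rV1 = e"
    "avail R' G' (AV \<union> (set (ndl T) - {u}))"
    "lst (\<lambda>i. G' aINX i 0) (R' rLIST) acc'"
    "distinct acc'"
    "set acc' = set acc \<union> {i \<in> set (itl T). live G i}"
    "\<And>a i s. a \<notin> {aINX, aLST, aNXT} \<Longrightarrow> G' a i s = G a i s"
    "\<And>i s. i \<notin> set (itl T) \<Longrightarrow> G' aINX i s = G aINX i s"
    "\<And>i. G' aLST i 0 = (if i \<in> set (itl T) \<and> \<not> live G i then 0 else G aLST i 0)"
    "\<And>i s. i \<notin> set (ndl T) - {u} \<Longrightarrow> G' aNXT i s = G aNXT i s"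
  shows "cpost T t R G e AV u acc t' R' G' acc'"
  unfolding cpost_def by (intro conjI allI impI) (fact assms | rule assms, assumption)+

lemma cpostD:
  assumes "cpost T t R G e AV u acc t' R' G' acc'"
  shows "t' \<le> t + 300 * length (ndl T) + 200 * length (itl T)"
    "\<And>r. r \<in> {rNI, rTEND, rU0} \<Longrightarrow> R' r = R r"
    "R' rV1 = e"
    "avail R' G' (AV \<union> (set (ndl T) - {u}))"
    "lst (\<lambda>i. G' aINX i 0) (R' rLIST) acc'"
    "distinct acc'"
    "set acc' = set acc \<union> {i \<in> set (itl T). live G i}"
    "\<And>a i s. a \<notin> {aINX, aLST, aNXT} \<Longrightarrow> G' a i s = G a i s"
    "\<And>i s. i \<notin> set (itl T) \<Longrightarrow> G' aINX i s = G aINX i s"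
    "\<And>i. G' aLST i 0 = (if i \<in> set (itl T) \<and> \<not> live G i then 0 else G aLST i 0)"
    "\<And>i s. i \<notin> set (ndl T) - {u} \<Longrightarrow> G' aNXT i s = G aNXT i s"
  using assms unfolding cpost_def by (simp_all only: not_False_eq_True simp_thms)

text \<open>Again one stretch of the thread with a continuation. \<open>AV\<close> grows while the
  traversal frees vertices and overwrites their links, so the shape of the right subtree has to be
  transported past the collection of the left one.\<close>

lemma collect_seg:
  assumes "shp G T e" "distinct (ndl T)" "distinct (itl T)"
    and "\<And>i. i \<in> set (itl T) \<Longrightarrow> i < NR \<and> G aIC i 0 + G aIC i 1 \<le> Z"
    and "\<And>v. v \<in> set (ndl T) \<Longrightarrow> v < NR \<and> v \<notin> AV" "avail R G AV"
    and "R rV1 = Suc (root T)" "R rTEND = te" "te = 0 \<or> te - 1 \<notin> set (ndl T)" "R rU0 = u"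
    and "lst (\<lambda>i. G aINX i 0) (R rLIST) acc" "set acc \<inter> set (itl T) = {}" "distinct acc"
    and Q: "\<And>t' R' G' acc'. cpost T t R G e AV u acc t' R' G' acc' \<Longrightarrow> wp p_collect Q (t', R', G')"
  shows "wp p_collect Q (t, R, G)"
  using assms
proof (induction "size T" arbitrary: T t R G e AV acc rule: less_induct)
  case (less T t R G e AV acc)
  show ?case
proof (cases T)
  case (AL v xs S0 c)
  note ALp = less.prems[unfolded AL]
  note shp = ALp(1) and it = ALp(3,4) and nd = ALp(5) and av = ALp(6)
    and reg = ALp(7-10) and acc = ALp(11-13) and Q = ALp(14)
  have v: "v < NR" "v \<notin> AV" "te \<noteq> Suc v" using nd reg(3) by auto
  have n: "G aNXT v 0 = e" "G aRGT v 0 = 0" "lst (\<lambda>i. G aINX i 0) (G aHEAD v 0) xs" "R rV1 = Suc v"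
    using shp reg by auto
  show ?thesis
    apply (subst collect_unfold)
    apply (simp add: wbd wids v n reg(2) not_sym[OF v(3)])
    apply (rule collect_list[where v = v and xs = xs and acc = acc])
    subgoal by simp
    subgoal by (rule v)
    subgoal by (rule n)
    subgoal using it by simp
    subgoal using it by simp
    subgoal using acc by simp
    subgoal using acc by simp
    subgoal premises p for t1 R1 G1
    proof -
      have sh: "te \<noteq> Suc v" by (rule v)
      have av1: "avail R1 G1 AV" by (rule avail_cong[OF av]) (use p(2,4) in auto)
      show ?thesis
        apply (rule collect_free[where AV = AV and v = v and u = u])
        subgoal by (rule av1)
        subgoal by (rule v)
        subgoal by (rule v)
        subgoal using p(2) by simp
        subgoal using p(2) reg by simp
        subgoal premises p2 for t2 R2 G2
          apply (rule Q[OF cpostI[where acc' = "rev (filter (live G) xs) @ acc"]])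
          subgoal using p2(1) p(1) by simp
          subgoal using p2(2) p(2) by auto
          subgoal using p2(2) p(2) shp by simp
          subgoal using p2(3) by simp
          subgoal using lst_cong[OF p(3)] p2(2,4) by simp
          subgoal using it acc by auto
          subgoal by auto
          subgoal using p2(4) p(4) by simp
          subgoal using p2(4) p(5) by simp
          subgoal using p2(4) p(6) by simp
          subgoal using p2(4) p(4) by auto
          done
        done
    qed
    done
next
  case (AN v j a S0 c l r)
  note ANp = less.prems[unfolded AN]
  have szl: "size l < size T" and szr: "size r < size T" using AN by auto
  note shp = ANp(1) and dn = ANp(2) and it = ANp(3,4) and nd = ANp(5) and av = ANp(6)
    and reg = ANp(7-10) and acc = ANp(11-13) and Q = ANp(14)
  have v: "v < NR" "v \<notin> AV" "te \<noteq> Suc v" using nd reg(3) by auto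
  have n: "G aNXT v 0 = Suc (root l)" "G aRGT v 0 = Suc (root r)" using shp by auto
  let ?AV1 = "AV \<union> ({v} - {u})"
  show ?thesis
    apply (subst collect_unfold)
    apply (simp add: wbd wids v n reg(1,2) not_sym[OF v(3)])
    apply (rule collect_free[where AV = AV and v = v and u = u])
    subgoal by (rule avail_cong[OF av]) auto
    subgoal by (rule v)
    subgoal by (rule v)
    subgoal by simp
    subgoal using reg by simp
    subgoal premises p for t1 R1 G1
    proof -
      have R1: "R1 rV1 = Suc (root l)" "R1 rTEND = te" "R1 rU0 = u" "R1 rNI = R rNI" "R1 rLIST = R rLIST" using p(2) reg by auto
      have fr1: "G1 a i s = G a i s" if "a \<noteq> aNXT \<or> i \<noteq> v" for a i s using p(4) that by blast
      have lv: "live G1 i = live G i" for i unfolding live_def using fr1 by simp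
      have shl: "shp G1 l (Suc (root r))"
      proof (rule shp_cong[where G = G])
        fix a' i s assume "i \<in> set (ndl l)"
        then have "i \<noteq> v" using dn by auto
        then show "G1 a' i s = G a' i s" using fr1 by simp
      qed (use fr1 shp in auto)
      show ?thesis
        apply (rule less.hyps[OF szl, where e = "Suc (root r)" and AV = ?AV1 and acc = acc])
        subgoal by (rule shl)
        subgoal using dn by simp
        subgoal using it by simp
        subgoal using it fr1 by simp
        subgoal using nd dn by auto
        subgoal by (rule p(3))
        subgoal by (rule R1)
        subgoal by (rule R1)
        subgoal using reg(3) by auto
        subgoal by (rule R1)
        subgoal using acc(1) R1 fr1 by simp
        subgoal using acc by auto
        subgoal using acc by auto
        subgoal premises p1' for t2 R2 G2 acc1
        proof -
          note p1 = cpostD[OF p1']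
          have R2: "R2 rTEND = te" "R2 rU0 = u" "R2 rNI = R rNI" using p1(2) R1 by auto
          have fr2: "G2 a i s = G a i s" if "a \<notin> {aINX, aLST, aNXT}" for a i s using p1(8)[OF that] fr1 that by auto
          have lv2: "live G2 i = live G i" for i unfolding live_def using fr2 by simp
          have nx2: "G2 aNXT i s = G aNXT i s" if "i \<notin> set (v # ndl l) - {u}" for i s
            using p1(11)[of i s] p(4)[of aNXT i s] that by auto
          have ix2: "G2 aINX i s = G aINX i s" if "i \<notin> set (itl l)" for i s
            using p1(9)[OF that] fr1[of aINX] by simp
          have s1: "set acc1 = set acc \<union> {i \<in> set (itl l). live G i}" using p1(7) lv by simp
          have dj: "set (ndl l) \<inter> set (ndl r) = {}" "v \<notin> set (ndl l)" "v \<notin> set (ndl r)" "set (itl l) \<inter> set (itl r) = {}"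
            using dn it by auto
          have shr: "shp G2 r e"
          proof (rule shp_cong[where G = G])
            fix a' i s assume a: "a' \<in> {aNXT, aRGT, aNJ, aNA, aHEAD}" "i \<in> set (ndl r)"
            then have "i \<notin> set (v # ndl l) - {u}" using dj by auto
            then show "G2 a' i s = G a' i s" using a(1) fr2[of a' i s] nx2 by (cases "a' = aNXT") auto
          next
            fix i s assume "i \<in> set (itl r)"
            then have "i \<notin> set (itl l)" using dj by auto
            then show "G2 aINX i s = G aINX i s" by (rule ix2)
          qed (use shp in auto)
          show ?thesis
            apply (rule less.hyps[OF szr, where e = e and AV = "?AV1 \<union> (set (ndl l) - {u})" and acc = acc1])
            subgoal by (rule shr)
            subgoal using dn by simp
            subgoal using it by simp
            subgoal using it fr2 by simp
            subgoal using nd dj by auto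
            subgoal by (rule p1(4))
            subgoal by (rule p1(3))
            subgoal by (rule R2)
            subgoal using reg(3) by auto
            subgoal by (rule R2)
            subgoal by (rule p1(5))
            subgoal using s1 acc dj by auto
            subgoal by (rule p1(6))
            subgoal premises p2' for t3 R3 G3 acc2
            proof -
              note p2 = cpostD[OF p2']
              show ?thesis
              apply (rule Q[OF cpostI[where acc' = acc2]])
              subgoal using p2(1) p1(1) p(1) by simp
              subgoal premises pp for r
              proof -
                have "R3 r = R2 r" by (rule p2(2)[OF pp])
                then show ?thesis using pp R2 reg by auto
              qed
              subgoal by (rule p2(3))
              subgoal
              proof -
                have "?AV1 \<union> (set (ndl l) - {u}) \<union> (set (ndl r) - {u}) = AV \<union> (set (ndl (AN v j a S0 c l r)) - {u})" by auto
                then show ?thesis using p2(4) by simp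
              qed
              subgoal by (rule p2(5))
              subgoal by (rule p2(6))
              subgoal using p2(7) s1 lv2 by auto
              subgoal using p2(8) fr2 by simp
              subgoal using p2(9) ix2 by simp
              subgoal for i
              proof -
                have "G1 aLST i 0 = G aLST i 0" using fr1 by simp
                then show ?thesis unfolding p2(10) p1(10) lv lv2 by auto
              qed
              subgoal premises pp for i s
              proof -
                have "i \<notin> set (ndl r) - {u}" "i \<notin> set (v # ndl l) - {u}" using pp by auto
                then show ?thesis using p2(11) nx2 by simp
              qed
              done
            qed
            done
        qed
        done
    qed
    done
qed
qed

end

section \<open>Descending to a leaf\<close>

context algo
begin

section \<open>Finding or creating the record of a point\<close>

lemma agr_K:
  assumes "x \<in> domain A d" "y \<in> domain A d" "agr d (K x) (K y)"
  shows "x = y"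
  using assms K_inj unfolding agr_def by blast

lemma of_bool_less: "(of_bool y :: nat) < 2"
  by (cases y) auto

lemma of_bool_inj: "(of_bool y :: nat) = of_bool y' \<longleftrightarrow> y = y'"
  by (cases y; cases y') auto

definition upS :: "nat \<Rightarrow> point \<Rightarrow> bool \<Rightarrow> example multiset \<Rightarrow> example multiset" where
  "upS kd x y S = (if kd = 0 then S + {#(x, y)#} else S - {#(x, y)#})"

lemma count_upS: "count (upS kd x y S) (x, y) = (if kd = 0 then count S (x, y) + 1 else count S (x, y) - 1)"
  "e \<noteq> (x, y) \<Longrightarrow> count (upS kd x y S) e = count S e"
  unfolding upS_def by simp_all

lemma item:
  assumes r: "R rNI = length ps" "length ps < NR" and it: "itemsI G ps S" "trieI G (map K ps)" "fst ` set_mset S \<subseteq> set ps"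
    and x: "x \<in> domain A d" and inp: "I 0 < 2" "I 1 = of_bool y" "\<And>l. l < d \<Longrightarrow> I (l + 2) = K x l"
    and S': "size (upS (I 0) x y S) \<le> N"
  defines "ps' \<equiv> if x \<in> set ps then ps else ps @ [x]"
  assumes Q: "\<And>t' R' G' cur. t' \<le> t + 500 + 500 * d + 100 * (d * m) \<Longrightarrow> cur < length ps' \<Longrightarrow> ps' ! cur = x \<Longrightarrow>
      R' rNI = length ps' \<Longrightarrow> R' rCUR = cur \<Longrightarrow> R' rY = of_bool y \<Longrightarrow> R' rOLD = count S (x, y) \<Longrightarrow>
      R' rNEW = count (upS (I 0) x y S) (x, y) \<Longrightarrow> R' rNB = R rNB \<Longrightarrow> R' rFR = R rFR \<Longrightarrow>
      itemsI G' ps' (upS (I 0) x y S) \<Longrightarrow> trieI G' (map K ps') \<Longrightarrow>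
      (\<And>a i s. a \<notin> {aIC, aKEY, aTRI, aLST} \<Longrightarrow> G' a i s = G a i s) \<Longrightarrow>
      (\<And>i. i < length ps \<Longrightarrow> G' aLST i 0 = G aLST i 0) \<Longrightarrow>
      (x \<notin> set ps \<Longrightarrow> G' aLST cur 0 = 0) \<Longrightarrow> Q (t', R', G')"
  shows "wp (p_item d m) Q (t, R, G)"
proof -
  let ?n = "length ps" and ?S' = "upS (I 0) x y S" and ?ks = "map K ps"
  have kx: "K x l < m" if "l < d" for l using K_less[OF x that] .
  define J where "J = (\<lambda>l (t', R', G'). t' \<le> t + 10 + 100 * l \<and> (\<forall>r. r \<noteq> rL \<longrightarrow> R' r = R r) \<and> R' rL = l \<and>
      (\<forall>a i s. \<not> (a = aKEY \<and> i = ?n) \<longrightarrow> G' a i s = G a i s) \<and> (\<forall>l'<l. G' aKEY ?n l' = K x l'))"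
  have dps: "set ps \<subseteq> domain A d" "distinct ps" using it(1) by (auto simp: itemsI_def)
  have key: "G aKEY i l = K (ps ! i) l" if "i < ?n" "l < d" for i l using it(1) that by (simp add: itemsI_def)
  have ic: "G aIC i (of_bool y) = count S (ps ! i, y)" if "i < ?n" for i y using it(1) that by (simp add: itemsI_def)
  show ?thesis unfolding p_item_def
    apply (simp add: wbd)
    apply (rule wp_for[where J = J and i = 0 and n = d])
    subgoal by (simp add: J_def)
    subgoal by simp
    subgoal premises pp for l t' R' G'
    proof -
      have w: "Suc (Suc l) < W" "K x l < W" "I (Suc (Suc l)) = K x l" "Suc l < W"
        using kx[OF pp(2)] pp(2) bounds wbd inp(3)[OF pp(2)] by (auto intro!: wlt)
      show ?thesis using pp r w unfolding J_def by (auto simp: wbd wids upd_apply less_Suc_eq)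
    qed
    subgoal premises pp for t1 R1 G1
    proof -
      have J: "t1 \<le> t + 10 + 100 * d" "\<And>r. r \<noteq> rL \<Longrightarrow> R1 r = R r" "R1 rL = d"
        "\<And>a i s. \<not> (a = aKEY \<and> i = ?n) \<Longrightarrow> G1 a i s = G a i s" "\<And>l. l < d \<Longrightarrow> G1 aKEY ?n l = K x l"
        using pp unfolding J_def prod.case by blast+
      show ?thesis
        apply (simp add: J(3) wbd)
        apply (rule trie[where ks = ?ks and f = "K x"])
        subgoal using J(2) r by simp
        subgoal using r by simp
        subgoal using it(2) J(4) by (simp add: trieI_def)
        subgoal using J(5) by simp
        subgoal by (rule kx)
        subgoal premises p for t2 R2 G2 cur
        proof -
          have R2: "R2 rNI = ?n" "R2 rNB = R rNB" "R2 rFR = R rFR" using p(2) J(2) r by auto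
          have fr2: "G2 a i s = G a i s" if "a \<noteq> aTRI" "\<not> (a = aKEY \<and> i = ?n)" for a i s
            using p(3)[OF that(1)] J(4)[OF that(2)] by simp
          have k2: "G2 aKEY ?n l = K x l" if "l < d" for l using p(3)[of aKEY] J(5)[OF that] by simp
          have cur: "cur \<le> ?n" using fnd_SucD[OF p(5)] by simp
          have cl: "cur < NR" using cur r by simp
          \<comment> \<open>The first key that agrees with \<open>x\<close> belongs either to an
            earlier record, whose point is \<open>x\<close> since ranks determine points, or to the
            free slot, and then \<open>x\<close> is new.\<close>
          have cases: "cur < ?n \<and> x \<in> set ps \<and> ps ! cur = x \<or> cur = ?n \<and> x \<notin> set ps"
          proof (cases "cur < ?n")
            case True
            have "agr d (K x) (K (ps ! cur))" using fnd_SucD[OF p(5)] True by (simp add: nth_append)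
            then have "x = ps ! cur" using agr_K[OF x] dps(1) nth_mem[OF True] by blast
            then show ?thesis using True nth_mem[OF True] by simp
          next
            case False
            then have c: "cur = ?n" using cur by simp
            have "x \<notin> set ps"
            proof
              assume "x \<in> set ps"
              then have "fnd (agr d (K x)) ?ks \<noteq> 0" by (auto simp: fnd_0 agr_def)
              then have "fnd (agr d (K x)) ?ks = Suc ?n" using p(5) c by (simp add: fnd_snoc)
              then show False using fnd_SucD by fastforce
            qed
            then show ?thesis using c by simp
          qed
          have c0: "count S (x, y) = 0" if "x \<notin> set ps" for y
          proof -
            have "(x, y) \<notin># S" using it(3) that by force
            then show ?thesis by (simp add: count_eq_zero_iff)
          qed
          define G3 where "G3 = (if cur = ?n then upd (upd (upd G2 aIC ?n 0 0) aIC ?n 1 0) aLST ?n 0 0 else G2)"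
          have ic3: "G3 aIC cur (of_bool y) = count S (x, y)" for y
            using cases
          proof
            assume c: "cur < ?n \<and> x \<in> set ps \<and> ps ! cur = x"
            then show ?thesis using ic[of cur y] fr2 by (simp add: G3_def)
          next
            assume c: "cur = ?n \<and> x \<notin> set ps"
            then show ?thesis using c0[of y] by (cases y) (simp_all add: G3_def upd_apply)
          qed
          have io: "G3 aIC i s = G aIC i s" if "i < ?n" for i s using that fr2 by (auto simp: G3_def upd_apply)
          have cw: "count S (x, y) \<le> N"
            using it(1) count_le_size[of S "(x, y)"] by (simp add: itemsI_def)
          have w: "Suc (count S (x, y)) < W" using cw N_Z by (intro wlt) simp
          have n': "length ps' \<le> NR" "Suc ?n < W" using r wbd by (auto simp: ps'_def)
          have tI: "trieI G2 (map K ps')"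
          proof (cases "x \<in> set ps")
            case True
            then have c: "cur < ?n" "ps ! cur = x" using cases by auto
            have "trieI G2 ?ks" by (rule trie_dup[OF p(6), of cur]) (use c in \<open>auto simp: agr_def\<close>)
            then show ?thesis using True by (simp add: ps'_def)
          next
            case False
            then show ?thesis using p(6) by (simp add: ps'_def)
          qed
          have pc: "cur < length ps'" "ps' ! cur = x" using cases by (auto simp: ps'_def)
          define G4 where "G4 = upd G3 aIC cur (of_bool y) (count ?S' (x, y))"
          have fin: "Q (t', R', G4)"
            if "t' \<le> t2 + 300" "R' rNI = length ps'" "R' rCUR = cur" "R' rY = of_bool y" "R' rOLD = count S (x, y)"
              "R' rNEW = count ?S' (x, y)" "R' rNB = R rNB" "R' rFR = R rFR" for t' R'
            apply (rule Q[where cur = cur])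
            subgoal using that(1) p(1) J(1) by simp
            subgoal by (rule pc)
            subgoal by (rule pc)
            subgoal by (rule that)
            subgoal by (rule that)
            subgoal by (rule that)
            subgoal by (rule that)
            subgoal by (rule that)
            subgoal by (rule that)
            subgoal by (rule that)
            subgoal unfolding itemsI_def
              apply (intro conjI allI impI)
              subgoal using dps by (auto simp: ps'_def)
              subgoal using dps x by (auto simp: ps'_def)
              subgoal by (rule n')
              subgoal by (rule S')
              subgoal premises q for i l
              proof -
                have e: "G4 aKEY i l = G2 aKEY i l" by (simp add: G4_def G3_def upd_apply)
                show ?thesis
                proof (cases "i < ?n")
                  case True
                  then show ?thesis using key[OF True q(2)] fr2[of aKEY i l] e by (simp add: ps'_def nth_append)
                next
                  case False
                  then have "i = ?n" "x \<notin> set ps" using q(1) by (auto simp: ps'_def split: if_splits)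
                  then show ?thesis using k2[OF q(2)] e by (simp add: ps'_def)
                qed
              qed
              subgoal premises q for i y'
              proof (cases "i = cur")
                case True
                then show ?thesis using ic3[of y'] pc count_upS(1) count_upS(2)[of "(x, y')" x y]
                  by (cases "y' = y") (auto simp: G4_def upd_apply of_bool_inj)
              next
                case False
                then have i: "i < ?n" using q cases by (auto simp: ps'_def split: if_splits)
                have "ps ! i \<noteq> x"
                proof
                  assume "ps ! i = x"
                  then have "cur < ?n" "ps ! cur = ps ! i" using cases i by auto
                  then show False using False i dps(2) by (simp add: nth_eq_iff_index_eq)
                qed
                then have "count ?S' (ps ! i, y') = count S (ps ! i, y')" by (intro count_upS) auto
                then show ?thesis using False i ic[OF i, of y'] io[OF i] by (simp add: G4_def upd_apply ps'_def nth_append)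
              qed
              done
            subgoal using tI by (simp add: trieI_def G4_def G3_def upd_apply)
            subgoal for a i s using fr2[of a i s] by (auto simp: G4_def G3_def upd_apply)
            subgoal for i using fr2[of aLST i 0] by (auto simp: G4_def G3_def upd_apply)
            subgoal using cases by (auto simp: G4_def G3_def upd_apply)
            done
          define yb :: nat where "yb = of_bool y"
          define cS where "cS = count S (x, y)"
          define cN where "cN = count ?S' (x, y)"
          note fin' = fin[folded yb_def cS_def cN_def]
          have y2: "yb < 2" unfolding yb_def by (rule of_bool_less)
          have yW: "yb < W" using y2 wbd by linarith
          have iw: "I 0 < W" "I (Suc 0) = yb" using inp wbd by (auto simp: yb_def)
          have eA: "Suc cS = cN" if "I 0 = 0" using count_upS(1)[of "I 0" x y S] that by (simp add: cS_def cN_def)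
          have eB: "cS - Suc 0 = cN" if "0 < I 0" using count_upS(1)[of "I 0" x y S] that by (simp add: cS_def cN_def)
          have ic3': "G2 aIC cur yb = cS" if "cur \<noteq> ?n"
            using ic3[of y] that by (simp add: G3_def yb_def cS_def)
          have ic3'': "upd (upd (upd G2 aIC ?n 0 0) aIC ?n (Suc 0) 0) aLST ?n 0 0 aIC ?n yb = cS" if "cur = ?n"
            using ic3[of y] that by (simp add: G3_def yb_def cS_def)
          have l': "length ps' = (if cur = ?n then Suc ?n else ?n)" using cases by (auto simp: ps'_def)
          have w': "Suc cS < W" using w by (simp add: cS_def)
          show ?thesis
          proof (cases "cur = ?n")
            case True
            have G4': "upd (upd (upd (upd G2 aIC ?n 0 0) aIC ?n (Suc 0) 0) aLST ?n 0 0) aIC ?n yb cN = G4"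
              by (simp add: G4_def G3_def True yb_def cN_def)
            have R4: "R2 rCUR = ?n" using p(4) True by simp
            show ?thesis
              apply (simp add: R4 R2(1) wbd wids r(2) n' iw yW y2 ic3''[OF True] w')
              apply (intro conjI impI)
              subgoal premises q unfolding eB[OF q] G4'
                by (rule fin') (simp_all add: R4 True l' R2)
              subgoal premises q unfolding eA[OF q] G4'
                by (rule fin') (simp_all add: R4 True l' R2)
              done
          next
            case False
            have G4': "upd G2 aIC cur yb cN = G4"
              by (simp add: G4_def G3_def False yb_def cN_def)
            show ?thesis
              apply (simp add: p(4) R2(1) False wbd wids cl iw yW y2 ic3'[OF False] w')
              apply (intro conjI impI)
              subgoal premises q unfolding eB[OF q] G4'
                by (rule fin') (simp_all add: p(4) False l' R2)
              subgoal premises q unfolding eA[OF q] G4'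
                by (rule fin') (simp_all add: p(4) False l' R2)
              done
          qed
        qed
        done
    qed
    done
qed

section \<open>Where the counting of an update stops\<close>

definition spent :: "atr \<Rightarrow> bool" where
  "spent T \<longleftrightarrow> cof T = budget q (snap T)"

text \<open>The subtree at which the update stops: the first vertex on the route whose budget is used up,
  or else the leaf.\<close>

primrec ft :: "point \<Rightarrow> atr \<Rightarrow> atr" where
  "ft x (AL v xs S0 c) = AL v xs S0 c"
| "ft x (AN v j a S0 c l r) = (if c = budget q S0 then AN v j a S0 c l r else if K x j \<le> a then ft x l else ft x r)"

text \<open>The vertices above \<open>ft x T\<close> on the route; their budgets shrink by one, as
  does that of \<open>ft x T\<close> if it is an unspent leaf.\<close>

primrec tset :: "point \<Rightarrow> atr \<Rightarrow> nat list" where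
  "tset x (AL v xs S0 c) = []"
| "tset x (AN v j a S0 c l r) = (if c = budget q S0 then [] else v # (if K x j \<le> a then tset x l else tset x r))"

text \<open>The pointer behind \<open>ft x T\<close> on the thread, i.e. the value of
  \<open>rEND\<close> when the descent reaches that subtree.\<close>

primrec fe :: "point \<Rightarrow> atr \<Rightarrow> nat \<Rightarrow> nat" where
  "fe x (AL v xs S0 c) e = e"
| "fe x (AN v j a S0 c l r) e = (if c = budget q S0 then e else if K x j \<le> a then fe x l (Suc (root r)) else fe x r e)"

primrec lf :: "point \<Rightarrow> atr \<Rightarrow> nat" where
  "lf x (AL v xs S0 c) = v"
| "lf x (AN v j a S0 c l r) = (if K x j \<le> a then lf x l else lf x r)"

primrec jok :: "atr \<Rightarrow> bool" where
  "jok (AL v xs S0 c) \<longleftrightarrow> True"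
| "jok (AN v j a S0 c l r) \<longleftrightarrow> j < d \<and> jok l \<and> jok r"

lemma wf_jok: "wf dep X S T \<Longrightarrow> jok T"
  by (induction T arbitrary: dep X S) auto

lemma walk_unfold: "wp p_walk Q (t, R, G) \<longleftrightarrow> R rV < NR \<and> (if 0 < G aRGT (R rV) 0 then
    wp (If (Lt (Get1 aNA (V rV)) (Get aKEY (V rCUR) (Get1 aNJ (V rV)))) (Asg rV (Get1 aRGT (V rV) \<ominus> ex.N 1))
         (Asg rEND (Get1 aRGT (V rV)) ;; Asg rV (Get1 aNXT (V rV) \<ominus> ex.N 1)) ;; p_touch) (wp p_walk Q) (t + 11, R, G)
    else Q (t + 11, R, G))"
  unfolding p_walk_def by (subst wp_unfold) (auto simp: wbd wids add.commute)

lemma walk_done: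
  assumes "shp G T e" "jok T" "\<And>i. i \<in> set (ndl T) \<Longrightarrow> i < NR" "\<And>l. l < d \<Longrightarrow> G aKEY (R rCUR) l = K x l" "R rCUR < NR"
    "R rV = root T" "0 < R rTRIG"
    and "\<And>t' R'. t' \<le> t + 50 + 200 * ht T \<Longrightarrow> R' rV = lf x T \<Longrightarrow> (\<And>r. r \<notin> {rV, rEND} \<Longrightarrow> R' r = R r) \<Longrightarrow> Q (t', R', G)"
  shows "wp p_walk Q (t, R, G)"
  using assms
proof (induction T arbitrary: t R e)
  case (AL v xs S0 c)
  then show ?case by (subst walk_unfold) (auto simp: wids intro!: AL.prems(8))
next
  case (AN v j a S0 c l r)
  have n: "v < NR" "G aRGT v 0 = Suc (root r)" "G aNXT v 0 = Suc (root l)" "G aNJ v 0 = j" "G aNA v 0 = a" "j < d" "R rV = v"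
    using AN.prems by auto
  have key: "G aKEY (R rCUR) j = K x j" using AN.prems(4) n by simp
  show ?case
  proof (cases "K x j \<le> a")
    case True
    then have nl: "\<not> a < K x j" by simp
    show ?thesis
      apply (subst walk_unfold)
      using AN.prems(7) apply (simp add: n key wbd wids AN.prems(5) p_touch_def nl)
      apply (rule AN.IH(1)[where e = "Suc (root r)"])
      using AN.prems by (auto intro!: AN.prems(8) simp: True)
  next
    case False
    then have "a < K x j" by simp
    show ?thesis
      apply (subst walk_unfold)
      using AN.prems(7) \<open>a < K x j\<close> apply (simp add: n key wbd wids AN.prems(5) p_touch_def)
      apply (rule AN.IH(2)[where e = e])
      using AN.prems False by (auto intro!: AN.prems(8))
  qed
qed

end

context algo
begin

text \<open>The root is touched before the loop and every other vertex right after the step to it,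
  so the induction is over a touch followed by the rest of the walk.\<close>

lemma walk:
  assumes "rep G dep S T e" "jok T" "distinct (ndl T)" "\<And>i. i \<in> set (ndl T) \<Longrightarrow> i < NR"
    "\<And>l. l < d \<Longrightarrow> G aKEY (R rCUR) l = K x l" "R rCUR < NR"
    "R rV = root T" "R rTRIG = 0" "R rEND = e"
    and "\<And>t' R' G'. t' \<le> t + 300 * (ht T + 1) \<Longrightarrow> R' rV = lf x T \<Longrightarrow>
      R' rTRIG = (if spent (ft x T) then Suc (root (ft x T)) else 0) \<Longrightarrow>
      (spent (ft x T) \<Longrightarrow> R' rTEND = fe x T e) \<Longrightarrow>
      (\<And>r. r \<notin> {rV, rEND, rTRIG, rTEND} \<Longrightarrow> R' r = R r) \<Longrightarrow>
      (\<And>a i s. a \<noteq> aBUD \<Longrightarrow> G' a i s = G a i s) \<Longrightarrow>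
      (\<And>i. G' aBUD i 0 = G aBUD i 0 -
        (if i \<in> set (tset x T) \<or> \<not> spent (ft x T) \<and> i = root (ft x T) then 1 else 0)) \<Longrightarrow> Q (t', R', G')"
  shows "wp p_touch (wp p_walk Q) (t, R, G)"
  using assms
proof (induction T arbitrary: t R G dep S e)
  case (AL v xs S0 c)
  note Q = AL.prems(10)
  have n: "v < NR" "G aRGT v 0 = 0" "R rV = v" "R rTRIG = 0" "R rEND = e" "G aBUD v 0 + c = budget q S0"
    using AL.prems(1-9) by auto
  have w: "Suc v < W" using n wbd by linarith
  show ?case
  proof (cases "c = budget q S0")
    case True
    then have b: "G aBUD v 0 = 0" using n by simp
    show ?thesis unfolding p_touch_def
      apply (simp add: n b wbd wids w)
      apply (subst walk_unfold)
      apply (simp add: n)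
      apply (rule Q)
      using True n by (auto simp: spent_def)
  next
    case False
    then have b: "0 < G aBUD v 0" using n by simp
    show ?thesis unfolding p_touch_def
      apply (simp add: n b wbd wids w)
      apply (subst walk_unfold)
      apply (simp add: n upd_apply)
      apply (rule Q)
      using False n by (auto simp: spent_def upd_apply)
  qed
next
  case (AN v j a S0 c l r)
  note Q = AN.prems(10)
  have n: "v < NR" "G aRGT v 0 = Suc (root r)" "G aNXT v 0 = Suc (root l)" "G aNJ v 0 = j" "G aNA v 0 = a" "j < d"
    "R rV = v" "R rTRIG = 0" "R rEND = e" "G aBUD v 0 + c = budget q S0"
    using AN.prems(1-9) by auto
  have key: "G aKEY (R rCUR) j = K x j" using AN.prems(5) n by simp
  have cur: "R rCUR < NR" by (rule AN.prems)
  have w: "Suc v < W" using n wbd by linarith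
  show ?case
  proof (cases "c = budget q S0")
    case True
    then have b: "G aBUD v 0 = 0" using n by simp
    show ?thesis unfolding p_touch_def
      apply (simp add: n b wbd wids w)
      apply (rule walk_done[where T = "AN v j a S0 c l r" and e = e and x = x])
      subgoal using rep_shp[OF AN.prems(1)] .
      subgoal by (rule AN.prems)
      subgoal by (rule AN.prems)
      subgoal using AN.prems(5) by simp
      subgoal using cur by simp
      subgoal using n by simp
      subgoal by simp
      subgoal premises p for t' R'
        apply (rule Q)
        subgoal using p(1) by simp
        subgoal using p(2) by simp
        subgoal using p(3) True by (simp add: spent_def)
        subgoal using p(3) True by (simp add: spent_def)
        subgoal using p(3) by simp
        subgoal by simp
        subgoal using True by (simp add: spent_def)
        done
      done
  next
    case False
    then have b: "0 < G aBUD v 0" using n by simp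
    let ?G = "upd G aBUD v 0 (G aBUD v 0 - Suc 0)"
    have rl: "rep ?G (Suc dep) (sle j a S) l (Suc (root r))"
    proof (rule rep_cong[where G = G])
      fix a' i s assume "i \<in> set (ndl l)"
      then have "i \<noteq> v" using AN.prems(3) by auto
      then show "?G a' i s = G a' i s" by (simp add: upd_apply)
    qed (use AN.prems(1) in \<open>auto simp: upd_apply\<close>)
    have rr: "rep ?G (Suc dep) (sgt j a S) r e"
    proof (rule rep_cong[where G = G])
      fix a' i s assume "i \<in> set (ndl r)"
      then have "i \<noteq> v" using AN.prems(3) by auto
      then show "?G a' i s = G a' i s" by (simp add: upd_apply)
    qed (use AN.prems(1) in \<open>auto simp: upd_apply\<close>)
    have vn: "v \<notin> set (ndl l)" "v \<notin> set (ndl r)" "distinct (ndl l)" "distinct (ndl r)" using AN.prems(3) by auto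
    have ts: "set (tset x T) \<subseteq> set (ndl T)" "root (ft x T) \<in> set (ndl T)" for T
      using root_ndl by (induction T) auto
    show ?thesis
    proof (cases "K x j \<le> a")
      case le: True
      then have nl: "\<not> a < K x j" by simp
      have u: "ft x (AN v j a S0 c l r) = ft x l" "tset x (AN v j a S0 c l r) = v # tset x l"
         "fe x (AN v j a S0 c l r) e = fe x l (Suc (root r))" "lf x (AN v j a S0 c l r) = lf x l"
        using False le by auto
      show ?thesis
        apply (subst p_touch_def)
        apply (simp add: n b wbd wids w)
        apply (subst walk_unfold)
        apply (simp add: n key cur wbd wids upd_apply nl)
        apply (rule AN.IH(1)[OF rl])
        subgoal using AN.prems(2) by simp
        subgoal by (rule vn)
        subgoal using AN.prems(4) by simp
        subgoal using AN.prems(5) by (simp add: upd_apply)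
        subgoal using cur by simp
        subgoal by simp
        subgoal using n by simp
        subgoal by simp
        subgoal premises p for t' R' G'
          apply (rule Q)
          unfolding u
          subgoal using p(1) by simp
          subgoal by (rule p(2))
          subgoal by (rule p(3))
          subgoal by (rule p(4))
          subgoal using p(5) by simp
          subgoal using p(6) by (simp add: upd_apply)
          subgoal for i using p(7)[of i] ts[of l] vn by (auto simp: upd_apply)
          done
        done
    next
      case gt: False
      then have nl: "a < K x j" by simp
      have u: "ft x (AN v j a S0 c l r) = ft x r" "tset x (AN v j a S0 c l r) = v # tset x r"
         "fe x (AN v j a S0 c l r) e = fe x r e" "lf x (AN v j a S0 c l r) = lf x r"
        using False gt by auto
      show ?thesis
        apply (subst p_touch_def)
        apply (simp add: n b wbd wids w)
        apply (subst walk_unfold)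
        apply (simp add: n key cur wbd wids upd_apply nl)
        apply (rule AN.IH(2)[OF rr])
        subgoal using AN.prems(2) by simp
        subgoal by (rule vn)
        subgoal using AN.prems(4) by simp
        subgoal using AN.prems(5) by (simp add: upd_apply)
        subgoal using cur by simp
        subgoal by simp
        subgoal using n by simp
        subgoal using n by simp
        subgoal premises p for t' R' G'
          apply (rule Q)
          unfolding u
          subgoal using p(1) by simp
          subgoal by (rule p(2))
          subgoal by (rule p(3))
          subgoal by (rule p(4))
          subgoal using p(5) by simp
          subgoal using p(6) by (simp add: upd_apply)
          subgoal for i using p(7)[of i] ts[of r] vn by (auto simp: upd_apply)
          done
        done
    qed
  qed
qed

lemma leaf:
  assumes "R rV = v" "v < NR" "R rCUR = cur" "cur < NR" "R rY < 2" "G aNN v (R rY) + R rNEW \<le> 4 * Z"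
    and Q: "\<And>t' G'. t' \<le> t + 200 \<Longrightarrow>
      (\<And>a i s. a \<notin> {aNN, aHEAD, aINX, aLST} \<Longrightarrow> G' a i s = G a i s) \<Longrightarrow>
      (\<And>i s. i \<noteq> v \<Longrightarrow> G' aNN i s = G aNN i s) \<Longrightarrow> (\<And>i s. i \<noteq> v \<Longrightarrow> G' aHEAD i s = G aHEAD i s) \<Longrightarrow>
      (\<And>s. G' aNN v s = (if s = R rY then G aNN v s + R rNEW - R rOLD else G aNN v s)) \<Longrightarrow>
      (0 < G aLST cur 0 \<Longrightarrow> G' aHEAD v 0 = G aHEAD v 0 \<and> (\<forall>i s. G' aINX i s = G aINX i s) \<and> (\<forall>i s. G' aLST i s = G aLST i s)) \<Longrightarrow>
      (G aLST cur 0 = 0 \<Longrightarrow> G' aHEAD v 0 = Suc cur \<and> G' aINX cur 0 = G aHEAD v 0 \<and>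
         (\<forall>i s. i \<noteq> cur \<longrightarrow> G' aINX i s = G aINX i s) \<and> (\<forall>i. G' aLST i 0 = (if i = cur then 1 else G aLST i 0))) \<Longrightarrow> Q (t', R, G')"
  shows "wp p_leaf Q (t, R, G)"
proof -
  have w: "G aNN v (R rY) + R rNEW < W" "Suc cur < W"
  proof -
    show "G aNN v (R rY) + R rNEW < W" using assms(6) by (intro wlt) simp
    show "Suc cur < W" using assms(4) wbd by linarith
  qed
  show ?thesis unfolding p_leaf_def
    apply (simp add: assms(1-5) w wbd wids upd_apply)
    apply (intro conjI impI)
    subgoal by (rule Q) (auto simp: upd_apply)
    subgoal by (rule Q) (auto simp: upd_apply)
    done
qed

section \<open>Answering a labeling request\<close>

lemma label_walk:
  assumes "shp G T e" "jok T" "\<And>i. i \<in> set (ndl T) \<Longrightarrow> i < NR" "\<And>l. l < d \<Longrightarrow> I (l + 2) = K x l" "\<And>l. l < d \<Longrightarrow> K x l < m"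
    "R rV = root T"
    and "\<And>t' R'. t' \<le> t + 50 + 200 * ht T \<Longrightarrow> R' rV = lf x T \<Longrightarrow> (\<And>r. r \<noteq> rV \<Longrightarrow> R' r = R r) \<Longrightarrow> Q (t', R', G)"
  shows "wp (Whl (Lt (ex.N 0) (Get1 aRGT (V rV)))
       (If (Lt (Get1 aNA (V rV)) (In (Get1 aNJ (V rV) \<oplus> ex.N 2))) (Asg rV (Get1 aRGT (V rV) \<ominus> ex.N 1))
         (Asg rV (Get1 aNXT (V rV) \<ominus> ex.N 1)))) Q (t, R, G)"
  using assms
proof (induction T arbitrary: t R e)
  case (AL v xs S0 c)
  then show ?case by (subst wp_unfold) (auto simp: wids wbd intro!: AL.prems(7))
next
  case (AN v j a S0 c l r)
  have n: "v < NR" "G aRGT v 0 = Suc (root r)" "G aNXT v 0 = Suc (root l)" "G aNJ v 0 = j" "G aNA v 0 = a" "j < d" "R rV = v"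
    using AN.prems(1-6) by auto
  have key: "I (Suc (Suc j)) = K x j" using AN.prems(4)[OF n(6)] by simp
  have w: "Suc (Suc j) < W" "K x j < W"
  proof -
    show "Suc (Suc j) < W" using n(6) bounds by (intro wlt) simp
    show "K x j < W" using AN.prems(5)[OF n(6)] wbd by linarith
  qed
  show ?case
  proof (cases "K x j \<le> a")
    case True
    then have nl: "\<not> a < K x j" by simp
    show ?thesis
      apply (subst wp_unfold)
      apply (simp add: n key wbd wids w nl)
      apply (rule AN.IH(1)[where e = "Suc (root r)", simplified])
      using AN.prems(1-6) True by (auto intro!: AN.prems(7))
  next
    case False
    then have nl: "a < K x j" by simp
    show ?thesis
      apply (subst wp_unfold)
      apply (simp add: n key wbd wids w nl)
      apply (rule AN.IH(2)[where e = e, simplified])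
      using AN.prems(1-6) False by (auto intro!: AN.prems(7))
  qed
qed

text \<open>All leaves of a chain carry the same label, so the counts at the stored leaf decide, and
  these are kept current by every update.\<close>

lemma rep_lf:
  "rep G dep S T e \<Longrightarrow> wf dep X S T \<Longrightarrow> x \<in> domain A d \<Longrightarrow>
    classify (toD dep S T) x \<longleftrightarrow> G aNN (lf x T) 0 < G aNN (lf x T) 1"
proof (induction T arbitrary: dep S e X)
  case (AL v xs S0 c)
  then have "G aNN v 0 = cls S False" "G aNN v 1 = cls S True"
    using AL.prems(1) by (auto dest: spec[of _ False] spec[of _ True])
  then show ?case by (simp add: classify_chain)
next
  case (AN v j a S0 c l r)
  then have "x (Suc j) \<le> thr A a \<longleftrightarrow> K x j \<le> a" by (intro le_thr) auto
  then show ?case using AN by (auto simp: classify_Node)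
qed

lemma lf_ndl: "lf x T \<in> set (ndl T)"
  by (induction T) auto

lemma label:
  assumes "rep G 0 S T 0" "wf 0 X S T" "\<And>i. i \<in> set (ndl T) \<Longrightarrow> i < NR" "root T = 0"
    "x \<in> domain A d" "\<And>l. l < d \<Longrightarrow> I (l + 2) = K x l"
    and Q: "\<And>t' R'. t' \<le> t + 150 + 200 * ht T \<Longrightarrow> R' 0 = of_bool (classify (toD 0 S T) x) \<Longrightarrow>
      (\<And>r. r \<noteq> rV \<Longrightarrow> r \<noteq> 0 \<Longrightarrow> R' r = R r) \<Longrightarrow> Q (t', R', G)"
  shows "wp p_label Q (t, R, G)"
proof -
  have kx: "K x l < m" if "l < d" for l using K_less[OF assms(5) that] .
  have lfn: "lf x T < NR" using assms(3) lf_ndl by blast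
  show ?thesis unfolding p_label_def
    apply (simp add: wbd)
    apply (rule label_walk[where T = T and e = 0 and x = x, simplified])
    subgoal by (rule rep_shp[OF assms(1)])
    subgoal by (rule wf_jok[OF assms(2)])
    subgoal by (rule assms(3))
    subgoal using assms(6) by simp
    subgoal by (rule kx)
    subgoal using assms(4) by simp
    subgoal premises p for t' R'
      using lfn rep_lf[OF assms(1,2,5)] p(2)
      apply (simp add: wids wbd)
      apply (intro conjI impI)
      subgoal by (rule Q) (use p in auto)
      subgoal by (rule Q) (use p in auto)
      done
    done
qed

section \<open>Compacting the points\<close>

lemma move:
  assumes r: "R rNI = n" "length qs = n" "n < NR" "R rOLD = i" "i < NR"
    and tr: "trieI G (map K qs)" and key: "\<And>l. l < d \<Longrightarrow> G aKEY i l = K x l" and x: "x \<in> domain A d"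
    and Q: "\<And>t' R' G'. t' \<le> t + 500 + 500 * d + 100 * (d * m) \<Longrightarrow> R' rNI = Suc n \<Longrightarrow> R' rLIST = Suc n \<Longrightarrow>
      R' rOLD = i \<Longrightarrow> R' rM0 = R rM0 \<Longrightarrow>
      (\<And>s. s < 2 \<Longrightarrow> G' aIC n s = G aIC i s) \<Longrightarrow> (\<And>l. l < d \<Longrightarrow> G' aKEY n l = K x l) \<Longrightarrow> trieI G' (map K (qs @ [x])) \<Longrightarrow>
      G' aINX n 0 = R rLIST \<Longrightarrow> G' aLST n 0 = 1 \<Longrightarrow>
      (\<And>a j s. a \<noteq> aTRI \<Longrightarrow> j \<noteq> n \<Longrightarrow> G' a j s = G a j s) \<Longrightarrow>
      (\<And>a j s. a \<notin> {aIC, aKEY, aTRI, aLST, aINX} \<Longrightarrow> G' a j s = G a j s) \<Longrightarrow> Q (t', R', G')"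
  shows "wp (p_move d m) Q (t, R, G)"
proof -
  define G1 where "G1 = upd (upd G aIC n 0 (G aIC i 0)) aIC n 1 (G aIC i 1)"
  have e1: "upd (upd G aIC n 0 (G aIC i 0)) aIC n (Suc 0) (upd G aIC n 0 (G aIC i 0) aIC i (Suc 0)) = G1"
    by (simp add: G1_def upd_apply)
  define J where "J = (\<lambda>l (t', R', G'). t' \<le> t + 100 + 100 * l \<and> (\<forall>r. r \<noteq> rL \<longrightarrow> R' r = R r) \<and> R' rL = l \<and>
      (\<forall>a j s. \<not> (a = aKEY \<and> j = n) \<longrightarrow> G' a j s = G1 a j s) \<and> (\<forall>l'. l' < l \<longrightarrow> G' aKEY n l' = K x l') \<and>
      (\<forall>l'. l' < d \<longrightarrow> G' aKEY i l' = K x l'))"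
  have w: "Suc n < W" using r wbd by linarith
  show ?thesis unfolding p_move_def
    apply (simp add: r wbd wids e1)
    apply (rule wp_for[where J = J and i = 0 and n = d])
    subgoal using key by (simp add: J_def G1_def upd_apply)
    subgoal by simp
    subgoal premises pp for l t' R' G'
    proof -
      have wl: "Suc l < W" using pp(2) wbd by linarith
      show ?thesis using pp r wl unfolding J_def by (auto simp: wbd wids upd_apply less_Suc_eq)
    qed
    subgoal premises pp for t1 R1 G2
    proof -
      have J: "t1 \<le> t + 100 + 100 * d" "\<And>r. r \<noteq> rL \<Longrightarrow> R1 r = R r" "R1 rL = d"
        "\<And>a j s. \<not> (a = aKEY \<and> j = n) \<Longrightarrow> G2 a j s = G1 a j s" "\<And>l. l < d \<Longrightarrow> G2 aKEY n l = K x l"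
        using pp unfolding J_def prod.case by blast+
      show ?thesis
        apply (simp add: J(3) wbd)
        apply (rule trie[where ks = "map K qs" and f = "K x"])
        subgoal using J(2) r by simp
        subgoal using r by simp
        subgoal using tr J(4) by (simp add: trieI_def G1_def upd_apply)
        subgoal using J(5) r by simp
        subgoal using K_less[OF x] .
        subgoal premises p for t2 R2 G3 cur
        proof -
          have R2: "R2 rNI = n" "R2 rLIST = R rLIST" "R2 rOLD = i" "R2 rM0 = R rM0" using p(2) J(2) r by auto
          have fr: "G3 a j s = G1 a j s" if "a \<noteq> aTRI" "\<not> (a = aKEY \<and> j = n)" for a j s
            using p(3)[OF that(1)] J(4)[OF that(2)] by simp
          have k3: "G3 aKEY n l = K x l" if "l < d" for l using p(3)[of aKEY] J(5)[OF that] by simp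
          show ?thesis
            apply (simp add: R2 r w wbd wids)
            apply (rule Q)
            subgoal using p(1) J(1) by simp
            subgoal by simp
            subgoal by simp
            subgoal using R2 by simp
            subgoal using R2 by simp
            subgoal for s using fr[of aIC n s] by (auto simp: upd_apply G1_def less_Suc_eq numeral_2_eq_2)
            subgoal using k3 by (simp add: upd_apply)
            subgoal using p(6) by (simp add: trieI_def upd_apply)
            subgoal by (simp add: upd_apply)
            subgoal by (simp add: upd_apply)
            subgoal for a j s using fr[of a j s] by (simp add: upd_apply G1_def)
            subgoal for a j s using fr[of a j s] by (simp add: upd_apply G1_def)
            done
        qed
        done
    qed
    done
qed

text \<open>Moving records in place is safe because the number of live points found never exceeds
  the scan position; the last conjunct of \<open>J\<close> says that the unread records are
  intact.\<close>

lemma global: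
  assumes r: "R rNI = length ps" and it: "itemsI G ps S"
  defines "qs \<equiv> filter (\<lambda>x. \<exists>y. (x, y) \<in># S) ps"
  assumes Q: "\<And>t' R' G'. t' \<le> t + 500 + length ps * (1000 + 500 * d + 100 * (d * m)) \<Longrightarrow> R' rNI = length qs \<Longrightarrow>
      R' rNB = 0 \<Longrightarrow> R' rFR = 0 \<Longrightarrow> R' rU0 = 0 \<Longrightarrow> R' rTEND = 0 \<Longrightarrow>
      lst (\<lambda>i. G' aINX i 0) (R' rLIST) (rev [0..<length qs]) \<Longrightarrow> (\<And>i. i < length qs \<Longrightarrow> G' aLST i 0 = 1) \<Longrightarrow>
      itemsI G' qs S \<Longrightarrow> trieI G' (map K qs) \<Longrightarrow> G' aDEP 0 0 = 0 \<Longrightarrow> Q (t', R', G')"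
  shows "wp (p_global d m) Q (t, R, G)"
proof -
  let ?n = "length ps" and ?P = "\<lambda>x. \<exists>y. (x, y) \<in># S"
  define c where "c = 700 + 500 * d + 100 * (d * m)"
  have itp: "distinct ps" "set ps \<subseteq> domain A d" "?n \<le> NR" "size S \<le> N" using it by (auto simp: itemsI_def)
  have key: "G aKEY i l = K (ps ! i) l" if "i < ?n" "l < d" for i l using it that by (simp add: itemsI_def)
  have ic: "G aIC i (of_bool y) = count S (ps ! i, y)" if "i < ?n" for i y using it that by (simp add: itemsI_def)
  define J where "J = (\<lambda>i (t', R', G'). t' \<le> t + 50 + i * c \<and> R' rOLD = i \<and> R' rM0 = ?n \<and>
     R' rNI = length (filter ?P (take i ps)) \<and>
     lst (\<lambda>i. G' aINX i 0) (R' rLIST) (rev [0..<length (filter ?P (take i ps))]) \<and>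
     (\<forall>j<length (filter ?P (take i ps)). G' aLST j 0 = 1) \<and> trieI G' (map K (filter ?P (take i ps))) \<and>
     (\<forall>j<length (filter ?P (take i ps)). (\<forall>l<d. G' aKEY j l = K (filter ?P (take i ps) ! j) l) \<and>
        (\<forall>y. G' aIC j (of_bool y) = count S (filter ?P (take i ps) ! j, y))) \<and>
     (\<forall>j<?n. i \<le> j \<longrightarrow> (\<forall>l<d. G' aKEY j l = K (ps ! j) l) \<and> (\<forall>y. G' aIC j (of_bool y) = count S (ps ! j, y))))"
  show ?thesis unfolding p_global_def
    apply (simp add: wbd r)
    apply (rule wp_for[where J = J and i = 0 and n = ?n])
    subgoal using key ic by (simp add: J_def trieI_def)
    subgoal by simp
    subgoal premises pp for i t' R' G'
    proof -
      let ?q = "filter ?P (take i ps)"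
      let ?x = "ps ! i"
      have J: "t' \<le> t + 50 + i * c" "R' rOLD = i" "R' rM0 = ?n" "R' rNI = length ?q"
        "lst (\<lambda>i. G' aINX i 0) (R' rLIST) (rev [0..<length ?q])"
        "\<And>j. j < length ?q \<Longrightarrow> G' aLST j 0 = 1" "trieI G' (map K ?q)"
        "\<And>j l. j < length ?q \<Longrightarrow> l < d \<Longrightarrow> G' aKEY j l = K (?q ! j) l"
        "\<And>j y. j < length ?q \<Longrightarrow> G' aIC j (of_bool y) = count S (?q ! j, y)"
        "\<And>j l. j < ?n \<Longrightarrow> i \<le> j \<Longrightarrow> l < d \<Longrightarrow> G' aKEY j l = K (ps ! j) l"
        "\<And>j y. j < ?n \<Longrightarrow> i \<le> j \<Longrightarrow> G' aIC j (of_bool y) = count S (ps ! j, y)"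
        using pp(1) unfolding J_def prod.case by blast+
      have ts: "take (Suc i) ps = take i ps @ [?x]" using pp(2) by (simp add: take_Suc_conv_app_nth)
      have nq: "length ?q \<le> i" using length_filter_le[of ?P "take i ps"] pp(2) by simp
      have iN: "i < NR" "length ?q < NR" using pp(2) itp(3) nq by linarith+
      have c01: "G' aIC i 0 = count S (?x, False)" "G' aIC i (Suc 0) = count S (?x, True)"
        using J(11)[OF pp(2), of False] J(11)[OF pp(2), of True] by auto
      have w: "count S (?x, False) + count S (?x, True) < W" "Suc i < W"
      proof -
        have "count S (?x, False) \<le> N" "count S (?x, True) \<le> N"
          using count_le_size[of S] itp(4) order_trans by blast+
        then show "count S (?x, False) + count S (?x, True) < W" using N_Z by (intro wlt) simp
        show "Suc i < W" using iN wbd by linarith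
      qed
      have P: "?P ?x \<longleftrightarrow> 0 < count S (?x, False) + count S (?x, True)"
        by (metis (full_types) add_gr_0 count_greater_zero_iff)
      define cF where "cF = count S (?x, False)"
      define cT where "cT = count S (?x, True)"
      note c01 = c01[folded cF_def cT_def] and w = w[folded cF_def cT_def] and P = P[folded cF_def cT_def]
      show ?thesis
      proof (cases "?P ?x")
        case False
        then have z: "cF = 0" "cT = 0" using P by simp_all
        have tk: "filter ?P (take (Suc i) ps) = ?q" using False by (simp add: ts)
        have tb: "t' + 100 \<le> t + 50 + Suc i * c" using J(1) by (simp add: c_def)
        show ?thesis
          apply (simp add: J(2,3) c01 z wbd wids iN w pp(2))
          unfolding J_def prod.case tk
          using J tb by (auto simp: Suc_le_eq)
      next
        case True
        then have p: "0 < cF \<or> 0 < cT" using P by simp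
        have tk: "filter ?P (take (Suc i) ps) = ?q @ [?x]" using True by (simp add: ts)
        have xd: "?x \<in> domain A d" using itp(2) nth_mem[OF pp(2)] by blast
        show ?thesis
          apply (simp add: J(2,3) c01 p wbd wids iN w pp(2))
          apply (rule move[where n = "length ?q" and qs = ?q and i = i and x = ?x])
          subgoal using J by simp
          subgoal by simp
          subgoal by (rule iN)
          subgoal using J by simp
          subgoal by (rule iN)
          subgoal by (rule J)
          subgoal using J(10)[OF pp(2)] by simp
          subgoal by (rule xd)
          subgoal premises m for t2 R2 G2
          proof -
            have tb: "t2 + 50 \<le> t + 50 + Suc i * c" using m(1) J(1) by (simp add: c_def)
            have o: "G2 a j s = G' a j s" if "a \<noteq> aTRI" "j \<noteq> length ?q" for a j s using m(11)[OF that] .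
            show ?thesis
              apply (simp add: m(4) w wbd)
              unfolding J_def prod.case tk
              apply (intro conjI allI impI)
              subgoal using tb by simp
              subgoal by simp
              subgoal using m(5) J(3) by simp
              subgoal using m(2) by simp
              subgoal
              proof -
                have "lst (\<lambda>i. G2 aINX i 0) (R' rLIST) (rev [0..<length ?q])" by (rule lst_cong[OF J(5)]) (auto intro!: o)
                then show ?thesis using m(3,9) by simp
              qed
              subgoal for j using m(10) o[of aLST j 0] J(6)[of j] by (cases "j = length ?q") auto
              subgoal using m(8) by simp
              subgoal for j l using m(7)[of l] o[of aKEY j l] J(8)[of j l] by (cases "j = length ?q") (auto simp: nth_append)
              subgoal for j y
              proof (cases "j = length ?q")
                case True
                then show ?thesis using m(6)[of "of_bool y"] J(11)[OF pp(2), of y] of_bool_less[of y] by simp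
              next
                case False
                moreover assume "j < length (?q @ [?x])"
                ultimately show ?thesis using o[of aIC j "of_bool y"] J(9)[of j y] by (simp add: nth_append)
              qed
              subgoal for j l using o[of aKEY j l] J(10)[of j l] nq by simp
              subgoal for j y using o[of aIC j "of_bool y"] J(11)[of j y] nq by simp
              done
          qed
          done
      qed
    qed
    subgoal premises pp for t' R' G'
    proof -
      note J = pp[unfolded J_def prod.case take_all[OF order.refl], folded qs_def]
      have NR0: "0 < NR" using NR_N by simp
      have lq: "length qs \<le> NR" unfolding qs_def by (rule le_trans[OF length_filter_le itp(3)])
      have tb: "?n * c \<le> ?n * (1000 + 500 * d + 100 * (d * m))" unfolding c_def by (intro mult_le_mono2) simp
      have it': "itemsI G' qs S" unfolding itemsI_def using J itp lq by (auto simp: qs_def)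
      have R': "R' rOLD = ?n" "R' rM0 = ?n" and J1: "t' \<le> t + 50 + ?n * c" using J by auto
      show ?thesis
        apply (simp add: R' wbd wids NR0)
        apply (rule Q)
        subgoal using J1 tb by linarith
        subgoal using J by simp
        subgoal by simp
        subgoal by simp
        subgoal by simp
        subgoal by simp
        subgoal using J by (simp add: upd_apply)
        subgoal using J by (simp add: upd_apply)
        subgoal using it' by (simp add: itemsI_def upd_apply)
        subgoal using J by (simp add: trieI_def upd_apply)
        subgoal by (simp add: upd_apply)
        done
    qed
    done
qed

end

section \<open>Replacing a subtree\<close>

context algo
begin

primrec rpl :: "point \<Rightarrow> atr \<Rightarrow> atr \<Rightarrow> atr" where
  "rpl x new (AL v xs S0 c) = new"
| "rpl x new (AN v j a S0 c l r) = (if c = budget q S0 then new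
     else if K x j \<le> a then AN v j a S0 (Suc c) (rpl x new l) r else AN v j a S0 (Suc c) l (rpl x new r))"

text \<open>\<open>fd\<close>, \<open>fS\<close>, \<open>fX\<close> and \<open>fl\<close> describe
  the place of \<open>ft x T\<close> in the whole tree: its depth, its multiset, its region and the
  levels of its ancestors.\<close>

primrec fd :: "point \<Rightarrow> atr \<Rightarrow> nat \<Rightarrow> nat" where
  "fd x (AL v xs S0 c) dep = dep"
| "fd x (AN v j a S0 c l r) dep = (if c = budget q S0 then dep
     else if K x j \<le> a then fd x l (Suc dep) else fd x r (Suc dep))"

primrec fS :: "point \<Rightarrow> atr \<Rightarrow> example multiset \<Rightarrow> example multiset" where
  "fS x (AL v xs S0 c) S = S"
| "fS x (AN v j a S0 c l r) S = (if c = budget q S0 then S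
     else if K x j \<le> a then fS x l (sle j a S) else fS x r (sgt j a S))"

primrec fX :: "point \<Rightarrow> atr \<Rightarrow> point set \<Rightarrow> point set" where
  "fX x (AL v xs S0 c) X = X"
| "fX x (AN v j a S0 c l r) X = (if c = budget q S0 then X
     else if K x j \<le> a then fX x l {x \<in> X. K x j \<le> a} else fX x r {x \<in> X. \<not> K x j \<le> a})"

primrec fl :: "point \<Rightarrow> atr \<Rightarrow> nat set \<Rightarrow> nat set" where
  "fl x (AL v xs S0 c) ls = ls"
| "fl x (AN v j a S0 c l r) ls = (if c = budget q S0 then ls
     else if K x j \<le> a then fl x l (insert (lev S0) ls) else fl x r (insert (lev S0) ls))"

text \<open>The lists between the registration of a new record at its leaf and the rebuild.\<close>

primrec addl :: "point \<Rightarrow> nat list \<Rightarrow> atr \<Rightarrow> atr" where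
  "addl x il (AL v xs S0 c) = AL v (il @ xs) S0 c"
| "addl x il (AN v j a S0 c l r) = (if K x j \<le> a then AN v j a S0 c (addl x il l) r else AN v j a S0 c l (addl x il r))"

text \<open>A vertex contributes its counter unless one of its ancestors, whose levels are \<open>ls\<close>, has the
  same level; so an update adds at most 1 per level to the potential, and the first vertex of its
  level has the largest counter.\<close>

primrec pot :: "nat set \<Rightarrow> atr \<Rightarrow> nat" where
  "pot ls (AL v xs S0 c) = (if lev S0 \<in> ls then 0 else c)"
| "pot ls (AN v j a S0 c l r) = (if lev S0 \<in> ls then 0 else c) + pot (insert (lev S0) ls) l + pot (insert (lev S0) ls) r"

primrec szok :: "atr \<Rightarrow> bool" where
  "szok (AL v xs S0 c) \<longleftrightarrow> size S0 \<le> N"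
| "szok (AN v j a S0 c l r) \<longleftrightarrow> size S0 \<le> N \<and> szok l \<and> szok r"

lemma upS_filter:
  "P (x, y) \<Longrightarrow> filter_mset P (upS kd x y S) = upS kd x y (filter_mset P S)"
  "\<not> P (x, y) \<Longrightarrow> filter_mset P (upS kd x y S) = filter_mset P S"
  by (simp_all add: upS_def)

lemma close_upS: "close S0 c S \<Longrightarrow> close S0 (Suc c) (upS kd x y S)"
  unfolding upS_def by (auto intro: close.add[of S0 c S "(x, y)", simplified] close.rem)

lemma fS_upS: "fS x T (upS kd x y S) = upS kd x y (fS x T S)"
  by (induction T arbitrary: S) (auto simp: upS_filter)

lemma fS_count: "count (fS x T S) (x, y) = count S (x, y)"
  by (induction T arbitrary: S) auto

lemma fS_filter: "fS x T (filter_mset (\<lambda>e. fst e \<in> X) S) = filter_mset (\<lambda>e. fst e \<in> fX x T X) S"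
proof (induction T arbitrary: X)
  case (AN v j a S0 c l r)
  have *: "filter_mset (\<lambda>e. K (fst e) j \<le> a) (filter_mset (\<lambda>e. fst e \<in> X) S) = filter_mset (\<lambda>e. fst e \<in> {x \<in> X. K x j \<le> a}) S"
    "filter_mset (\<lambda>e. \<not> K (fst e) j \<le> a) (filter_mset (\<lambda>e. fst e \<in> X) S) = filter_mset (\<lambda>e. fst e \<in> {x \<in> X. \<not> K x j \<le> a}) S"
    unfolding filter_filter_mset by (auto intro!: filter_mset_cong)
  show ?case unfolding fS.simps fX.simps * AN.IH by auto
qed simp

lemma ft_sub:
  "set (ndl (ft x T)) \<subseteq> set (ndl T)" "set (itl (ft x T)) \<subseteq> set (itl T)" "set (tset x T) \<subseteq> set (ndl T)"
  by (induction T) auto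

lemma ft_distinct:
  "distinct (ndl T) \<Longrightarrow> distinct (ndl (ft x T))" "distinct (itl T) \<Longrightarrow> distinct (itl (ft x T))"
  by (induction T) auto

lemma tset_disj: "distinct (ndl T) \<Longrightarrow> set (tset x T) \<inter> set (ndl (ft x T)) = {}"
proof (induction T)
  case (AN v j a S0 c l r)
  then show ?case using ft_sub(1)[of x l] ft_sub(1)[of x r] by auto
qed simp

lemma lf_ft: "lf x (ft x T) = lf x T"
  by (induction T) auto

lemma root_rpl: "root new = root (ft x T) \<Longrightarrow> root (rpl x new T) = root T"
  by (induction T) auto

lemma rep_ft: "rep G dep S T e \<Longrightarrow> rep G (fd x T dep) (fS x T S) (ft x T) (fe x T e)"
  by (induction T arbitrary: dep S e) auto

lemma wf_ft: "wf dep X S T \<Longrightarrow> wf (fd x T dep) (fX x T X) (fS x T S) (ft x T)"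
  by (induction T arbitrary: dep S X) auto

lemma plc_ft: "plc ps X T \<Longrightarrow> plc ps (fX x T X) (ft x T)"
  by (induction T arbitrary: X) auto

lemma wf_mono: "wf dep X S T \<Longrightarrow> X \<subseteq> Y \<Longrightarrow> wf dep Y S T"
proof (induction T arbitrary: dep X Y S)
  case (AN v j a S0 c l r)
  have "{x \<in> X. K x j \<le> a} \<subseteq> {x \<in> Y. K x j \<le> a}" "{x \<in> X. \<not> K x j \<le> a} \<subseteq> {x \<in> Y. \<not> K x j \<le> a}"
    using AN.prems(2) by auto
  then have "wf (Suc dep) {x \<in> Y. K x j \<le> a} (sle j a S) l" "wf (Suc dep) {x \<in> Y. \<not> K x j \<le> a} (sgt j a S) r"
    using AN.IH AN.prems(1) by auto
  then show ?case using AN.prems by auto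
qed auto

text \<open>A frame rule: outside \<open>ft x T\<close> the memory has changed only in the budgets
  on the route, matching the increased counters of \<open>rpl\<close>.\<close>

lemma rep_rpl:
  assumes "rep G dep S T e" "distinct (ndl T)" "distinct (itl T)" "root new = root (ft x T)"
    "rep Gn (fd x T dep) (fS x T (upS kd x y S)) new (fe x T e)"
    "\<And>a i s. i \<in> set (ndl T) \<Longrightarrow> i \<notin> set (ndl (ft x T)) \<Longrightarrow> a \<in> ndarr \<Longrightarrow> a \<noteq> aBUD \<Longrightarrow> Gn a i s = G a i s"
    "\<And>i. i \<in> set (ndl T) \<Longrightarrow> i \<notin> set (ndl (ft x T)) \<Longrightarrow> Gn aBUD i 0 = G aBUD i 0 - (if i \<in> set (tset x T) then 1 else 0)"
    "\<And>i s. i \<in> set (itl T) \<Longrightarrow> i \<notin> set (itl (ft x T)) \<Longrightarrow> Gn aINX i s = G aINX i s"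
  shows "rep Gn dep (upS kd x y S) (rpl x new T) e"
  using assms
proof (induction T arbitrary: dep S e)
  case (AN v j a S0 c l r)
  note P = AN.prems
  have bud: "G aBUD v 0 + c = budget q S0" using P(1) by simp
  show ?case
  proof (cases "c = budget q S0")
    case True
    then show ?thesis using P(5) by simp
  next
    case False
    have vn: "v \<notin> set (ndl l)" "v \<notin> set (ndl r)" "set (ndl l) \<inter> set (ndl r) = {}" "set (itl l) \<inter> set (itl r) = {}"
      using P(2,3) by auto
    show ?thesis
    proof (cases "K x j \<le> a")
      case le: True
      have u: "ft x (AN v j a S0 c l r) = ft x l" "tset x (AN v j a S0 c l r) = v # tset x l"
        "fe x (AN v j a S0 c l r) e = fe x l (Suc (root r))" "fd x (AN v j a S0 c l r) dep = fd x l (Suc dep)"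
        "fS x (AN v j a S0 c l r) (upS kd x y S) = fS x l (upS kd x y (sle j a S))"
        using False le by (auto simp: upS_filter)
      note P = P[unfolded u]
      have sub: "set (ndl (ft x l)) \<subseteq> set (ndl l)" "set (itl (ft x l)) \<subseteq> set (itl l)" "set (tset x l) \<subseteq> set (ndl l)"
        by (rule ft_sub)+
      have 1: "rep Gn (Suc dep) (upS kd x y (sle j a S)) (rpl x new l) (Suc (root r))"
      proof (rule AN.IH(1))
        show "Gn aBUD i 0 = G aBUD i 0 - (if i \<in> set (tset x l) then 1 else 0)"
          if "i \<in> set (ndl l)" "i \<notin> set (ndl (ft x l))" for i using P(7)[of i] that vn by auto
      qed (use P in auto)
      have 2: "rep Gn (Suc dep) (sgt j a S) r e"
      proof (rule rep_cong[where G = G])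
        fix a' i and s :: nat assume a: "a' \<in> ndarr" "i \<in> set (ndl r)" "s = 0 \<or> a' = aNN"
        then have i: "i \<notin> set (ndl (ft x l))" "i \<noteq> v" "i \<notin> set (tset x l)" using sub vn by auto
        show "Gn a' i s = G a' i s" using P(6)[of i a' s] P(7)[of i] a i by (cases "a' = aBUD") auto
      next
        fix i and s :: nat assume a: "i \<in> set (itl r)"
        then have "i \<notin> set (itl (ft x l))" using sub(2) vn(4) by blast
        then show "Gn aINX i s = G aINX i s" using P(8)[of i s] a by simp
      qed (use P in auto)
      have v: "v \<notin> set (ndl (ft x l))" using sub vn by auto
      have "Gn a' v s = G a' v s" if "a' \<in> ndarr" "a' \<noteq> aBUD" for a' s using P(6)[of v a' s] v that by simp
      moreover have "Gn aBUD v 0 = G aBUD v 0 - 1" using P(7)[of v] v by simp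
      moreover have "root (rpl x new l) = root l" by (rule root_rpl) (rule P(4))
      ultimately show ?thesis using P(1) False le 1 2 bud by (simp add: ndarr_def upS_filter)
    next
      case gt: False
      have u: "ft x (AN v j a S0 c l r) = ft x r" "tset x (AN v j a S0 c l r) = v # tset x r"
        "fe x (AN v j a S0 c l r) e = fe x r e" "fd x (AN v j a S0 c l r) dep = fd x r (Suc dep)"
        "fS x (AN v j a S0 c l r) (upS kd x y S) = fS x r (upS kd x y (sgt j a S))"
        using False gt by (auto simp: upS_filter)
      note P = P[unfolded u]
      have sub: "set (ndl (ft x r)) \<subseteq> set (ndl r)" "set (itl (ft x r)) \<subseteq> set (itl r)" "set (tset x r) \<subseteq> set (ndl r)"
        by (rule ft_sub)+
      have 1: "rep Gn (Suc dep) (upS kd x y (sgt j a S)) (rpl x new r) e"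
      proof (rule AN.IH(2))
        show "Gn aBUD i 0 = G aBUD i 0 - (if i \<in> set (tset x r) then 1 else 0)"
          if "i \<in> set (ndl r)" "i \<notin> set (ndl (ft x r))" for i using P(7)[of i] that vn by auto
      qed (use P in auto)
      have 2: "rep Gn (Suc dep) (sle j a S) l (Suc (root r))"
      proof (rule rep_cong[where G = G])
        fix a' i and s :: nat assume a: "a' \<in> ndarr" "i \<in> set (ndl l)" "s = 0 \<or> a' = aNN"
        then have i: "i \<notin> set (ndl (ft x r))" "i \<noteq> v" "i \<notin> set (tset x r)" using sub vn by auto
        show "Gn a' i s = G a' i s" using P(6)[of i a' s] P(7)[of i] a i by (cases "a' = aBUD") auto
      next
        fix i and s :: nat assume a: "i \<in> set (itl l)"
        then have "i \<notin> set (itl (ft x r))" using sub(2) vn(4) by blast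
        then show "Gn aINX i s = G aINX i s" using P(8)[of i s] a by simp
      qed (use P in auto)
      have v: "v \<notin> set (ndl (ft x r))" using sub vn by auto
      have "Gn a' v s = G a' v s" if "a' \<in> ndarr" "a' \<noteq> aBUD" for a' s using P(6)[of v a' s] v that by simp
      moreover have "Gn aBUD v 0 = G aBUD v 0 - 1" using P(7)[of v] v by simp
      moreover have "root (rpl x new r) = root r" by (rule root_rpl) (rule P(4))
      ultimately show ?thesis using P(1) False gt 1 2 bud by (simp add: ndarr_def upS_filter)
    qed
  qed
qed simp

text \<open>The vertices above \<open>ft x T\<close> are unspent and tolerate one more update.
  Weight and counter of the replaced subtree may grow by 1, which the incremented counter of the
  parent makes up for.\<close>

lemma wf_rpl:
  assumes "wf dep X S T" "wf (fd x T dep) (fX x T X) (fS x T (upS kd x y S)) new"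
    "wt new \<le> wt (ft x T) + 1" "cof new \<le> cof (ft x T) + 1"
  shows "wf dep X (upS kd x y S) (rpl x new T) \<and> wt (rpl x new T) \<le> wt T + 1 \<and> cof (rpl x new T) \<le> cof T + 1"
  using assms
proof (induction T arbitrary: dep X S)
  case (AN v j a S0 c l r)
  show ?case
  proof (cases "c = budget q S0")
    case True
    then show ?thesis using AN.prems by simp
  next
    case False
    then have c: "Suc c \<le> budget q S0" "close S0 (Suc c) (upS kd x y S)" using AN.prems(1) close_upS by auto
    show ?thesis
    proof (cases "K x j \<le> a")
      case True
      have "wf (Suc dep) {x \<in> X. K x j \<le> a} (upS kd x y (sle j a S)) (rpl x new l) \<and>
          wt (rpl x new l) \<le> wt l + 1 \<and> cof (rpl x new l) \<le> cof l + 1"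
        by (rule AN.IH(1)) (use AN.prems False True in \<open>auto simp: upS_filter\<close>)
      then show ?thesis using AN.prems(1) c False True by (simp add: upS_filter)
    next
      case gt: False
      have "wf (Suc dep) {x \<in> X. \<not> K x j \<le> a} (upS kd x y (sgt j a S)) (rpl x new r) \<and>
          wt (rpl x new r) \<le> wt r + 1 \<and> cof (rpl x new r) \<le> cof r + 1"
        by (rule AN.IH(2)) (use AN.prems False gt in \<open>auto simp: upS_filter\<close>)
      then show ?thesis using AN.prems(1) c False gt by (simp add: upS_filter)
    qed
  qed
qed simp

lemma snap_rpl: "\<not> spent T \<Longrightarrow> ft x T \<noteq> T \<Longrightarrow> snap (rpl x new T) = snap T \<and> cof (rpl x new T) = Suc (cof T)"
  by (cases T) (auto simp: spent_def)

lemma ndl_rpl: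
  assumes "distinct (ndl T)" "distinct (ndl new)" "set (ndl new) \<inter> (set (ndl T) - set (ndl (ft x T))) = {}"
  shows "set (ndl (rpl x new T)) = set (ndl T) - set (ndl (ft x T)) \<union> set (ndl new) \<and> distinct (ndl (rpl x new T))"
  using assms
proof (induction T)
  case (AN v j a S0 c l r)
  have sub: "set (ndl (ft x l)) \<subseteq> set (ndl l)" "set (ndl (ft x r)) \<subseteq> set (ndl r)" by (rule ft_sub)+
  show ?case
  proof (cases "c = budget q S0")
    case False
    show ?thesis
    proof (cases "K x j \<le> a")
      case True
      have "set (ndl (rpl x new l)) = set (ndl l) - set (ndl (ft x l)) \<union> set (ndl new) \<and> distinct (ndl (rpl x new l))"
        by (rule AN.IH(1)) (use AN.prems False True in auto)
      then show ?thesis using AN.prems sub False True by auto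
    next
      case gt: False
      have "set (ndl (rpl x new r)) = set (ndl r) - set (ndl (ft x r)) \<union> set (ndl new) \<and> distinct (ndl (rpl x new r))"
        by (rule AN.IH(2)) (use AN.prems False gt in auto)
      then show ?thesis using AN.prems sub False gt by auto
    qed
  qed (use AN.prems in auto)
qed auto

lemma itl_rpl:
  assumes "distinct (itl T)" "distinct (itl new)" "set (itl new) \<inter> (set (itl T) - set (itl (ft x T))) = {}"
  shows "set (itl (rpl x new T)) = set (itl T) - set (itl (ft x T)) \<union> set (itl new) \<and> distinct (itl (rpl x new T))"
  using assms
proof (induction T)
  case (AN v j a S0 c l r)
  have sub: "set (itl (ft x l)) \<subseteq> set (itl l)" "set (itl (ft x r)) \<subseteq> set (itl r)" by (rule ft_sub)+
  show ?case
  proof (cases "c = budget q S0")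
    case False
    show ?thesis
    proof (cases "K x j \<le> a")
      case True
      have "set (itl (rpl x new l)) = set (itl l) - set (itl (ft x l)) \<union> set (itl new) \<and> distinct (itl (rpl x new l))"
        by (rule AN.IH(1)) (use AN.prems False True in auto)
      then show ?thesis using AN.prems sub False True by auto
    next
      case gt: False
      have "set (itl (rpl x new r)) = set (itl r) - set (itl (ft x r)) \<union> set (itl new) \<and> distinct (itl (rpl x new r))"
        by (rule AN.IH(2)) (use AN.prems False gt in auto)
      then show ?thesis using AN.prems sub False gt by auto
    qed
  qed (use AN.prems in auto)
qed auto

lemma plc_rpl: "plc ps X T \<Longrightarrow> plc ps (fX x T X) new \<Longrightarrow> plc ps X (rpl x new T)"
  by (induction T arbitrary: X) auto

lemma plc_cong: "plc ps X T \<Longrightarrow> (\<And>i. i \<in> set (itl T) \<Longrightarrow> ps' ! i = ps ! i) \<Longrightarrow> plc ps' X T"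
  by (induction T arbitrary: X) auto

lemma szok_rpl: "szok T \<Longrightarrow> szok new \<Longrightarrow> szok (rpl x new T)"
  by (induction T) auto

lemma szok_ft: "szok T \<Longrightarrow> szok (ft x T)"
  by (induction T) auto

lemma szok_snap: "szok T \<Longrightarrow> size (snap T) \<le> N"
  by (cases T) auto

lemma szok_built: "wf dep X S T \<Longrightarrow> czero T \<Longrightarrow> size S \<le> N \<Longrightarrow> szok T"
proof (induction T arbitrary: dep X S)
  case (AL v xs S0 c)
  then have "S0 = S" by (auto elim: close.cases)
  then show ?case using AL by simp
next
  case (AN v j a S0 c l r)
  then have "S0 = S" by (auto elim: close.cases)
  moreover have "size (sle j a S) \<le> N" "size (sgt j a S) \<le> N"
    using AN.prems(3) size_filter_mset_lesseq order_trans by blast+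
  ultimately show ?case using AN by auto
qed

section \<open>The potential\<close>

lemma pot_czero: "czero T \<Longrightarrow> pot ls T = 0"
  by (induction T arbitrary: ls) auto

lemma cof_ft: "wf dep X S T \<Longrightarrow> cof (ft x T) \<le> cof T"
proof (induction T arbitrary: dep X S)
  case (AN v j a S0 c l r)
  have "cof (ft x l) \<le> cof l" "cof (ft x r) \<le> cof r" using AN by auto
  then show ?case using AN.prems by auto
qed simp

text \<open>An ancestor of the same level has the same budget, and its counter is at least that of
  its descendants; it would have been exhausted first. So the counter of an exhausted
  \<open>ft x T\<close> is fully present in the potential.\<close>

lemma lev_fl: "wf dep X S T \<Longrightarrow> spent (ft x T) \<Longrightarrow> lev (snap (ft x T)) \<in> fl x T ls \<Longrightarrow> lev (snap (ft x T)) \<in> ls"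
proof (induction T arbitrary: dep X S ls)
  case (AN v j a S0 c l r)
  show ?case
  proof (cases "c = budget q S0")
    case False
    then have c: "c < budget q S0" using AN.prems(1) by simp
    define u where "u = (if K x j \<le> a then l else r)"
    have u: "ft x (AN v j a S0 c l r) = ft x u" "fl x (AN v j a S0 c l r) ls = fl x u (insert (lev S0) ls)"
      using False by (auto simp: u_def)
    obtain X' S' where wu: "wf (Suc dep) X' S' u" and cu': "cof u \<le> c"
      using AN.prems(1) by (cases "K x j \<le> a") (auto simp: u_def)
    have cu: "cof (ft x u) \<le> c" by (rule order_trans[OF cof_ft[OF wu] cu'])
    have "lev (snap (ft x u)) \<in> insert (lev S0) ls"
    proof (cases "K x j \<le> a")
      case True
      then have e: "u = l" by (simp add: u_def)
      show ?thesis using AN.IH(1)[OF wu[unfolded e], where ls = "insert (lev S0) ls"] AN.prems(2,3) unfolding u by (simp add: e)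
    next
      case F: False
      then have e: "u = r" by (simp add: u_def)
      show ?thesis using AN.IH(2)[OF wu[unfolded e], where ls = "insert (lev S0) ls"] AN.prems(2,3) unfolding u by (simp add: e)
    qed
    moreover have "lev (snap (ft x u)) \<noteq> lev S0"
    proof
      assume "lev (snap (ft x u)) = lev S0"
      then have "budget q (snap (ft x u)) = budget q S0" by (simp add: budget_def)
      then show False using AN.prems(2) cu c unfolding u spent_def by simp
    qed
    ultimately show ?thesis unfolding u by simp
  qed (use AN.prems in simp)
qed simp

lemma lev_le: "size S \<le> N \<Longrightarrow> lev S \<le> floor_log N"
  unfolding lev_def by (rule monoD[OF floor_log_mono])

lemma pot_rpl:
  assumes "szok T" "pot (fl x T ls) new + g \<le> pot (fl x T ls) (ft x T) + card ({..floor_log N} - fl x T ls)"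
  shows "pot ls (rpl x new T) + g \<le> pot ls T + card ({..floor_log N} - ls)"
  using assms
proof (induction T arbitrary: ls)
  case (AN v j a S0 c l r)
  show ?case
  proof (cases "c = budget q S0")
    case False
    have L: "lev S0 \<le> floor_log N" using AN.prems(1) lev_le by simp
    have card: "card ({..floor_log N} - insert (lev S0) ls) + (if lev S0 \<in> ls then 0 else 1) = card ({..floor_log N} - ls)"
    proof (cases "lev S0 \<in> ls")
      case True
      then show ?thesis by (simp add: insert_absorb)
    next
      case F: False
      have "{..floor_log N} - insert (lev S0) ls = ({..floor_log N} - ls) - {lev S0}" by auto
      moreover have "lev S0 \<in> {..floor_log N} - ls" using L F by simp
      ultimately show ?thesis using F card.remove[of "{..floor_log N} - ls" "lev S0"] by simp
    qed
    show ?thesis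
    proof (cases "K x j \<le> a")
      case True
      have "pot (insert (lev S0) ls) (rpl x new l) + g \<le>
          pot (insert (lev S0) ls) l + card ({..floor_log N} - insert (lev S0) ls)"
        by (rule AN.IH(1)) (use AN.prems False True in auto)
      then show ?thesis using card False True by (auto split: if_splits)
    next
      case gt: False
      have "pot (insert (lev S0) ls) (rpl x new r) + g \<le>
          pot (insert (lev S0) ls) r + card ({..floor_log N} - insert (lev S0) ls)"
        by (rule AN.IH(2)) (use AN.prems False gt in auto)
      then show ?thesis using card False gt by (auto split: if_splits)
    qed
  qed (use AN.prems in simp)
qed simp

lemma pot_spent:
  assumes "wf dep X S T" "szok T" "spent (ft x T)" "czero new"
  shows "pot {} (rpl x new T) + (budget q (snap (ft x T)) + 1) \<le> pot {} T + (floor_log N + 1)"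
proof -
  let ?U = "ft x T" and ?ls = "fl x T {}"
  have nl: "lev (snap ?U) \<notin> ?ls" using lev_fl[OF assms(1,3)] by blast
  have "budget q (snap ?U) \<le> pot ?ls ?U" using nl assms(3) by (cases ?U) (auto simp: spent_def)
  moreover have "1 \<le> card ({..floor_log N} - ?ls)"
  proof -
    have "lev (snap ?U) \<in> {..floor_log N} - ?ls" using nl lev_le szok_snap szok_ft assms(2) by simp
    then have "{..floor_log N} - ?ls \<noteq> {}" by blast
    then show ?thesis by (simp add: Suc_le_eq card_gt_0_iff)
  qed
  ultimately have "pot ?ls new + (budget q (snap ?U) + 1) \<le> pot ?ls ?U + card ({..floor_log N} - ?ls)"
    using pot_czero[OF assms(4)] by simp
  from pot_rpl[OF assms(2) this] show ?thesis by simp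
qed

lemma pot_unspent:
  assumes "szok T" "ft x T = AL v xs S0 c" "new = AL v ys S0 (Suc c)"
  shows "pot {} (rpl x new T) \<le> pot {} T + (floor_log N + 1)"
proof -
  let ?ls = "fl x T {}"
  have "lev S0 \<le> floor_log N" using szok_ft[OF assms(1), of x] assms(2) lev_le by simp
  then have "lev S0 \<notin> ?ls \<Longrightarrow> 1 \<le> card ({..floor_log N} - ?ls)"
    by (metis DiffI One_nat_def Suc_leI atMost_iff card_gt_0_iff empty_iff finite_Diff finite_atMost)
  then have "pot ?ls new + 0 \<le> pot ?ls (ft x T) + card ({..floor_log N} - ?ls)" using assms by auto
  from pot_rpl[OF assms(1) this] show ?thesis by simp
qed

section \<open>Registering a point at its leaf\<close>

lemma addl_simps:
  "ndl (addl x il T) = ndl T" "root (addl x il T) = root T" "set (itl (addl x il T)) = set il \<union> set (itl T)"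
  "ft x (addl x il T) = addl x il (ft x T)" "fS x (addl x il T) S = fS x T S" "fX x (addl x il T) X = fX x T X"
  "length (itl (addl x il T)) = length il + length (itl T)"
proof -
  show n: "ndl (addl x il T) = ndl T" for T by (induction T) auto
  show r: "root (addl x il T) = root T" for T by (cases T) auto
  show "set (itl (addl x il T)) = set il \<union> set (itl T)" by (induction T) auto
  show "ft x (addl x il T) = addl x il (ft x T)" by (induction T) auto
  show "fS x (addl x il T) S = fS x T S" by (induction T arbitrary: S) auto
  show "fX x (addl x il T) X = fX x T X" by (induction T arbitrary: X) auto
  show "length (itl (addl x il T)) = length il + length (itl T)" by (induction T) auto
qed

lemma addl_distinct: "distinct (itl T) \<Longrightarrow> distinct il \<Longrightarrow> set il \<inter> set (itl T) = {} \<Longrightarrow> distinct (itl (addl x il T))"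
  by (induction T) (auto simp: addl_simps)

lemma plc_addl: "plc ps X T \<Longrightarrow> (\<And>i. i \<in> set il \<Longrightarrow> ps ! i = x) \<Longrightarrow> x \<in> X \<Longrightarrow> plc ps X (addl x il T)"
  by (induction T arbitrary: X) auto

lemma shp_addl:
  assumes "shp G T e" "distinct (ndl T)"
    "\<And>a i s. a \<in> {aNXT, aRGT, aNJ, aNA} \<Longrightarrow> G' a i s = G a i s" "\<And>i s. i \<noteq> lf x T \<Longrightarrow> G' aHEAD i s = G aHEAD i s"
    "\<And>i s. i \<in> set (itl T) \<Longrightarrow> G' aINX i s = G aINX i s"
    "il = [] \<and> G' aHEAD (lf x T) 0 = G aHEAD (lf x T) 0 \<or>
     il = [cur] \<and> G' aHEAD (lf x T) 0 = Suc cur \<and> G' aINX cur 0 = G aHEAD (lf x T) 0"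
  shows "shp G' (addl x il T) e"
  using assms
proof (induction T arbitrary: e)
  case (AL v xs S0 c)
  have "lst (\<lambda>i. G' aINX i 0) (G aHEAD v 0) xs"
    by (rule lst_cong[of "\<lambda>i. G aINX i 0"]) (use AL.prems in auto)
  then show ?case using AL.prems by auto
next
  case (AN v j a S0 c l r)
  show ?case
  proof (cases "K x j \<le> a")
    case True
    have "shp G' (addl x il l) (Suc (root r))" by (rule AN.IH(1)) (use AN.prems True in auto)
    moreover have "shp G' r e"
    proof (rule shp_cong[where G = G])
      fix a' i and s :: nat assume a: "a' \<in> {aNXT, aRGT, aNJ, aNA, aHEAD}" "i \<in> set (ndl r)"
      have "lf x l \<in> set (ndl l)" by (rule lf_ndl)
      then have "i \<noteq> lf x (AN v j a S0 c l r)" using a(2) AN.prems(2) True by auto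
      then show "G' a' i s = G a' i s" using AN.prems(3,4) a(1) by auto
    qed (use AN.prems in auto)
    ultimately show ?thesis using AN.prems True by (simp add: addl_simps)
  next
    case False
    have "shp G' (addl x il r) e" by (rule AN.IH(2)) (use AN.prems False in auto)
    moreover have "shp G' l (Suc (root r))"
    proof (rule shp_cong[where G = G])
      fix a' i and s :: nat assume a: "a' \<in> {aNXT, aRGT, aNJ, aNA, aHEAD}" "i \<in> set (ndl l)"
      have "lf x r \<in> set (ndl r)" by (rule lf_ndl)
      then have "i \<noteq> lf x (AN v j a S0 c l r)" using a(2) AN.prems(2) False by auto
      then show "G' a' i s = G a' i s" using AN.prems(3,4) a(1) by auto
    qed (use AN.prems in auto)
    ultimately show ?thesis using AN.prems False by (simp add: addl_simps)
  qed
qed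

text \<open>By placement, a point on one side of a split is not listed on the other side, so
  completeness of the lists is inherited by the subtree on the route.\<close>

lemma complete_ft:
  assumes "plc ps X T" "fst ` set_mset S \<subseteq> (!) ps ` set (itl T)"
  shows "fst ` set_mset (fS x T S) \<subseteq> (!) ps ` set (itl (ft x T))"
  using assms
proof (induction T arbitrary: X S)
  case (AN v j a S0 c l r)
  have pin: "ps ! i \<in> X" if "plc ps X T" "i \<in> set (itl T)" for T X i
    using that by (induction T arbitrary: X) auto
  show ?case
  proof (cases "c = budget q S0")
    case False
    show ?thesis
    proof (cases "K x j \<le> a")
      case True
      have "fst ` set_mset (sle j a S) \<subseteq> (!) ps ` set (itl l)"
      proof
        fix z assume "z \<in> fst ` set_mset (sle j a S)"
        then have z: "z \<in> fst ` set_mset S" "K z j \<le> a" by auto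
        then obtain i where i: "i \<in> set (itl l) \<union> set (itl r)" "z = ps ! i" using AN.prems(2) by fastforce
        have "i \<notin> set (itl r)" using pin[of "{x \<in> X. \<not> K x j \<le> a}" r i] AN.prems(1) i z(2) by auto
        then show "z \<in> (!) ps ` set (itl l)" using i by auto
      qed
      then show ?thesis using AN.IH(1)[of "{x \<in> X. K x j \<le> a}" "sle j a S"] AN.prems False True by simp
    next
      case gt: False
      have "fst ` set_mset (sgt j a S) \<subseteq> (!) ps ` set (itl r)"
      proof
        fix z assume "z \<in> fst ` set_mset (sgt j a S)"
        then have z: "z \<in> fst ` set_mset S" "\<not> K z j \<le> a" by auto
        then obtain i where i: "i \<in> set (itl l) \<union> set (itl r)" "z = ps ! i" using AN.prems(2) by fastforce
        have "i \<notin> set (itl l)" using pin[of "{x \<in> X. K x j \<le> a}" l i] AN.prems(1) i z(2) by auto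
        then show "z \<in> (!) ps ` set (itl r)" using i by auto
      qed
      then show ?thesis using AN.IH(2)[of "{x \<in> X. \<not> K x j \<le> a}" "sgt j a S"] AN.prems False gt by simp
    qed
  qed (use AN.prems in simp)
qed simp

lemma plc_in: "plc ps X T \<Longrightarrow> i \<in> set (itl T) \<Longrightarrow> ps ! i \<in> X"
  by (induction T arbitrary: X) auto

text \<open>The stop pointer never denotes a vertex of the subtree itself, hence neither collecting
  nor building stops early.\<close>

lemma fe_cases: "distinct (ndl T) \<Longrightarrow> fe x T e = e \<or> (\<exists>u. fe x T e = Suc u \<and> u \<in> set (ndl T) - set (ndl (ft x T)))"
proof (induction T arbitrary: e)
  case (AN v j a S0 c l r)
  have sub: "set (ndl (ft x l)) \<subseteq> set (ndl l)" "set (ndl (ft x r)) \<subseteq> set (ndl r)" by (rule ft_sub)+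
  have rr: "root r \<in> set (ndl r)" by (rule root_ndl)
  show ?case using AN.IH(1)[of "Suc (root r)"] AN.IH(2)[of e] AN.prems sub rr by auto
qed simp

lemma ndl_length: "length (ndl T) + 1 \<le> 2 * wt T" "length (itl T) \<le> wt T"
  by (induction T) auto

text \<open>The program tells a rebuild of the whole tree by the record number of its root; distinct
  record numbers make this test sound.\<close>

lemma ft_root: "distinct (ndl T) \<Longrightarrow> root (ft x T) = root T \<Longrightarrow> ft x T = T"
proof (cases T)
  case (AN v j a S0 c l r)
  assume d: "distinct (ndl T)" "root (ft x T) = root T"
  have "root (ft x l) \<in> set (ndl l)" "root (ft x r) \<in> set (ndl r)" using root_ndl ft_sub(1) by blast+
  then show ?thesis using d AN by (auto split: if_splits)
qed simp

end

section \<open>Correctness and cost of an update\<close>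

context algo
begin

definition built where
  "built G ps S its dep e u AV R' G' T AV' \<longleftrightarrow> avail R' G' AV' \<and> AV' \<subseteq> AV \<and> root T = u \<and>
    snap T = ms ps S its \<and> set (ndl T) = insert u (AV - AV') \<and> distinct (ndl T) \<and>
    rep G' dep (ms ps S its) T e \<and> wf dep ((!) ps ` set its) (ms ps S its) T \<and> czero T \<and>
    plc ps ((!) ps ` set its) T \<and> set (itl T) = set its \<and> distinct (itl T) \<and> wt T \<le> max 1 (length its) \<and>
    (\<forall>a i s. a \<in> {aIC, aKEY, aTRI, aLST} \<longrightarrow> G' a i s = G a i s) \<and>
    (\<forall>i s. i \<notin> set its \<longrightarrow> G' aINX i s = G aINX i s) \<and>
    (\<forall>a i s. a \<noteq> aINX \<longrightarrow> i \<noteq> u \<longrightarrow> i \<notin> AV \<longrightarrow> G' a i s = G a i s)"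

lemma builtD:
  assumes "built G ps S its dep e u AV R' G' T AV'"
  shows "avail R' G' AV'" "AV' \<subseteq> AV" "root T = u"
    "snap T = ms ps S its" "set (ndl T) = insert u (AV - AV')" "distinct (ndl T)"
    "rep G' dep (ms ps S its) T e" "wf dep ((!) ps ` set its) (ms ps S its) T" "czero T"
    "plc ps ((!) ps ` set its) T" "set (itl T) = set its" "distinct (itl T)" "wt T \<le> max 1 (length its)"
    "\<And>a i s. a \<in> {aIC, aKEY, aTRI, aLST} \<Longrightarrow> G' a i s = G a i s"
    "\<And>i s. i \<notin> set its \<Longrightarrow> G' aINX i s = G aINX i s"
    "\<And>a i s. a \<noteq> aINX \<Longrightarrow> i \<noteq> u \<Longrightarrow> i \<notin> AV \<Longrightarrow> G' a i s = G a i s"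
  using assms unfolding built_def by blast+

definition p_finish :: hcom where
  "p_finish = Put1 aHEAD (V rU0) (V rLIST) ;; Put1 aNXT (V rU0) (V rTEND) ;; Asg rU (V rU0) ;; p_count d m ;;
     Asg rV1 (V rU0 \<oplus> ex.N 1) ;; p_build d m k h q"

lemma rebuild_finish: "p_rebuild d m k h q = If (Ne (V rTRIG) (ex.N 1)) p_local (p_global d m) ;; p_finish"
  unfolding p_rebuild_def p_finish_def ..

lemma finish:
  assumes it: "itemsI G ps S" "distinct its" "set its \<subseteq> {..<length ps}"
    and live: "\<And>i. i \<in> set its \<Longrightarrow> live G i"
    and l: "lst (\<lambda>i. G aINX i 0) (R rLIST) its"
    and u: "R rU0 = u" "u < NR" "u \<notin> AV" "avail R G AV" "2 * max 1 (length its) \<le> card AV + 2"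
    and dep: "dep \<le> h" "G aDEP u 0 = dep" and te: "R rTEND = te" "te = 0 \<or> te - 1 \<notin> insert u AV"
    and Q: "\<And>t' R' G' T AV'. t' \<le> t + 500 + 100 * (d * m) + 250 * (d * length its) + bt (length its) (d * m) \<Longrightarrow>
      R' rNI = R rNI \<Longrightarrow> built G ps S its dep te u AV R' G' T AV' \<Longrightarrow> Q (t', R', G')"
  shows "wp p_finish Q (t, R, G)"
proof -
  have itl: "i < NR" "G aKEY i l < m" if "i \<in> set its" "l < d" for i l
    using itok_items[OF it] that by (auto simp: itok_def)
  have lN: "lst f p its' \<Longrightarrow> set its' \<subseteq> {..<NR} \<Longrightarrow> p \<le> NR" for f p its' by (cases its') auto
  have iNR: "set its \<subseteq> {..<NR}" using itok_items[OF it] by (auto simp: itok_def)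
  have w: "u < W" "Suc u < W" using u(2) wbd by linarith+
  define G1 where "G1 = upd (upd G aHEAD u 0 (R rLIST)) aNXT u 0 te"
  show ?thesis unfolding p_finish_def
    apply (simp add: u(1,2) te(1) w wids wbd G1_def[symmetric])
    apply (rule count[where its = its])
    subgoal using u by simp
    subgoal using l by (simp add: G1_def upd_apply)
    subgoal using iNR by auto
    subgoal using itl by (simp add: G1_def upd_apply)
    subgoal using itok_items[OF it] by (simp add: itok_def nsum_def G1_def upd_apply)
    subgoal premises p for t1 R1 G2
    proof -
      have R1: "R1 rU0 = u" "R1 rTEND = te" "R1 rNI = R rNI" "R1 rFR = R rFR" "R1 rNB = R rNB"
        using p(2) u te by simp_all
      have fr: "G2 a i s = G1 a i s" if "a \<noteq> aCNT" "a \<noteq> aNN \<or> i \<noteq> u" for a i s using p(3)[of a i s] that by simp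
      have fr': "G2 a i s = G a i s" if "a \<notin> {aCNT, aNN, aHEAD, aNXT} \<or> i \<noteq> u" for a i s
        using p(3)[of a i s] that by (auto simp: G1_def upd_apply)
      have sums: "csum G1 its l a y = csum G2 its l a y" "nsum G1 its y = nsum G2 its y" for l a y
        unfolding csum_def nsum_def using fr by (auto intro!: arg_cong[of _ _ sum_list])
      have "\<And>l a y. l < d \<Longrightarrow> a < m \<Longrightarrow> y < 2 \<Longrightarrow> G2 aCNT u (cidx m l a y) = csum G2 its l a y"
        "\<And>y. y < 2 \<Longrightarrow> G2 aNN u y = nsum G2 its y"
        using p(4,5) sums by (simp_all add: u nsum_def csum_def)
      moreover have "G2 aHEAD u 0 = R rLIST" "G2 aNXT u 0 = te" "G2 aDEP u 0 = dep" "lst (\<lambda>i. G2 aINX i 0) (R rLIST) its"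
        using l dep(2) by (simp_all add: fr fr' G1_def upd_apply)
      ultimately have pe: "pend G2 u its dep te" by (simp add: pend_def)
      have it2: "itemsI G2 ps S" using it(1) by (simp add: itemsI_def fr')
      show ?thesis
        apply (simp add: R1 w wbd)
        apply (rule build_seg[where v = u and its = its and ps = ps and S = S and AV = AV and dep = dep and e = te and te = te])
        subgoal by (rule pe)
        subgoal by (rule it2)
        subgoal by (rule it)
        subgoal by (rule it)
        subgoal for i using live[of i] by (simp add: live_def fr')
        subgoal by (rule u)
        subgoal by (rule u)
        subgoal using u(3,4) by (intro avail_cong[OF u(4)]) (auto simp: R1 intro!: fr')
        subgoal by (rule u)
        subgoal by (rule dep)
        subgoal by simp
        subgoal by (simp add: R1)
        subgoal by (rule te)
        subgoal premises b for t' R' G' T AV'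
        proof -
          have "bt (length its) (card (nontriv ((!) ps ` set its))) \<le> bt (length its) (d * m)"
            unfolding bt_def using card_nontriv by simp
          then have tb: "t' + 8 \<le> t + 500 + 100 * (d * m) + 250 * (d * length its) + bt (length its) (d * m)"
            using b(1) p(1) by simp
          have "built G ps S its dep te u AV R' G' T AV'"
            unfolding built_def
            apply (intro conjI allI impI)
            subgoal by (rule b)
            subgoal by (rule b)
            subgoal by (rule b)
            subgoal by (rule b)
            subgoal by (rule b)
            subgoal by (rule b)
            subgoal by (rule b)
            subgoal by (rule b)
            subgoal by (rule b)
            subgoal by (rule b)
            subgoal by (rule b)
            subgoal by (rule b)
            subgoal by (rule b)
            subgoal for a i s using b(19)[of a i s] fr'[of a i s] by auto
            subgoal for i s using b(20)[of i s] fr'[of aINX i s] by auto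
            subgoal for a i s using b(21)[of a i s] fr'[of a i s] by auto
            done
          then have "Q (t' + 8, R', G')" using Q[OF tb] b(2) R1 by simp
          then show ?thesis using b(3,4) by (simp add: build_unfold)
        qed
        done
    qed
    done
qed

text \<open>The lists contain every active point and possibly dead ones. The last conjunct bounds
  the point records, as a record is created only by an update and a rebuild at the root compacts
  them.\<close>

definition Inv where
  "Inv S T ps R G \<longleftrightarrow> itemsI G ps S \<and> trieI G (map K ps) \<and> R rNI = length ps \<and>
    (\<forall>i<length ps. 0 < G aLST i 0 \<longleftrightarrow> i \<in> set (itl T)) \<and> set (itl T) \<subseteq> {..<length ps} \<and> distinct (itl T) \<and>
    fst ` set_mset S \<subseteq> (!) ps ` set (itl T) \<and> plc ps (domain A d) T \<and> rep G 0 S T 0 \<and> root T = 0 \<and>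
    distinct (ndl T) \<and> set (ndl T) \<subseteq> {..<NR} \<and> avail R G ({..<NR} - set (ndl T)) \<and> wf 0 (domain A d) S T \<and>
    szok T \<and> length ps \<le> size (snap T) + cof T"

lemma InvD:
  assumes "Inv S T ps R G"
  shows "itemsI G ps S" "trieI G (map K ps)" "R rNI = length ps"
    "\<And>i. i < length ps \<Longrightarrow> 0 < G aLST i 0 \<longleftrightarrow> i \<in> set (itl T)" "set (itl T) \<subseteq> {..<length ps}" "distinct (itl T)"
    "fst ` set_mset S \<subseteq> (!) ps ` set (itl T)" "plc ps (domain A d) T" "rep G 0 S T 0" "root T = 0"
    "distinct (ndl T)" "set (ndl T) \<subseteq> {..<NR}" "avail R G ({..<NR} - set (ndl T))" "wf 0 (domain A d) S T"
    "szok T" "length ps \<le> size (snap T) + cof T"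
  using assms unfolding Inv_def by blast+

lemma wf_bounds: "wf dep X S T \<Longrightarrow> cof T \<le> budget q (snap T) \<and> wt T \<le> max 1 (size (snap T)) + cof T"
  by (cases T) auto

lemma budget_le: "budget q S \<le> size S"
proof (cases "size S = 0")
  case True
  then show ?thesis using q_ge(4) by (simp add: budget_def lev_def)
next
  case False
  then have "2 ^ lev S \<le> size S" unfolding lev_def by (intro floor_log_exp2_le) (simp add: nonempty_has_size)
  moreover have "2 ^ lev S div q \<le> 2 ^ lev S" by simp
  ultimately show ?thesis unfolding budget_def by linarith
qed

text \<open>\<open>BC\<close> is the cost of a rebuild per unit of weight, \<open>C1\<close> the
  value of one unit of potential, and \<open>C2\<close> the cost of an update apart from
  rebuilding.\<close>

definition BC :: nat where
  "BC = 2 * bc + 3000 + 1000 * d + 600 * (d * m) + 250 * (d * floor_log N)"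

definition C1 :: nat where
  "C1 = 5 * q * BC"

definition C2 :: nat where
  "C2 = 3000 + 1000 * d + 1000 * (d * m)"

text \<open>The \<open>L\<close> live points are counted and distributed, while \<open>w\<close>
  also covers dead records and old vertices, which have to be traversed.\<close>

lemma rebuild_cost:
  assumes "L \<le> w" "L \<le> N" "1 \<le> w"
  shows "1500 + w * (1000 + 500 * d + 100 * (d * m)) + 100 * (d * m) + 250 * (d * L) + bt L (d * m) \<le> w * BC"
proof -
  have "floor_log L \<le> floor_log N" by (rule monoD[OF floor_log_mono assms(2)])
  then have "d * (L * floor_log L) \<le> d * (w * floor_log N)" using assms(1) by (intro mult_le_mono) auto
  moreover have "(2 * max 1 L - 1) * bc \<le> 2 * w * bc" using assms by (intro mult_le_mono1) auto
  moreover have "L * (d * m) \<le> w * (d * m)" "d * L \<le> d * w"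
    by (rule mult_le_mono1[OF assms(1)], rule mult_le_mono2[OF assms(1)])
  moreover have "1 * (d * m) \<le> w * (d * m)" by (rule mult_le_mono1[OF assms(3)])
  moreover have "w * BC = 2 * w * bc + 3000 * w + 1000 * (d * w) + 600 * (w * (d * m)) + 250 * (d * (w * floor_log N))"
    by (simp add: BC_def algebra_simps)
  moreover have "w * (1000 + 500 * d + 100 * (d * m)) = 1000 * w + 500 * (d * w) + 100 * (w * (d * m))"
    by (simp add: algebra_simps)
  ultimately show ?thesis using assms(3) unfolding bt_def by linarith
qed

text \<open>The factor 5 is the 4 of \<open>budget_spent\<close> for the snapshot plus 1 for what
  the counted updates have added since.\<close>

lemma wt_spent:
  assumes "wf dep X S T" "spent T"
  shows "wt T + 1 \<le> 5 * q * (budget q (snap T) + 1)" "size (snap T) + cof T + 1 \<le> 5 * q * (budget q (snap T) + 1)"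
proof -
  let ?b = "budget q (snap T)"
  have q: "0 < q" using q_ge by linarith
  have "size (snap T) < 4 * q * (?b + 1)" by (rule budget_spent[OF q])
  moreover have "?b + 1 \<le> q * (?b + 1)" using mult_le_mono1[of 1 q "?b + 1"] q by simp
  moreover have "5 * q * (?b + 1) = 4 * q * (?b + 1) + q * (?b + 1)" by (simp add: algebra_simps)
  ultimately have "size (snap T) + ?b + 1 < 5 * q * (?b + 1)" "1 + ?b + 1 \<le> 5 * q * (?b + 1)" using q q_ge(4)
    by linarith+
  then show "wt T + 1 \<le> 5 * q * (?b + 1)" "size (snap T) + cof T + 1 \<le> 5 * q * (?b + 1)"
    using wf_bounds[OF assms(1)] by linarith+
qed

text \<open>Releasing \<open>g\<close> units of potential yields \<open>C1 * g >= w * BC\<close>,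
  which pays for the rebuild.\<close>

lemma pot_cost:
  assumes "w \<le> 5 * q * g" "p' + g \<le> p + (l + 1)" "t' \<le> t + w * BC"
  shows "t' + C1 * p' \<le> t + C1 * p + C1 * (l + 1)"
proof -
  have "w * BC \<le> C1 * g" using mult_le_mono1[OF assms(1), of BC] by (simp add: C1_def algebra_simps)
  moreover have "C1 * (p' + g) \<le> C1 * (p + (l + 1))" by (rule mult_le_mono2[OF assms(2)])
  ultimately show ?thesis using assms(3) unfolding distrib_left by linarith
qed

end

text \<open>The situation after the walk and the change at the leaf, just before a possible rebuild.
  \<open>il\<close> holds the record that the leaf has newly listed, if any.\<close>

locale update_step = algo +
  fixes x y kd S T ps R G ps' S' cur il R3 G3
  assumes inv: "Inv S T ps R G" and x: "x \<in> domain A d"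
    and it: "itemsI G3 ps' S'" "trieI G3 (map K ps')" and S': "S' = upS kd x y S"
    and ps': "ps' = ps \<or> ps' = ps @ [x]" "cur < length ps'" "ps' ! cur = x"
    and il: "il = [] \<or> il = [cur]" "set il \<inter> set (itl T) = {}" "cur \<in> set il \<union> set (itl T)"
    and lst: "\<And>i. i < length ps' \<Longrightarrow> 0 < G3 aLST i 0 \<longleftrightarrow> i \<in> set il \<union> set (itl T)"
    and R3: "R3 rNI = length ps'" "R3 rNB = R rNB" "R3 rFR = R rFR"
      "R3 rTRIG = (if spent (ft x T) then Suc (root (ft x T)) else 0)" "spent (ft x T) \<Longrightarrow> R3 rTEND = fe x T 0"
    and G3: "\<And>a i s. a \<in> {aNXT, aRGT, aNJ, aNA, aDEP} \<Longrightarrow> G3 a i s = G a i s"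
      "\<And>i s. i \<noteq> lf x T \<Longrightarrow> G3 aHEAD i s = G aHEAD i s" "\<And>i s. i \<noteq> lf x T \<Longrightarrow> G3 aNN i s = G aNN i s"
      "\<And>b. G3 aNN (lf x T) (of_bool b) = G aNN (lf x T) (of_bool b) + count S' (x, b) - count S (x, b)"
      "\<And>i. G3 aBUD i 0 = G aBUD i 0 -
        (if i \<in> set (tset x T) \<or> \<not> spent (ft x T) \<and> i = root (ft x T) then 1 else 0)"
      "\<And>i s. i \<notin> set il \<Longrightarrow> G3 aINX i s = G aINX i s"
      "il = [] \<and> G3 aHEAD (lf x T) 0 = G aHEAD (lf x T) 0 \<or>
       il = [cur] \<and> G3 aHEAD (lf x T) 0 = Suc cur \<and> G3 aINX cur 0 = G aHEAD (lf x T) 0"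
begin

lemma mid_facts:
  "plc ps' (domain A d) T" "fst ` set_mset S' \<subseteq> (!) ps' ` (set il \<union> set (itl T))"
  "set il \<union> set (itl T) \<subseteq> {..<length ps'}" "distinct il" "length il \<le> 1" "length ps' \<le> length ps + 1" "okS S'"
  "x \<in> fX x T (domain A d)"
proof -
  note I = InvD[OF inv]
  have same: "ps' ! i = ps ! i" if "i < length ps" for i using ps'(1) that by (auto simp: nth_append)
  show 1: "plc ps' (domain A d) T" by (rule plc_cong[OF I(8)]) (use same I(5) in auto)
  have im: "(!) ps' ` set (itl T) = (!) ps ` set (itl T)" using same I(5) by (intro image_cong) auto
  have "fst ` set_mset S' \<subseteq> insert x (fst ` set_mset S)" unfolding S' upS_def by (auto dest: in_diffD)
  moreover have "x \<in> (!) ps' ` (set il \<union> set (itl T))" using il(3) ps'(3) by blast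
  moreover have "fst ` set_mset S \<subseteq> (!) ps' ` (set il \<union> set (itl T))" using I(7) im by (simp add: image_Un) blast
  ultimately show "fst ` set_mset S' \<subseteq> (!) ps' ` (set il \<union> set (itl T))" by blast
  show 2: "set il \<union> set (itl T) \<subseteq> {..<length ps'}" using il(1) ps'(1,2) I(5) by auto
  show "distinct il" "length il \<le> 1" using il(1) by auto
  show "length ps' \<le> length ps + 1" using ps'(1) by auto
  have "(!) ps' ` (set il \<union> set (itl T)) \<subseteq> set ps'" using 2 by auto
  moreover have "set ps' \<subseteq> domain A d" using it(1) by (simp add: itemsI_def)
  ultimately show "okS S'" using \<open>fst ` set_mset S' \<subseteq> (!) ps' ` (set il \<union> set (itl T))\<close> unfolding okS_def by blast
  have "x \<in> X \<Longrightarrow> x \<in> fX x T X" for T X by (induction T arbitrary: X) auto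
  then show "x \<in> fX x T (domain A d)" using x by blast
qed

lemma update_plain:
  assumes "\<not> spent (ft x T)"
  shows "\<exists>T'. Inv S' T' ps' R3 G3 \<and> pot {} T' \<le> pot {} T + (floor_log N + 1)"
proof -
  note I = InvD[OF inv] and M = mid_facts
  \<comment> \<open>The descent stops at an internal vertex only if that vertex is spent, so here it
    has stopped at a leaf.\<close>
  have "ft x T = AN v j a S0 c l r \<Longrightarrow> spent (ft x T)" for v j a S0 c l r
    by (induction T) (auto simp: spent_def split: if_splits)
  then obtain v xs S0 c where f: "ft x T = AL v xs S0 c" using assms by (cases "ft x T") auto
  define new where "new = AL v (il @ xs) S0 (Suc c)"
  define T' where "T' = rpl x new T"
  have sub: "set (ndl (ft x T)) \<subseteq> set (ndl T)" "set (itl (ft x T)) \<subseteq> set (itl T)" by (rule ft_sub)+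
  have v: "v \<in> set (ndl T)" "lf x T = v" using sub(1) f lf_ft[of x T] by simp_all
  have td: "set (tset x T) \<inter> set (ndl (ft x T)) = {}" by (rule tset_disj) (rule I)
  have wff: "wf (fd x T 0) (fX x T (domain A d)) (fS x T S) (AL v xs S0 c)" using wf_ft[OF I(14)] f by metis
  have rf: "rep G (fd x T 0) (fS x T S) (AL v xs S0 c) (fe x T 0)" using rep_ft[OF I(9)] f by metis
  have cb: "c < budget q S0" using wff assms f by (simp add: spent_def)
  have fsS': "fS x T S' = upS kd x y (fS x T S)" unfolding S' by (rule fS_upS)
  have il': "set il \<inter> set xs = {}" "set il \<inter> (set (itl T) - set (itl (ft x T))) = {}" using il(2) sub(2) f by auto
  \<comment> \<open>The stored count moves with the multiplicity of \<open>(x, b)\<close>; deleting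
    an absent example moves neither.\<close>
  have clsf: "G3 aNN v (of_bool b) = cls (fS x T S') b" for b
  proof -
    have "G aNN v (of_bool b) = cls (fS x T S) b" using rf by simp
    then have g: "G3 aNN v (of_bool b) = cls (fS x T S) b + count S' (x, b) - count S (x, b)" using G3(4)[of b] v by simp
    have c1: "count (fS x T S) (x, b) = count S (x, b)" by (rule fS_count)
    have "cls (fS x T S') b + count S (x, b) = cls (fS x T S) b + count S' (x, b)"
    proof (cases "kd = 0 \<or> b \<noteq> y")
      case True
      then show ?thesis unfolding fsS' unfolding S' upS_def cls_def by auto
    next
      case False
      show ?thesis
      proof (cases "(x, y) \<in># S")
        case True
        then have "(x, y) \<in># fS x T S" by (metis count_greater_zero_iff fS_count)
        then obtain S2 where S2: "fS x T S = add_mset (x, y) S2" by (metis multi_member_split)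
        have "0 < count S (x, y)" using True by simp
        then show ?thesis using False S2 unfolding fsS' unfolding S' upS_def cls_def by simp
      next
        case F: False
        then have "(x, y) \<notin># fS x T S" by (metis count_greater_zero_iff fS_count)
        then show ?thesis using F False unfolding fsS' unfolding S' upS_def by (simp add: diff_single_trivial)
      qed
    qed
    then show ?thesis using g by simp
  qed
  have repn: "rep G3 (fd x T 0) (fS x T S') new (fe x T 0)"
  proof -
    have "v \<notin> set (tset x T)" using td f by auto
    then have "G3 aBUD v 0 + Suc c = budget q S0" using G3(5)[of v] assms f rf cb by simp
    moreover have "lst (\<lambda>i. G3 aINX i 0) (G aHEAD v 0) xs"
      by (rule lst_cong[of "\<lambda>i. G aINX i 0"]) (use rf il' G3(6) in auto)
    then have "lst (\<lambda>i. G3 aINX i 0) (G3 aHEAD v 0) (il @ xs)" using G3(7) v by auto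
    ultimately show ?thesis using rf clsf unfolding new_def by (simp add: G3(1))
  qed
  have wfn: "wf (fd x T 0) (fX x T (domain A d)) (fS x T S') new"
    using wff close_upS[of S0 c "fS x T S" kd x y] cb M(5) unfolding fsS' new_def by simp
  have itl': "set (itl T') = set (itl T) \<union> set il \<and> distinct (itl T')"
    using itl_rpl[where new = new and T = T and x = x] I(6) ft_distinct(2)[OF I(6), of x] M(4) il' f sub(2)
    unfolding T'_def new_def by auto
  have ndl': "set (ndl T') = set (ndl T) \<and> distinct (ndl T')"
    using ndl_rpl[where new = new and T = T and x = x] I(11) f v unfolding T'_def new_def by auto
  have wf': "wf 0 (domain A d) S' T'" using wf_rpl[OF I(14) wfn[unfolded S']] M(5) f unfolding T'_def S' new_def by simp
  have rep': "rep G3 0 S' T' 0" unfolding S' T'_def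
  proof (rule rep_rpl[OF I(9,11,6)])
    show "root new = root (ft x T)" using f by (simp add: new_def)
    show "rep G3 (fd x T 0) (fS x T (upS kd x y S)) new (fe x T 0)" using repn unfolding S' .
    show "G3 aBUD i 0 = G aBUD i 0 - (if i \<in> set (tset x T) then 1 else 0)"
      if "i \<in> set (ndl T)" "i \<notin> set (ndl (ft x T))" for i using G3(5)[of i] that f by simp
    show "G3 aINX i s = G aINX i s" if "i \<in> set (itl T)" "i \<notin> set (itl (ft x T))" for i s
      using G3(6) il(2) that by blast
    show "G3 a i s = G a i s" if "i \<in> set (ndl T)" "i \<notin> set (ndl (ft x T))" "a \<in> ndarr" "a \<noteq> aBUD" for a i s
      using G3(1)[of a i s] G3(2)[of i s] G3(3)[of i s] that v f by (auto simp: ndarr_def)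
  qed
  have root': "root T' = 0" using root_rpl[of new x T] f I(10) by (simp add: T'_def new_def)
  have snap': "snap T' = snap T" "cof T' = Suc (cof T)"
  proof -
    have "snap T' = snap T \<and> cof T' = Suc (cof T)"
    proof (cases "ft x T = T")
      case True
      then have "T = AL v xs S0 c" using f by simp
      then show ?thesis by (simp add: T'_def new_def)
    next
      case False
      have "\<not> spent T" using False by (cases T) (auto simp: spent_def)
      then show ?thesis unfolding T'_def using snap_rpl False by blast
    qed
    then show "snap T' = snap T" "cof T' = Suc (cof T)" by auto
  qed
  have "Inv S' T' ps' R3 G3" unfolding Inv_def
    apply (intro conjI allI impI)
    subgoal by (rule it)
    subgoal by (rule it)
    subgoal by (rule R3)
    subgoal for i using lst[of i] itl' by auto
    subgoal using M(3) itl' by auto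
    subgoal using itl' by blast
    subgoal using M(2) itl' by (simp add: Un_commute)
    subgoal unfolding T'_def
      by (rule plc_rpl[OF M(1)]) (use plc_ft[OF M(1), of x] f M(8) il(1) ps'(3) in \<open>auto simp: new_def\<close>)
    subgoal by (rule rep')
    subgoal by (rule root')
    subgoal using ndl' by blast
    subgoal using ndl' I(12) by blast
    subgoal using ndl' I(13) R3 G3(1) by (intro avail_cong[OF I(13)[folded conjunct1[OF ndl']]]) auto
    subgoal by (rule wf')
    subgoal unfolding T'_def by (rule szok_rpl[OF I(15)]) (use szok_ft[OF I(15), of x] f in \<open>simp add: new_def\<close>)
    subgoal using I(16) snap' M(6) by simp
    done
  moreover have "pot {} T' \<le> pot {} T + (floor_log N + 1)"
    unfolding T'_def by (rule pot_unspent[OF I(15) f new_def])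
  ultimately show ?thesis by blast
qed

lemma update_local:
  assumes sp: "spent (ft x T)" "ft x T \<noteq> T"
    and Q: "\<And>t' R' G' T'. t' + C1 * pot {} T' \<le> t3 + C1 * pot {} T + C1 * (floor_log N + 1) \<Longrightarrow>
      Inv S' T' ps' R' G' \<Longrightarrow> Q (t', R', G')"
  shows "wp (p_rebuild d m k h q) Q (t3, R3, G3)"
proof -
  note I = InvD[OF inv] and M = mid_facts
  define f where "f = ft x T"
  define u where "u = root f"
  define te where "te = fe x T 0"
  define Tc where "Tc = addl x il f"
  define AV where "AV = {..<NR} - set (ndl T)"
  define dep where "dep = fd x T 0"
  define Xf where "Xf = fX x T (domain A d)"
  define w where "w = wt f + 1"
  have sub: "set (ndl f) \<subseteq> set (ndl T)" "set (itl f) \<subseteq> set (itl T)" "set (tset x T) \<subseteq> set (ndl T)"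
    unfolding f_def by (rule ft_sub)+
  have dist: "distinct (ndl f)" "distinct (itl f)" unfolding f_def using ft_distinct I by blast+
  have uf: "u \<in> set (ndl f)" unfolding u_def by (rule root_ndl)
  have u: "u \<noteq> 0" "u < NR" using ft_root[OF I(11), of x] sp(2) I(10,12) uf sub by (auto simp: u_def f_def)
  have trig: "R3 rTRIG = Suc u" "R3 rTEND = te" using R3 sp by (simp_all add: u_def f_def te_def)
  have teC: "te = 0 \<or> te - 1 \<in> set (ndl T) - set (ndl f)"
    using fe_cases[OF I(11), of x 0] unfolding te_def f_def by auto
  have lf: "lf x T \<in> set (ndl f)" using lf_ndl[of x f] unfolding f_def lf_ft .
  have repf: "rep G dep (fS x T S) f te" unfolding dep_def te_def f_def by (rule rep_ft[OF I(9)])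
  have wff: "wf dep Xf (fS x T S) f" unfolding dep_def f_def Xf_def by (rule wf_ft[OF I(14)])
  have dep: "dep \<le> h" using wff by (cases f) (auto simp: splittable_def)
  have depu: "G aDEP u 0 = dep" using repf unfolding u_def by (cases f) auto
  have shpc: "shp G3 Tc te" unfolding Tc_def
  proof (rule shp_addl[OF rep_shp[OF repf] dist(1)])
    show "G3 aINX i s = G aINX i s" if "i \<in> set (itl f)" for i s using G3(6) il(2) sub(2) that by blast
    show "G3 aHEAD i s = G aHEAD i s" if "i \<noteq> lf x f" for i s using G3(2) that by (simp add: f_def lf_ft)
    show "il = [] \<and> G3 aHEAD (lf x f) 0 = G aHEAD (lf x f) 0 \<or>
       il = [cur] \<and> G3 aHEAD (lf x f) 0 = Suc cur \<and> G3 aINX cur 0 = G aHEAD (lf x f) 0"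
      using G3(7) by (simp add: f_def lf_ft)
  qed (use G3(1) in auto)
  have Tc: "ndl Tc = ndl f" "root Tc = u" "set (itl Tc) = set il \<union> set (itl f)" "length (itl Tc) = length il + length (itl f)"
    by (simp_all add: Tc_def addl_simps u_def)
  have dTc: "distinct (itl Tc)" unfolding Tc_def by (rule addl_distinct) (use dist M il(2) sub in auto)
  have lps: "length ps' \<le> NR" using it(1) by (simp add: itemsI_def)
  have icb: "i < NR \<and> G3 aIC i 0 + G3 aIC i 1 \<le> Z" if "i \<in> set (itl Tc)" for i
  proof -
    have i: "i < length ps'" using that Tc M(3) sub by auto
    have "G3 aIC i 0 = count S' (ps' ! i, False)" "G3 aIC i 1 = count S' (ps' ! i, True)"
      using it(1) i unfolding itemsI_def by (metis of_bool_eq)+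
    moreover have "count S' e \<le> N" for e using count_le_size[of S' e] it(1) by (simp add: itemsI_def)
    ultimately have "G3 aIC i 0 + G3 aIC i 1 \<le> N + N" using add_mono by metis
    then show ?thesis using N_Z i lps by linarith
  qed
  have wb: "length (ndl f) + 1 \<le> 2 * wt f" "length (itl f) \<le> wt f" by (rule ndl_length)+
  have live: "live G3 i \<longleftrightarrow> (\<exists>b. (ps' ! i, b) \<in># S')" if "i < length ps'" for i
  proof -
    have "G3 aIC i 0 = count S' (ps' ! i, False)" "G3 aIC i 1 = count S' (ps' ! i, True)"
      using it(1) that unfolding itemsI_def by (metis of_bool_eq)+
    then show ?thesis unfolding live_def by (metis (full_types) add_gr_0 count_greater_zero_iff)
  qed
  have uW: "Suc u < W" using u wbd by linarith
  show ?thesis unfolding rebuild_finish p_local_def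
    apply (simp add: trig u wbd uW)
    apply (rule collect_seg[where T = Tc and e = te and te = te and AV = AV and acc = "[]" and u = u])
    subgoal by (rule shpc)
    subgoal using dist Tc by simp
    subgoal by (rule dTc)
    subgoal for i using icb[of i] by simp
    subgoal for v using sub(1) I(12) by (auto simp: Tc AV_def)
    subgoal unfolding AV_def by (intro avail_cong[OF I(13)]) (simp_all add: R3 G3)
    subgoal by (simp add: Tc)
    subgoal by (simp add: trig)
    subgoal using teC Tc by auto
    subgoal by simp
    subgoal by simp
    subgoal by simp
    subgoal by simp
    subgoal premises p for t4 R4 G4 its
    proof -
      note C0 = cpostD[OF p]
      have C: "t4 \<le> t3 + 100 + 300 * length (ndl f) + 200 * (length il + length (itl f))"
        "R4 rNI = length ps'" "R4 rTEND = te" "R4 rU0 = u" "R4 rV1 = te" "avail R4 G4 (AV \<union> (set (ndl f) - {u}))"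
        "lst (\<lambda>i. G4 aINX i 0) (R4 rLIST) its" "distinct its"
        "set its = {i \<in> set il \<union> set (itl f). live G3 i}"
        "\<And>a i s. a \<notin> {aINX, aLST, aNXT} \<Longrightarrow> G4 a i s = G3 a i s"
        "\<And>i s. i \<notin> set il \<union> set (itl f) \<Longrightarrow> G4 aINX i s = G3 aINX i s"
        "\<And>i. G4 aLST i 0 = (if i \<in> set il \<union> set (itl f) \<and> \<not> live G3 i then 0 else G3 aLST i 0)"
        "\<And>i s. i \<notin> set (ndl f) - {u} \<Longrightarrow> G4 aNXT i s = G3 aNXT i s"
        using C0(1) C0(2)[of rNI] C0(2)[of rTEND] C0(2)[of rU0] C0(3-11) by (simp_all add: Tc R3 trig)
      define AV4 where "AV4 = AV \<union> (set (ndl f) - {u})"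
      have it4: "itemsI G4 ps' S'" using it(1) C(10) by (simp add: itemsI_def)
      have its: "set its \<subseteq> {..<length ps'}" using C(9) M(3) sub by auto
      have live4: "live G4 i" if "i \<in> set its" for i using C(9,10) that by (auto simp: live_def)
      have lw: "length its \<le> w"
      proof -
        have "set its \<subseteq> set (itl Tc)" using C(9) Tc by auto
        then have "length its \<le> length (itl Tc)"
          using C(8) dTc by (metis List.finite_set card_mono distinct_card)
        then show ?thesis using M(5) wb(2) Tc(4) by (simp add: w_def)
      qed
      have lN: "length its \<le> N"
        using live_length[of its G4] live4 size_ms[OF it4 C(8) its] by (force simp: live_def)
      have wN: "wt f \<le> 2 * N + 1"
      proof -
        have "size (snap f) \<le> N" unfolding f_def by (rule szok_snap[OF szok_ft[OF I(15)]])
        then show ?thesis using wf_bounds[OF wff] budget_le[of "snap f"] by linarith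
      qed
      have wtN: "wt T \<le> 2 * N + 1"
        using szok_snap[OF I(15)] wf_bounds[OF I(14)] budget_le[of "snap T"] by linarith
      \<comment> \<open>The old tree has at most \<open>4 * N + 1\<close> of the
        \<open>8 * N + 16\<close> records.\<close>
      have cAV: "4 * N + 14 \<le> card AV4"
      proof -
        have "card (set (ndl T)) \<le> 4 * N + 1" using ndl_length(1)[of T] wtN card_length[of "ndl T"] by linarith
        then have "4 * N + 14 \<le> card AV" unfolding AV_def using card_Diff_subset[of "set (ndl T)" "{..<NR}"] I(12) NR_N by simp
        also have "\<dots> \<le> card AV4" unfolding AV4_def by (intro card_mono) (auto simp: AV_def)
        finally show ?thesis .
      qed
      have uAV: "u \<notin> AV4" using uf sub by (auto simp: AV4_def AV_def)
      have tefin: "te = 0 \<or> te - 1 \<notin> insert u AV4" using teC uf by (auto simp: AV4_def AV_def)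
      show ?thesis
        apply (subst collect_unfold)
        apply (simp add: C(3,5))
        apply (rule finish[where ps = ps' and S = S' and its = its and AV = AV4 and dep = dep and te = te and u = u])
        subgoal by (rule it4)
        subgoal by (rule C)
        subgoal by (rule its)
        subgoal for i by (rule live4)
        subgoal by (rule C)
        subgoal by (rule C)
        subgoal by (rule u)
        subgoal by (rule uAV)
        subgoal using C(6) by (simp add: AV4_def)
        subgoal using cAV lN by simp
        subgoal by (rule dep)
        subgoal using C(10)[of aDEP] G3(1)[of aDEP] depu by simp
        subgoal by (rule C)
        subgoal by (rule tefin)
        subgoal premises b for t5 R5 G5 Tn AV5
        proof -
          note B0 = builtD[OF b(3)]
          have dS': "filter_mset (\<lambda>e. fst e \<in> domain A d) S' = S'"
            using M(7) filter_mset_cong[OF refl, of S' "\<lambda>e. fst e \<in> domain A d" "\<lambda>_. True"] by (auto simp: okS_def)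
          have fsX: "fS x T S' = filter_mset (\<lambda>e. fst e \<in> Xf) S'"
            using fS_filter[of x T "domain A d" S'] unfolding dS' Xf_def .
          \<comment> \<open>Completeness is inherited along the tree with the new record listed, as
            this may be the only record of \<open>x\<close> in a list.\<close>
          have pa: "plc ps' (domain A d) (addl x il T)"
            by (rule plc_addl[OF M(1) _ x]) (use il(1) ps'(3) in auto)
          have "fst ` set_mset (fS x (addl x il T) S') \<subseteq> (!) ps' ` set (itl (ft x (addl x il T)))"
            by (rule complete_ft[OF pa]) (use M(2) in \<open>simp add: addl_simps\<close>)
          then have cpl: "fst ` set_mset (fS x T S') \<subseteq> (!) ps' ` (set il \<union> set (itl f))"
            by (simp add: addl_simps f_def)
          have plcc: "plc ps' Xf Tc" using plc_ft[OF pa, of x] by (simp add: addl_simps Tc_def Xf_def f_def)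
          have itX: "(!) ps' ` set its \<subseteq> Xf"
            using plc_in[OF plcc] C(9) Tc(3) by auto
          have itlive: "i \<in> set its" if "i \<in> set il \<union> set (itl f)" "e \<in># S'" "fst e = ps' ! i" for i e
          proof -
            have "i < length ps'" using that(1) M(3) sub(2) by auto
            then have "live G3 i" using live[of i] that(2,3) by (cases e) auto
            then show ?thesis using C(9) that(1) by auto
          qed
          \<comment> \<open>The collected live records are exactly the points of the subtree's
            multiset: placement gives one inclusion, completeness the other.\<close>
          have msE: "ms ps' S' its = fS x T S'" unfolding fsX ms_def
          proof (rule filter_mset_cong[OF refl])
            fix e assume e: "e \<in># S'"
            show "fst e \<in> (!) ps' ` set its \<longleftrightarrow> fst e \<in> Xf"
            proof
              assume "fst e \<in> Xf"
              then have "e \<in># fS x T S'" using e by (simp add: fsX)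
              then obtain i where "i \<in> set il \<union> set (itl f)" "fst e = ps' ! i" using cpl by fastforce
              then show "fst e \<in> (!) ps' ` set its" using itlive[of i e] e by auto
            qed (use itX in blast)
          qed
          note B = B0[unfolded msE]
          define T' where "T' = rpl x Tn T"
          have wfn: "wf dep Xf (fS x T S') Tn" by (rule wf_mono[OF B(8) itX])
          have wtn: "wt Tn \<le> wt f + 1" using B(13) lw wt_pos[of f] by (simp add: w_def)
          have cof0: "cof Tn = 0" by (rule czero_cof[OF B(9)])
          have AVs: "AV4 \<inter> (set (ndl T) - set (ndl f)) = {}" by (auto simp: AV4_def AV_def)
          have ndn: "set (ndl Tn) \<inter> (set (ndl T) - set (ndl f)) = {}" using AVs B(5) uf by auto
          have ndl': "set (ndl T') = set (ndl T) - set (ndl f) \<union> set (ndl Tn)" "distinct (ndl T')"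
            using ndl_rpl[OF I(11) B(6), of x] ndn unfolding T'_def f_def by auto
          have itn: "set (itl Tn) \<inter> (set (itl T) - set (itl f)) = {}" using B(11) C(9) il(2) by auto
          have itl': "set (itl T') = set (itl T) - set (itl f) \<union> set its" "distinct (itl T')"
            using itl_rpl[OF I(6) B(12), of x] itn B(11) unfolding T'_def f_def by auto
          have wf': "wf 0 (domain A d) S' T'"
            using wf_rpl[OF I(14), of x kd y Tn] wfn wtn cof0 unfolding S' T'_def dep_def Xf_def f_def by simp
          have fr: "G5 a i s = G3 a i s" if "i \<in> set (ndl T)" "i \<notin> set (ndl f)" "a \<in> ndarr" for a i s
          proof -
            have "i \<noteq> u" "i \<notin> AV4" using that uf AVs by auto
            then have "G5 a i s = G4 a i s" using B(16)[of a i s] that(3) by (auto simp: ndarr_def)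
            also have "\<dots> = G3 a i s" using C(10)[of a i s] C(13)[of i s] that by (auto simp: ndarr_def)
            finally show ?thesis .
          qed
          have rep': "rep G5 0 S' T' 0" unfolding S' T'_def
          proof (rule rep_rpl[OF I(9,11,6)])
            show "root Tn = root (ft x T)" using B(3) by (simp add: u_def f_def)
            show "rep G5 (fd x T 0) (fS x T (upS kd x y S)) Tn (fe x T 0)" using B(7) unfolding S' dep_def te_def .
            show "G5 aBUD i 0 = G aBUD i 0 - (if i \<in> set (tset x T) then 1 else 0)"
              if "i \<in> set (ndl T)" "i \<notin> set (ndl (ft x T))" for i
              using fr[of i aBUD 0] G3(5)[of i] that sp(1) by (simp add: f_def ndarr_def)
            show "G5 aINX i s = G aINX i s" if "i \<in> set (itl T)" "i \<notin> set (itl (ft x T))" for i s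
            proof -
              have n: "i \<notin> set il" using il(2) that(1) by blast
              then have "i \<notin> set its" using C(9) that(2) by (simp add: f_def)
              then show ?thesis using n B(15)[of i s] C(11)[of i s] G3(6)[of i s] that(2) by (simp add: f_def)
            qed
            show "G5 a i s = G a i s" if "i \<in> set (ndl T)" "i \<notin> set (ndl (ft x T))" "a \<in> ndarr" "a \<noteq> aBUD" for a i s
            proof -
              have "i \<noteq> lf x T" using lf that(2) by (auto simp: f_def)
              then show ?thesis
                using fr[of i a s] G3(1)[of a i s] G3(2)[of i s] G3(3)[of i s] that by (auto simp: ndarr_def f_def)
            qed
          qed
          have nsp: "\<not> spent T" using sp(2) by (cases T) (auto simp: spent_def)
          have sn: "snap T' = snap T" "cof T' = Suc (cof T)"
            using snap_rpl[OF nsp sp(2)] by (auto simp: T'_def)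
          have av: "{..<NR} - set (ndl T') = AV5"
          proof -
            have "AV4 \<subseteq> {..<NR}" using I(12) sub(1) by (auto simp: AV4_def AV_def)
            moreover have "{..<NR} - (set (ndl T) - set (ndl f)) \<subseteq> insert u AV4" by (auto simp: AV4_def AV_def)
            moreover have "NR0 - (D \<union> insert u (A4 - A5)) = A5"
              if "A4 \<subseteq> NR0" "NR0 - D \<subseteq> insert u A4" "A5 \<subseteq> A4" "u \<notin> A4" "A4 \<inter> D = {}" for NR0 D A4 A5
              using that by blast
            ultimately show ?thesis unfolding ndl'(1) B(5) using B(2) uAV AVs by simp
          qed
          have inv': "Inv S' T' ps' R5 G5" unfolding Inv_def
            apply (intro conjI allI impI)
            subgoal using it4 B(14)[of aIC] B(14)[of aKEY] by (simp add: itemsI_def)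
            subgoal using it(2) B(14)[of aTRI] C(10)[of aTRI] by (simp add: trieI_def)
            subgoal using b(2) C(2) by simp
            subgoal for i
            proof -
              assume i: "i < length ps'"
              have e: "G5 aLST i 0 = (if i \<in> set il \<union> set (itl f) \<and> \<not> live G3 i then 0 else G3 aLST i 0)"
                using B(14)[of aLST i 0] C(12)[of i] by simp
              have "i \<in> set (itl f) \<Longrightarrow> i \<in> set (itl T)" "i \<in> set il \<Longrightarrow> i \<notin> set (itl T)"
                using sub(2) il(2) by blast+
              then show ?thesis unfolding e itl'(1) C(9) using lst[OF i] by auto
            qed
            subgoal using itl'(1) its M(3) by blast
            subgoal by (rule itl')
            subgoal
            proof
              fix z assume "z \<in> fst ` set_mset S'"
              then obtain e where e: "e \<in># S'" "fst e = z" by auto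
              then obtain i where i: "i \<in> set il \<union> set (itl T)" "z = ps' ! i" using M(2) by blast
              show "z \<in> (!) ps' ` set (itl T')"
              proof (cases "i \<in> set il \<union> set (itl f)")
                case True
                then have "i \<in> set its" using itlive[OF True e(1)] e(2) i(2) by simp
                then show ?thesis using i(2) itl'(1) by blast
              next
                case False
                then show ?thesis using i itl'(1) by blast
              qed
            qed
            subgoal unfolding T'_def by (rule plc_rpl[OF M(1)]) (use plc_mono[OF B(10) itX] in \<open>simp add: Xf_def\<close>)
            subgoal by (rule rep')
            subgoal unfolding T'_def using root_rpl[of Tn x T] B(3) I(10) by (simp add: u_def f_def)
            subgoal by (rule ndl')
            subgoal using av ndl' B(2,5) I(12) u(2) avail_less[OF C(6)] by (fastforce simp: AV4_def)
            subgoal unfolding av by (rule B)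
            subgoal by (rule wf')
            subgoal unfolding T'_def
            proof (rule szok_rpl[OF I(15) szok_built[OF wfn B(9)]])
              have "size (fS x T S') \<le> size S'" unfolding fsX by (rule size_filter_mset_lesseq)
              then show "size (fS x T S') \<le> N" using it(1) by (simp add: itemsI_def)
            qed
            subgoal using I(16) M(6) sn by simp
            done
          have pt: "pot {} T' + (budget q (snap f) + 1) \<le> pot {} T + (floor_log N + 1)"
            unfolding T'_def f_def by (rule pot_spent[OF I(14,15) sp(1) B(9)])
          have w5: "w \<le> 5 * q * (budget q (snap f) + 1)"
            unfolding w_def by (rule wt_spent(1)[OF wff]) (use sp in \<open>simp add: f_def\<close>)
          have "t5 \<le> t3 + w * BC"
          proof -
            have "t4 \<le> t3 + 100 + w * 800"
              using C(1) wb M(5) by (simp add: w_def)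
            moreover have "w * 1000 \<le> w * (1000 + 500 * d + 100 * (d * m))" by (intro mult_le_mono2) simp
            moreover note rebuild_cost[OF lw lN]
            ultimately show ?thesis using b(1) by (simp add: w_def)
          qed
          then show ?thesis using Q[OF pot_cost[OF w5 pt] inv'] by simp
        qed
        done
    qed
    done
qed

lemma update_global:
  assumes sp: "spent (ft x T)" "ft x T = T"
    and Q: "\<And>t' R' G' T' qs. t' + C1 * pot {} T' \<le> t3 + C1 * pot {} T + C1 * (floor_log N + 1) \<Longrightarrow>
      Inv S' T' qs R' G' \<Longrightarrow> Q (t', R', G')"
  shows "wp (p_rebuild d m k h q) Q (t3, R3, G3)"
proof -
  note I = InvD[OF inv] and M = mid_facts
  define qs where "qs = filter (\<lambda>x. \<exists>y. (x, y) \<in># S') ps'"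
  define w where "w = size (snap T) + cof T + 1"
  have trig: "R3 rTRIG = Suc 0" using R3 sp I(10) by simp
  have pw: "length ps' \<le> w" using I(16) M(6) by (simp add: w_def)
  have qw: "length qs \<le> w" unfolding qs_def by (rule le_trans[OF length_filter_le pw])
  show ?thesis unfolding rebuild_finish
    apply (simp add: trig wbd)
    apply (rule global[where R = R3 and ps = ps' and G = G3 and S = S', folded qs_def])
    subgoal by (rule R3)
    subgoal by (rule it)
    subgoal premises p for t4 R4 G4
    proof -
      let ?its = "rev [0..<length qs]"
      let ?AV = "{0<..<NR}"
      have ic: "G4 aIC i 0 = count S' (qs ! i, False)" "G4 aIC i 1 = count S' (qs ! i, True)" if "i < length qs" for i
        using p(9) that unfolding itemsI_def by (metis of_bool_eq)+
      have live: "live G4 i" if "i \<in> set ?its" for i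
      proof -
        have i: "i < length qs" using that by simp
        then have "qs ! i \<in> set qs" by simp
        then obtain b where "(qs ! i, b) \<in># S'" by (auto simp: qs_def)
        then show ?thesis unfolding live_def ic[OF i] by (cases b) (auto simp: add_gr_0)
      qed
      have its: "distinct ?its" "set ?its \<subseteq> {..<length qs}" by auto
      have lN: "length qs \<le> N"
        using live_length[of ?its G4] live size_ms[OF p(9) its] by (force simp: live_def)
      have NR0: "0 < NR" using NR_N by simp
      have av: "avail R4 G4 ?AV" using p(3,4) NR0 by (auto simp: avail_def intro!: exI[of _ "[]"])
      have dm: "d * m \<le> w * (d * m)" by (simp add: w_def)
      have imq: "(!) qs ` set ?its = set qs" by (auto simp: in_set_conv_nth)
      have msE: "ms qs S' ?its = S'"
      proof -
        have "fst e \<in> set qs" if "e \<in># S'" for e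
        proof -
          have "fst e \<in> (!) ps' ` (set il \<union> set (itl T))" using M(2) that by blast
          then have "fst e \<in> set ps'" using M(3) by auto
          then show ?thesis using that unfolding qs_def by (cases e) auto
        qed
        then show ?thesis unfolding ms_def imq
          using filter_mset_cong[OF refl, of S' "\<lambda>e. fst e \<in> set qs" "\<lambda>_. True"] by auto
      qed
      show ?thesis
        apply (rule finish[where ps = qs and S = S' and its = ?its and AV = ?AV and dep = 0 and te = 0 and u = 0])
        subgoal by (rule p)
        subgoal by (rule its)
        subgoal by (rule its)
        subgoal for i by (rule live)
        subgoal by (rule p)
        subgoal by (rule p)
        subgoal using NR_N by simp
        subgoal by simp
        subgoal by (rule av)
        subgoal using lN NR_N by simp
        subgoal by simp
        subgoal by (rule p)
        subgoal by (rule p)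
        subgoal by simp
        subgoal premises b for t5 R5 G5 Tn AV5
        proof -
          note B = builtD[OF b(3), unfolded msE imq]
          have qd: "set qs \<subseteq> domain A d" using p(9) by (simp add: itemsI_def)
          have wfn: "wf 0 (domain A d) S' Tn" by (rule wf_mono[OF B(8) qd])
          have nd: "{..<NR} - set (ndl Tn) = AV5"
            unfolding B(5) using B(2) by auto
          have inv': "Inv S' Tn qs R5 G5" unfolding Inv_def
            apply (intro conjI allI impI)
            subgoal using p(9) B(14)[of aIC] B(14)[of aKEY] by (simp add: itemsI_def)
            subgoal using p(10) B(14)[of aTRI] by (simp add: trieI_def)
            subgoal using b(2) p(2) by simp
            subgoal for i using p(8)[of i] B(14)[of aLST i 0] B(11) by simp
            subgoal using B(11) by auto
            subgoal by (rule B)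
            subgoal
            proof -
              have "fst ` set_mset S' \<subseteq> set qs" using msE unfolding ms_def imq
                by (metis (mono_tags, lifting) image_subsetI mem_Collect_eq set_mset_filter)
              then show ?thesis unfolding B(11) imq .
            qed
            subgoal by (rule plc_mono[OF B(10) qd])
            subgoal by (rule B)
            subgoal by (rule B)
            subgoal by (rule B)
            subgoal unfolding B(5) using NR_N by auto
            subgoal unfolding nd by (rule B)
            subgoal by (rule wfn)
            subgoal by (rule szok_built[OF wfn B(9)]) (use it(1) in \<open>simp add: itemsI_def\<close>)
            subgoal
            proof -
              have "length qs \<le> size S'"
                using live_length[of ?its G4] live size_ms[OF p(9) its] unfolding msE by (force simp: live_def)
              then show ?thesis using B(4) by simp
            qed
            done
          \<comment> \<open>The whole tree is replaced, so \<open>pot_spent\<close> speaks about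
            \<open>Tn\<close> itself.\<close>
          have "rpl x Tn T = Tn" using sp by (cases T) (auto simp: spent_def)
          then have pt: "pot {} Tn + (budget q (snap T) + 1) \<le> pot {} T + (floor_log N + 1)"
            using pot_spent[OF I(14,15) sp(1) B(9)] sp(2) by simp
          have w5: "w \<le> 5 * q * (budget q (snap T) + 1)"
            unfolding w_def by (rule wt_spent(2)[OF I(14)]) (use sp in simp)
          have "t5 \<le> t3 + w * BC"
          proof -
            have "length ps' * (1000 + 500 * d + 100 * (d * m)) \<le> w * (1000 + 500 * d + 100 * (d * m))"
              using pw by (rule mult_le_mono1)
            then show ?thesis using b(1) p(1) rebuild_cost[OF qw lN] by (simp add: w_def)
          qed
          then show ?thesis using Q[OF pot_cost[OF w5 pt] inv'] by simp
        qed
        done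
    qed
    done
qed

end

context algo
begin

lemma wp_Seq_fun: "wp (c ;; c') Q = wp c (wp c' Q)"
  by (rule ext) simp

lemma rep_NN_le: "rep G dep S T e \<Longrightarrow> G aNN (lf x T) (of_bool b) \<le> size S"
proof (induction T arbitrary: dep S e)
  case (AL v xs S0 c)
  then show ?case by (simp add: cls_def size_filter_mset_lesseq)
next
  case (AN v j a S0 c l r)
  have "size (sle j a S) \<le> size S" "size (sgt j a S) \<le> size S" by (rule size_filter_mset_lesseq)+
  then show ?case using AN.IH AN.prems by (fastforce intro: order_trans)
qed

lemma update:
  assumes inv: "Inv S T ps R G" and x: "x \<in> domain A d"
    and inp: "I 0 < 2" "I 1 = of_bool y" "\<And>l. l < d \<Longrightarrow> I (l + 2) = K x l"
    and sz: "size (upS (I 0) x y S) \<le> N"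
    and Q: "\<And>t' R' G' T' ps'. t' + C1 * pot {} T' \<le> t + C2 + C1 * pot {} T + C1 * (floor_log N + 1) \<Longrightarrow>
      Inv (upS (I 0) x y S) T' ps' R' G' \<Longrightarrow> Q (t', R', G')"
  shows "wp (p_update d m k h q) Q (t, R, G)"
proof -
  note J = InvD[OF inv]
  define S' where "S' = upS (I 0) x y S"
  have wtN: "wt T \<le> 2 * N + 1"
    using szok_snap[OF J(15)] wf_bounds[OF J(14)] budget_le[of "snap T"] by linarith
  \<comment> \<open>Strictness leaves a free slot in which \<open>p_item\<close> can write the
    requested point.\<close>
  have lps: "length ps < NR"
    using szok_snap[OF J(15)] wf_bounds[OF J(14)] budget_le[of "snap T"] J(16) NR_N by linarith
  have Sps: "fst ` set_mset S \<subseteq> set ps" using J(5,7) by force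
  have hT: "ht T \<le> d * m" by (rule ht_le[OF J(14)])
  have ndN: "i < NR" if "i \<in> set (ndl T)" for i using J(12) that by auto
  define ps' where "ps' = (if x \<in> set ps then ps else ps @ [x])"
  show ?thesis unfolding p_update_def
    apply simp
    apply (rule item[where R = R and ps = ps and G = G and S = S and x = x and y = y, folded ps'_def S'_def,
      OF J(3) lps J(1,2) Sps x inp])
    subgoal by assumption
    subgoal using sz by (simp add: S'_def)
    subgoal premises p for t1 R1 G1 cur
    proof -
      have rep1: "rep G1 0 S T 0"
        by (rule rep_cong[OF _ _ J(9)]) (use p(13) in \<open>auto simp: ndarr_def\<close>)
      have curN: "cur < NR" using p(2) lps by (auto simp: ps'_def split: if_splits)
      have key1: "G1 aKEY cur l = K x l" if "l < d" for l using p(2,3,11) that by (simp add: itemsI_def)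
      have w0: "0 < W" using wbd by simp
      show ?thesis
        apply (simp add: w0)
        apply (subst wp_Seq_fun)
        apply (rule walk[where S = S and T = T and dep = 0 and e = 0 and x = x])
        subgoal by (rule rep1)
        subgoal by (rule wf_jok[OF J(14)])
        subgoal by (rule J)
        subgoal by (rule ndN)
        subgoal by (simp add: p(5) key1)
        subgoal by (simp add: p(5) curN)
        subgoal by (simp add: J(10))
        subgoal by simp
        subgoal by simp
        subgoal premises u for t2 R2 G2
        proof -
          have R2: "R2 rCUR = cur" "R2 rY = of_bool y" "R2 rOLD = count S (x, y)" "R2 rNEW = count S' (x, y)"
            "R2 rNI = length ps'" "R2 rNB = R rNB" "R2 rFR = R rFR"
            using u(5) p(4-10) by simp_all
          have lfN: "lf x T < NR" using ndN lf_ndl by blast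
          have G2: "G2 a i s = G a i s" if "a \<notin> {aIC, aKEY, aTRI, aLST, aBUD}" for a i s
            using u(6)[of a i s] p(13)[of a i s] that by simp
          have cN: "count S' e \<le> N" "size S \<le> N" for e
            using count_le_size[of S' e] p(11) J(1) by (auto simp: itemsI_def)
          have nn: "G aNN (lf x T) (of_bool b) \<le> N" for b using rep_NN_le[OF J(9), of x b] cN(2) by linarith
          have N4: "2 * N \<le> 4 * Z" using N_Z by linarith
          show ?thesis
            apply (simp del: wp_If)
            apply (rule leaf[where v = "lf x T" and cur = cur])
            subgoal by (rule u)
            subgoal by (rule lfN)
            subgoal by (rule R2)
            subgoal by (rule curN)
            subgoal by (simp add: R2)
            subgoal using nn[of y] cN(1)[of "(x, y)"] N4 by (simp add: R2 G2)
            subgoal premises f for t3 G3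
            proof -
              define il where "il = (if 0 < G2 aLST cur 0 then [] else [cur])"
              have lst2: "G2 aLST i s = G1 aLST i s" for i s using u(6) by simp
              \<comment> \<open>For a known point the mark is membership in a list by the invariant.
                A new record has a cleared mark, and its number lies beyond all listed ones.\<close>
              have curT: "0 < G2 aLST cur 0 \<longleftrightarrow> cur \<in> set (itl T)"
              proof (cases "x \<in> set ps")
                case True
                then show ?thesis using p(2,14) J(4)[of cur] by (simp add: ps'_def lst2)
              next
                case False
                then have "cur \<notin> set (itl T)" using p(3) J(5) by (auto simp: ps'_def nth_append split: if_splits)
                then show ?thesis using p(15)[OF False] by (simp add: lst2)
              qed
              have itm: "itemsI G3 ps' S'" "trieI G3 (map K ps')"
                using p(11,12) f(2) u(6) by (simp_all add: itemsI_def trieI_def)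
              interpret M: update_step k q \<alpha> \<beta> \<epsilon> A d h NR W I Z N x y "I 0" S T ps R G ps' S' cur il R2 G3
              proof unfold_locales
                show "Inv S T ps R G" "x \<in> domain A d" "S' = upS (I 0) x y S" by (fact inv x S'_def)+
                show "itemsI G3 ps' S'" "trieI G3 (map K ps')" by (fact itm)+
                show "ps' = ps \<or> ps' = ps @ [x]" by (auto simp: ps'_def)
                show "cur < length ps'" "ps' ! cur = x" by (fact p)+
                show "il = [] \<or> il = [cur]" "set il \<inter> set (itl T) = {}" "cur \<in> set il \<union> set (itl T)"
                  using curT by (auto simp: il_def)
                show "(0 < G3 aLST i 0) = (i \<in> set il \<union> set (itl T))" if "i < length ps'" for i
                proof (cases "i = cur")
                  case True
                  then show ?thesis using curT f(6,7) by (auto simp: il_def)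
                next
                  case False
                  have "i < length ps"
                  proof (rule ccontr)
                    assume "\<not> i < length ps"
                    then have "i = length ps" "ps' = ps @ [x]" "x \<notin> set ps" using that by (auto simp: ps'_def split: if_splits)
                    moreover have "cur < length ps" using \<open>ps' = ps @ [x]\<close> p(2) False \<open>i = length ps\<close> by simp
                    ultimately show False using p(3) by (simp add: nth_append) (metis nth_mem)
                  qed
                  then show ?thesis using J(4)[of i] p(14)[of i] f(6,7) False curT lst2[of i 0] by (auto simp: il_def)
                qed
                show "R2 rNI = length ps'" "R2 rNB = R rNB" "R2 rFR = R rFR" by (fact R2)+
                show "R2 rTRIG = (if spent (ft x T) then Suc (root (ft x T)) else 0)" by (fact u)
                show "spent (ft x T) \<Longrightarrow> R2 rTEND = fe x T 0" by (fact u)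
                show "G3 a i s = G a i s" if "a \<in> {aNXT, aRGT, aNJ, aNA, aDEP}" for a i s
                  using f(2)[of a i s] G2[of a i s] that by auto
                show "i \<noteq> lf x T \<Longrightarrow> G3 aHEAD i s = G aHEAD i s" for i s using f(4)[of i s] G2[of aHEAD i s] by simp
                show "i \<noteq> lf x T \<Longrightarrow> G3 aNN i s = G aNN i s" for i s using f(3)[of i s] G2[of aNN i s] by simp
                show "G3 aNN (lf x T) (of_bool b) = G aNN (lf x T) (of_bool b) + count S' (x, b) - count S (x, b)" for b
                proof (cases "b = y")
                  case True
                  then show ?thesis using f(5)[of "of_bool b"] G2[of aNN "lf x T" "of_bool b"] R2 by simp
                next
                  case False
                  then have "count S' (x, b) = count S (x, b)" unfolding S'_def by (intro count_upS) simp
                  then show ?thesis using False f(5)[of "of_bool b"] G2[of aNN "lf x T" "of_bool b"] R2 by (simp add: of_bool_inj)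
                qed
                show "G3 aBUD i 0 = G aBUD i 0 -
                  (if i \<in> set (tset x T) \<or> \<not> spent (ft x T) \<and> i = root (ft x T) then 1 else 0)" for i
                  using f(2)[of aBUD i 0] u(7)[of i] p(13)[of aBUD i 0] by simp
                show "G3 aINX i s = G aINX i s" if "i \<notin> set il" for i s
                  using f(6,7) G2[of aINX i s] that by (auto simp: il_def split: if_splits)
                show "il = [] \<and> G3 aHEAD (lf x T) 0 = G aHEAD (lf x T) 0 \<or>
                   il = [cur] \<and> G3 aHEAD (lf x T) 0 = Suc cur \<and> G3 aINX cur 0 = G aHEAD (lf x T) 0"
                  using f(6,7) G2[of aHEAD "lf x T" 0] by (auto simp: il_def)
              qed
              have tb: "t3 + 100 \<le> t + C2"
                using p(1) u(1) f(1) mult_le_mono2[OF hT, of 300] by (simp add: C2_def)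
              show ?thesis
              proof (cases "spent (ft x T)")
                case False
                then obtain T' where T': "Inv S' T' ps' R2 G3" "pot {} T' \<le> pot {} T + (floor_log N + 1)"
                  using M.update_plain by blast
                have "C1 * pot {} T' \<le> C1 * pot {} T + C1 * (floor_log N + 1)"
                  using mult_le_mono2[OF T'(2), of C1] by (simp only: distrib_left)
                then show ?thesis using Q[of "Suc (Suc (Suc (Suc (Suc t3))))" T' ps' R2 G3] T'(1) tb False u(2,3) w0 by (simp add: S'_def)
              next
                case True
                have tr: "R2 rTRIG = Suc (root (ft x T))" using u(3) True by simp
                have Q': "Q (t', R', G')" if "t' + C1 * pot {} T' \<le> Suc (Suc (Suc (Suc t3))) + C1 * pot {} T + C1 * (floor_log N + 1)"
                  "Inv S' T' qs R' G'" for t' R' G' T' qs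
                  by (rule Q[where T' = T' and ps' = qs]) (use that tb in \<open>simp_all add: S'_def\<close>)
                have "wp (p_rebuild d m k h q) Q (Suc (Suc (Suc (Suc t3))), R2, G3)"
                proof (cases "ft x T = T")
                  case eq: True
                  show ?thesis by (rule M.update_global[OF True eq, where Q = Q]) (rule Q')
                next
                  case neq: False
                  show ?thesis by (rule M.update_local[OF True neq, where Q = Q]) (rule Q')
                qed
                then show ?thesis using tr w0 by (simp add: add.commute)
              qed
            qed
            done
        qed
        done
    qed
    done
qed

end

section \<open>Request sequences\<close>

locale machine = algo k q \<alpha> \<beta> \<epsilon> A d h NR W I Z N + ram_impl d "card A" NR W I M
  for k q \<alpha> \<beta> \<epsilon> A d h NR W I Z N M
begin

abbreviation "P \<equiv> comp d m (p_main d m k h q)"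

lemma input_main:
  assumes "I = input A d r"
  shows "I 0 = kind_code r" "I 1 = label_code r" "\<And>l. l < d \<Longrightarrow> I (l + 2) = K (point_of r) l"
  unfolding assms input_def kv_def by auto

lemma exec_update:
  assumes I: "I = input A d r" and r: "is_update r" "point_of r \<in> domain A d"
    and inv: "Inv S T ps R G" "rel s R G" and sz: "size (apply_request r S) \<le> N"
  shows "\<exists>u s' R' G' T' ps'. exec W M I P s u s' \<and> rel s' R' G' \<and> Inv (apply_request r S) T' ps' R' G' \<and>
    u + C1 * pot {} T' \<le> C1 * pot {} T + (C2 + 5 + C1 * (floor_log N + 1))"
proof -
  obtain y where y: "I 1 = of_bool y" "apply_request r S = upS (I 0) (point_of r) y S" "I 0 < 2"
    using r(1) input_main[OF I] by (cases r) (auto simp: upS_def)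
  define Q where "Q = (\<lambda>(t', R', G'). \<exists>T' ps'. Inv (apply_request r S) T' ps' R' G' \<and>
    t' + C1 * pot {} T' \<le> C1 * pot {} T + (C2 + 5 + C1 * (floor_log N + 1)))"
  have "wp (p_update d m k h q) Q (Suc (Suc (Suc (Suc 0))), R, G)"
    by (rule update[OF inv(1) r(2) y(3,1) input_main(3)[OF I]]) (use sz in \<open>auto simp: Q_def y(2)\<close>)
  then have "wp (p_main d m k h q) Q (0, R, G)"
    using y(3) wbd by (simp add: p_main_def)
  then show ?thesis using wp_exec[OF _ inv(2)] unfolding Q_def by fastforce
qed

lemma exec_label:
  assumes I: "I = input A d (Lab x)" and x: "x \<in> domain A d" and inv: "Inv S T ps R G" "rel s R G"
  shows "\<exists>u s' R'. exec W M I P s u s' \<and> rel s' R' G \<and> Inv S T ps R' G \<and>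
    fst s' 0 = of_bool (classify (toD 0 S T) x) \<and> u \<le> 160 + 200 * ht T"
proof -
  note J = InvD[OF inv(1)]
  define Q where "Q = (\<lambda>(t', R', G'). t' \<le> 160 + 200 * ht T \<and> G' = G \<and> R' 0 = of_bool (classify (toD 0 S T) x) \<and>
    (\<forall>r. r \<noteq> rV \<longrightarrow> r \<noteq> 0 \<longrightarrow> R' r = R r))"
  have "wp p_label Q (Suc (Suc (Suc (Suc 0))), R, G)"
    by (rule label[OF J(9,14) _ J(10) x input_main(3)[OF I, unfolded point_of.simps]]) (use J(12) in \<open>auto simp: Q_def\<close>)
  moreover have "I 0 = 2" using input_main[OF I] by simp
  ultimately have "wp (p_main d m k h q) Q (0, R, G)"
    using wbd by (simp add: p_main_def)
  then obtain u s' R' where s': "exec W M I P s u s'" "rel s' R' G" "Q (u, R', G)"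
    using wp_exec[OF _ inv(2)] unfolding Q_def by fastforce
  have R': "R' rNI = R rNI" "R' rFR = R rFR" "R' rNB = R rNB" using s'(3) by (simp_all add: Q_def)
  have "Inv S T ps R' G" using inv(1) R' avail_cong[OF J(13) R'(2,3)] unfolding Inv_def by simp
  moreover have "fst s' 0 = R' 0" using s'(2) by (simp add: rel_def)
  then have "fst s' 0 = of_bool (classify (toD 0 S T) x)" "u \<le> 160 + 200 * ht T" using s'(3) by (simp_all add: Q_def)
  ultimately show ?thesis using s'(1,2) by (intro exI conjI)
qed

text \<open>Zeroed memory already represents the empty leaf with record 0 as root.\<close>

lemma Inv_init: "Inv {#} (AL 0 [] {#} 0) [] (\<lambda>_. 0) (\<lambda>_ _ _. 0)"
proof -
  have NR0: "0 < NR" using NR_N by simp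
  have "budget q {#} = 0" using q_ge(4) by (simp add: budget_def lev_def)
  moreover have "avail (\<lambda>_. 0) (\<lambda>_ _ _. 0) ({..<NR} - {0})"
    unfolding avail_def by (rule exI[of _ "[]"]) (use NR0 in auto)
  ultimately show ?thesis using NR0
    by (simp add: Inv_def itemsI_def trieI_def okS_def cls_def splittable_def close.none)
qed

text \<open>The bound is carried for time plus \<open>C1\<close> times the potential, so the
  amortized costs add up; labelings contribute no time, since \<open>run\<close> counts updates
  only.\<close>

lemma run_Inv:
  assumes "\<sigma> \<in> requests A d" "\<And>i. i \<le> length \<sigma> \<Longrightarrow> size (active (take i \<sigma>)) \<le> N"
  shows "\<exists>t s T ps R G. run A d W M P \<sigma> t s \<and> rel s R G \<and> Inv (active \<sigma>) T ps R G \<and>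
    t + C1 * pot {} T \<le> num_updates \<sigma> * (C2 + 5 + C1 * (floor_log N + 1))"
  using assms
proof (induction \<sigma> rule: rev_induct)
  case Nil
  have "rel init_state (\<lambda>_. 0) (\<lambda>_ _ _. 0)" using wbd by (simp add: rel_def init_state_def)
  moreover have "run A d W M P [] 0 init_state" by (rule run.Nil)
  moreover have "Inv (active []) (AL 0 [] {#} 0) [] (\<lambda>_. 0) (\<lambda>_ _ _. 0)" using Inv_init by (simp add: active_def)
  moreover have "pot {} (AL 0 [] {#} 0) = 0" by simp
  ultimately show ?case by (metis add.right_neutral le0 mult_0_right)
next
  case (snoc r \<sigma>)
  \<comment> \<open>Every request has its own input array, which is a parameter of the
    locale.\<close>
  interpret J: machine k q \<alpha> \<beta> \<epsilon> A d h NR W "input A d r" Z N M by unfold_locales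
  have "\<sigma> \<in> requests A d" and r: "point_of r \<in> domain A d" using snoc.prems(1) by (auto simp: requests_def)
  moreover have "size (active (take i \<sigma>)) \<le> N" if "i \<le> length \<sigma>" for i using snoc.prems(2)[of i] that by simp
  ultimately obtain t s T ps R G where IH: "run A d W M P \<sigma> t s" "rel s R G" "Inv (active \<sigma>) T ps R G"
    "t + C1 * pot {} T \<le> num_updates \<sigma> * (C2 + 5 + C1 * (floor_log N + 1))" using snoc.IH by blast
  have act: "active (\<sigma> @ [r]) = apply_request r (active \<sigma>)" by (simp add: active_def)
  have sz: "size (apply_request r (active \<sigma>)) \<le> N" using snoc.prems(2)[of "Suc (length \<sigma>)"] act by simp
  show ?case
  proof (cases "is_update r")
    case True
    obtain u s' R' G' T' ps' where u: "exec W M (input A d r) P s u s'" "rel s' R' G'"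
      "Inv (apply_request r (active \<sigma>)) T' ps' R' G'"
      "u + C1 * pot {} T' \<le> C1 * pot {} T + (C2 + 5 + C1 * (floor_log N + 1))"
      using J.exec_update[OF refl True r IH(3,2) sz] by blast
    have "run A d W M P (\<sigma> @ [r]) (t + u) s'" using run.snoc[OF IH(1) u(1)] True by simp
    moreover have "t + u + C1 * pot {} T' \<le> num_updates (\<sigma> @ [r]) * (C2 + 5 + C1 * (floor_log N + 1))"
    proof -
      have nu: "num_updates (\<sigma> @ [r]) = Suc (num_updates \<sigma>)" using True by (simp add: num_updates_def)
      show ?thesis unfolding nu mult_Suc using u(4) IH(4) by linarith
    qed
    ultimately show ?thesis unfolding act using u(2,3) by (intro exI conjI)
  next
    case False
    then obtain x where x: "r = Lab x" by (cases r) auto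
    obtain u s' R' where u: "exec W M (input A d r) P s u s'" "rel s' R' G" "Inv (active \<sigma>) T ps R' G"
      using J.exec_label[of x "active \<sigma>" T ps R G s] r IH x by auto
    have "run A d W M P (\<sigma> @ [r]) t s'" using run.snoc[OF IH(1) u(1)] False by simp
    moreover have nu: "num_updates (\<sigma> @ [r]) = num_updates \<sigma>" and act': "active (\<sigma> @ [r]) = active \<sigma>"
      using False act x by (simp_all add: num_updates_def)
    ultimately show ?thesis unfolding act' nu using u(2,3) IH(4) by (intro exI conjI)
  qed
qed

lemma coherent_query:
  assumes "Inv S T ps R G" "rel s R G"
  shows "coherent A d W M P s (toD 0 S T)" "query_time_le A d W M P s (160 + 200 * ht T)"
proof -
  have "\<exists>u s'. exec W M (input A d (Lab x)) P s u s' \<and> fst s' 0 = of_bool (classify (toD 0 S T) x) \<and> u \<le> 160 + 200 * ht T"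
    if x: "x \<in> domain A d" for x
  proof -
    interpret J: machine k q \<alpha> \<beta> \<epsilon> A d h NR W "input A d (Lab x)" Z N M by unfold_locales
    from J.exec_label[OF refl x assms] obtain u s' where "exec W M (input A d (Lab x)) P s u s'"
      "fst s' 0 = of_bool (classify (toD 0 S T) x)" "u \<le> 160 + 200 * ht T" by (elim exE conjE)
    then show ?thesis by (intro exI conjI)
  qed
  note * = this
  show "coherent A d W M P s (toD 0 S T)" unfolding coherent_def
  proof
    fix x assume "x \<in> domain A d"
    from *[OF this] obtain u s' where "exec W M (input A d (Lab x)) P s u s'"
      "fst s' 0 = of_bool (classify (toD 0 S T) x)" by (elim exE conjE)
    then show "\<exists>t s'. exec W M (input A d (Lab x)) P s t s' \<and> fst s' 0 = of_bool (classify (toD 0 S T) x)"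
      by (intro exI conjI)
  qed
  show "query_time_le A d W M P s (160 + 200 * ht T)" unfolding query_time_le_def
  proof
    fix x assume "x \<in> domain A d"
    from *[OF this] obtain u s' where "exec W M (input A d (Lab x)) P s u s'" "u \<le> 160 + 200 * ht T" by (elim exE conjE)
    then show "\<exists>t s'. exec W M (input A d (Lab x)) P s t s' \<and> t \<le> 160 + 200 * ht T" by (intro exI conjI)
  qed
qed

lemma Inv_feasible:
  assumes "Inv S T ps R G"
  shows "feasible d k h \<alpha> \<beta> S (toD 0 S T)" "height (toD 0 S T) \<le> h" "ht T \<le> height (toD 0 S T)"
proof -
  note J = InvD[OF assms]
  have "(!) ps ` set (itl T) \<subseteq> set ps" using J(5) by auto
  moreover have "set ps \<subseteq> domain A d" using J(1) by (simp add: itemsI_def)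
  ultimately have "okS S" unfolding okS_def using J(7) by (meson order_trans)
  then show "feasible d k h \<alpha> \<beta> S (toD 0 S T)" by (rule feas_feasible[OF feas_toD[OF J(14)]])
  show "height (toD 0 S T) \<le> h" using height_toD[OF J(14)] by simp
qed (rule ht_le_height)

text \<open>One logarithm comes from \<open>BC\<close>, the other from the number of levels, and
  \<open>q <= 2 / \<epsilon>\<close> follows from \<epsilon> <= 1. Terms without a logarithm are
  absorbed since \<open>d * L >= 1\<close>.\<close>

lemma total_time:
  assumes N: "1 \<le> N" and L: "1 \<le> L" "real (floor_log N) \<le> L" and e1: "\<epsilon> \<le> 1"
  shows "real (C2 + 5 + C1 * (floor_log N + 1)) \<le> (300000 + 40000 * real m) * (real d * L\<^sup>2 / \<epsilon>)"
proof -
  define X where "X = real d * L"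
  have "1 * 1 \<le> real d * L" using L d by (intro mult_mono) auto
  then have X: "real d \<le> X" "1 \<le> X" "0 \<le> real m" using L d by (simp_all add: X_def mult_le_cancel_left1)
  have XL: "X * 1 \<le> X * L" using X L by (intro mult_left_mono) auto
  have mX: "real m * real d \<le> real m * X" "real m * X * 1 \<le> real m * X * L"
    by (intro mult_left_mono X L; use X in simp)+
  have dl: "real d * real (floor_log N) \<le> X" unfolding X_def using L by (intro mult_left_mono) auto
  have fl: "real (floor_log N) \<le> X" using dl d mult_right_mono[of 1 "real d" "real (floor_log N)"] by simp
  have "real BC \<le> (11000 + 1800 * real m) * X"
  proof -
    have "real BC = 9200 + 100 * real (floor_log N) + 1400 * real d + 1800 * (real m * real d) + 250 * (real d * real (floor_log N))"
      by (simp add: BC_def bc_def base_def algebra_simps)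
    then have "real BC \<le> 9200 * X + 100 * X + 1400 * X + 1800 * (real m * X) + 250 * X" using fl dl X mX by linarith
    then show ?thesis using X by (simp add: algebra_simps)
  qed
  moreover have "real q \<le> 2 / \<epsilon>" using q_ge(2) e1 eps(1) by (simp add: field_simps)
  ultimately have qB: "real q * real BC \<le> (2 / \<epsilon>) * ((11000 + 1800 * real m) * X)" using eps(1) by (intro mult_mono) auto
  have L2: "real (floor_log N + 1) \<le> 2 * L" using L by simp
  have qBL: "real q * real BC * real (floor_log N + 1) \<le> (2 / \<epsilon>) * ((11000 + 1800 * real m) * X) * (2 * L)"
    by (rule mult_mono[OF qB L2]) (use eps(1) X in auto)
  have 1: "real (C1 * (floor_log N + 1)) \<le> (220000 + 36000 * real m) * (X * L / \<epsilon>)"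
  proof -
    have "real (C1 * (floor_log N + 1)) = 5 * (real q * real BC * real (floor_log N + 1))" by (simp add: C1_def algebra_simps)
    moreover have "5 * ((2 / \<epsilon>) * ((11000 + 1800 * real m) * X) * (2 * L)) = (220000 + 36000 * real m) * (X * L / \<epsilon>)"
      by (simp add: field_simps)
    ultimately show ?thesis using qBL by linarith
  qed
  have "real (C2 + 5) \<le> 4005 * X + 1000 * (real m * X)" using X mX by (simp add: C2_def algebra_simps)
  also have "\<dots> \<le> 4005 * (X * L) + 1000 * (real m * X * L)" using XL mX by linarith
  also have "\<dots> = (4005 + 1000 * real m) * (X * L)" by (simp add: algebra_simps)
  also have "\<dots> \<le> (4005 + 1000 * real m) * (X * L / \<epsilon>)"
    using e1 eps(1) X L by (intro mult_left_mono) (auto simp: le_divide_eq)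
  finally have 2: "real (C2 + 5) \<le> (4005 + 1000 * real m) * (X * L / \<epsilon>)" .
  have "real (C2 + 5 + C1 * (floor_log N + 1)) \<le> (224005 + 37000 * real m) * (X * L / \<epsilon>)"
  proof -
    have "(224005 + 37000 * real m) * Y = (4005 + 1000 * real m) * Y + (220000 + 36000 * real m) * Y" for Y
      by (simp add: algebra_simps)
    then have e: "(4005 + 1000 * real m) * (X * L / \<epsilon>) + (220000 + 36000 * real m) * (X * L / \<epsilon>) =
      (224005 + 37000 * real m) * (X * L / \<epsilon>)" by (rule sym)
    show ?thesis unfolding of_nat_add[of "C2 + 5"] e[symmetric] by (rule add_mono[OF 2 1])
  qed
  also have "\<dots> \<le> (300000 + 40000 * real m) * (X * L / \<epsilon>)" using X L eps(1) by (intro mult_right_mono) auto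
  finally show ?thesis by (simp add: X_def power2_eq_square algebra_simps)
qed

end

lemma floor_log_le_log:
  assumes "1 \<le> n"
  shows "real (floor_log n) \<le> log 2 (real n)"
proof -
  have "(2::real) ^ floor_log n \<le> real n"
    using floor_log_exp2_le[of n] assms by (metis One_nat_def Suc_le_eq of_nat_le_iff of_nat_numeral of_nat_power)
  then show ?thesis using assms by (simp add: le_log_iff powr_realpow)
qed

lemma rsize_le:
  assumes "1 \<le> d"
  shows "rsize d m \<le> (16 + 3 * m) * d"
proof -
  have "rsize d m = 15 + d + 3 * (d * m)"
    by (simp add: rsize_def off_def wid_def eval_nat_numeral lessThan_Suc algebra_simps)
  then show ?thesis using assms by (simp add: algebra_simps)
qed

text \<open>The values \<open>n\<close>, \<open>W\<close> and \<open>M\<close> are determined only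
  by the whole sequence, whereas \<open>P\<close> depends on none of them; here the sequence is
  fixed and \<open>N\<close> can be chosen to fit.\<close>

lemma exists_tree:
  fixes A :: "real set" and d k h q C :: nat and \<alpha> \<beta> \<epsilon> :: real
  assumes A: "finite A" and hyp: "d \<ge> 1" "\<beta> \<le> 1" "0 < \<epsilon>"
      "\<epsilon> < min (1 / (real k + 1)) (min (\<alpha> / 5) (\<beta> / 12.5))"
    and q: "q = nat \<lceil>1 / \<epsilon>\<rceil>" and C: "300000 + 40000 * card A \<le> C" and \<sigma>: "\<sigma> \<in> requests A d"
  defines "P \<equiv> comp d (card A) (p_main d (card A) k h q)" and "n \<equiv> max_active \<sigma>"
  defines "W \<equiv> word_bound C d k h \<epsilon> n" and "M \<equiv> C * (max 1 n * d)"
  shows "\<exists>T. height T \<le> h \<and> feasible d k h \<alpha> \<beta> (active \<sigma>) T \<and>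
    (\<exists>t s. run A d W M P \<sigma> t s \<and> coherent A d W M P s T \<and>
      query_time_le A d W M P s (C * max 1 (height T)) \<and>
      real t \<le> real C * (real (num_updates \<sigma>) * (real d * (log 2 (max 2 (real n)))\<^sup>2 / \<epsilon>)))"
proof -
  \<comment> \<open>A sequence without active examples still needs the record of the root, hence the
    maximum with 1.\<close>
  define N where "N = max 1 n"
  define m where "m = card A"
  define s where "s = n + d + k + h + q"
  \<comment> \<open>The 30 covers \<open>NR + 2 = 8 * N + 18\<close> and the other linear bounds,
    the summand \<open>2 * m\<close> the table size \<open>2 * d * m\<close>.\<close>
  define Z where "Z = (30 + 2 * m) * s"
  have N: "1 \<le> N" "N \<le> s" "1 \<le> s" "d \<le> s" "k \<le> s" "h \<le> s" "q \<le> s" using hyp(1) by (auto simp: N_def s_def)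
  have eps: "\<epsilon> < 1 / (real k + 1)" "\<epsilon> < \<alpha> / 5" "\<epsilon> < \<beta> / 12.5" using hyp(4) by simp_all
  interpret thresholds k q \<alpha> \<beta> \<epsilon> by unfold_locales (use hyp eps q in auto)
  have e1: "\<epsilon> \<le> 1" using eps(4) hyp(2) by simp
  have Z: "30 * s + 2 * (m * s) = Z" by (simp add: Z_def algebra_simps)
  have ms: "m * d \<le> m * s" using N by simp
  have W: "W = (C * s) ^ C" by (simp add: W_def word_bound_def s_def q)
  have Cs: "1 \<le> C * s" using C N by (metis One_nat_def Suc_le_eq add_gr_0 le_trans mult_pos_pos zero_less_numeral less_le_trans)
  \<comment> \<open>The factor 8 is absorbed by one more power of \<open>C * s\<close>, and the
    exponent \<open>C\<close> is at least 7.\<close>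
  have W1: "8 * Z ^ 6 \<le> W"
  proof -
    have "Z ^ 6 \<le> (C * s) ^ 6" unfolding Z_def using C by (intro power_mono mult_le_mono1) (auto simp: m_def)
    moreover have "8 \<le> C * s" using mult_le_mono[of 8 C 1 s] C N by simp
    ultimately have "8 * Z ^ 6 \<le> (C * s) ^ 7" using mult_le_mono[of 8 "C * s" "Z ^ 6" "(C * s) ^ 6"] by (simp add: power_Suc[symmetric])
    also have "\<dots> \<le> W" unfolding W using Cs C by (intro power_increasing) auto
    finally show ?thesis .
  qed
  have M1: "(8 * N + 16) * rsize d (card A) \<le> M"
  proof -
    have "(8 * N + 16) * rsize d m \<le> (24 * N) * ((16 + 3 * m) * d)"
      using N rsize_le[OF hyp(1), of m] by (intro mult_le_mono) auto
    also have "\<dots> = (24 * (16 + 3 * m)) * (N * d)" by (simp add: algebra_simps)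
    also have "\<dots> \<le> C * (N * d)" using C by (intro mult_le_mono1) (simp add: m_def)
    finally show ?thesis by (simp add: M_def N_def m_def)
  qed
  have M2: "M \<le> W"
  proof -
    have "M \<le> C * (s * s)" unfolding M_def N_def[symmetric] using N by (intro mult_le_mono) auto
    also have "\<dots> \<le> (C * s) * (C * s)" using C by (simp add: mult_le_mono algebra_simps)
    also have "\<dots> = (C * s) ^ 2" by (simp add: power2_eq_square)
    also have "\<dots> \<le> W" unfolding W using Cs C by (intro power_increasing) auto
    finally show ?thesis .
  qed
  interpret machine k q \<alpha> \<beta> \<epsilon> A d h "8 * N + 16" W "\<lambda>_. 0" Z N M
  proof unfold_locales
    have "2 * d * card A = 2 * (m * d)" by (simp add: m_def)
    then show "2 * d * card A + 2 \<le> Z" using Z ms N by linarith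
    show "1 \<le> q" using q_ge by simp
  qed (use A hyp N Z W1 M1 M2 in linarith)+
  have "size (active (take i \<sigma>)) \<le> N" if "i \<le> length \<sigma>" for i
  proof -
    have "size (active (take i \<sigma>)) \<le> n" unfolding n_def max_active_def using that by (intro Max_ge) auto
    then show ?thesis by (simp add: N_def)
  qed
  from run_Inv[OF \<sigma> this] obtain t s' T ps R G where run: "run A d W M P \<sigma> t s'" "rel s' R G" "Inv (active \<sigma>) T ps R G"
    "t + C1 * pot {} T \<le> num_updates \<sigma> * (C2 + 5 + C1 * (floor_log N + 1))" unfolding P_def by blast
  define tr where "tr = toD 0 (active \<sigma>) T"
  have tr: "feasible d k h \<alpha> \<beta> (active \<sigma>) tr" "height tr \<le> h" "ht T \<le> height tr"
    unfolding tr_def by (rule Inv_feasible[OF run(3)])+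
  have "query_time_le A d W M P s' (C * max 1 (height tr))"
  proof -
    have "160 + 200 * ht T \<le> 360 * max 1 (height tr)" using tr(3) by simp
    also have "\<dots> \<le> C * max 1 (height tr)" using C by (intro mult_le_mono1) simp
    finally show ?thesis using coherent_query(2)[OF run(3,2)] unfolding query_time_le_def P_def[symmetric] by (meson order_trans)
  qed
  moreover have "coherent A d W M P s' tr" using coherent_query(1)[OF run(3,2)] unfolding tr_def P_def .
  moreover have "real t \<le> real C * (real (num_updates \<sigma>) * (real d * (log 2 (max 2 (real n)))\<^sup>2 / \<epsilon>))"
  proof -
    define L where "L = log 2 (max 2 (real n))"
    have L: "1 \<le> L" "real (floor_log N) \<le> L"
    proof -
      show "1 \<le> L" by (simp add: L_def le_log_iff)
      have "real (floor_log N) \<le> log 2 (real N)" by (rule floor_log_le_log[OF N(1)])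
      also have "\<dots> \<le> L" unfolding L_def by (intro log_mono) (auto simp: N_def)
      finally show "real (floor_log N) \<le> L" .
    qed
    have "real t \<le> real (num_updates \<sigma>) * real (C2 + 5 + C1 * (floor_log N + 1))"
      using run(4) by (metis add_leE of_nat_le_iff of_nat_mult)
    also have "\<dots> \<le> real (num_updates \<sigma>) * ((300000 + 40000 * real (card A)) * (real d * L\<^sup>2 / \<epsilon>))"
      by (intro mult_left_mono total_time N L e1) simp
    also have "\<dots> \<le> real (num_updates \<sigma>) * (real C * (real d * L\<^sup>2 / \<epsilon>))"
    proof -
      have "real (300000 + 40000 * card A) \<le> real C" using C by (rule of_nat_mono)
      then have "300000 + 40000 * real (card A) \<le> real C" by simp
      then show ?thesis using hyp(3) by (intro mult_left_mono mult_right_mono) auto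
    qed
    finally show ?thesis unfolding L_def by (simp add: mult.left_commute)
  qed
  ultimately show ?thesis using run(1) tr(1,2) by blast
qed

theorem theorem3p3:
  fixes A :: "real set"
  assumes "finite A"
  shows "\<exists>C::nat. \<forall>(d::nat) (k::nat) (h::nat) (\<alpha>::real) (\<beta>::real) (\<epsilon>::real).
    d \<ge> 1 \<longrightarrow> k \<ge> 1 \<longrightarrow> h \<ge> 1 \<longrightarrow> \<alpha> \<in> {0<..1} \<longrightarrow> \<beta> \<in> {0<..1} \<longrightarrow>
    0 < \<epsilon> \<longrightarrow> \<epsilon> < min (1 / (real k + 1)) (min (\<alpha> / 5) (\<beta> / 12.5)) \<longrightarrow>
    (\<exists>P tree. com_size P \<le> C \<and>
      (\<forall>\<sigma>\<in>requests A d.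
        let n = max_active \<sigma>;
            hstar = max_height tree \<sigma>;
            W = word_bound C d k h \<epsilon> n;
            M = C * (max 1 n * d)
        in hstar \<le> h \<and>
           feasible d k h \<alpha> \<beta> (active \<sigma>) (tree \<sigma>) \<and>
           (\<exists>t s. run A d W M P \<sigma> t s \<and>
              coherent A d W M P s (tree \<sigma>) \<and>
              query_time_le A d W M P s (C * max 1 hstar) \<and>
              real t \<le> real C * (real (num_updates \<sigma>) *
                (real d * (log 2 (max 2 (real n)))\<^sup>2 / \<epsilon>)))))"
proof -
  obtain c where c: "\<And>d m k h q. com_size (comp d m (p_main d m k h q)) = c" using com_size_main by blast
  define C where "C = 300000 + 40000 * card A + c"
  show ?thesis
  proof (intro exI[of _ C] allI impI, goal_cases)
    case (1 d k h \<alpha> \<beta> \<epsilon>)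
    define q where "q = nat \<lceil>1 / \<epsilon>\<rceil>"
    define P where "P = comp d (card A) (p_main d (card A) k h q)"
    define good where "good = (\<lambda>\<sigma> T. height T \<le> h \<and> feasible d k h \<alpha> \<beta> (active \<sigma>) T \<and>
      (\<exists>t s. run A d (word_bound C d k h \<epsilon> (max_active \<sigma>)) (C * (max 1 (max_active \<sigma>) * d)) P \<sigma> t s \<and>
        coherent A d (word_bound C d k h \<epsilon> (max_active \<sigma>)) (C * (max 1 (max_active \<sigma>) * d)) P s T \<and>
        query_time_le A d (word_bound C d k h \<epsilon> (max_active \<sigma>)) (C * (max 1 (max_active \<sigma>) * d)) P s (C * max 1 (height T)) \<and>
        real t \<le> real C * (real (num_updates \<sigma>) * (real d * (log 2 (max 2 (real (max_active \<sigma>))))\<^sup>2 / \<epsilon>))))"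
    \<comment> \<open>Any witness will do. Prefixes of a request sequence are request sequences as
      well, so the bound on the height holds at every moment.\<close>
    define tree where "tree = (\<lambda>\<sigma>. SOME T. good \<sigma> T)"
    have tree: "good \<sigma> (tree \<sigma>)" if "\<sigma> \<in> requests A d" for \<sigma>
    proof -
      have "\<exists>T. good \<sigma> T" unfolding good_def P_def
        by (rule exists_tree[OF assms 1(1) _ 1(6,7) q_def _ that]) (use 1 in \<open>auto simp: C_def\<close>)
      then show ?thesis unfolding tree_def by (rule someI_ex)
    qed
    show ?case
    proof (intro exI[of _ P] exI[of _ tree] conjI ballI)
      show "com_size P \<le> C" using c by (simp add: P_def C_def)
      fix \<sigma> assume \<sigma>: "\<sigma> \<in> requests A d"
      have pre: "take i \<sigma> \<in> requests A d" for i using \<sigma> by (auto simp: requests_def dest: in_set_takeD)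
      have 2: "max_height tree \<sigma> \<le> h" unfolding max_height_def
        using tree[OF pre] by (intro Max.boundedI) (auto simp: good_def)
      have 3: "height (tree \<sigma>) \<le> max_height tree \<sigma>" unfolding max_height_def
        by (rule Max_ge) (auto intro!: image_eqI[of _ _ "length \<sigma>"])
      have 4: "query_time_le A d W M P s (C * max 1 (max_height tree \<sigma>))"
        if "query_time_le A d W M P s (C * max 1 (height (tree \<sigma>)))" for W M s
      proof -
        have "C * max 1 (height (tree \<sigma>)) \<le> C * max 1 (max_height tree \<sigma>)" using 3 by (intro mult_le_mono2) auto
        then show ?thesis using that unfolding query_time_le_def by (meson order_trans)
      qed
      show "let n = max_active \<sigma>;
            hstar = max_height tree \<sigma>;
            W = word_bound C d k h \<epsilon> n;
            M = C * (max 1 n * d)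
        in hstar \<le> h \<and>
           feasible d k h \<alpha> \<beta> (active \<sigma>) (tree \<sigma>) \<and>
           (\<exists>t s. run A d W M P \<sigma> t s \<and>
              coherent A d W M P s (tree \<sigma>) \<and>
              query_time_le A d W M P s (C * max 1 hstar) \<and>
              real t \<le> real C * (real (num_updates \<sigma>) *
                (real d * (log 2 (max 2 (real n)))\<^sup>2 / \<epsilon>)))"
        unfolding Let_def using 2 tree[OF \<sigma>] 4 unfolding good_def by blast
    qed
  qed
qed

end
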